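(* Let $P$ be an irrational right triangle. Then the set of periodic billiard orbits is dense in the phase space of the billiard in $P$: the set of phase points $(p,\theta)\in P\times\mathbb{S}^1$ whose billiard orbit is periodic is dense in $P\times\mathbb{S}^1$.
   Context: Billiard: a point moves inside a polygon $P\subset\mathbb{R}^2$ with unit speed along a straight line until it reaches the boundary $\partial P$, where its direction changes instantaneously according to the mirror law (angle of incidence equals angle of reflection), and then it continues along the new line. If the trajectory hits a corner of $P$ it stops there by definition (so an orbit hitting a corner is not periodic). The phase space is the set of pairs $(p,\theta)$, with $p\in P$ a position and $\theta\in\mathbb{S}^1$ a direction, where at a (non-corner) boundary point an outward pointing direction is identified with its reflection in the side. An orbit is periodic if it returns to its initial phase point. A polygon is rational if all angles between its sides are rational multiples of $\pi$, and irrational otherwise. Thus a right triangle is irrational exactly when its acute angles are not rational multiples of $\pi$. *)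

theory Defs
  imports "HOL-Analysis.Analysis"
begin

type_synonym point = "real ^ 2"

definition vertex_angle :: "point \<Rightarrow> point \<Rightarrow> point \<Rightarrow> real" where
  "vertex_angle A B C = arccos (((A - B) \<bullet> (C - B)) / (norm (A - B) * norm (C - B)))"

(* vertex_angle A B C is the angle at the middle argument B. *)

definition triangle :: "point \<Rightarrow> point \<Rightarrow> point \<Rightarrow> point set" where
  "triangle A B C = convex hull {A, B, C}"

definition right_triangle :: "point \<Rightarrow> point \<Rightarrow> point \<Rightarrow> bool" where
  "right_triangle A B C \<longleftrightarrow> \<not> collinear {A, B, C} \<and> vertex_angle A C B = pi / 2"

(* The vertices are named so that the right angle is at C. *)

definition rational_triangle :: "point \<Rightarrow> point \<Rightarrow> point \<Rightarrow> bool" where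
  "rational_triangle A B C \<longleftrightarrow>
     vertex_angle B A C / pi \<in> \<rat> \<and> vertex_angle A B C / pi \<in> \<rat> \<and> vertex_angle A C B / pi \<in> \<rat>"

definition reflect :: "point \<Rightarrow> point \<Rightarrow> point" where
  "reflect u v = (2 * (v \<bullet> u) / (u \<bullet> u)) *\<^sub>R u - v"

(* reflect u keeps the component of v along the line spanned by u and negates the
   component normal to it: the mirror law at a side of direction u. *)

definition sides :: "point \<Rightarrow> point \<Rightarrow> point \<Rightarrow> (point \<times> point) set" where
  "sides A B C = {(A, B), (B, C), (C, A)}"

(* flow A B C x t y: starting from the phase point x and moving for time t, the billiard
   trajectory is at the phase point y.  A phase point is a pair (position, unit direction).
   The rule bounce takes no time.  Since reflect u is an involution, it identifies the two
   directions at a non-corner boundary point that are mirror images of each other, so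
   flow is a relation on phase points up to this identification.  It creates no spurious
   branching: of two distinct such directions only the inward one admits a further move.
   A trajectory may arrive at a corner but cannot leave it. *)

inductive flow ::
  "point \<Rightarrow> point \<Rightarrow> point \<Rightarrow> point \<times> point \<Rightarrow> real \<Rightarrow> point \<times> point \<Rightarrow> bool"
  for A B C :: point and x :: "point \<times> point" where
  start: "flow A B C x 0 x"
| move: "flow A B C x t (p, v) \<Longrightarrow> 0 < s \<Longrightarrow>
    \<forall>r\<in>{0..<s}. p + r *\<^sub>R v \<in> triangle A B C - {A, B, C} \<Longrightarrow>
    p + s *\<^sub>R v \<in> triangle A B C \<Longrightarrow>
    flow A B C x (t + s) (p + s *\<^sub>R v, v)"
| bounce: "flow A B C x t (p, v) \<Longrightarrow> (a, b) \<in> sides A B C \<Longrightarrow> p \<in> open_segment a b \<Longrightarrow>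
    flow A B C x t (p, reflect (b - a) v)"

definition phase_space :: "point \<Rightarrow> point \<Rightarrow> point \<Rightarrow> (point \<times> point) set" where
  "phase_space A B C = triangle A B C \<times> sphere 0 1"

definition periodic :: "point \<Rightarrow> point \<Rightarrow> point \<Rightarrow> point \<times> point \<Rightarrow> bool" where
  "periodic A B C x \<longleftrightarrow> (\<exists>T>0. flow A B C x T x)"

end

theory Submission
  imports Defs
begin

text \<open>
Unfold the triangle around its right angle to a rhombus and glue copies of the rhombus along their
sides: a billiard trajectory becomes a straight line in a chain of rhombi, and the half turns about the
centres of the rhombi are symmetries of the unfolding. A segment joining two centres therefore gives
periodic trajectories: displace it slightly to one side, run to the far end, turn by the half
turn about that centre, run back and turn again.

So it suffices that from every point some centre is visible in a direction of any given open interval;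
applied first to a point of the phase space and then to the centre found, backwards through that point,
this yields a segment between two centres passing close to the given phase point. To see a centre,
follow rays from the point until the beam meets a vertex. In the direction of that vertex consider the
first return map to an interval, on a late edge of the chain, bounded by two separatrices. A parity count of
crossings shows that a returning trajectory comes back reversed, so it retraces itself about
a centre, and that the rhombus levels reached before the return are bounded; where the count bounds
only one side, the direction is perturbed so that it becomes parallel to a side of the rhombi, a wall for the
trajectories. Irrationality of the angle makes such directions dense.
\<close>


section \<open>One-dimensional dynamics of a fixed direction\<close>

text \<open>The obstacle is escape: for an irrational angle rhombi of infinitely many orientations
  occur, and a trajectory may climb through the levels forever without returning. So bounding the
  levels is the crux; returns then follow by a pigeonhole argument. Parity works because of
  planarity. Modulo translations and half turns there is one rhombus per level. Folded by its half
  turn it is a disc bounded by two arcs, one for each side level, both running from the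
  \<open>A\<close>-corner to the \<open>B\<close>-corner. Glued along the arcs the discs form a
  simply connected stack of bigons, on which trajectories of one direction never cross. All counts
  below are intersection numbers modulo 2 on this surface. The visible vertex cuts the base interval
  into two shorter ones, so there are three candidates. The parities that govern their levels have
  odd sum, hence at least one is odd, which bounds the levels from below. The bound from above needs
  two vertices of the same type; if the types differ, the wall comes from a perturbed
  direction.\<close>

text \<open>A trajectory of fixed direction is followed through the sides it crosses. \<open>St k y d\<close> is the crossing of a side of level \<open>k\<close>
at distance \<open>y\<close> (measured across the direction) from its \<open>A\<close>-vertex, towards the levels beyond \<open>k\<close> on the side \<open>d\<close>; \<open>\<bar>f k\<bar>\<close> is the width of the
sides of level \<open>k\<close>. In the next rhombus the trajectory leaves through the side adjacent at the \<open>A\<close>-vertex (\<open>PA\<close>), adjacent at the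
\<open>B\<close>-vertex (\<open>PB\<close>) or opposite (\<open>OP\<close>).\<close>

datatype st = St (lev: int) (pos: real) (dr: int)
datatype move = PA | PB | OP

abbreviation nb :: "st \<Rightarrow> int" where "nb s \<equiv> lev s + dr s"

text \<open>The projection of the neighbouring side, taken away from the \<open>A\<close>-vertex
  both sides share and oriented so that the current side projects positively. Hence
  \<open>om\<close> and \<open>\<bar>f k\<bar> + om\<close> are the positions of the two far
  vertices of the rhombus.\<close>

definition om :: "(int \<Rightarrow> real) \<Rightarrow> int \<Rightarrow> int \<Rightarrow> real" where
  "om f k k' = (if f k * f k' \<ge> 0 then \<bar>f k'\<bar> else - \<bar>f k'\<bar>)"

definition inner_st :: "(int \<Rightarrow> real) \<Rightarrow> st \<Rightarrow> bool" where
  "inner_st f s \<longleftrightarrow> (dr s = 1 \<or> dr s = -1) \<and> 0 < pos s \<and> pos s < \<bar>f (lev s)\<bar>"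

definition okst :: "(int \<Rightarrow> real) \<Rightarrow> st \<Rightarrow> bool" where
  "okst f s \<longleftrightarrow> inner_st f s \<and> pos s \<noteq> om f (lev s) (nb s)
     \<and> pos s \<noteq> \<bar>f (lev s)\<bar> + om f (lev s) (nb s)"

definition mv :: "(int \<Rightarrow> real) \<Rightarrow> st \<Rightarrow> move" where
  "mv f s = (if pos s < om f (lev s) (nb s) then PA
     else if pos s > \<bar>f (lev s)\<bar> + om f (lev s) (nb s) then PB else OP)"

text \<open>Positions are always measured from the \<open>A\<close>-vertex of the new side: the same
  vertex for \<open>PA\<close>, the opposite corner of the rhombus for \<open>PB\<close> and
  \<open>OP\<close>. Behind the opposite side lies the rhombus on the other side of level
  \<open>lev s\<close>, so \<open>OP\<close> reverses \<open>dr\<close>.\<close>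

definition nxt :: "(int \<Rightarrow> real) \<Rightarrow> st \<Rightarrow> st" where
  "nxt f s = (case mv f s of
      PA \<Rightarrow> St (nb s) (pos s) (dr s)
    | PB \<Rightarrow> St (nb s) (pos s - \<bar>f (lev s)\<bar> - om f (lev s) (nb s)) (dr s)
    | OP \<Rightarrow> St (lev s) (\<bar>f (lev s)\<bar> + om f (lev s) (nb s) - pos s) (- dr s))"

definition rv :: "st \<Rightarrow> st" where "rv s = St (lev s) (pos s) (- dr s)"

text \<open>Identifies all rhombi of one level; the label is the larger of the two levels of its
  sides.\<close>

definition tile :: "st \<Rightarrow> int" where "tile s = (if dr s = 1 then lev s + 1 else lev s)"

definition less_st :: "st \<Rightarrow> st \<Rightarrow> bool" where
  "less_st m z \<longleftrightarrow> lev m = lev z \<and> pos m < pos z"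

text \<open>The trajectory runs into a vertex, of type \<open>A\<close> or \<open>B\<close> according to the flag; vertices on the current side are included.\<close>

definition hits :: "(int \<Rightarrow> real) \<Rightarrow> bool \<Rightarrow> st \<Rightarrow> bool" where
  "hits f a s \<longleftrightarrow> (dr s = 1 \<or> dr s = -1) \<and> 0 \<le> pos s \<and> pos s \<le> \<bar>f (lev s)\<bar> \<and>
     (if a then pos s = 0 \<or> pos s = \<bar>f (lev s)\<bar> + om f (lev s) (nb s)
      else pos s = \<bar>f (lev s)\<bar> \<or> pos s = om f (lev s) (nb s))"

lemma rv_simps [simp]: "lev (rv s) = lev s" "pos (rv s) = pos s" "dr (rv s) = - dr s" "rv (rv s) = s"
  by (simp_all add: rv_def)

lemma less_rv [simp]: "less_st (rv m) z = less_st m z" "less_st m (rv z) = less_st m z"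
  by (simp_all add: less_st_def)

lemma st_eqI: "lev s = lev t \<Longrightarrow> pos s = pos t \<Longrightarrow> dr s = dr t \<Longrightarrow> s = t"
  by (simp add: st.expand)

lemma okst_inner: "okst f s \<Longrightarrow> inner_st f s" by (simp add: okst_def)

lemma inner_rv [simp]: "inner_st f (rv s) = inner_st f s" by (auto simp: inner_st_def)

lemma nxt_cases:
  assumes "okst f s"
  obtains (PA) "mv f s = PA" "nxt f s = St (nb s) (pos s) (dr s)" "f (lev s) * f (nb s) \<ge> 0"
      "om f (lev s) (nb s) = \<bar>f (nb s)\<bar>" "om f (nb s) (lev s) = \<bar>f (lev s)\<bar>" "pos s < \<bar>f (nb s)\<bar>"
  | (PB) "mv f s = PB" "nxt f s = St (nb s) (pos s - \<bar>f (lev s)\<bar> + \<bar>f (nb s)\<bar>) (dr s)"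
      "f (lev s) * f (nb s) < 0"
      "om f (lev s) (nb s) = - \<bar>f (nb s)\<bar>" "om f (nb s) (lev s) = - \<bar>f (lev s)\<bar>"
      "pos s > \<bar>f (lev s)\<bar> - \<bar>f (nb s)\<bar>"
  | (OP) "mv f s = OP" "nxt f s = St (lev s) (\<bar>f (lev s)\<bar> + om f (lev s) (nb s) - pos s) (- dr s)"
      "om f (lev s) (nb s) < pos s" "pos s < \<bar>f (lev s)\<bar> + om f (lev s) (nb s)"
proof -
  have sym: "f (nb s) * f (lev s) = f (lev s) * f (nb s)" by (simp add: mult.commute)
  consider "pos s < om f (lev s) (nb s)" | "pos s > \<bar>f (lev s)\<bar> + om f (lev s) (nb s)"
    | "om f (lev s) (nb s) < pos s" "pos s < \<bar>f (lev s)\<bar> + om f (lev s) (nb s)"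
    using assms unfolding okst_def by linarith
  then show ?thesis
  proof cases
    case 1
    have "f (lev s) * f (nb s) \<ge> 0"
      using 1 assms unfolding okst_def inner_st_def om_def by (auto split: if_splits)
    then show ?thesis using 1 PA by (auto simp: mv_def nxt_def om_def sym)
  next
    case 2
    have "f (lev s) * f (nb s) < 0"
      using 2 assms unfolding okst_def inner_st_def om_def by (auto split: if_splits)
    moreover have "\<not> pos s < om f (lev s) (nb s)" using 2 by linarith
    ultimately show ?thesis using 2 PB by (auto simp: mv_def nxt_def om_def sym)
  next
    case 3
    then show ?thesis using OP by (auto simp: mv_def nxt_def)
  qed
qed

lemma nxt_inner:
  assumes "okst f s" shows "inner_st f (nxt f s)"
  using assms
proof (cases rule: nxt_cases)
  case PA then show ?thesis using assms by (auto simp: okst_def inner_st_def)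
next
  case PB then show ?thesis using assms by (auto simp: okst_def inner_st_def)
next
  case OP then show ?thesis using assms by (auto simp: okst_def inner_st_def)
qed

text \<open>Each move is undone by a move of the same kind, which gives time reversal and with it
  the injectivity of \<open>nxt\<close>.\<close>

lemma nxt_rv:
  assumes "okst f s" shows "okst f (rv (nxt f s))" "nxt f (rv (nxt f s)) = rv s"
proof -
  have i: "inner_st f s" and d: "dr s = 1 \<or> dr s = -1" and p: "0 < pos s" "pos s < \<bar>f (lev s)\<bar>"
    using assms by (auto simp: okst_def inner_st_def)
  have in': "inner_st f (rv (nxt f s))" using nxt_inner[OF assms] by simp
  from assms have "okst f (rv (nxt f s)) \<and> nxt f (rv (nxt f s)) = rv s"
  proof (cases rule: nxt_cases)
    case PA
    have "nb (rv (nxt f s)) = lev s" using PA by simp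
    then show ?thesis using PA p in' d
      by (auto simp: okst_def nxt_def mv_def rv_def)
  next
    case PB
    have "nb (rv (nxt f s)) = lev s" using PB by simp
    then show ?thesis using PB p in' d
      by (auto simp: okst_def nxt_def mv_def rv_def)
  next
    case OP
    have "nb (rv (nxt f s)) = nb s" using OP by simp
    then show ?thesis using OP p in' d
      by (auto simp: okst_def nxt_def mv_def rv_def)
  qed
  then show "okst f (rv (nxt f s))" "nxt f (rv (nxt f s)) = rv s" by auto
qed

lemma nxt_inj:
  assumes "okst f s" "okst f t" "nxt f s = nxt f t" shows "s = t"
  by (metis assms nxt_rv(2) rv_simps(4))

lemma tile_rv_nxt: assumes "okst f s" shows "tile (rv (nxt f s)) = tile s"
proof -
  have d: "dr s = 1 \<or> dr s = -1" using assms by (auto simp: okst_def inner_st_def)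
  from assms show ?thesis
    by (cases rule: nxt_cases) (use d in \<open>auto simp: tile_def\<close>)
qed

lemma inner_not_ok_hits: "inner_st f s \<Longrightarrow> \<not> okst f s \<Longrightarrow> \<exists>a. hits f a s"
  by (auto simp: okst_def hits_def inner_st_def)

lemma hits_not_ok: "hits f a s \<Longrightarrow> \<not> okst f s"
  by (auto simp: okst_def hits_def inner_st_def split: if_splits)

section \<open>Parity of the end points of chords in one rhombus\<close>

lemma same_tile_cases:
  assumes "tile m = tile z" "dr m = 1 \<or> dr m = -1" "dr z = 1 \<or> dr z = -1"
  shows "(lev m = lev z \<and> nb m = nb z \<and> dr m = dr z) \<or> (lev m = nb z \<and> nb m = lev z \<and> dr m = - dr z)"
  using assms by (auto simp: tile_def split: if_splits)

lemma nxt_cases2: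
  assumes "okst f s" "W = \<bar>f (lev s)\<bar>" "V = \<bar>f (nb s)\<bar>" "S \<longleftrightarrow> f (lev s) * f (nb s) \<ge> 0"
  shows "(S \<and> nxt f s = St (nb s) (pos s) (dr s) \<and> pos s < V) \<or>
    (\<not> S \<and> nxt f s = St (nb s) (pos s - W + V) (dr s) \<and> pos s > W - V) \<or>
    (S \<and> nxt f s = St (lev s) (W + V - pos s) (- dr s) \<and> pos s > V) \<or>
    (\<not> S \<and> nxt f s = St (lev s) (W - V - pos s) (- dr s) \<and> pos s < W - V)"
  using assms(1)
proof (cases rule: nxt_cases)
  case OP then show ?thesis using assms by (auto simp: om_def split: if_splits)
qed (use assms in auto)

lemma hits_cases2:
  assumes "hits f a s" "W = \<bar>f (lev s)\<bar>" "V = \<bar>f (nb s)\<bar>" "S \<longleftrightarrow> f (lev s) * f (nb s) \<ge> 0"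
  shows "(a \<and> pos s = 0) \<or> (\<not> a \<and> pos s = W) \<or> (a \<and> \<not> S \<and> pos s = W - V) \<or> (\<not> a \<and> S \<and> pos s = V)
    \<or> (a \<and> pos s = W \<and> V = 0) \<or> (\<not> a \<and> pos s = 0 \<and> V = 0)"
  using assms by (auto simp: hits_def om_def split: if_splits)

text \<open>The pairs \<open>a\<close>, \<open>K - a\<close> and \<open>b\<close>,
  \<open>K - b\<close> are concentric, hence nested and never linked. This settles two chords that
  both join opposite sides.\<close>

lemma flip_flip: "b \<noteq> a \<Longrightarrow> b \<noteq> K - a \<Longrightarrow>
  even (of_bool (a < b) + of_bool (a < K - b) + of_bool (K - a < b) + of_bool (K - a < K - b) :: nat)"
  for a b K :: real
proof -
  assume "b \<noteq> a" "b \<noteq> K - a"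
  then have "K - a < K - b \<longleftrightarrow> \<not> a < b" "K - a < b \<longleftrightarrow> \<not> a < K - b" by auto
  then show ?thesis by simp
qed

lemma chord_parity_aux:
  fixes n l :: int
  assumes ad: "n \<noteq> l"
    and z: "(S \<and> z' = St n y d \<and> y < V) \<or> (\<not> S \<and> z' = St n (y - W + V) d \<and> y > W - V) \<or>
      (S \<and> z' = St l (W + V - y) d' \<and> y > V) \<or> (\<not> S \<and> z' = St l (W - V - y) d' \<and> y < W - V)"
    and m: "(S \<and> m' = St n x e \<and> x < V) \<or> (\<not> S \<and> m' = St n (x - W + V) e \<and> x > W - V) \<or>
      (S \<and> m' = St l (W + V - x) e' \<and> x > V) \<or> (\<not> S \<and> m' = St l (W - V - x) e' \<and> x < W - V)"
    and r: "0 < x" "x < W" "0 < y" "y < W" and zl: "lev z = l" "pos z = y" and ml: "lev m = l" "pos m = x"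
    and ne: "\<not> (lev m = lev z \<and> pos m = pos z)" "\<not> (lev m' = lev z \<and> pos m' = pos z)"
  shows "even (of_bool (less_st m z) + of_bool (less_st m z')
     + of_bool (less_st m' z) + of_bool (less_st m' z') :: nat)"
  using z
proof (elim disjE conjE)
  assume z: "S" "z' = St n y d" "y < V"
  show ?thesis using m z ad r zl ml ne by (elim disjE conjE) (simp_all add: less_st_def)
next
  assume z: "\<not> S" "z' = St n (y - W + V) d" "W - V < y"
  show ?thesis using m z ad r zl ml ne by (elim disjE conjE) (simp_all add: less_st_def)
next
  assume z: "S" "z' = St l (W + V - y) d'" "V < y"
  show ?thesis using m
  proof (elim disjE conjE)
    assume "S" "m' = St l (W + V - x) e'" then show ?thesis using z ad r zl ml ne flip_flip[of y x "W+V"]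
      by (simp add: less_st_def)
  qed (use z ad r zl ml ne in \<open>simp_all add: less_st_def\<close>)
next
  assume z: "\<not> S" "z' = St l (W - V - y) d'" "y < W - V"
  show ?thesis using m
  proof (elim disjE conjE)
    assume "m' = St l (W - V - x) e'" then show ?thesis using z ad r zl ml ne flip_flip[of y x "W-V"]
      by (simp add: less_st_def)
  qed (use z ad r zl ml ne in \<open>simp_all add: less_st_def\<close>)
qed

lemma chord_parity_aux2:
  fixes n l :: int
  assumes ad: "n \<noteq> l"
    and z: "(S \<and> z' = St n y d \<and> y < V) \<or> (\<not> S \<and> z' = St n (y - W + V) d \<and> y > W - V) \<or>
      (S \<and> z' = St l (W + V - y) d' \<and> y > V) \<or> (\<not> S \<and> z' = St l (W - V - y) d' \<and> y < W - V)"
    and m: "(S \<and> m' = St l x e \<and> x < W) \<or> (\<not> S \<and> m' = St l (x - V + W) e \<and> x > V - W) \<or>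
      (S \<and> m' = St n (W + V - x) e' \<and> x > W) \<or> (\<not> S \<and> m' = St n (V - W - x) e' \<and> x < V - W)"
    and r: "0 < x" "x < V" "0 < y" "y < W" and zl: "lev z = l" "pos z = y" and ml: "lev m = n" "pos m = x"
    and ne: "\<not> (lev m = lev z \<and> pos m = pos z)" "\<not> (lev m' = lev z \<and> pos m' = pos z)"
  shows "even (of_bool (less_st m z) + of_bool (less_st m z')
     + of_bool (less_st m' z) + of_bool (less_st m' z') :: nat)"
  using z
proof (elim disjE conjE)
  assume z: "S" "z' = St n y d" "y < V"
  show ?thesis using m z ad r zl ml ne by (elim disjE conjE) (simp_all add: less_st_def)
next
  assume z: "\<not> S" "z' = St n (y - W + V) d" "W - V < y"
  show ?thesis using m z ad r zl ml ne
    by (elim disjE conjE) (auto simp: less_st_def of_bool_def)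
next
  assume z: "S" "z' = St l (W + V - y) d'" "V < y"
  show ?thesis using m z ad r zl ml ne by (elim disjE conjE) (simp_all add: less_st_def)
next
  assume z: "\<not> S" "z' = St l (W - V - y) d'" "y < W - V"
  show ?thesis using m z ad r zl ml ne by (elim disjE conjE) (simp_all add: less_st_def)
qed

text \<open>Chords of the same direction do not cross, so their end points are unlinked on the
  boundary of the folded rhombus, one arc for each of the two levels. Unlinked pairs have an even
  number of order relations. Excluding a common end point at \<open>z\<close> is enough: a common
  end point makes the chords equal.\<close>

lemma chord_parity:
  assumes m: "okst f m" and z: "okst f z" and t: "tile m = tile z"
    and ne: "\<not> (lev m = lev z \<and> pos m = pos z)" "\<not> (lev (nxt f m) = lev z \<and> pos (nxt f m) = pos z)"
  shows "even (of_bool (less_st m z) + of_bool (less_st m (nxt f z))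
     + of_bool (less_st (nxt f m) z) + of_bool (less_st (nxt f m) (nxt f z)) :: nat)"
proof -
  obtain W V S where WVS: "W = \<bar>f (lev z)\<bar>" "V = \<bar>f (nb z)\<bar>" "S \<longleftrightarrow> f (lev z) * f (nb z) \<ge> 0" by blast
  have dm: "dr m = 1 \<or> dr m = -1" "0 < pos m" "pos m < \<bar>f (lev m)\<bar>"
    and dz: "dr z = 1 \<or> dr z = -1" "0 < pos z" "pos z < W"
    using m z WVS by (auto simp: okst_def inner_st_def)
  have ad: "nb z \<noteq> lev z" using dz by auto
  note zc = nxt_cases2[OF z WVS]
  from same_tile_cases[OF t dm(1) dz(1)] show ?thesis
  proof (elim disjE conjE)
    assume e: "lev m = lev z" "nb m = nb z" "dr m = dr z"
    have mc: "W = \<bar>f (lev m)\<bar>" "V = \<bar>f (nb m)\<bar>" "S \<longleftrightarrow> f (lev m) * f (nb m) \<ge> 0"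
      by (simp_all only: e WVS)
    note mc = nxt_cases2[OF m mc, unfolded e(2), unfolded e(1)]
    show ?thesis
      by (rule chord_parity_aux[OF ad zc mc dm(2) dm(3)[unfolded e, folded WVS] dz(2,3) refl refl e(1) refl ne])
  next
    assume e: "lev m = nb z" "nb m = lev z" "dr m = - dr z"
    have mc: "V = \<bar>f (lev m)\<bar>" "W = \<bar>f (nb m)\<bar>" "S \<longleftrightarrow> f (lev m) * f (nb m) \<ge> 0"
      unfolding e(2) unfolding e(1) WVS by (simp_all only: mult.commute)
    note mc = nxt_cases2[OF m mc, unfolded e(2), unfolded e(1), unfolded add.commute[of V W]]
    show ?thesis
      by (rule chord_parity_aux2[OF ad zc mc dm(2) dm(3)[unfolded e, folded WVS] dz(2,3) refl refl e(1) refl ne])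
  qed
qed

text \<open>A chord that changes level separates the \<open>A\<close>-corner from the
  \<open>B\<close>-corner, and \<open>m\<close> stays on the side of the corner it runs into, which
  is below \<open>z\<close> exactly for type \<open>A\<close>. A chord that keeps its level leaves
  both corners on one side.\<close>

lemma terminal_parity1:
  assumes m: "hits f a m" and z: "okst f z" and t: "tile m = tile z"
  shows "odd (of_bool (less_st m z) + of_bool (less_st m (nxt f z)) :: nat)
     \<longleftrightarrow> a \<and> lev (nxt f z) \<noteq> lev z"
proof -
  obtain W V S where WVS: "W = \<bar>f (lev z)\<bar>" "V = \<bar>f (nb z)\<bar>" "S \<longleftrightarrow> f (lev z) * f (nb z) \<ge> 0" by blast
  have dm: "dr m = 1 \<or> dr m = -1" "0 \<le> pos m" "pos m \<le> \<bar>f (lev m)\<bar>"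
    and dz: "dr z = 1 \<or> dr z = -1" "0 < pos z" "pos z < W" and V0: "V \<ge> 0"
    using m z WVS by (auto simp: okst_def inner_st_def hits_def)
  define n where "n = nb z"
  define l where "l = lev z"
  have ad: "n \<noteq> l" using dz by (auto simp: n_def l_def)
  note zc = nxt_cases2[OF z WVS, folded n_def l_def]
  from same_tile_cases[OF t dm(1) dz(1)] show ?thesis
  proof (elim disjE conjE)
    assume e: "lev m = lev z" "nb m = nb z" "dr m = dr z"
    have mc: "W = \<bar>f (lev m)\<bar>" "V = \<bar>f (nb m)\<bar>" "S \<longleftrightarrow> f (lev m) * f (nb m) \<ge> 0"
      by (simp_all only: e WVS)
    note mc = hits_cases2[OF m mc]
    show ?thesis using zc mc ad dm(2,3)[unfolded e, folded WVS] dz(2,3) e(1)[folded l_def] l_def V0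
      by (elim disjE conjE) (simp_all add: less_st_def)
  next
    assume e: "lev m = nb z" "nb m = lev z" "dr m = - dr z"
    have mc: "V = \<bar>f (lev m)\<bar>" "W = \<bar>f (nb m)\<bar>" "S \<longleftrightarrow> f (lev m) * f (nb m) \<ge> 0"
      unfolding e(2) unfolding e(1) WVS by (simp_all only: mult.commute)
    note mc = hits_cases2[OF m mc]
    show ?thesis using zc mc ad dm(2,3)[unfolded e, folded WVS] dz(2,3) e(1)[folded n_def] l_def V0
      by (elim disjE conjE) (simp_all add: less_st_def)
  qed
qed

text \<open>The same separation with the roles exchanged: a level-changing chord has an end below
  the terminal state exactly when the latter runs into the \<open>B\<close>-corner.\<close>

lemma terminal_parity2:
  assumes z: "hits f a z" and m: "okst f m" and t: "tile m = tile z"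
  shows "odd (of_bool (less_st m z) + of_bool (less_st (nxt f m) z) :: nat)
     \<longleftrightarrow> \<not> a \<and> lev (nxt f m) \<noteq> lev m"
proof -
  obtain W V S where WVS: "W = \<bar>f (lev m)\<bar>" "V = \<bar>f (nb m)\<bar>" "S \<longleftrightarrow> f (lev m) * f (nb m) \<ge> 0" by blast
  have dz: "dr z = 1 \<or> dr z = -1" "0 \<le> pos z" "pos z \<le> \<bar>f (lev z)\<bar>"
    and dm: "dr m = 1 \<or> dr m = -1" "0 < pos m" "pos m < W" and V0: "V \<ge> 0"
    using m z WVS by (auto simp: okst_def inner_st_def hits_def)
  define n where "n = nb m"
  define l where "l = lev m"
  have ad: "n \<noteq> l" using dm by (auto simp: n_def l_def)
  note zc = nxt_cases2[OF m WVS, folded n_def l_def]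
  from same_tile_cases[OF t[symmetric] dz(1) dm(1)] show ?thesis
  proof (elim disjE conjE)
    assume e: "lev z = lev m" "nb z = nb m" "dr z = dr m"
    have mc: "W = \<bar>f (lev z)\<bar>" "V = \<bar>f (nb z)\<bar>" "S \<longleftrightarrow> f (lev z) * f (nb z) \<ge> 0"
      by (simp_all only: e WVS)
    note mc = hits_cases2[OF z mc]
    show ?thesis using zc mc ad dz(2,3)[unfolded e, folded WVS] dm(2,3) e(1)[folded l_def] l_def V0
      by (elim disjE conjE) (simp_all add: less_st_def)
  next
    assume e: "lev z = nb m" "nb z = lev m" "dr z = - dr m"
    have mc: "V = \<bar>f (lev z)\<bar>" "W = \<bar>f (nb z)\<bar>" "S \<longleftrightarrow> f (lev z) * f (nb z) \<ge> 0"
      unfolding e(2) unfolding e(1) WVS by (simp_all only: mult.commute)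
    note mc = hits_cases2[OF z mc]
    show ?thesis using zc mc ad dz(2,3)[unfolded e, folded WVS] dm(2,3) e(1)[folded n_def] l_def V0
      by (elim disjE conjE) (simp_all add: less_st_def)
  qed
qed

section \<open>Counting crossings modulo 2\<close>

definition run :: "(int \<Rightarrow> real) \<Rightarrow> (nat \<Rightarrow> st) \<Rightarrow> nat \<Rightarrow> bool" where
  "run f p n \<longleftrightarrow> (\<forall>i<n. okst f (p i) \<and> p (Suc i) = nxt f (p i))"

text \<open>Counts the end points, on the side of \<open>z\<close> and below \<open>z\<close>, of the chords which the run leaves in the rhombus that \<open>z\<close> enters; only its parity matters.\<close>

definition cnt :: "(nat \<Rightarrow> st) \<Rightarrow> nat \<Rightarrow> st \<Rightarrow> nat" where
  "cnt p n z = (\<Sum>i<n. of_bool (tile (p i) = tile z) *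
     (of_bool (less_st (p i) z) + of_bool (less_st (p (Suc i)) z)))"

lemma run_rev:
  assumes "run f p n" shows "run f (\<lambda>j. rv (p (n - j))) n"
  unfolding run_def
proof (intro allI impI)
  fix i assume "i < n"
  then obtain j where j: "n - i = Suc j" "n - Suc i = j" "j < n"
    by (metis Suc_diff_Suc diff_Suc_less gr_implies_not0 neq0_conv)
  then have "okst f (p j)" "p (Suc j) = nxt f (p j)" using assms by (auto simp: run_def)
  then show "okst f (rv (p (n - i))) \<and> rv (p (n - Suc i)) = nxt f (rv (p (n - i)))"
    using nxt_rv j by simp
qed

lemma run_inner:
  assumes "run f p n" "i \<le> n" "n > 0" shows "inner_st f (p i)"
proof (cases i)
  case 0 then show ?thesis using assms by (simp add: run_def okst_inner)
next
  case (Suc j) then show ?thesis using assms nxt_inner by (simp add: run_def)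
qed

lemma run_tile: "run f p n \<Longrightarrow> i < n \<Longrightarrow> tile (rv (p (Suc i))) = tile (p i)"
  by (simp add: run_def tile_rv_nxt)

lemma inner_dr: "inner_st f s \<Longrightarrow> dr s = 1 \<or> dr s = -1" by (simp add: inner_st_def)

lemma same_point:
  assumes "dr s = 1 \<or> dr s = -1" "dr t = 1 \<or> dr t = -1" "lev s = lev t" "pos s = pos t"
  shows "s = t \<or> s = rv t"
  using assms by (auto intro: st_eqI)

text \<open>\<open>rv (nxt f z)\<close> looks back into the rhombus that \<open>z\<close> enters, so
  this transports the parity through one rhombus; it is \<open>chord_parity\<close> summed over the
  run.\<close>

lemma cnt_leaf:
  assumes p: "run f p n" and z: "okst f z"
    and ne: "\<And>i. i \<le> n \<Longrightarrow> \<not> (lev (p i) = lev z \<and> pos (p i) = pos z)"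
  shows "even (cnt p n z + cnt p n (rv (nxt f z)))"
proof -
  have t: "tile (rv (nxt f z)) = tile z" by (rule tile_rv_nxt[OF z])
  have "cnt p n z + cnt p n (rv (nxt f z)) = (\<Sum>i<n. of_bool (tile (p i) = tile z) *
     (of_bool (less_st (p i) z) + of_bool (less_st (p i) (nxt f z))
     + of_bool (less_st (p (Suc i)) z) + of_bool (less_st (p (Suc i)) (nxt f z))))"
    unfolding cnt_def t by (simp add: sum.distrib[symmetric] algebra_simps)
  also have "even \<dots>"
  proof (rule dvd_sum)
    fix i assume "i \<in> {..<n}"
    then have i: "i < n" "okst f (p i)" "p (Suc i) = nxt f (p i)" using p by (auto simp: run_def)
    show "even (of_bool (tile (p i) = tile z) *
     (of_bool (less_st (p i) z) + of_bool (less_st (p i) (nxt f z))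
     + of_bool (less_st (p (Suc i)) z) + of_bool (less_st (p (Suc i)) (nxt f z))) :: nat)"
    proof (cases "tile (p i) = tile z")
      case True
      show ?thesis using chord_parity[OF i(2) z True] ne[of i] ne[of "Suc i"] i True by auto
    qed simp
  qed
  finally show ?thesis .
qed

lemma tile_two:
  assumes "lev s = lev z" "dr s = 1 \<or> dr s = -1" "dr z = 1 \<or> dr z = -1"
  shows "of_bool (tile s = tile z) + of_bool (tile s = tile (rv z)) = (1::nat)"
  using assms by (auto simp: tile_def)

lemma sum_telescope_even: "even ((\<Sum>i<n. a i + a (Suc i)) + a 0 + a n :: nat)"
  by (induction n) (auto simp: algebra_simps)

text \<open>A crossing ends a chord on one side of the edge and starts the next on the other. Seen
  from both sides together an inner crossing is therefore counted twice, the first and the last only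
  once.\<close>

lemma cnt_balance:
  assumes p: "run f p n" and z: "dr z = 1 \<or> dr z = -1"
  shows "even (cnt p n z + cnt p n (rv z) + of_bool (less_st (p 0) z) + of_bool (less_st (p n) z))"
proof -
  have "cnt p n z + cnt p n (rv z) = (\<Sum>i<n. of_bool (less_st (p i) z) + of_bool (less_st (p (Suc i)) z))"
    unfolding cnt_def sum.distrib[symmetric]
  proof (rule sum.cong[OF refl])
    fix i assume "i \<in> {..<n}"
    then have i: "i < n" "n > 0" by auto
    have d1: "dr (p i) = 1 \<or> dr (p i) = -1" using run_inner[OF p, of i] i inner_dr by simp
    have d2: "dr (rv (p (Suc i))) = 1 \<or> dr (rv (p (Suc i))) = -1"
      using run_inner[OF p, of "Suc i"] i inner_dr by fastforce
    have A: "of_bool (tile (p i) = tile z) * of_bool (less_st (p i) z)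
      + of_bool (tile (p i) = tile (rv z)) * of_bool (less_st (p i) z) = (of_bool (less_st (p i) z)::nat)"
    proof (cases "less_st (p i) z")
      case True
      then have "lev (p i) = lev z" by (simp add: less_st_def)
      from tile_two[OF this d1 z] show ?thesis using True by simp
    qed simp
    have B: "of_bool (tile (p i) = tile z) * of_bool (less_st (p (Suc i)) z)
      + of_bool (tile (p i) = tile (rv z)) * of_bool (less_st (p (Suc i)) z) = (of_bool (less_st (p (Suc i)) z)::nat)"
    proof (cases "less_st (p (Suc i)) z")
      case True
      then have "lev (rv (p (Suc i))) = lev z" by (simp add: less_st_def)
      from tile_two[OF this d2 z] show ?thesis using True run_tile[OF p i(1)] by simp
    qed simp
    show "of_bool (tile (p i) = tile z) * (of_bool (less_st (p i) z) + of_bool (less_st (p (Suc i)) z)) +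
         of_bool (tile (p i) = tile (rv z)) * (of_bool (less_st (p i) (rv z)) + of_bool (less_st (p (Suc i)) (rv z))) =
         of_bool (less_st (p i) z) + (of_bool (less_st (p (Suc i)) z) :: nat)"
      using A B by (simp add: algebra_simps)
  qed
  then show ?thesis using sum_telescope_even[of "\<lambda>i. of_bool (less_st (p i) z)" n] by simp
qed

lemma cnt_step:
  assumes p: "run f p n" and z: "okst f z"
    and ne: "\<And>i. i \<le> n \<Longrightarrow> \<not> (lev (p i) = lev z \<and> pos (p i) = pos z)"
  shows "even (cnt p n z + cnt p n (nxt f z)
    + of_bool (less_st (p 0) (nxt f z)) + of_bool (less_st (p n) (nxt f z)))"
proof -
  have "dr (nxt f z) = 1 \<or> dr (nxt f z) = -1" using nxt_inner[OF z] inner_dr by blast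
  from cnt_balance[OF p this] cnt_leaf[OF p z ne] show ?thesis by presburger
qed

text \<open>A chord that changes level in tile \<open>k\<close> crosses the threshold between
  \<open>k - 1\<close> and \<open>k\<close>, and no other chord does.\<close>

lemma passes_even:
  assumes p: "run f p n"
  shows "even ((\<Sum>i<n. of_bool (tile (p i) = k \<and> lev (p (Suc i)) \<noteq> lev (p i)))
     + of_bool (lev (p 0) \<ge> k) + of_bool (lev (p n) \<ge> k) :: nat)"
proof -
  have "of_bool (tile (p i) = k \<and> lev (p (Suc i)) \<noteq> lev (p i)) =
    (of_bool ((lev (p i) \<ge> k) \<noteq> (lev (p (Suc i)) \<ge> k)) :: nat)" if i: "i < n" for i
  proof -
    have ok: "okst f (p i)" "p (Suc i) = nxt f (p i)" using p i by (auto simp: run_def)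
    have d: "dr (p i) = 1 \<or> dr (p i) = -1" using ok by (auto simp: okst_def inner_st_def)
    from ok(1) show ?thesis
      by (cases rule: nxt_cases) (use d ok(2) in \<open>auto simp: tile_def\<close>)
  qed
  then have "(\<Sum>i<n. of_bool (tile (p i) = k \<and> lev (p (Suc i)) \<noteq> lev (p i)))
     = (\<Sum>i<n. of_bool ((lev (p i) \<ge> k) \<noteq> (lev (p (Suc i)) \<ge> k)) :: nat)"
    by (intro sum.cong) auto
  moreover have "even ((\<Sum>i<m. of_bool ((lev (p i) \<ge> k) \<noteq> (lev (p (Suc i)) \<ge> k)))
     + of_bool (lev (p 0) \<ge> k) + of_bool (lev (p m) \<ge> k) :: nat)" for m
    by (induction m) auto
  ultimately show ?thesis by simp
qed

text \<open>By \<open>terminal_parity2\<close> only passages through the rhombus of \<open>z\<close>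
  matter, and a run that comes back to its level passes every rhombus an even number of
  times.\<close>

lemma cnt_terminal:
  assumes p: "run f p n" and z: "hits f a z" and c: "lev (p 0) = lev (p n)"
  shows "even (cnt p n z)"
proof -
  have "(of_bool (tile (p i) = tile z) * (of_bool (less_st (p i) z) + of_bool (less_st (p (Suc i)) z)) :: nat) mod 2
    = of_bool (\<not> a) * of_bool (tile (p i) = tile z \<and> lev (p (Suc i)) \<noteq> lev (p i))" if i: "i < n" for i
  proof (cases "tile (p i) = tile z")
    case True
    have ok: "okst f (p i)" "p (Suc i) = nxt f (p i)" using p i by (auto simp: run_def)
    show ?thesis using terminal_parity2[OF z ok(1) True] True
      unfolding mod_2_eq_odd ok(2) by simp
  qed simp
  then have "cnt p n z mod 2 = (\<Sum>i<n. of_bool (\<not> a) * of_bool (tile (p i) = tile z \<and> lev (p (Suc i)) \<noteq> lev (p i))) mod 2"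
    unfolding cnt_def by (subst mod_sum_eq[symmetric]) simp
  also have "\<dots> = (of_bool (\<not> a) * (\<Sum>i<n. of_bool (tile (p i) = tile z \<and> lev (p (Suc i)) \<noteq> lev (p i)))) mod 2"
    by (simp add: sum_distrib_left)
  also have "\<dots> = 0"
    using passes_even[OF p, of "tile z"] c by (cases a) auto
  finally show ?thesis by auto
qed

section \<open>First returns to a base interval\<close>

text \<open>A separatrix that leaves the end \<open>q\<close> of the base interval and runs into a
  vertex. Length \<open>r = 0\<close> is allowed; it serves for a vertex seen directly from the base
  side.\<close>

definition tail :: "(int \<Rightarrow> real) \<Rightarrow> int \<Rightarrow> real \<Rightarrow> real \<Rightarrow> real \<Rightarrow> bool \<Rightarrow> (nat \<Rightarrow> st) \<Rightarrow> nat \<Rightarrow> bool" where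
  "tail f N q1 q2 q a t r \<longleftrightarrow> lev (t 0) = N \<and> pos (t 0) = q \<and> run f t r \<and> hits f a (t r) \<and>
     (\<forall>i. 0 < i \<and> i \<le> r \<longrightarrow> \<not> (lev (t i) = N \<and> q1 < pos (t i) \<and> pos (t i) < q2))"

locale base =
  fixes f :: "int \<Rightarrow> real" and N :: int and q1 q2 :: real
    and a1 a2 :: bool and t1 t2 :: "nat \<Rightarrow> st" and r1 r2 :: nat
  assumes q12: "q1 < q2"
    and tail1: "tail f N q1 q2 q1 a1 t1 r1"
    and tail2: "tail f N q1 q2 q2 a2 t2 r2"
begin

definition inJ :: "st \<Rightarrow> bool" where "inJ s \<longleftrightarrow> lev s = N \<and> q1 < pos s \<and> pos s < q2"

lemma inJ_rv [simp]: "inJ (rv s) = inJ s" by (simp add: inJ_def)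

lemma J_range: "0 \<le> q1" "q2 \<le> \<bar>f N\<bar>"
proof -
  have *: "0 \<le> pos (t 0) \<and> pos (t 0) \<le> \<bar>f (lev (t 0))\<bar>" if "run f t r" "hits f a (t r)" for t r a
    using that run_inner[of f t r 0] by (cases "r = 0") (auto simp: hits_def inner_st_def)
  show "0 \<le> q1" using * tail1 by (metis tail_def)
  show "q2 \<le> \<bar>f N\<bar>" using * tail2 by (metis tail_def)
qed

text \<open>From a common state on both would coincide, but the tail dies at a vertex without
  entering the base interval, in which the run still has to end.\<close>

lemma tail_run_disj:
  assumes t: "tail f N q1 q2 q a t r" and q: "q = q1 \<or> q = q2"
    and p: "run f p n" and J: "inJ (p n)" and i: "i \<le> n" and s: "s \<le> r"
  shows "t s \<noteq> p i"
  using i s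
proof (induction "n - i" arbitrary: i s)
  case 0
  then have "i = n" by simp
  then show ?case using J t q \<open>s \<le> r\<close> unfolding tail_def inJ_def
    by (cases "s = 0") (auto)
next
  case (Suc k)
  then have i: "i < n" by simp
  show ?case
  proof
    assume e: "t s = p i"
    have ok: "okst f (t s)" using p i e by (simp add: run_def)
    then have "s \<noteq> r" using t hits_not_ok by (auto simp: tail_def)
    then have "s < r" using Suc by simp
    then have "t (Suc s) = p (Suc i)" using e p i t by (simp add: run_def tail_def)
    moreover have "t (Suc s) \<noteq> p (Suc i)" using Suc \<open>s < r\<close> i by simp
    ultimately show False by simp
  qed
qed

lemma tail_dr: 
  assumes t: "tail f N q1 q2 q a t r" and s: "s \<le> r" shows "dr (t s) = 1 \<or> dr (t s) = -1"
proof (cases "s = r")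
  case True then show ?thesis using t by (auto simp: tail_def hits_def)
next
  case False then show ?thesis using t s run_inner[of f t r s] inner_dr by (auto simp: tail_def)
qed

lemma tail_run_points:
  assumes t: "tail f N q1 q2 q a t r" and q: "q = q1 \<or> q = q2"
    and p: "run f p n" and n: "n > 0" and J: "inJ (p 0)" "inJ (p n)" and i: "i \<le> n" and s: "s \<le> r"
  shows "\<not> (lev (p i) = lev (t s) \<and> pos (p i) = pos (t s))"
proof
  assume e: "lev (p i) = lev (t s) \<and> pos (p i) = pos (t s)"
  have d: "dr (p i) = 1 \<or> dr (p i) = -1" using run_inner[OF p i n] inner_dr by blast
  from same_point[OF tail_dr[OF t s] d] e have "t s = p i \<or> t s = rv (p i)" by simp
  moreover have "t s \<noteq> p i" by (rule tail_run_disj[OF t q p J(2) i s])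
  moreover have "t s \<noteq> rv (p (n - (n - i)))"
    by (rule tail_run_disj[OF t q run_rev[OF p] _ _ s]) (use J in auto)
  ultimately show False using i by simp
qed


text \<open>The parity is transported backwards along the tail from its vertex, where it is even.
  The corrections in \<open>cnt_step\<close> cancel: no later point of the tail lies in the base
  interval, so none separates the two ends of the run.\<close>

lemma cnt_tail:
  assumes t: "tail f N q1 q2 q a t r" and q: "q = q1 \<or> q = q2"
    and p: "run f p n" and n: "n > 0" and J: "inJ (p 0)" "inJ (p n)" and s: "s \<le> r"
  shows "even (cnt p n (t s))"
proof -
  have "even (cnt p n (t (r - k)))" if "k \<le> r" for k
    using that
  proof (induction k)
    case 0
    show ?case using cnt_terminal[OF p, of a "t r"] t J by (auto simp: tail_def inJ_def)
  next
    case (Suc k)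
    let ?s = "r - Suc k"
    have s: "Suc ?s = r - k" "?s < r" "?s \<le> r" using Suc.prems by auto
    have ok: "okst f (t ?s)" and nx: "t (r - k) = nxt f (t ?s)"
      using t s unfolding tail_def run_def by metis+
    have av: "\<not> (lev (t (r - k)) = N \<and> q1 < pos (t (r - k)) \<and> pos (t (r - k)) < q2)"
      using t s unfolding tail_def by (metis Suc_leI zero_less_Suc)
    have "less_st (p 0) (t (r - k)) = less_st (p n) (t (r - k))"
      using J av unfolding less_st_def inJ_def by auto
    moreover have "even (cnt p n (t ?s) + cnt p n (t (r - k))
      + of_bool (less_st (p 0) (t (r - k))) + of_bool (less_st (p n) (t (r - k))))"
      unfolding nx by (rule cnt_step[OF p ok]) (use tail_run_points[OF t q p n J _ s(3)] in blast)
    moreover have "even (cnt p n (t (r - k)))" using Suc by simp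
    ultimately show ?case by auto
  qed
  from this[of "r - s"] show ?thesis using s by simp
qed

definition arc :: "real \<Rightarrow> int \<Rightarrow> (nat \<Rightarrow> st) \<Rightarrow> nat \<Rightarrow> bool" where
  "arc x d p n \<longleftrightarrow> p 0 = St N x d \<and> run f p n \<and> n > 0 \<and> inJ (p 0) \<and> inJ (p n)
     \<and> (\<forall>i. 0 < i \<and> i < n \<longrightarrow> \<not> inJ (p i))"

text \<open>Inner crossings avoid the base interval, so between \<open>q1\<close> and
  \<open>y\<close> only the two ends of the arc can lie. The conditions on \<open>e\<close> tell
  from which side of the interval the first and the last chord are seen.\<close>

lemma cnt_on_J:
  assumes a: "arc x d p n" and y: "q1 \<le> y" "y \<le> q2" and e: "e = 1 \<or> e = -1"
  shows "cnt p n (St N y e) = cnt p n (St N q1 e) + of_bool (e = d \<and> x < y) + of_bool (e = - dr (p n) \<and> pos (p n) < y)"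
proof -
  have p: "run f p n" "n > 0" "inJ (p 0)" "inJ (p n)" "p 0 = St N x d" using a by (auto simp: arc_def)
  have d0: "d = 1 \<or> d = -1" using run_inner[OF p(1), of 0] p inner_dr by fastforce
  have dn: "dr (p n) = 1 \<or> dr (p n) = -1" using run_inner[OF p(1), of n] p inner_dr by fastforce
  let ?T = "\<lambda>i. of_bool (tile (p i) = tile (St N y e)) :: nat"
  have tl: "tile (St N q1 e) = tile (St N y e)" by (simp add: tile_def)
  have nq: "\<not> (lev (p i) = N \<and> pos (p i) = q1)" if "i \<le> n" for i
    using tail_run_points[OF tail1 _ p(1,2,3,4) that, of 0] tail1 by (auto simp: tail_def)
  have int: "of_bool (less_st (p i) (St N y e)) = of_bool (less_st (p i) (St N q1 e))
     + (of_bool (i = 0 \<and> x < y) + of_bool (i = n \<and> pos (p n) < y) :: nat)" if i: "i \<le> n" for i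
  proof -
    consider "i = 0" | "i = n" "i \<noteq> 0" | "0 < i" "i < n" using i by linarith
    then show ?thesis
    proof cases
      case 1 then show ?thesis using p unfolding less_st_def inJ_def by auto
    next
      case 2 then show ?thesis using p unfolding less_st_def inJ_def by auto
    next
      case 3
      then have "\<not> inJ (p i)" using a by (auto simp: arc_def)
      then have "less_st (p i) (St N y e) = less_st (p i) (St N q1 e)"
        using nq[OF i] y unfolding less_st_def inJ_def by auto
      then show ?thesis using 3 by simp
    qed
  qed
  have "cnt p n (St N y e) = (\<Sum>i<n. ?T i * (of_bool (less_st (p i) (St N q1 e)) + of_bool (less_st (p (Suc i)) (St N q1 e)))
      + ?T i * of_bool (i = 0 \<and> x < y) + ?T i * of_bool (Suc i = n \<and> pos (p n) < y))"
    unfolding cnt_def by (intro sum.cong refl) (use int p in \<open>auto simp: algebra_simps\<close>)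
  also have "\<dots> = cnt p n (St N q1 e) + (\<Sum>i<n. ?T i * of_bool (i = 0 \<and> x < y))
      + (\<Sum>i<n. ?T i * of_bool (Suc i = n \<and> pos (p n) < y))"
    unfolding cnt_def tl by (simp add: sum.distrib)
  also have "(\<Sum>i<n. ?T i * of_bool (i = 0 \<and> x < y)) = ?T 0 * of_bool (x < y)"
    by (subst sum.remove[of _ 0]) (use p in auto)
  also have "(\<Sum>i<n. ?T i * of_bool (Suc i = n \<and> pos (p n) < y)) = ?T (n - 1) * of_bool (pos (p n) < y)"
    by (subst sum.remove[of _ "n - 1"]) (use p in auto)
  also have "?T 0 = of_bool (e = d)" using p d0 e by (auto simp: tile_def)
  also have "tile (p (n - 1)) = tile (rv (p n))" using run_tile[OF p(1), of "n - 1"] p by simp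
  also have "of_bool (tile (rv (p n)) = tile (St N y e)) = (of_bool (e = - dr (p n)) :: nat)"
    using p dn e by (auto simp: tile_def inJ_def)
  finally show ?thesis by auto
qed

text \<open>The tail leaves \<open>q1\<close> to one side only; the other side follows from
  \<open>cnt_balance\<close>, since both ends of the arc lie above \<open>q1\<close>.\<close>

lemma cnt_q1:
  assumes a: "arc x d p n" and e: "e = 1 \<or> e = -1"
  shows "even (cnt p n (St N q1 e))"
proof -
  have p: "run f p n" "n > 0" "inJ (p 0)" "inJ (p n)" using a by (auto simp: arc_def)
  have 0: "even (cnt p n (t1 0))" using cnt_tail[OF tail1 _ p, of 0] by simp
  have t: "t1 0 = St N q1 (dr (t1 0))" using tail1 by (auto simp: tail_def intro: st_eqI)
  have d: "dr (t1 0) = 1 \<or> dr (t1 0) = -1" using tail_dr[OF tail1, of 0] by simp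
  have l: "\<not> less_st (p 0) (St N q1 e')" "\<not> less_st (p n) (St N q1 e')" for e'
    using p by (auto simp: less_st_def inJ_def)
  have b: "even (cnt p n (St N q1 e) + cnt p n (St N q1 (- e)))"
    using cnt_balance[OF p(1), of "St N q1 e"] e l by (simp add: rv_def)
  show ?thesis
  proof (cases "e = dr (t1 0)")
    case True then show ?thesis using 0 t by simp
  next
    case False
    then have "- e = dr (t1 0)" using d e by auto
    then show ?thesis using b 0 t by (metis dvd_add_left_iff)
  qed
qed

text \<open>If the arc came back in its original direction, either side of the interval would see
  exactly one of its ends and the count at \<open>q2\<close> would be odd. But a tail starts at
  \<open>q2\<close>, so the count there is even.\<close>

lemma arc_returns_reversed:
  assumes a: "arc x d p n" shows "dr (p n) = - d"
proof (rule ccontr)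
  assume ne: "dr (p n) \<noteq> - d"
  have p: "run f p n" "n > 0" "inJ (p 0)" "inJ (p n)" "p 0 = St N x d" using a by (auto simp: arc_def)
  have d0: "d = 1 \<or> d = -1" using run_inner[OF p(1), of 0] p inner_dr by fastforce
  have dn: "dr (p n) = 1 \<or> dr (p n) = -1" using run_inner[OF p(1), of n] p inner_dr by fastforce
  have eq: "dr (p n) = d" using ne d0 dn by auto
  have t: "t2 0 = St N q2 (dr (t2 0))" using tail2 by (auto simp: tail_def intro: st_eqI)
  have d: "dr (t2 0) = 1 \<or> dr (t2 0) = -1" using tail_dr[OF tail2, of 0] by simp
  have "even (cnt p n (St N q2 (dr (t2 0))))" using cnt_tail[OF tail2 _ p(1-4), of 0] t by simp
  moreover have "x < q2" "pos (p n) < q2" using p by (auto simp: inJ_def)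
  ultimately show False using cnt_on_J[OF a _ _ d, of q2] cnt_q1[OF a d] q12 eq d d0 by auto
qed

text \<open>Since the arc returns reversed, both of its ends are seen from the side
  \<open>d\<close>, and exactly one of them lies below \<open>y\<close>.\<close>

lemma cnt_inside:
  assumes a: "arc x d p n" and y: "min x (pos (p n)) < y" "y < max x (pos (p n))"
  shows "odd (cnt p n (St N y d))"
proof -
  have p: "run f p n" "n > 0" "inJ (p 0)" "inJ (p n)" "p 0 = St N x d" using a by (auto simp: arc_def)
  have d0: "d = 1 \<or> d = -1" using run_inner[OF p(1), of 0] p inner_dr by fastforce
  have "q1 < x" "x < q2" "q1 < pos (p n)" "pos (p n) < q2" using p by (auto simp: inJ_def)
  then have "q1 \<le> y" "y \<le> q2" using y by auto
  from cnt_on_J[OF a this d0] cnt_q1[OF a d0] arc_returns_reversed[OF a] y show ?thesis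
    by (auto simp: min_def max_def split: if_splits)
qed

end

section \<open>Neighbouring orbits and time reversal\<close>

definition orb :: "(int \<Rightarrow> real) \<Rightarrow> st \<Rightarrow> nat \<Rightarrow> st" where
  "orb f s i = (nxt f ^^ i) s"

lemma orb_0 [simp]: "orb f s 0 = s" and orb_Suc: "orb f s (Suc i) = nxt f (orb f s i)"
  by (simp_all add: orb_def)

lemma run_orb: "(\<And>i. i < n \<Longrightarrow> okst f (orb f s i)) \<Longrightarrow> run f (orb f s) n"
  by (simp add: run_def orb_Suc)

lemma run_mono: "run f p n \<Longrightarrow> m \<le> n \<Longrightarrow> run f p m"
  by (simp add: run_def)

text \<open>Neighbouring orbits move rigidly: the difference of \<open>dr * pos\<close> is preserved
  as long as the moves agree.\<close>

lemma move_affine: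
  assumes "okst f s" "okst f t" "lev s = lev t" "dr s = dr t" "mv f s = mv f t"
  shows "lev (nxt f t) = lev (nxt f s)" "dr (nxt f t) = dr (nxt f s)"
    "pos (nxt f t) - pos (nxt f s) = of_int (dr (nxt f s)) * of_int (dr s) * (pos t - pos s)"
proof -
  have d: "dr s = 1 \<or> dr s = -1" using assms by (auto simp: okst_def inner_st_def)
  have "lev (nxt f t) = lev (nxt f s) \<and> dr (nxt f t) = dr (nxt f s) \<and>
    pos (nxt f t) - pos (nxt f s) = of_int (dr (nxt f s)) * of_int (dr s) * (pos t - pos s)"
    using assms(3-5) d unfolding nxt_def by (cases "mv f t") (auto simp: assms(3,4)[symmetric])
  then show "lev (nxt f t) = lev (nxt f s)" "dr (nxt f t) = dr (nxt f s)"
    "pos (nxt f t) - pos (nxt f s) = of_int (dr (nxt f s)) * of_int (dr s) * (pos t - pos s)" by auto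
qed

lemma run_back:
  assumes "run f p n" "run f q m" "p i = q j" "i \<le> n" "j \<le> m" "l \<le> i" "l \<le> j"
  shows "p (i - l) = q (j - l)"
  using assms(6,7)
proof (induction l)
  case 0 then show ?case using assms by simp
next
  case (Suc l)
  have e: "Suc (i - Suc l) = i - l" "Suc (j - Suc l) = j - l" "i - Suc l < n" "j - Suc l < m"
    using Suc.prems assms(4,5) by auto
  have "okst f (p (i - Suc l))" "nxt f (p (i - Suc l)) = p (i - l)"
    using assms(1) e unfolding run_def by metis+
  moreover have "okst f (q (j - Suc l))" "nxt f (q (j - Suc l)) = q (j - l)"
    using assms(2) e unfolding run_def by metis+
  ultimately show ?case using Suc nxt_inj by simp
qed

text \<open>Time reversal gives \<open>p j = rv (p (n - j))\<close>. For even \<open>n\<close> the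
  middle state would be its own reversal; so \<open>n\<close> is odd and the turn happens inside one
  rhombus.\<close>

lemma retrace:
  assumes p: "run f p n" and e: "p n = rv (p 0)" and n: "n > 0"
  obtains a where "n = 2 * a + 1" "p (Suc a) = rv (p a)"
proof -
  have q: "run f (\<lambda>j. rv (p (n - j))) n" by (rule run_rev[OF p])
  have *: "p j = rv (p (n - j))" if "j \<le> n" for j
  proof -
    have "p (n - (n - j)) = rv (p (n - (n - (n - j))))"
      by (rule run_back[OF p q]) (use e that in auto)
    then show ?thesis using that by simp
  qed
  show ?thesis
  proof (cases "even n")
    case True
    then obtain b where b: "n = 2 * b" by auto
    have "p b = rv (p b)" using *[of b] b by simp
    moreover have "dr (p b) = 1 \<or> dr (p b) = -1" using run_inner[OF p _ n, of b] b inner_dr by auto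
    ultimately show ?thesis by (metis rv_simps(3) equal_neg_zero zero_neq_one one_neq_neg_one neg_equal_zero neg_0_equal_iff_equal zero_neq_neg_one)
  next
    case False
    then obtain a where a: "n = 2 * a + 1" by (auto elim: oddE)
    show ?thesis by (rule that[OF a]) (use *[of "Suc a"] a in simp)
  qed
qed

lemma between_affine:
  fixes x z a b \<theta> e :: real
  assumes e: "e = 1 \<or> e = -1" and b: "b = a + e * (z - x)"
    and th: "(a < \<theta> \<and> \<theta> < b) \<or> (b < \<theta> \<and> \<theta> < a)"
  obtains y where "(x < y \<and> y < z) \<or> (z < y \<and> y < x)" "\<theta> = a + e * (y - x)"
  by (rule that[of "x + e * (\<theta> - a)"]) (use assms in auto)

text \<open>Two orbits can only part around a far vertex of the rhombus. Combined with
  \<open>between_affine\<close>, some orbit starting between them then runs into this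
  vertex.\<close>

lemma mv_threshold:
  assumes "okst f s" "okst f t" "lev s = lev t" "dr s = dr t" "mv f s \<noteq> mv f t"
  obtains \<theta> where "\<theta> = om f (lev s) (nb s) \<or> \<theta> = \<bar>f (lev s)\<bar> + om f (lev s) (nb s)"
    "(pos s < \<theta> \<and> \<theta> < pos t) \<or> (pos t < \<theta> \<and> \<theta> < pos s)"
proof -
  define T where "T = om f (lev s) (nb s)"
  define U where "U = \<bar>f (lev s)\<bar> + om f (lev s) (nb s)"
  have n: "pos s \<noteq> T" "pos s \<noteq> U" "pos t \<noteq> T" "pos t \<noteq> U"
    using assms(1-4) by (auto simp: okst_def T_def U_def)
  have m: "mv f s = (if pos s < T then PA else if pos s > U then PB else OP)"
    "mv f t = (if pos t < T then PA else if pos t > U then PB else OP)"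
    using assms(3,4) by (simp_all add: mv_def T_def U_def)
  have "(pos s < T) \<noteq> (pos t < T) \<or> (pos s > U) \<noteq> (pos t > U)"
    using assms(5) unfolding m by (rule contrapos_np) simp
  then show ?thesis
  proof
    assume "(pos s < T) \<noteq> (pos t < T)"
    then show ?thesis using that[of T] n by (auto simp: T_def U_def)
  next
    assume "(pos s > U) \<noteq> (pos t > U)"
    then show ?thesis using that[of U] n by (auto simp: T_def U_def)
  qed
qed

section \<open>Orbits enclosed by a returning arc\<close>

context base
begin

text \<open>From a common state one can run back to the later of the two departures. That would put
  a state of the base interval strictly inside the other segment or identify the starting position
  with an end of the arc.\<close>

lemma orb_arc_points:
  assumes q: "run f q n" and qJ: "\<And>j. 0 < j \<Longrightarrow> j < n \<Longrightarrow> \<not> inJ (q j)" "inJ (q 0)"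
    and o: "run f p i" "inJ (p 0)" "\<And>j. 0 < j \<Longrightarrow> j \<le> i \<Longrightarrow> \<not> inJ (p j)"
    and ne: "pos (p 0) \<noteq> pos (q 0)" "pos (p 0) \<noteq> pos (q n)" and j: "j \<le> n"
  shows "p i \<noteq> q j"
proof
  assume e: "p i = q j"
  show False
  proof (cases "j \<ge> i")
    case True
    have "p (i - i) = q (j - i)" by (rule run_back[OF o(1) q e]) (use True j in auto)
    then have 1: "p 0 = q (j - i)" by simp
    then have "inJ (q (j - i))" using o by simp
    moreover have "j - i \<noteq> 0" using 1 ne by auto
    moreover have "j - i \<noteq> n" using 1 ne by auto
    moreover have "j - i \<le> n" using j by simp
    ultimately show False using qJ(1)[of "j - i"] by auto
  next
    case False
    have "p (i - j) = q (j - j)" by (rule run_back[OF o(1) q e]) (use False j in auto)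
    then show False using o(3)[of "i - j"] qJ(2) False by simp
  qed
qed

text \<open>Together with the piece of the base interval between its ends the arc forms a closed
  curve, for which \<open>cnt\<close> is the winding parity. It is odd at \<open>z\<close> and stays
  odd along the orbit of \<open>z\<close>, whereas vertices and the ends \<open>q1\<close> and
  \<open>q2\<close> have even count. So the strip of orbits between the ends is neither split by a
  vertex nor does any part of it return early.\<close>

lemma flip:
  assumes a: "arc x d p n" and ne: "pos (p n) \<noteq> x"
    and z: "min x (pos (p n)) < z" "z < max x (pos (p n))"
  shows "\<And>j. j < n \<Longrightarrow> okst f (orb f (St N z d) j) \<and> mv f (orb f (St N z d) j) = mv f (p j)"
    and "\<And>j. 0 < j \<Longrightarrow> j < n \<Longrightarrow> \<not> inJ (orb f (St N z d) j)"
    and "orb f (St N z d) n = St N (x + pos (p n) - z) (- d)"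
proof -
  define x' where "x' = pos (p n)"
  have p: "run f p n" "n > 0" "inJ (p 0)" "inJ (p n)" "p 0 = St N x d"
    and nJ: "\<And>i. 0 < i \<Longrightarrow> i < n \<Longrightarrow> \<not> inJ (p i)" using a by (auto simp: arc_def)
  have dp: "dr (p i) = 1 \<or> dr (p i) = -1" if "i \<le> n" for i using run_inner[OF p(1) that p(2)] inner_dr by blast
  have d0: "d = 1 \<or> d = -1" using dp[of 0] p by simp
  have xJ: "q1 < x" "x < q2" "q1 < x'" "x' < q2" using p by (auto simp: inJ_def x'_def)
  let ?o = "\<lambda>z. orb f (St N z d)"
  \<comment> \<open>The induction runs over all \<open>z\<close> at once: a deviation of one orbit
    is refuted by an intermediate orbit that would run into a vertex.\<close>
  define P where "P i z \<longleftrightarrow> (\<forall>j<i. okst f (?o z j) \<and> mv f (?o z j) = mv f (p j)) \<and>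
      (\<forall>j. 0 < j \<and> j \<le> i \<and> j < n \<longrightarrow> \<not> inJ (?o z j)) \<and> lev (?o z i) = lev (p i) \<and> dr (?o z i) = dr (p i) \<and>
      pos (?o z i) = pos (p i) + of_int (dr (p i) * d) * (z - x) \<and> (i < n \<longrightarrow> odd (cnt p n (?o z i)))" for i z
  have main: "i \<le> n \<Longrightarrow> min x x' < z \<Longrightarrow> z < max x x' \<Longrightarrow> P i z" for i z
  proof (induction i arbitrary: z)
    case 0
    then show ?case using p d0 cnt_inside[OF a, of z] by (auto simp: P_def x'_def)
  next
    case (Suc i)
    have i: "i < n" "i \<le> n" using Suc.prems by auto
    have IH: "P i y" if "min x x' < y" "y < max x x'" for y using Suc.IH i that by simp
    have okp: "okst f (p i)" and np: "p (Suc i) = nxt f (p i)" using p(1) i by (auto simp: run_def)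
    have ok: "okst f (?o y i)" if y: "min x x' < y" "y < max x x'" for y
    proof (rule ccontr)
      assume n: "\<not> okst f (?o y i)"
      have "inner_st f (?o y i)"
      proof (cases i)
        case 0 then show ?thesis using y xJ J_range d0 by (auto simp: inner_st_def)
      next
        case (Suc k) then show ?thesis using IH[OF y] nxt_inner by (simp add: P_def orb_Suc)
      qed
      from inner_not_ok_hits[OF this n] obtain b where "hits f b (?o y i)" ..
      then have "even (cnt p n (?o y i))" using cnt_terminal[OF p(1)] p(3,4) by (auto simp: inJ_def)
      then show False using IH[OF y] i by (auto simp: P_def)
    qed
    have sgn: "(of_int (dr (p i) * d)::real) = 1 \<or> (of_int (dr (p i) * d)::real) = -1" using dp[of i] d0 i by auto
    have mve: "mv f (?o y i) = mv f (p i)" if y: "min x x' < y" "y < max x x'" for y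
    proof (rule ccontr)
      assume ne: "mv f (?o y i) \<noteq> mv f (p i)"
      have e: "lev (?o y i) = lev (p i)" "dr (?o y i) = dr (p i)"
        "pos (?o y i) = pos (p i) + of_int (dr (p i) * d) * (y - x)" using IH[OF y] by (auto simp: P_def)
      obtain \<theta> where th: "\<theta> = om f (lev (p i)) (nb (p i)) \<or> \<theta> = \<bar>f (lev (p i))\<bar> + om f (lev (p i)) (nb (p i))"
         "(pos (p i) < \<theta> \<and> \<theta> < pos (?o y i)) \<or> (pos (?o y i) < \<theta> \<and> \<theta> < pos (p i))"
        by (rule mv_threshold[OF okp ok[OF y] e(1,2)[symmetric] ne[symmetric]])
      obtain w where w: "(x < w \<and> w < y) \<or> (y < w \<and> w < x)" "\<theta> = pos (p i) + of_int (dr (p i) * d) * (w - x)"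
        by (rule between_affine[OF sgn e(3) th(2)])
      have wr: "min x x' < w" "w < max x x'" using w(1) y by auto
      have "lev (?o w i) = lev (p i)" "dr (?o w i) = dr (p i)" "pos (?o w i) = \<theta>"
        using IH[OF wr] w by (auto simp: P_def)
      then show False using ok[OF wr] th(1) by (auto simp: okst_def)
    qed
    have nx: "lev (?o y (Suc i)) = lev (p (Suc i))" "dr (?o y (Suc i)) = dr (p (Suc i))"
      "pos (?o y (Suc i)) = pos (p (Suc i)) + of_int (dr (p (Suc i)) * d) * (y - x)"
      if y: "min x x' < y" "y < max x x'" for y
    proof -
      have e: "lev (p i) = lev (?o y i)" "dr (p i) = dr (?o y i)"
        "pos (?o y i) - pos (p i) = of_int (dr (p i) * d) * (y - x)" using IH[OF y] by (auto simp: P_def)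
      note m = move_affine[OF okp ok[OF y] e(1,2) mve[OF y, symmetric]]
      show "lev (?o y (Suc i)) = lev (p (Suc i))" "dr (?o y (Suc i)) = dr (p (Suc i))"
        using m by (simp_all add: orb_Suc np)
      have "real_of_int (dr (p i)) * real_of_int (dr (p i)) = 1" using dp[of i] i by auto
      then have "pos (?o y (Suc i)) - pos (p (Suc i)) = of_int (dr (p (Suc i))) * of_int d * (y - x)"
        using m(3) unfolding e(3) np orb_Suc
        by (simp add: mult.assoc[symmetric])
      then show "pos (?o y (Suc i)) = pos (p (Suc i)) + of_int (dr (p (Suc i)) * d) * (y - x)" by simp
    qed
    have disj: "\<not> (lev (p j) = lev (?o y i) \<and> pos (p j) = pos (?o y i))"
      if y: "min x x' < y" "y < max x x'" and j: "j \<le> n" for y j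
    proof
      assume "lev (p j) = lev (?o y i) \<and> pos (p j) = pos (?o y i)"
      then have "?o y i = p j \<or> ?o y i = rv (p j)"
        using same_point[of "?o y i" "p j"] dp[OF j] dp[OF i(2)] IH[OF y] by (auto simp: P_def)
      moreover have r: "run f (?o y) i" using IH[OF y] by (intro run_orb) (auto simp: P_def)
      have y0: "inJ (?o y 0)" using y xJ by (auto simp: inJ_def)
      have yn: "\<And>j. 0 < j \<Longrightarrow> j \<le> i \<Longrightarrow> \<not> inJ (?o y j)" using IH[OF y] i by (auto simp: P_def)
      have "?o y i \<noteq> p j"
        by (rule orb_arc_points[OF p(1) nJ p(3) r y0 yn _ _ j]) (use y p in \<open>auto simp: x'_def\<close>)
      moreover have "?o y i \<noteq> rv (p (n - (n - j)))"
        by (rule orb_arc_points[OF run_rev[OF p(1)] _ _ r y0 yn]) (use y p nJ in \<open>auto simp: x'_def\<close>)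
      ultimately show False using j by simp
    qed
    have par: "even (cnt p n (?o y i) + cnt p n (?o y (Suc i)) + of_bool (less_st (p 0) (?o y (Suc i)))
        + of_bool (less_st (p n) (?o y (Suc i))))" if y: "min x x' < y" "y < max x x'" for y
      unfolding orb_Suc by (rule cnt_step[OF p(1) ok[OF y]]) (use disj[OF y] in blast)
    \<comment> \<open>An early return of \<open>z\<close> at a time when \<open>p\<close> is outside
      would make an intermediate orbit land on \<open>q1\<close> or \<open>q2\<close>, where the
      count is even.\<close>
    have nret: "\<not> inJ (?o z (Suc i))" if si: "Suc i < n"
    proof
      assume J: "inJ (?o z (Suc i))"
      have z: "min x x' < z" "z < max x x'" using Suc.prems by auto
      have lN: "lev (p (Suc i)) = N" using J nx(1)[OF z] by (simp add: inJ_def)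
      have nq: "pos (p (Suc i)) \<noteq> q1" "pos (p (Suc i)) \<noteq> q2"
        using tail_run_points[OF tail1 _ p(1,2,3,4), of "Suc i" 0] tail_run_points[OF tail2 _ p(1,2,3,4), of "Suc i" 0]
          lN si tail1 tail2 by (auto simp: tail_def)
      have "\<exists>q. (q = q1 \<or> q = q2) \<and> ((pos (p (Suc i)) < q \<and> q < pos (?o z (Suc i))) \<or> (pos (?o z (Suc i)) < q \<and> q < pos (p (Suc i))))"
        using nJ[of "Suc i"] si lN nq J by (auto simp: inJ_def)
      then obtain q where q: "q = q1 \<or> q = q2"
        "(pos (p (Suc i)) < q \<and> q < pos (?o z (Suc i))) \<or> (pos (?o z (Suc i)) < q \<and> q < pos (p (Suc i)))" by blast
      have sg: "(of_int (dr (p (Suc i)) * d)::real) = 1 \<or> (of_int (dr (p (Suc i)) * d)::real) = -1"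
        using dp[of "Suc i"] d0 si by auto
      obtain w where w: "(x < w \<and> w < z) \<or> (z < w \<and> w < x)" "q = pos (p (Suc i)) + of_int (dr (p (Suc i)) * d) * (w - x)"
        by (rule between_affine[OF sg nx(3)[OF z] q(2)])
      have wr: "min x x' < w" "w < max x x'" using w(1) z by auto
      define e where "e = dr (p (Suc i))"
      have ee: "e = 1 \<or> e = -1" using dp[of "Suc i"] si by (simp add: e_def)
      have ow: "?o w (Suc i) = St N q e" using nx[OF wr] lN w(2) by (auto intro: st_eqI simp: e_def)
      have "less_st (p 0) (St N q e) = less_st (p n) (St N q e)"
        using q(1) p xJ by (auto simp: less_st_def inJ_def)
      then have "odd (cnt p n (St N q e))" using par[OF wr] IH[OF wr] i unfolding ow by (auto simp: P_def)
      moreover have "even (cnt p n (St N q1 e))" by (rule cnt_q1[OF a ee])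
      moreover have "even (cnt p n (St N q2 e))"
        using cnt_on_J[OF a _ _ ee, of q2] cnt_q1[OF a ee] arc_returns_reversed[OF a] q12 xJ by (auto simp: x'_def)
      ultimately show False using q(1) by auto
    qed
    have z: "min x x' < z" "z < max x x'" using Suc.prems by auto
    have od: "odd (cnt p n (?o z (Suc i)))" if si: "Suc i < n"
    proof -
      have lq: "\<not> inJ (?o z (Suc i))" by (rule nret[OF si])
      have "less_st (p 0) (?o z (Suc i)) = less_st (p n) (?o z (Suc i))"
        using lq p(3,4) by (auto simp: less_st_def inJ_def)
      then show ?thesis using par[OF z] IH[OF z] i by (auto simp: P_def)
    qed
    show ?case unfolding P_def
    proof (intro conjI)
      show "\<forall>j<Suc i. okst f (?o z j) \<and> mv f (?o z j) = mv f (p j)"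
        using IH[OF z] ok[OF z] mve[OF z] by (auto simp: P_def less_Suc_eq)
      show "\<forall>j. 0 < j \<and> j \<le> Suc i \<and> j < n \<longrightarrow> \<not> inJ (?o z j)"
        using IH[OF z] nret by (auto simp: P_def le_Suc_eq)
    qed (use nx[OF z] od in auto)
  qed
  have zz: "min x x' < z" "z < max x x'" using z by (auto simp: x'_def)
  from main[OF order_refl zz] have Pn: "P n z" .
  show "okst f (?o z j) \<and> mv f (?o z j) = mv f (p j)" if "j < n" for j using Pn that by (auto simp: P_def)
  show "\<not> inJ (?o z j)" if "0 < j" "j < n" for j using Pn that by (auto simp: P_def)
  have "dr (p n) = - d" by (rule arc_returns_reversed[OF a])
  moreover have "lev (p n) = N" using p by (simp add: inJ_def)
  ultimately show "?o z n = St N (x + pos (p n) - z) (- d)" using Pn d0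
    by (intro st_eqI) (auto simp: P_def)
qed

end

section \<open>Boundedness of the levels\<close>

text \<open>Adds the last half chord of the tail, from its final crossing to the vertex; it has only
  one end on a side.\<close>

definition cbar :: "(nat \<Rightarrow> st) \<Rightarrow> nat \<Rightarrow> st \<Rightarrow> nat" where
  "cbar t r z = cnt t r z + of_bool (tile (t r) = tile z \<and> less_st (t r) z)"

text \<open>By \<open>terminal_parity1\<close> a level change through the rhombus in which a type
  \<open>A\<close> tail ends alters the parity of the count. This term jumps at exactly the same
  place and cancels the change.\<close>

definition corr :: "bool \<Rightarrow> (nat \<Rightarrow> st) \<Rightarrow> nat \<Rightarrow> int \<Rightarrow> nat" where
  "corr a t r k = of_bool (a \<and> tile (t r) \<le> k)"

lemma cbar_step:
  assumes t: "run f t r" "hits f a (t r)" and z: "okst f z"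
    and ne: "\<And>i. i \<le> r \<Longrightarrow> \<not> (lev (t i) = lev z \<and> pos (t i) = pos z)"
  shows "even (cbar t r z + cbar t r (nxt f z) + of_bool (less_st (t 0) (nxt f z))
    + corr a t r (lev z) + corr a t r (lev (nxt f z)))"
proof -
  define z' where "z' = nxt f z"
  have dz: "dr z = 1 \<or> dr z = -1" using z by (auto simp: okst_def inner_st_def)
  have dz': "dr z' = 1 \<or> dr z' = -1" using nxt_inner[OF z] inner_dr z'_def by blast
  have dt: "dr (t r) = 1 \<or> dr (t r) = -1" using t by (auto simp: hits_def)
  have tz: "tile (rv z') = tile z" unfolding z'_def by (rule tile_rv_nxt[OF z])
  have s: "even (cnt t r z + cnt t r z' + of_bool (less_st (t 0) z') + of_bool (less_st (t r) z'))"
    unfolding z'_def by (rule cnt_step[OF t(1) z ne])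
  have b: "(of_bool (tile (t r) = tile z' \<and> less_st (t r) z') + of_bool (tile (t r) = tile z \<and> less_st (t r) z') :: nat)
     = of_bool (less_st (t r) z')"
  proof (cases "less_st (t r) z'")
    case True
    then have "lev (t r) = lev z'" by (simp add: less_st_def)
    from tile_two[OF this dt dz'] show ?thesis using True tz by simp
  qed simp
  have c: "(of_bool (a \<and> lev z' \<noteq> lev z \<and> tile (t r) = tile z) + corr a t r (lev z) + corr a t r (lev z')) mod 2 = 0"
  proof -
    from z have "lev z' = lev z \<or> (lev z' = nb z)" unfolding z'_def by (cases rule: nxt_cases) auto
    then show ?thesis using dz by (auto simp: corr_def tile_def)
  qed
  have b': "even (of_bool (tile (t r) = tile z' \<and> less_st (t r) z') + of_bool (tile (t r) = tile z \<and> less_st (t r) z')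
     + of_bool (less_st (t r) z') :: nat)" unfolding b by simp
  have c': "even (of_bool (a \<and> lev z' \<noteq> lev z \<and> tile (t r) = tile z) + corr a t r (lev z) + corr a t r (lev z'))"
    using c by presburger
  have d: "even (of_bool (tile (t r) = tile z \<and> less_st (t r) z) + of_bool (tile (t r) = tile z \<and> less_st (t r) z')
     + of_bool (a \<and> lev z' \<noteq> lev z \<and> tile (t r) = tile z) :: nat)"
  proof (cases "tile (t r) = tile z")
    case True
    have "odd (of_bool (less_st (t r) z) + of_bool (less_st (t r) z') :: nat) \<longleftrightarrow> a \<and> lev z' \<noteq> lev z"
      unfolding z'_def by (rule terminal_parity1[OF t(2) z True])
    then show ?thesis using True by auto
  qed simp
  show ?thesis using s b' c' d unfolding cbar_def z'_def[symmetric] even_add by argo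
qed

lemma cnt_zero: "(\<And>i. i \<le> r \<Longrightarrow> lev (t i) \<noteq> lev z) \<Longrightarrow> cbar t r z = 0"
  by (auto simp: cbar_def cnt_def less_st_def)

context base
begin

text \<open>The correction terms make the parity of this count invariant along a trajectory until it returns to the base interval.
Far below the tails the count is zero and far above it is the number of tails of type \<open>A\<close>, which bounds the levels.\<close>

definition psi :: "st \<Rightarrow> nat" where
  "psi z = cbar t1 r1 z + cbar t2 r2 z + corr a1 t1 r1 (lev z) + corr a2 t2 r2 (lev z)"

text \<open>An orbit may join a tail and follow it to the vertex, but it cannot travel it backwards:
  the reversed orbit ends in the base interval, which the tail avoids.\<close>

lemma orb_not_rv_tail:
  assumes o: "run f p i" "inJ (p 0)"
    and t: "tail f N q1 q2 q a t r" "q = q1 \<or> q = q2" and s: "s \<le> r"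
  shows "p i \<noteq> rv (t s)"
proof
  assume e: "p i = rv (t s)"
  have r: "run f (\<lambda>j. rv (p (i - j))) i" by (rule run_rev[OF o(1)])
  have "t s \<noteq> (\<lambda>j. rv (p (i - j))) 0"
    by (rule tail_run_disj[OF t r _ _ s]) (use o in auto)
  then show False using e by simp
qed

text \<open>A point outside the base interval is above both starting points of the tails or above
  neither, so the corrections of the two tails cancel. The point \<open>q2\<close> itself is
  excluded separately because \<open>less_st\<close> is strict.\<close>

lemma psi_step:
  assumes o: "run f p (Suc i)" "inJ (p 0)" "\<not> inJ (p (Suc i))"
    and nt: "\<And>s. s \<le> r1 \<Longrightarrow> p i \<noteq> t1 s" "\<And>s. s \<le> r2 \<Longrightarrow> p i \<noteq> t2 s"
      "\<And>s. s \<le> r2 \<Longrightarrow> p (Suc i) \<noteq> t2 s"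
  shows "even (psi (p i) + psi (p (Suc i)))"
proof -
  have ok: "okst f (p i)" and nx: "p (Suc i) = nxt f (p i)" using o by (auto simp: run_def)
  have dp: "dr (p j) = 1 \<or> dr (p j) = -1" if "j \<le> Suc i" for j using run_inner[OF o(1) that] inner_dr by blast
  have r: "run f p i" using run_mono[OF o(1)] by simp
  have ne1: "\<not> (lev (t1 s) = lev (p i) \<and> pos (t1 s) = pos (p i))" if "s \<le> r1" for s
    using same_point[OF dp[of i] tail_dr[OF tail1 that]] nt(1)[OF that] orb_not_rv_tail[OF r o(2) tail1 _ that] by auto
  have ne2: "\<not> (lev (t2 s) = lev (p i) \<and> pos (t2 s) = pos (p i))" if "s \<le> r2" for s
    using same_point[OF dp[of i] tail_dr[OF tail2 that]] nt(2)[OF that] orb_not_rv_tail[OF r o(2) tail2 _ that] by auto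
  have ne3: "\<not> (lev (t2 0) = lev (p (Suc i)) \<and> pos (t2 0) = pos (p (Suc i)))"
    using same_point[OF dp[of "Suc i"] tail_dr[OF tail2, of 0]] nt(3)[of 0] orb_not_rv_tail[OF o(1) o(2) tail2, of 0] by auto
  have t: "run f t1 r1" "hits f a1 (t1 r1)" "run f t2 r2" "hits f a2 (t2 r2)"
    "lev (t1 0) = N" "pos (t1 0) = q1" "lev (t2 0) = N" "pos (t2 0) = q2"
    using tail1 tail2 by (auto simp: tail_def)
  have "less_st (t1 0) (p (Suc i)) = less_st (t2 0) (p (Suc i))"
    using o(3) ne3 t q12 unfolding less_st_def inJ_def by auto
  then have "even (of_bool (less_st (t1 0) (p (Suc i))) + of_bool (less_st (t2 0) (p (Suc i))) :: nat)" by simp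
  moreover have "even (cbar t1 r1 (p i) + cbar t1 r1 (nxt f (p i)) + of_bool (less_st (t1 0) (nxt f (p i)))
    + corr a1 t1 r1 (lev (p i)) + corr a1 t1 r1 (lev (nxt f (p i))))"
    by (rule cbar_step[OF t(1,2) ok]) (use ne1 in blast)
  moreover have "even (cbar t2 r2 (p i) + cbar t2 r2 (nxt f (p i)) + of_bool (less_st (t2 0) (nxt f (p i)))
    + corr a2 t2 r2 (lev (p i)) + corr a2 t2 r2 (lev (nxt f (p i))))"
    by (rule cbar_step[OF t(3,4) ok]) (use ne2 in blast)
  ultimately show ?thesis
    unfolding psi_def nx[symmetric] even_add by argo
qed

lemma psi_const_J:
  assumes "inJ (St N x e)" "inJ (St N y e)"
  shows "psi (St N x e) = psi (St N y e)"
proof -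
  have l: "less_st (t i) (St N x e) = less_st (t i) (St N y e)"
    if t: "tail f N q1 q2 q a t r" and q: "q = q1 \<or> q = q2" and i: "i \<le> r" for t q a r i
  proof (cases "i = 0")
    case True then show ?thesis using t q assms by (auto simp: tail_def less_st_def inJ_def)
  next
    case False
    then have "\<not> (lev (t i) = N \<and> q1 < pos (t i) \<and> pos (t i) < q2)" using t i by (auto simp: tail_def)
    then show ?thesis using assms by (auto simp: less_st_def inJ_def)
  qed
  have c: "cbar t r (St N x e) = cbar t r (St N y e)"
    if t: "tail f N q1 q2 q a t r" and q: "q = q1 \<or> q = q2" for t q a r
  proof -
    have "tile (St N x e) = tile (St N y e)" by (simp add: tile_def)
    moreover have "cnt t r (St N x e) = cnt t r (St N y e)"
      unfolding cnt_def by (rule sum.cong) (use l[OF that] in \<open>auto simp: tile_def\<close>)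
    ultimately show ?thesis using l[OF that, of r] by (simp add: cbar_def)
  qed
  show ?thesis using c[OF tail1] c[OF tail2] by (simp add: psi_def)
qed

text \<open>An orbit that has joined a tail stays on it until the vertex; before that
  \<open>psi_step\<close> applies.\<close>

lemma orb_psi:
  assumes o: "run f p n" "inJ (p 0)" "\<And>j. 0 < j \<Longrightarrow> j \<le> n \<Longrightarrow> \<not> inJ (p j)" and i: "i \<le> n"
  shows "(\<exists>s\<le>r1. p i = t1 s) \<or> (\<exists>s\<le>r2. p i = t2 s) \<or> even (psi (p 0) + psi (p i))"
  using i
proof (induction i)
  case 0 then show ?case by simp
next
  case (Suc i)
  have ok: "okst f (p i)" and nx: "p (Suc i) = nxt f (p i)" using o Suc by (auto simp: run_def)
  have cont: "\<exists>s'\<le>r. p (Suc i) = t s'" if t: "tail f N q1 q2 q a t r" and s: "s \<le> r" "p i = t s" for t q a r s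
  proof -
    have "s \<noteq> r" using hits_not_ok ok s t by (metis tail_def)
    then have "t (Suc s) = nxt f (t s)" "Suc s \<le> r" using t s by (auto simp: tail_def run_def)
    then show ?thesis using nx s by auto
  qed
  consider "\<exists>s\<le>r1. p i = t1 s" | "\<exists>s\<le>r2. p i = t2 s" | "\<exists>s\<le>r2. p (Suc i) = t2 s"
    | "\<nexists>s. s\<le>r1 \<and> p i = t1 s" "\<nexists>s. s \<le>r2 \<and> p i = t2 s" "\<nexists>s. s\<le>r2 \<and> p (Suc i) = t2 s" "even (psi (p 0) + psi (p i))"
    using Suc by auto
  then show ?case
  proof cases
    case 1 then show ?thesis using cont[OF tail1] by blast
  next
    case 2 then show ?thesis using cont[OF tail2] by blast
  next
    case 3 then show ?thesis by blast
  next
    case 4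
    have "even (psi (p i) + psi (p (Suc i)))"
      by (rule psi_step[OF run_mono[OF o(1)] o(2)]) (use Suc o 4 in auto)
    then have "even (psi (p 0) + psi (p (Suc i)))" using 4(4) by presburger
    then show ?thesis by simp
  qed
qed

lemma psi_far:
  assumes lo: "\<And>s. s \<le> r1 \<Longrightarrow> lo < lev (t1 s) \<and> lev (t1 s) < hi" "\<And>s. s \<le> r2 \<Longrightarrow> lo < lev (t2 s) \<and> lev (t2 s) < hi"
  shows "lev z \<le> lo \<Longrightarrow> psi z = 0" "lev z \<ge> hi \<Longrightarrow> psi z = of_bool a1 + of_bool a2"
proof -
  have t: "tile s = lev s \<or> tile s = lev s + 1" for s by (auto simp: tile_def)
  note l1 = lo(1)[of r1] and l2 = lo(2)[of r2]
  { assume z: "lev z \<le> lo"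
    have "cbar t1 r1 z = 0" "cbar t2 r2 z = 0" by (rule cnt_zero; use lo z in force)+
    then show "psi z = 0" using t[of "t1 r1"] t[of "t2 r2"] l1 l2 z by (auto simp: psi_def corr_def) }
  { assume z: "lev z \<ge> hi"
    have "cbar t1 r1 z = 0" "cbar t2 r2 z = 0" by (rule cnt_zero; use lo z in force)+
    then show "psi z = of_bool a1 + of_bool a2" using t[of "t1 r1"] t[of "t2 r2"] l1 l2 z
      by (auto simp: psi_def corr_def) }
qed

text \<open>Orbits that join a tail stay within its levels; the others cannot enter a region where
  \<open>psi\<close> has the wrong parity. With unlike types one direction remains open, upwards for
  odd and downwards for even parity; there a wall will be needed.\<close>

lemma levels_bounded:
  assumes lo: "\<And>s. s \<le> r1 \<Longrightarrow> lo < lev (t1 s) \<and> lev (t1 s) < hi" "\<And>s. s \<le> r2 \<Longrightarrow> lo < lev (t2 s) \<and> lev (t2 s) < hi"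
    and o: "run f p n" "inJ (p 0)" "\<And>j. 0 < j \<Longrightarrow> j \<le> n \<Longrightarrow> \<not> inJ (p j)"
  shows "odd (psi (p 0)) \<Longrightarrow> lo < lev (p n)"
    and "odd (psi (p 0)) \<Longrightarrow> a1 = a2 \<Longrightarrow> lev (p n) < hi"
    and "even (psi (p 0)) \<Longrightarrow> a1 \<noteq> a2 \<Longrightarrow> lev (p n) < hi"
proof -
  consider s where "s \<le> r1" "p n = t1 s" | s where "s \<le> r2" "p n = t2 s" | "even (psi (p 0) + psi (p n))"
    using orb_psi[OF o order_refl] by auto
  then have "(odd (psi (p 0)) \<longrightarrow> lo < lev (p n)) \<and> (odd (psi (p 0)) \<longrightarrow> a1 = a2 \<longrightarrow> lev (p n) < hi)
    \<and> (even (psi (p 0)) \<longrightarrow> a1 \<noteq> a2 \<longrightarrow> lev (p n) < hi)"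
  proof cases
    case 1 then show ?thesis using lo by auto
  next
    case 2 then show ?thesis using lo by auto
  next
    case 3
    have A: "lev (p n) \<le> lo \<Longrightarrow> even (psi (p n))" using psi_far(1)[OF lo, of "p n"] by simp
    have B: "hi \<le> lev (p n) \<Longrightarrow> even (psi (p n)) \<longleftrightarrow> a1 = a2"
      using psi_far(2)[OF lo, of "p n"] by (cases a1; cases a2) simp_all
    have C: "even (psi (p n)) = even (psi (p 0))" using 3 by auto
    show ?thesis using A B unfolding C by (metis not_less)
  qed
  then show "odd (psi (p 0)) \<Longrightarrow> lo < lev (p n)"
    and "odd (psi (p 0)) \<Longrightarrow> a1 = a2 \<Longrightarrow> lev (p n) < hi"
    and "even (psi (p 0)) \<Longrightarrow> a1 \<noteq> a2 \<Longrightarrow> lev (p n) < hi" by auto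
qed

section \<open>Returning germs\<close>


definition alive :: "int \<Rightarrow> real \<Rightarrow> nat \<Rightarrow> bool" where
  "alive d x m \<longleftrightarrow> (\<forall>i<m. okst f (orb f (St N x d) i)) \<and> (\<forall>i. 0 < i \<and> i \<le> m \<longrightarrow> \<not> inJ (orb f (St N x d) i))"

definition bad :: "int \<Rightarrow> real \<Rightarrow> bool" where
  "bad d x \<longleftrightarrow> inJ (St N x d) \<and> (\<exists>m. alive d x m \<and> \<not> okst f (orb f (St N x d) m))"

lemma alive_inner:
  assumes d: "d = 1 \<or> d = -1" and J: "inJ (St N x d)" and a: "\<And>i. i < m \<Longrightarrow> okst f (orb f (St N x d) i)"
  shows "inner_st f (orb f (St N x d) m)"
proof (cases m)
  case 0 then show ?thesis using J J_range d by (auto simp: inner_st_def inJ_def)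
next
  case (Suc k) then show ?thesis using a[of k] nxt_inner by (simp add: orb_Suc)
qed

text \<open>A bad orbit ends at the position of a far vertex, and bounded levels leave finitely many
  of these. Running back from a common final state shows that different starting points have
  different final states, since neither orbit has returned in between.\<close>

lemma finite_bad:
  assumes d: "d = 1 \<or> d = -1"
    and bd: "\<And>x m. inJ (St N x d) \<Longrightarrow> alive d x m \<Longrightarrow> k1 \<le> lev (orb f (St N x d) m) \<and> lev (orb f (St N x d) m) \<le> k2"
  shows "finite {x. bad d x}"
proof -
  define S where "S = (\<lambda>(k, e, b). St k (if b then om f k (k + e) else \<bar>f k\<bar> + om f k (k + e)) e) ` ({k1..k2} \<times> {1, -1} \<times> (UNIV :: bool set))"
  have "finite S" unfolding S_def by simp
  have "\<forall>x. bad d x \<longrightarrow> (\<exists>m. alive d x m \<and> \<not> okst f (orb f (St N x d) m))" by (simp add: bad_def)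
  then obtain m where m: "\<And>x. bad d x \<Longrightarrow> alive d x (m x) \<and> \<not> okst f (orb f (St N x d) (m x))" by metis
  define g where "g x = orb f (St N x d) (m x)" for x
  have "g ` {x. bad d x} \<subseteq> S"
  proof
    fix s assume "s \<in> g ` {x. bad d x}"
    then obtain x where x: "bad d x" "s = g x" by auto
    have i: "inner_st f s" unfolding x(2) g_def
      by (rule alive_inner[OF d]) (use x m[OF x(1)] in \<open>auto simp: bad_def alive_def\<close>)
    have n: "\<not> okst f s" using m[OF x(1)] x(2) g_def by simp
    have l: "lev s \<in> {k1..k2}" using bd[of x "m x"] m[OF x(1)] x by (auto simp: bad_def g_def)
    obtain b where b: "pos s = (if b then om f (lev s) (nb s) else \<bar>f (lev s)\<bar> + om f (lev s) (nb s))"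
      using i n unfolding okst_def by (metis (full_types))
    have "s = (\<lambda>(k, e, b). St k (if b then om f k (k + e) else \<bar>f k\<bar> + om f k (k + e)) e) (lev s, dr s, b)"
      by (intro st_eqI) (use b in auto)
    then show "s \<in> S" unfolding S_def using l inner_dr[OF i] by blast
  qed
  moreover have "inj_on g {x. bad d x}"
  proof -
    have aux: "x = x'" if b: "bad d x" "bad d x'" and e: "g x = g x'" and le: "m x \<le> m x'" for x x'
    proof -
      have r: "run f (orb f (St N x d)) (m x)" "run f (orb f (St N x' d)) (m x')"
        using m b by (auto intro!: run_orb simp: alive_def)
      have "orb f (St N x d) (m x - m x) = orb f (St N x' d) (m x' - m x)"
        by (rule run_back[OF r]) (use e le in \<open>auto simp: g_def\<close>)
      then have *: "St N x d = orb f (St N x' d) (m x' - m x)" by simp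
      show ?thesis
      proof (cases "m x' - m x = 0")
        case True then show ?thesis using * by simp
      next
        case False
        then have "\<not> inJ (orb f (St N x' d) (m x' - m x))" using m[OF b(2)] by (auto simp: alive_def)
        then show ?thesis using * b by (auto simp: bad_def)
      qed
    qed
    show ?thesis
    proof (rule inj_onI)
      fix x y assume "x \<in> {x. bad d x}" "y \<in> {x. bad d x}" "g x = g y"
      then show "x = y" using aux[of x y] aux[of y x] by (cases "m x \<le> m y") auto
    qed
  qed
  ultimately show ?thesis using \<open>finite S\<close> by (meson finite_imageD finite_subset)
qed

text \<open>If two orbits parted, an intermediate one would run into a vertex.\<close>

lemma same_moves:
  assumes d: "d = 1 \<or> d = -1" and x0: "\<alpha> < x0" "x0 < \<beta>"
    and ok: "\<And>y j. \<alpha> < y \<Longrightarrow> y < \<beta> \<Longrightarrow> j < m \<Longrightarrow> okst f (orb f (St N y d) j)"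
    and y: "\<alpha> < y" "y < \<beta>" and j: "j \<le> m"
  shows "lev (orb f (St N y d) j) = lev (orb f (St N x0 d) j) \<and> dr (orb f (St N y d) j) = dr (orb f (St N x0 d) j) \<and>
    pos (orb f (St N y d) j) = pos (orb f (St N x0 d) j) + of_int (dr (orb f (St N x0 d) j) * d) * (y - x0)"
  using j y
proof (induction j arbitrary: y)
  case 0 then show ?case using d by auto
next
  case (Suc j)
  let ?p = "orb f (St N x0 d) j" and ?q = "orb f (St N y d) j"
  have jm: "j < m" "j \<le> m" using Suc.prems by auto
  note IH = Suc.IH[OF jm(2) Suc.prems(2,3)]
  have okp: "okst f ?p" and okq: "okst f ?q" using ok x0 Suc.prems jm by auto
  have dp: "dr ?p = 1 \<or> dr ?p = -1" using okp by (auto simp: okst_def inner_st_def)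
  have sgn: "(of_int (dr ?p * d)::real) = 1 \<or> (of_int (dr ?p * d)::real) = -1" using dp d by auto
  have e: "lev ?p = lev ?q" "dr ?p = dr ?q" "pos ?q = pos ?p + of_int (dr ?p * d) * (y - x0)" using IH by auto
  have mv: "mv f ?p = mv f ?q"
  proof (rule ccontr)
    assume ne: "mv f ?p \<noteq> mv f ?q"
    obtain \<theta> where th: "\<theta> = om f (lev ?p) (nb ?p) \<or> \<theta> = \<bar>f (lev ?p)\<bar> + om f (lev ?p) (nb ?p)"
       "(pos ?p < \<theta> \<and> \<theta> < pos ?q) \<or> (pos ?q < \<theta> \<and> \<theta> < pos ?p)"
      by (rule mv_threshold[OF okp okq e(1,2) ne])
    obtain w where w: "(x0 < w \<and> w < y) \<or> (y < w \<and> w < x0)" "\<theta> = pos ?p + of_int (dr ?p * d) * (w - x0)"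
      by (rule between_affine[OF sgn e(3) th(2)])
    have wr: "\<alpha> < w" "w < \<beta>" using w(1) x0 Suc.prems by auto
    show False using Suc.IH[OF jm(2) wr] ok[OF wr jm(1)] th(1) w(2) by (auto simp: okst_def)
  qed
  note m = move_affine[OF okp okq e(1,2) mv]
  have sq: "real_of_int (dr ?p) * real_of_int (dr ?p) = 1" using dp by auto
  have "pos (nxt f ?q) - pos (nxt f ?p) = of_int (dr (nxt f ?p)) * of_int (dr ?p) * (of_int (dr ?p * d) * (y - x0))"
    using m(3) e(3) by simp
  also have "\<dots> = of_int (dr (nxt f ?p) * d) * (y - x0)" using sq by (simp add: mult.assoc[symmetric]) 
  finally show ?case using m(1,2) by (simp add: orb_Suc)
qed

text \<open>Recurrence by pigeonhole: the interval moves rigidly through finitely many sides of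
  finite width, so its images at two different times overlap. Running back from a common point
  yields a return.\<close>

lemma no_return_impossible:
  assumes d: "d = 1 \<or> d = -1" and ab: "\<alpha> < \<beta>"
    and bd: "\<And>x m. inJ (St N x d) \<Longrightarrow> alive d x m \<Longrightarrow> k1 \<le> lev (orb f (St N x d) m) \<and> lev (orb f (St N x d) m) \<le> k2"
    and I: "\<And>x. \<alpha> < x \<Longrightarrow> x < \<beta> \<Longrightarrow> inJ (St N x d)"
    and al: "\<And>x m. \<alpha> < x \<Longrightarrow> x < \<beta> \<Longrightarrow> alive d x m"
  shows False
proof -
  define h where "h = (\<beta> - \<alpha>) / 2"
  define x0 where "x0 = (\<alpha> + \<beta>) / 2"
  have h: "h > 0" and x0: "\<alpha> < x0" "x0 < \<beta>" and ab': "\<alpha> = x0 - h" "\<beta> = x0 + h"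
    using ab by (auto simp: h_def x0_def field_simps)
  let ?o = "\<lambda>y. orb f (St N y d)"
  have ok: "okst f (?o y j)" if "\<alpha> < y" "y < \<beta>" for y j using al[OF that, of "Suc j"] by (auto simp: alive_def)
  have sm: "lev (?o y j) = lev (?o x0 j) \<and> dr (?o y j) = dr (?o x0 j) \<and>
    pos (?o y j) = pos (?o x0 j) + of_int (dr (?o x0 j) * d) * (y - x0)" if "\<alpha> < y" "y < \<beta>" for y j
    by (rule same_moves[OF d x0 _ that order_refl]) (use ok in auto)
  define W where "W = (\<Sum>k\<in>{k1..k2}. \<bar>f k\<bar>)"
  \<comment> \<open>The interval has length \<open>2 * h\<close>, so equal values of
    \<open>G\<close> mean that its two images lie on the same side, in the same direction, and
    overlap.\<close>
  define G where "G m = (lev (?o x0 m), dr (?o x0 m), \<lfloor>pos (?o x0 m) / (2 * h)\<rfloor>)" for m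
  have "range G \<subseteq> {k1..k2} \<times> {1, -1} \<times> {0..\<lfloor>W / (2 * h)\<rfloor>}"
  proof
    fix g assume "g \<in> range G"
    then obtain m where g: "g = G m" by auto
    have l: "k1 \<le> lev (?o x0 m)" "lev (?o x0 m) \<le> k2" using bd[OF I[OF x0] al[OF x0]] by auto
    have in': "inner_st f (?o x0 m)" by (rule okst_inner[OF ok[OF x0]])
    have "pos (?o x0 m) < \<bar>f (lev (?o x0 m))\<bar>" using in' by (simp add: inner_st_def)
    also have "\<dots> \<le> W" unfolding W_def by (rule member_le_sum) (use l in auto)
    finally have "pos (?o x0 m) / (2 * h) \<le> W / (2 * h)" using h by (simp add: divide_right_mono)
    moreover have "pos (?o x0 m) > 0" using in' by (simp add: inner_st_def)
    ultimately show "g \<in> {k1..k2} \<times> {1, -1} \<times> {0..\<lfloor>W / (2 * h)\<rfloor>}"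
      using l inner_dr[OF in'] h unfolding g G_def by (auto simp: floor_mono)
  qed
  then have "finite (range G)" by (rule finite_subset) auto
  then have "\<not> inj G" using finite_imageD infinite_UNIV_nat by blast
  then obtain m1 m2 where "G m1 = G m2" "m1 \<noteq> m2" unfolding inj_def by blast
  then obtain m m' where mm: "G m = G m'" "m < m'" by (metis linorder_neqE_nat)
  define e where "e = dr (?o x0 m)"
  have e: "lev (?o x0 m) = lev (?o x0 m')" "dr (?o x0 m) = e" "dr (?o x0 m') = e"
    "\<lfloor>pos (?o x0 m) / (2 * h)\<rfloor> = \<lfloor>pos (?o x0 m') / (2 * h)\<rfloor>"
    using mm by (auto simp: G_def e_def)
  have ee: "e = 1 \<or> e = -1" using ok[OF x0, of m] by (auto simp: okst_def inner_st_def e_def)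
  define D where "D = pos (?o x0 m') - pos (?o x0 m)"
  have "\<bar>pos (?o x0 m) / (2 * h) - pos (?o x0 m') / (2 * h)\<bar> < 1" using e(4) by linarith
  then have "\<bar>pos (?o x0 m) - pos (?o x0 m')\<bar> < 2 * h" using h
    by (simp add: diff_divide_distrib[symmetric] abs_divide divide_less_eq)
  then have D: "\<bar>D\<bar> < 2 * h" by (simp add: D_def abs_minus_commute)
  define \<sigma> :: real where "\<sigma> = of_int (e * d)"
  have sg: "\<sigma> = 1 \<or> \<sigma> = -1" using ee d by (auto simp: \<sigma>_def)
  \<comment> \<open>The gap \<open>D\<close> between the two images is shared equally: shifting the
    starting points by \<open>D / 2\<close> in opposite senses makes the orbits coincide.\<close>
  define y where "y = x0 + \<sigma> * (D / 2)"
  define y' where "y' = x0 - \<sigma> * (D / 2)"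
  have "\<bar>\<sigma> * (D / 2)\<bar> < h" using sg D by auto
  then have yr: "\<alpha> < y" "y < \<beta>" "\<alpha> < y'" "y' < \<beta>" unfolding y_def y'_def ab' by auto
  have "\<sigma> * \<sigma> = 1" using sg by auto
  then have "\<sigma> * (y - x0) = D / 2" "\<sigma> * (y' - x0) = - D / 2"
    unfolding y_def y'_def by (auto simp: mult.assoc[symmetric])
  then have "?o y m = ?o y' m'"
    using sm[OF yr(1,2), of m] sm[OF yr(3,4), of m'] e unfolding \<sigma>_def
    by (intro st_eqI) (auto simp: D_def field_simps)
  have "?o y (m - m) = ?o y' (m' - m)"
    by (rule run_back[of f _ m _ m']) (use ok yr mm \<open>?o y m = ?o y' m'\<close> in \<open>auto intro!: run_orb\<close>)
  then have "inJ (?o y' (m' - m))" using I[OF yr(1,2)] by simp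
  then show False using al[OF yr(3,4), of "m' - m"] mm by (auto simp: alive_def)
qed

text \<open>The earliest return time of any point serves for all: otherwise the image of the
  interval would contain \<open>q1\<close> or \<open>q2\<close>, and the orbit landing there would
  follow a tail into a vertex. The form \<open>s - x\<close> reflects that arcs return
  reversed.\<close>

lemma common_return:
  assumes d: "d = 1 \<or> d = -1" and ab: "\<alpha> < \<beta>"
    and bd: "\<And>x m. inJ (St N x d) \<Longrightarrow> alive d x m \<Longrightarrow> k1 \<le> lev (orb f (St N x d) m) \<and> lev (orb f (St N x d) m) \<le> k2"
    and I: "\<And>x. \<alpha> < x \<Longrightarrow> x < \<beta> \<Longrightarrow> inJ (St N x d) \<and> \<not> bad d x"
  obtains n s where "n > 0" "\<And>x. \<alpha> < x \<Longrightarrow> x < \<beta> \<Longrightarrow> arc x d (orb f (St N x d)) n \<and> pos (orb f (St N x d) n) = s - x"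
proof -
  let ?o = "\<lambda>y. orb f (St N y d)"
  have okal: "okst f (?o x m)" if "\<alpha> < x" "x < \<beta>" "alive d x m" for x m
    using I[OF that(1,2)] that(3) by (auto simp: bad_def)
  define Ret where "Ret n \<longleftrightarrow> n > 0 \<and> (\<exists>x. \<alpha> < x \<and> x < \<beta> \<and> inJ (?o x n))" for n
  have "\<exists>n. Ret n"
  proof (rule ccontr)
    assume no: "\<nexists>n. Ret n"
    have "alive d x m" if x: "\<alpha> < x" "x < \<beta>" for x m
    proof (induction m)
      case 0 then show ?case by (simp add: alive_def)
    next
      case (Suc m)
      have nr: "\<not> inJ (?o x (Suc m))" using no x unfolding Ret_def by blast
      have o: "okst f (?o x m)" by (rule okal[OF x Suc])
      show ?case using Suc nr o unfolding alive_def less_Suc_eq le_Suc_eq by blast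
    qed
    then show False using no_return_impossible[OF d ab bd] I by blast
  qed
  define n where "n = (LEAST n. Ret n)"
  have Rn: "Ret n" unfolding n_def by (rule LeastI_ex) fact
  have nl: "\<not> Ret j" if "j < n" for j using that not_less_Least n_def by auto
  have al: "alive d x j" if x: "\<alpha> < x" "x < \<beta>" and j: "j < n" for x j
    using j
  proof (induction j)
    case 0 then show ?case by (simp add: alive_def)
  next
    case (Suc j)
    then have "alive d x j" "\<not> Ret (Suc j)" using nl by auto
    have nr: "\<not> inJ (?o x (Suc j))" using \<open>\<not> Ret (Suc j)\<close> x unfolding Ret_def by blast
    have o: "okst f (?o x j)" by (rule okal[OF x \<open>alive d x j\<close>])
    show ?case using \<open>alive d x j\<close> nr o unfolding alive_def less_Suc_eq le_Suc_eq by blast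
  qed
  have ok: "okst f (?o x j)" if "\<alpha> < x" "x < \<beta>" "j < n" for x j using okal al that by auto
  obtain x0 where x0: "\<alpha> < x0" "x0 < \<beta>" "inJ (?o x0 n)" and n0: "n > 0" using Rn by (auto simp: Ret_def)
  have sm: "lev (?o y n) = lev (?o x0 n) \<and> dr (?o y n) = dr (?o x0 n) \<and>
    pos (?o y n) = pos (?o x0 n) + of_int (dr (?o x0 n) * d) * (y - x0)" if "\<alpha> < y" "y < \<beta>" for y
    by (rule same_moves[OF d x0(1,2) _ that order_refl]) (use ok in auto)
  have d0: "dr (?o x0 n) = 1 \<or> dr (?o x0 n) = -1"
    using alive_inner[OF d, of x0 n] I[OF x0(1,2)] ok[OF x0(1,2)] inner_dr by auto
  have noq: "\<not> (pos (?o w n) = q)" if w: "\<alpha> < w" "w < \<beta>" and t: "tail f N q1 q2 q a t r" and q: "q = q1 \<or> q = q2" for w q a t r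
  proof
    assume e: "pos (?o w n) = q"
    have r: "run f (?o w) n" using ok[OF w] by (intro run_orb) auto
    have Jw: "inJ (?o w 0)" using I[OF w] by simp
    have lw: "lev (?o w n) = N" using sm[OF w] x0 by (simp add: inJ_def)
    have "t 0 = ?o w n \<or> t 0 = rv (?o w n)"
      by (rule same_point) (use tail_dr[OF t, of 0] sm[OF w] d0 t lw e in \<open>auto simp: tail_def\<close>)
    moreover have "?o w n \<noteq> rv (t 0)" by (rule orb_not_rv_tail[OF r Jw t q]) simp
    ultimately have t0: "t 0 = ?o w n" by auto
    have nJq: "\<not> inJ (t s)" if "s \<le> r" for s
      using t q that by (cases "s = 0") (auto simp: tail_def inJ_def)
    have ot: "?o w (n + s) = t s" if "s \<le> r" for s
      using that by (induction s) (use t0 t in \<open>auto simp: tail_def run_def orb_Suc\<close>)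
    have "alive d w (n + r)" unfolding alive_def
    proof (intro conjI allI impI)
      fix i assume "i < n + r"
      then show "okst f (?o w i)" using ok[OF w, of i] ot[of "i - n"] t
        by (cases "i < n") (auto simp: tail_def run_def)
    next
      fix i assume i: "0 < i \<and> i \<le> n + r"
      then show "\<not> inJ (?o w i)" using al[OF w, of i] ot[of "i - n"] nJq[of "i - n"]
        by (cases "i < n") (auto simp: alive_def)
    qed
    moreover have "\<not> okst f (?o w (n + r))" using ot[of r] t hits_not_ok by (auto simp: tail_def)
    ultimately show False using I[OF w] by (auto simp: bad_def)
  qed
  have ret: "inJ (?o y n)" if y: "\<alpha> < y" "y < \<beta>" for y
  proof (rule ccontr)
    assume nJ: "\<not> inJ (?o y n)"
    have sgn: "(of_int (dr (?o x0 n) * d)::real) = 1 \<or> (of_int (dr (?o x0 n) * d)::real) = -1" using d0 d by auto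
    have "pos (?o y n) \<noteq> q1" "pos (?o y n) \<noteq> q2" using noq[OF y tail1] noq[OF y tail2] by auto
    then have "\<exists>q. (q = q1 \<or> q = q2) \<and> ((pos (?o x0 n) < q \<and> q < pos (?o y n)) \<or> (pos (?o y n) < q \<and> q < pos (?o x0 n)))"
      using nJ x0(3) sm[OF y] by (auto simp: inJ_def)
    then obtain q where q: "q = q1 \<or> q = q2" "(pos (?o x0 n) < q \<and> q < pos (?o y n)) \<or> (pos (?o y n) < q \<and> q < pos (?o x0 n))" by blast
    obtain w where w: "(x0 < w \<and> w < y) \<or> (y < w \<and> w < x0)" "q = pos (?o x0 n) + of_int (dr (?o x0 n) * d) * (w - x0)"
      by (rule between_affine[OF sgn _ q(2)]) (use sm[OF y] in auto)
    have wr: "\<alpha> < w" "w < \<beta>" using w(1) x0 y by auto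
    have "pos (?o w n) = q" using sm[OF wr] w(2) by simp
    then show False using noq[OF wr tail1] noq[OF wr tail2] q(1) by auto
  qed
  have arc: "arc x d (?o x) n" if x: "\<alpha> < x" "x < \<beta>" for x
    unfolding arc_def using ret[OF x] I[OF x] n0 ok[OF x] al[OF x] by (auto intro!: run_orb simp: alive_def)
  have "dr (?o x0 n) = - d" by (rule arc_returns_reversed[OF arc[OF x0(1,2)]])
  then have dd: "real_of_int (dr (?o x0 n) * d) = -1" using d by auto
  show ?thesis
    by (rule that[OF n0, of "pos (?o x0 n) + x0"]) (use arc sm dd in auto)
qed

text \<open>\<open>\<mu>\<close> is the position of a line that turns about a centre in the rhombus
  entered after \<open>a\<close> moves. All lines between \<open>x\<close> and its mirror image pass
  through the same rhombi up to there.\<close>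

definition seen :: "int \<Rightarrow> real \<Rightarrow> nat \<Rightarrow> real \<Rightarrow> bool" where
  "seen d \<mu> a x \<longleftrightarrow> q1 < x \<and> x < q2 \<and> q1 < 2 * \<mu> - x \<and> 2 * \<mu> - x < q2 \<and>
     orb f (St N \<mu> d) (Suc a) = rv (orb f (St N \<mu> d) a) \<and>
     (\<forall>z. min x (2 * \<mu> - x) < z \<and> z < max x (2 * \<mu> - x) \<longrightarrow>
       (\<forall>j \<le> a. okst f (orb f (St N z d) j) \<and> mv f (orb f (St N z d) j) = mv f (orb f (St N \<mu> d) j)))"

text \<open>The fixed point \<open>s / 2\<close> of the return map comes back as its own reversal,
  so \<open>retrace\<close> applies to it. It may lie outside the given interval, but always between
  \<open>x\<close> and \<open>s - x\<close>, where \<open>flip\<close> controls it.\<close>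

lemma return_seen:
  assumes ab: "\<alpha> < \<beta>" and d: "d = 1 \<or> d = -1" and n: "n > 0"
    and arc: "\<And>x. \<alpha> < x \<Longrightarrow> x < \<beta> \<Longrightarrow> arc x d (orb f (St N x d)) n \<and> pos (orb f (St N x d) n) = s - x"
  obtains a where "\<And>x. \<alpha> < x \<Longrightarrow> x < \<beta> \<Longrightarrow> x \<noteq> s / 2 \<Longrightarrow> seen d (s / 2) a x"
proof -
  define \<mu> where "\<mu> = s / 2"
  have fl: "(\<forall>j<n. okst f (orb f (St N z d) j) \<and> mv f (orb f (St N z d) j) = mv f (orb f (St N x d) j))
      \<and> orb f (St N z d) n = St N (s - z) (- d)"
    if x: "\<alpha> < x" "x < \<beta>" "x \<noteq> \<mu>" and z: "min x (s - x) < z" "z < max x (s - x)" for x z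
  proof -
    have a: "arc x d (orb f (St N x d)) n" and e: "pos (orb f (St N x d) n) = s - x" using arc[OF x(1,2)] by auto
    have ne: "pos (orb f (St N x d) n) \<noteq> x" using e x(3) by (auto simp: \<mu>_def)
    show ?thesis using flip[OF a ne, of z] z unfolding e by auto
  qed
  obtain x0 where x0: "\<alpha> < x0" "x0 < \<beta>" "x0 \<noteq> \<mu>"
  proof (cases "(\<alpha> + \<beta>) / 2 = \<mu>")
    case True then show ?thesis using ab by (intro that[of "(\<alpha> + 3 * \<beta>) / 4"]) (auto simp: field_simps)
  next
    case False then show ?thesis using ab by (intro that[of "(\<alpha> + \<beta>) / 2"]) (auto simp: field_simps)
  qed
  have lb: "min x (s - x) < \<mu> \<and> \<mu> < max x (s - x)" if "x \<noteq> \<mu>" for x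
    using that by (auto simp: \<mu>_def min_def max_def field_simps)
  have l: "orb f (St N \<mu> d) n = rv (orb f (St N \<mu> d) 0)" "\<forall>j<n. okst f (orb f (St N \<mu> d) j)"
    using fl[OF x0] lb[OF x0(3)] by (auto simp: rv_def \<mu>_def)
  obtain a where a: "n = 2 * a + 1" "orb f (St N \<mu> d) (Suc a) = rv (orb f (St N \<mu> d) a)"
    by (rule retrace[OF run_orb l(1) n]) (use l(2) in auto)
  show ?thesis
  proof (rule that)
    fix x assume x: "\<alpha> < x" "x < \<beta>" "x \<noteq> s / 2"
    then have x': "x \<noteq> \<mu>" by (simp add: \<mu>_def)
    have J: "inJ (St N x d)" "inJ (orb f (St N x d) n)" "pos (orb f (St N x d) n) = s - x"
      using arc[OF x(1,2)] by (auto simp: arc_def)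
    have s2: "s - x = 2 * \<mu> - x" by (simp add: \<mu>_def)
    show "seen d (s / 2) a x" unfolding seen_def \<mu>_def[symmetric] s2[symmetric]
    proof (intro conjI allI impI)
      fix z j assume z: "min x (s - x) < z \<and> z < max x (s - x)" and j: "j \<le> a"
      have jn: "j < n" using j a by simp
      show "okst f (orb f (St N z d) j)" using fl[OF x(1,2) x', of z] z jn by auto
      show "mv f (orb f (St N z d) j) = mv f (orb f (St N \<mu> d) j)"
        using fl[OF x(1,2) x', of z] fl[OF x(1,2) x', of \<mu>] lb[OF x'] z jn by auto
    qed (use J a(2) in \<open>auto simp: inJ_def\<close>)
  qed
qed

text \<open>\<open>\<kappa>\<close> may be an end of the base interval, and its own orbit may run
  into a vertex. Only a one-sided neighbourhood free of the finitely many bad points is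
  used.\<close>

lemma germ_seen:
  assumes d: "d = 1 \<or> d = -1"
    and bd: "\<And>x m. inJ (St N x d) \<Longrightarrow> alive d x m \<Longrightarrow> k1 \<le> lev (orb f (St N x d) m) \<and> lev (orb f (St N x d) m) \<le> k2"
    and k: "q1 \<le> \<kappa>" "\<kappa> \<le> q2" and e: "e = (1::real) \<and> \<kappa> < q2 \<or> e = -1 \<and> q1 < \<kappa>"
  obtains \<mu> a \<delta> where "\<delta> > 0" "\<And>t. 0 < t \<Longrightarrow> t < \<delta> \<Longrightarrow> \<kappa> + e * t \<noteq> \<mu> \<Longrightarrow> seen d \<mu> a (\<kappa> + e * t)"
proof -
  have fin: "finite {x. bad d x}" by (rule finite_bad[OF d bd])
  define B where "B = insert q1 (insert q2 {x. bad d x}) - {\<kappa>}"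
  have "finite B" using fin by (simp add: B_def)
  then obtain \<delta> where del: "\<delta> > 0" "\<And>x. x \<in> B \<Longrightarrow> \<delta> \<le> dist \<kappa> x"
    using finite_set_avoid[of B \<kappa>] by (auto simp: B_def)
  have clear: "inJ (St N x d) \<and> \<not> bad d x" if x: "\<kappa> < x \<and> x < \<kappa> + \<delta> \<and> e = 1 \<or> \<kappa> - \<delta> < x \<and> x < \<kappa> \<and> e = -1" for x
  proof
    show "\<not> bad d x" using del(2)[of x] x by (auto simp: B_def dist_real_def)
    have "\<delta> \<le> q2 - \<kappa>" if "e = 1" using del(2)[of q2] that e by (auto simp: B_def dist_real_def)
    moreover have "\<delta> \<le> \<kappa> - q1" if "e = -1" using del(2)[of q1] that e by (auto simp: B_def dist_real_def)
    ultimately show "inJ (St N x d)" using x k by (auto simp: inJ_def)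
  qed
  show ?thesis
  proof (cases "e = 1")
    case True
    have c: "\<And>x. \<kappa> < x \<Longrightarrow> x < \<kappa> + \<delta> \<Longrightarrow> inJ (St N x d) \<and> \<not> bad d x" using clear True by auto
    have ab: "\<kappa> < \<kappa> + \<delta>" using del by simp
    obtain n s where ns: "n > 0" "\<And>x. \<kappa> < x \<Longrightarrow> x < \<kappa> + \<delta> \<Longrightarrow> arc x d (orb f (St N x d)) n \<and> pos (orb f (St N x d) n) = s - x"
      using common_return[OF d ab bd c] by blast
    obtain a where a: "\<And>x. \<kappa> < x \<Longrightarrow> x < \<kappa> + \<delta> \<Longrightarrow> x \<noteq> s / 2 \<Longrightarrow> seen d (s / 2) a x"
      using return_seen[OF ab d ns] by blast
    show ?thesis by (rule that[OF del(1), of "s/2" a]) (use a True in auto)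
  next
    case False
    then have e1: "e = -1" using e by auto
    have c: "\<And>x. \<kappa> - \<delta> < x \<Longrightarrow> x < \<kappa> \<Longrightarrow> inJ (St N x d) \<and> \<not> bad d x" using clear e1 by auto
    have ab: "\<kappa> - \<delta> < \<kappa>" using del by simp
    obtain n s where ns: "n > 0" "\<And>x. \<kappa> - \<delta> < x \<Longrightarrow> x < \<kappa> \<Longrightarrow> arc x d (orb f (St N x d)) n \<and> pos (orb f (St N x d) n) = s - x"
      using common_return[OF d ab bd c] by blast
    obtain a where a: "\<And>x. \<kappa> - \<delta> < x \<Longrightarrow> x < \<kappa> \<Longrightarrow> x \<noteq> s / 2 \<Longrightarrow> seen d (s / 2) a x"
      using return_seen[OF ab d ns] by blast
    show ?thesis by (rule that[OF del(1), of "s/2" a]) (use a e1 in auto)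
  qed
qed

end

section \<open>Chains of unfolded rhombi\<close>

definition cr :: "complex \<Rightarrow> complex \<Rightarrow> real" where "cr x y = Re x * Im y - Im x * Re y"

lemma cr_simps:
  "cr (x + y) z = cr x z + cr y z" "cr z (x + y) = cr z x + cr z y"
  "cr (x - y) z = cr x z - cr y z" "cr z (x - y) = cr z x - cr z y"
  "cr (a *\<^sub>R x) z = a * cr x z" "cr z (a *\<^sub>R x) = a * cr z x"
  "cr (- x) z = - cr x z" "cr z (- x) = - cr z x" "cr x x = 0" "cr 0 x = 0" "cr x 0 = 0"
  by (simp_all add: cr_def algebra_simps)

lemma cr_swap: "cr x y = - cr y x" by (simp add: cr_def algebra_simps)

lemma cr_le: "\<bar>cr x y\<bar> \<le> norm x * norm y"
proof -
  have "cr x y = Im (cnj x * y)" by (simp add: cr_def)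
  then show ?thesis by (metis abs_Im_le_cmod complex_mod_cnj norm_mult)
qed

lemma cr_identity: "cr x y *\<^sub>R v = cr v y *\<^sub>R x + cr x v *\<^sub>R y"
  by (simp add: cr_def complex_eq_iff algebra_simps)

lemma cr_0_parallel: assumes "cr x y = 0" "x \<noteq> 0" obtains c where "y = c *\<^sub>R x"
proof -
  have n: "norm x ^ 2 = Re x * Re x + Im x * Im x" unfolding cmod_power2 by (simp add: power2_eq_square)
  have n0: "norm x ^ 2 \<noteq> 0" using assms(2) by simp
  have "norm x ^ 2 *\<^sub>R y = (Re x * Re y + Im x * Im y) *\<^sub>R x"
    using assms(1) unfolding n(1) by (simp add: cr_def complex_eq_iff algebra_simps)
  then have "inverse (norm x ^ 2) *\<^sub>R norm x ^ 2 *\<^sub>R y = (inverse (norm x ^ 2) * (Re x * Re y + Im x * Im y)) *\<^sub>R x"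
    by simp
  then have "y = (inverse (norm x ^ 2) * (Re x * Re y + Im x * Im y)) *\<^sub>R x" using n0 by simp
  then show ?thesis by (rule that)
qed

definition wedge :: "complex \<Rightarrow> complex \<Rightarrow> complex set" where
  "wedge a b = {v. cr a v > 0 \<and> cr v b > 0}"

text \<open>The unfolded picture of a state: a side from the \<open>A\<close>-vertex \<open>av\<close> to \<open>av + sg E (kl)\<close>, crossed in the direction \<open>dd\<close>.\<close>

datatype ds = DS (kl: int) (av: complex) (sg: real) (dd: int)

abbreviation kn :: "ds \<Rightarrow> int" where "kn \<sigma> \<equiv> kl \<sigma> + dd \<sigma>"

locale geo =
  fixes L \<alpha> :: real
  assumes L: "L > 0" and al: "0 < \<alpha>" "\<alpha> < pi / 2"
begin

text \<open>Consecutive sides at an \<open>A\<close>-vertex enclose the rhombus angle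
  \<open>2 * \<alpha>\<close>; the offset \<open>\<alpha>\<close> makes the rhombus of level 0
  symmetric about the real axis.\<close>

definition E :: "int \<Rightarrow> complex" where "E k = L *\<^sub>R cis (of_int (2 * k + 1) * \<alpha>)"

text \<open>The area of a rhombus.\<close>

definition S :: real where "S = L\<^sup>2 * sin (2 * \<alpha>)"

lemma S_pos: "S > 0" unfolding S_def using L al by (intro mult_pos_pos sin_gt_zero) auto

lemma norm_E [simp]: "norm (E k) = L" using L by (simp add: E_def)

lemma cr_E: "e = 1 \<or> e = -1 \<Longrightarrow> cr (E k) (E (k + e)) = of_int e * S"
proof -
  have "cr (E k) (E j) = L\<^sup>2 * sin (of_int (2 * (j - k)) * \<alpha>)" for k j
  proof -
    have "cr (E k) (E j) = L\<^sup>2 * sin (of_int (2 * j + 1) * \<alpha> - of_int (2 * k + 1) * \<alpha>)"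
      unfolding sin_diff by (simp add: cr_def E_def algebra_simps power2_eq_square)
    then show ?thesis by (simp add: algebra_simps)
  qed
  then show "e = 1 \<or> e = -1 \<Longrightarrow> ?thesis" by (auto simp: S_def)
qed

abbreviation fu :: "complex \<Rightarrow> int \<Rightarrow> real" where "fu u k \<equiv> cr u (E k)"

definition Bv :: "ds \<Rightarrow> complex" where "Bv \<sigma> = av \<sigma> + sg \<sigma> *\<^sub>R E (kl \<sigma>)"
definition B2 :: "ds \<Rightarrow> complex" where "B2 \<sigma> = av \<sigma> + sg \<sigma> *\<^sub>R E (kn \<sigma>)"
definition A2 :: "ds \<Rightarrow> complex" where "A2 \<sigma> = av \<sigma> + sg \<sigma> *\<^sub>R (E (kl \<sigma>) + E (kn \<sigma>))"
definition ctr :: "ds \<Rightarrow> complex" where "ctr \<sigma> = av \<sigma> + (sg \<sigma> / 2) *\<^sub>R (E (kl \<sigma>) + E (kn \<sigma>))"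

text \<open>At the opposite corner \<open>A2\<close> the sides run back, hence \<open>- sg\<close>.
  The three cases mirror those of \<open>nxt\<close>, now remembering the place in the
  plane.\<close>

definition step :: "move \<Rightarrow> ds \<Rightarrow> ds" where
  "step m \<sigma> = (case m of PA \<Rightarrow> DS (kn \<sigma>) (av \<sigma>) (sg \<sigma>) (dd \<sigma>)
     | PB \<Rightarrow> DS (kn \<sigma>) (A2 \<sigma>) (- sg \<sigma>) (dd \<sigma>)
     | OP \<Rightarrow> DS (kl \<sigma>) (A2 \<sigma>) (- sg \<sigma>) (- dd \<sigma>))"

definition vld :: "ds \<Rightarrow> bool" where "vld \<sigma> \<longleftrightarrow> (dd \<sigma> = 1 \<or> dd \<sigma> = -1) \<and> (sg \<sigma> = 1 \<or> sg \<sigma> = -1)"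

lemma vld_step [simp]: "vld \<sigma> \<Longrightarrow> vld (step m \<sigma>)" by (cases m) (auto simp: vld_def step_def)

text \<open>Positive beyond the side, negative before it.\<close>

definition sd :: "ds \<Rightarrow> complex \<Rightarrow> real" where
  "sd \<sigma> x = of_int (dd \<sigma>) * sg \<sigma> * cr (E (kl \<sigma>)) (x - av \<sigma>)"

text \<open>The line on which \<open>cr u\<close> equals \<open>\<eta>\<close>, travelled in
  direction \<open>u\<close>, crosses the open side. The sum of the two inequalities also fixes the
  sense of the crossing.\<close>

definition crs :: "complex \<Rightarrow> real \<Rightarrow> ds \<Rightarrow> bool" where
  "crs u \<eta> \<sigma> \<longleftrightarrow> of_int (dd \<sigma>) * (cr u (av \<sigma>) - \<eta>) > 0 \<and> of_int (dd \<sigma>) * (\<eta> - cr u (Bv \<sigma>)) > 0"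

definition wcrs :: "complex \<Rightarrow> real \<Rightarrow> ds \<Rightarrow> bool" where
  "wcrs u \<eta> \<sigma> \<longleftrightarrow> of_int (dd \<sigma>) * (cr u (av \<sigma>) - \<eta>) \<ge> 0 \<and> of_int (dd \<sigma>) * (\<eta> - cr u (Bv \<sigma>)) \<ge> 0 \<and>
     of_int (dd \<sigma>) * (cr u (av \<sigma>) - cr u (Bv \<sigma>)) > 0"

lemma crs_wcrs: "crs u \<eta> \<sigma> \<Longrightarrow> wcrs u \<eta> \<sigma>" by (simp add: crs_def wcrs_def algebra_simps)

section \<open>Projection of the unfolding to the one-dimensional dynamics\<close>

definition pr :: "complex \<Rightarrow> real \<Rightarrow> ds \<Rightarrow> st" where
  "pr u \<eta> \<sigma> = St (kl \<sigma>) (of_int (dd \<sigma>) * (cr u (av \<sigma>) - \<eta>)) (dd \<sigma>)"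

lemma pr_simps [simp]: "lev (pr u \<eta> \<sigma>) = kl \<sigma>" "dr (pr u \<eta> \<sigma>) = dd \<sigma>"
  "pos (pr u \<eta> \<sigma>) = of_int (dd \<sigma>) * (cr u (av \<sigma>) - \<eta>)" by (simp_all add: pr_def)

lemma abs_om:
  assumes "vld \<sigma>" "of_int (dd \<sigma>) * (cr u (av \<sigma>) - cr u (Bv \<sigma>)) > 0"
  shows "\<bar>fu u (kl \<sigma>)\<bar> = of_int (dd \<sigma>) * (cr u (av \<sigma>) - cr u (Bv \<sigma>))"
    "om (fu u) (kl \<sigma>) (kn \<sigma>) = of_int (dd \<sigma>) * (cr u (av \<sigma>) - cr u (B2 \<sigma>))"
    "\<bar>fu u (kl \<sigma>)\<bar> + om (fu u) (kl \<sigma>) (kn \<sigma>) = of_int (dd \<sigma>) * (cr u (av \<sigma>) - cr u (A2 \<sigma>))"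
proof -
  have e: "cr u (Bv \<sigma>) = cr u (av \<sigma>) + sg \<sigma> * fu u (kl \<sigma>)" "cr u (B2 \<sigma>) = cr u (av \<sigma>) + sg \<sigma> * fu u (kn \<sigma>)"
    "cr u (A2 \<sigma>) = cr u (av \<sigma>) + sg \<sigma> * (fu u (kl \<sigma>) + fu u (kn \<sigma>))"
    by (simp_all add: Bv_def B2_def A2_def cr_simps algebra_simps)
  have *: "\<bar>fu u (kl \<sigma>)\<bar> = - of_int (dd \<sigma>) * sg \<sigma> * fu u (kl \<sigma>)"
    "om (fu u) (kl \<sigma>) (kn \<sigma>) = - of_int (dd \<sigma>) * sg \<sigma> * fu u (kn \<sigma>)"
    using assms unfolding e vld_def om_def by (auto simp: zero_le_mult_iff)
  show "\<bar>fu u (kl \<sigma>)\<bar> = of_int (dd \<sigma>) * (cr u (av \<sigma>) - cr u (Bv \<sigma>))"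
    "om (fu u) (kl \<sigma>) (kn \<sigma>) = of_int (dd \<sigma>) * (cr u (av \<sigma>) - cr u (B2 \<sigma>))"
    "\<bar>fu u (kl \<sigma>)\<bar> + om (fu u) (kl \<sigma>) (kn \<sigma>) = of_int (dd \<sigma>) * (cr u (av \<sigma>) - cr u (A2 \<sigma>))"
    unfolding * e by (simp_all add: algebra_simps)
qed

lemma crs_gap: "crs u \<eta> \<sigma> \<Longrightarrow> of_int (dd \<sigma>) * (cr u (av \<sigma>) - cr u (Bv \<sigma>)) > 0"
  by (simp add: crs_def algebra_simps)

lemma pr_inner: "vld \<sigma> \<Longrightarrow> crs u \<eta> \<sigma> \<Longrightarrow> inner_st (fu u) (pr u \<eta> \<sigma>)"
  using abs_om(1)[of \<sigma> u] crs_gap[of u \<eta> \<sigma>] by (auto simp: inner_st_def crs_def vld_def)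

lemma par4: "cr u (A2 \<sigma>) - cr u (B2 \<sigma>) = cr u (Bv \<sigma>) - cr u (av \<sigma>)"
  by (simp add: A2_def B2_def Bv_def cr_simps algebra_simps)

lemma pr_okst_iff:
  assumes "vld \<sigma>" "crs u \<eta> \<sigma>"
  shows "okst (fu u) (pr u \<eta> \<sigma>) \<longleftrightarrow> cr u (B2 \<sigma>) \<noteq> \<eta> \<and> cr u (A2 \<sigma>) \<noteq> \<eta>"
proof -
  have d: "dd \<sigma> = 1 \<or> dd \<sigma> = -1" using assms by (simp add: vld_def)
  show ?thesis unfolding okst_def using pr_inner[OF assms] abs_om[OF assms(1) crs_gap[OF assms(2)]] d by auto
qed

lemma pr_mv:
  assumes "vld \<sigma>" "crs u \<eta> \<sigma>"
  shows "mv (fu u) (pr u \<eta> \<sigma>) = (if of_int (dd \<sigma>) * (\<eta> - cr u (B2 \<sigma>)) > 0 then PA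
     else if of_int (dd \<sigma>) * (cr u (A2 \<sigma>) - \<eta>) > 0 then PB else OP)"
  unfolding mv_def using abs_om[OF assms(1) crs_gap[OF assms(2)]] by (auto simp: algebra_simps)

lemma pr_step:
  assumes "vld \<sigma>" "crs u \<eta> \<sigma>" "okst (fu u) (pr u \<eta> \<sigma>)"
  shows "crs u \<eta> (step (mv (fu u) (pr u \<eta> \<sigma>)) \<sigma>)" "pr u \<eta> (step (mv (fu u) (pr u \<eta> \<sigma>)) \<sigma>) = nxt (fu u) (pr u \<eta> \<sigma>)"
proof -
  have d: "dd \<sigma> = 1 \<or> dd \<sigma> = -1" "sg \<sigma> = 1 \<or> sg \<sigma> = -1" using assms by (auto simp: vld_def)
  note ab = abs_om[OF assms(1) crs_gap[OF assms(2)]]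
  note ne = assms(3)[unfolded pr_okst_iff[OF assms(1,2)]]
  have BB: "Bv (DS (kn \<sigma>) (av \<sigma>) (sg \<sigma>) (dd \<sigma>)) = B2 \<sigma>" "Bv (DS (kn \<sigma>) (A2 \<sigma>) (- sg \<sigma>) (dd \<sigma>)) = Bv \<sigma>"
    "Bv (DS (kl \<sigma>) (A2 \<sigma>) (- sg \<sigma>) (- dd \<sigma>)) = B2 \<sigma>"
    by (simp_all add: Bv_def B2_def A2_def algebra_simps)
  have "crs u \<eta> (step (mv (fu u) (pr u \<eta> \<sigma>)) \<sigma>) \<and>
    pr u \<eta> (step (mv (fu u) (pr u \<eta> \<sigma>)) \<sigma>) = nxt (fu u) (pr u \<eta> \<sigma>)"
  proof (cases "mv (fu u) (pr u \<eta> \<sigma>)")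
    case PA
    then have "of_int (dd \<sigma>) * (\<eta> - cr u (B2 \<sigma>)) > 0" using pr_mv[OF assms(1,2)] by (auto split: if_splits)
    then show ?thesis using PA assms(2) by (simp add: step_def nxt_def crs_def BB) (simp add: pr_def)
  next
    case PB
    then have "of_int (dd \<sigma>) * (cr u (A2 \<sigma>) - \<eta>) > 0" using pr_mv[OF assms(1,2)] by (auto split: if_splits)
    then show ?thesis using PB assms(2) ab(3) by (simp add: step_def nxt_def crs_def BB) (simp add: pr_def algebra_simps)
  next
    case OP
    then have "\<not> of_int (dd \<sigma>) * (\<eta> - cr u (B2 \<sigma>)) > 0" "\<not> of_int (dd \<sigma>) * (cr u (A2 \<sigma>) - \<eta>) > 0"
      using pr_mv[OF assms(1,2)] by (auto split: if_splits)
    then have "of_int (dd \<sigma>) * (\<eta> - cr u (B2 \<sigma>)) < 0" "of_int (dd \<sigma>) * (cr u (A2 \<sigma>) - \<eta>) < 0"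
      using ne d by auto
    then show ?thesis using OP assms(2) ab(3) by (simp add: step_def nxt_def crs_def BB) (simp add: pr_def algebra_simps)
  qed
  then show "crs u \<eta> (step (mv (fu u) (pr u \<eta> \<sigma>)) \<sigma>)"
    "pr u \<eta> (step (mv (fu u) (pr u \<eta> \<sigma>)) \<sigma>) = nxt (fu u) (pr u \<eta> \<sigma>)" by auto
qed

lemma step_ok:
  assumes v: "vld \<sigma>" and c: "crs u \<eta> \<sigma>" "crs u \<eta> (step m \<sigma>)"
  shows "okst (fu u) (pr u \<eta> \<sigma>)" "mv (fu u) (pr u \<eta> \<sigma>) = m"
proof -
  have d: "dd \<sigma> = 1 \<or> dd \<sigma> = -1" using v by (auto simp: vld_def)
  have BB: "Bv (DS (kn \<sigma>) (av \<sigma>) (sg \<sigma>) (dd \<sigma>)) = B2 \<sigma>" "Bv (DS (kn \<sigma>) (A2 \<sigma>) (- sg \<sigma>) (dd \<sigma>)) = Bv \<sigma>"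
    "Bv (DS (kl \<sigma>) (A2 \<sigma>) (- sg \<sigma>) (- dd \<sigma>)) = B2 \<sigma>"
    by (simp_all add: Bv_def B2_def A2_def algebra_simps)
  have "okst (fu u) (pr u \<eta> \<sigma>) \<and> mv (fu u) (pr u \<eta> \<sigma>) = m"
    unfolding pr_okst_iff[OF v c(1)] pr_mv[OF v c(1)]
    using d c par4[of u \<sigma>] by (cases m) (auto simp: crs_def step_def BB)
  then show "okst (fu u) (pr u \<eta> \<sigma>)" "mv (fu u) (pr u \<eta> \<sigma>) = m" by auto
qed

lemma hits_forward:
  assumes v: "vld \<sigma>" and c: "wcrs u \<eta> \<sigma>"
  shows "\<eta> = cr u (B2 \<sigma>) \<Longrightarrow> hits (fu u) False (pr u \<eta> \<sigma>)" "\<eta> = cr u (A2 \<sigma>) \<Longrightarrow> hits (fu u) True (pr u \<eta> \<sigma>)"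
    "\<eta> = cr u (Bv \<sigma>) \<Longrightarrow> hits (fu u) False (pr u \<eta> \<sigma>)" "\<eta> = cr u (av \<sigma>) \<Longrightarrow> hits (fu u) True (pr u \<eta> \<sigma>)"
proof -
  have d: "dd \<sigma> = 1 \<or> dd \<sigma> = -1" using v by (auto simp: vld_def)
  have g: "of_int (dd \<sigma>) * (cr u (av \<sigma>) - cr u (Bv \<sigma>)) > 0" using c by (simp add: wcrs_def)
  note ab = abs_om[OF v g]
  have p: "0 \<le> pos (pr u \<eta> \<sigma>)" "pos (pr u \<eta> \<sigma>) \<le> \<bar>fu u (kl \<sigma>)\<bar>"
    using c d unfolding wcrs_def ab by auto
  show "\<eta> = cr u (B2 \<sigma>) \<Longrightarrow> hits (fu u) False (pr u \<eta> \<sigma>)" "\<eta> = cr u (A2 \<sigma>) \<Longrightarrow> hits (fu u) True (pr u \<eta> \<sigma>)"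
    using p d ab by (auto simp: hits_def)
  show "\<eta> = cr u (Bv \<sigma>) \<Longrightarrow> hits (fu u) False (pr u \<eta> \<sigma>)" "\<eta> = cr u (av \<sigma>) \<Longrightarrow> hits (fu u) True (pr u \<eta> \<sigma>)"
    using p d ab by (auto simp: hits_def)
qed

text \<open>The quotient of \<open>- sd\<close> by the width of the side across \<open>u\<close> is
  the time at which the line through \<open>x\<close> in direction \<open>u\<close> reaches the
  side. Cleared of denominators, this is its increase in one move: proportional to the distance from
  the vertex about which the move pivots, or to the whole width for \<open>OP\<close>.\<close>

lemma sd_step:
  assumes v: "vld \<sigma>"
  shows "sd \<sigma> x * of_int (dd (step m \<sigma>)) * (cr u (av (step m \<sigma>)) - cr u (Bv (step m \<sigma>)))
      - sd (step m \<sigma>) x * of_int (dd \<sigma>) * (cr u (av \<sigma>) - cr u (Bv \<sigma>))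
    = S * of_int (dd \<sigma>) * (case m of PA \<Rightarrow> cr u (av \<sigma>) - cr u x | PB \<Rightarrow> cr u x - cr u (Bv \<sigma>) | OP \<Rightarrow> cr u (av \<sigma>) - cr u (Bv \<sigma>))"
proof -
  have d: "dd \<sigma> = 1 \<or> dd \<sigma> = -1" "sg \<sigma> = 1 \<or> sg \<sigma> = -1" using v by (auto simp: vld_def)
  obtain k a s e where s: "\<sigma> = DS k a s e" by (cases \<sigma>)
  define P where "P = E k"
  define Q where "Q = E (k + e)"
  have pq: "cr P Q = of_int e * S" using cr_E[of e k] d by (simp add: P_def Q_def s)
  have S: "S = of_int e * cr P Q" using pq d by (auto simp: s)
  have d': "(e = 1 \<or> e = -1) \<and> (s = 1 \<or> s = -1)" using d by (simp add: s)
  show ?thesis unfolding s S step_def sd_def Bv_def A2_def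
    apply (cases m)
      apply (simp_all only: ds.sel move.case P_def[symmetric] Q_def[symmetric])
      apply (insert d')
      apply (auto simp: cr_def algebra_simps)
    done
qed

section \<open>Chains of sides and crossing times\<close>

definition gap :: "complex \<Rightarrow> ds \<Rightarrow> real" where
  "gap u \<sigma> = of_int (dd \<sigma>) * (cr u (av \<sigma>) - cr u (Bv \<sigma>))"

definition chain :: "(nat \<Rightarrow> ds) \<Rightarrow> nat \<Rightarrow> bool" where
  "chain g n \<longleftrightarrow> vld (g 0) \<and> (\<forall>i<n. \<exists>m. g (Suc i) = step m (g i))"

lemma chain_vld: "chain g n \<Longrightarrow> i \<le> n \<Longrightarrow> vld (g i)"
proof (induction i)
  case (Suc i)
  then obtain m where "g (Suc i) = step m (g i)" unfolding chain_def by (meson Suc_le_lessD)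
  then show ?case using Suc by simp
qed (simp add: chain_def)

lemma chain_stepE: "chain g n \<Longrightarrow> i < n \<Longrightarrow> (\<And>m. g (Suc i) = step m (g i) \<Longrightarrow> thesis) \<Longrightarrow> thesis"
  unfolding chain_def by blast

lemma chain_mono: "chain g n \<Longrightarrow> m \<le> n \<Longrightarrow> chain g m"
  by (simp add: chain_def)

lemma chain_cong: "chain g n \<Longrightarrow> (\<And>i. i \<le> n \<Longrightarrow> h i = g i) \<Longrightarrow> chain h n"
  by (simp add: chain_def)

lemma chain_Suc: "chain g n \<Longrightarrow> g (Suc n) = step m (g n) \<Longrightarrow> chain g (Suc n)"
  unfolding chain_def using less_Suc_eq by auto

lemma chain_run:
  assumes g: "chain g n" and c: "\<And>i. j \<le> i \<Longrightarrow> i \<le> n \<Longrightarrow> crs u \<eta> (g i)"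
  shows "run (fu u) (\<lambda>i. pr u \<eta> (g (j + i))) (n - j)"
  unfolding run_def
proof (intro allI impI)
  fix i assume i: "i < n - j"
  obtain m where m: "g (Suc (j + i)) = step m (g (j + i))" by (rule chain_stepE[OF g, of "j + i"]) (use i in auto)
  have v: "vld (g (j + i))" by (rule chain_vld[OF g]) (use i in auto)
  have c1: "crs u \<eta> (g (j + i))" and c2: "crs u \<eta> (step m (g (j + i)))"
    using c[of "j + i"] c[of "Suc (j + i)"] i m by auto
  show "okst (fu u) (pr u \<eta> (g (j + i))) \<and> pr u \<eta> (g (j + Suc i)) = nxt (fu u) (pr u \<eta> (g (j + i)))"
    using step_ok[OF v c1 c2] pr_step[OF v c1] m by simp
qed

lemma gap_pos: "crs u \<eta> \<sigma> \<Longrightarrow> gap u \<sigma> > 0" "wcrs u \<eta> \<sigma> \<Longrightarrow> gap u \<sigma> > 0"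
  by (simp_all add: gap_def crs_def wcrs_def algebra_simps)

lemma gap_eq: "gap u \<sigma> = - of_int (dd \<sigma>) * sg \<sigma> * fu u (kl \<sigma>)"
  by (simp add: gap_def Bv_def cr_simps)

lemma gap_le: "vld \<sigma> \<Longrightarrow> gap u \<sigma> \<le> norm u * L"
  using cr_le[of u "E (kl \<sigma>)"] unfolding gap_eq vld_def by auto

lemma sd_gap:
  assumes "vld \<sigma>"
  shows "sd \<sigma> x * gap u (step m \<sigma>) - sd (step m \<sigma>) x * gap u \<sigma>
    = S * (case m of PA \<Rightarrow> of_int (dd \<sigma>) * (cr u (av \<sigma>) - cr u x) | PB \<Rightarrow> of_int (dd \<sigma>) * (cr u x - cr u (Bv \<sigma>)) | OP \<Rightarrow> gap u \<sigma>)"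
  using sd_step[OF assms, of x m u] by (cases m) (simp_all add: gap_def mult.assoc)

text \<open>Crossing times increase along the chain, so a point before one side lies before all
  later ones; \<open>sd_bwd\<close> is the converse for points beyond a side.\<close>

lemma sd_fwd:
  assumes v: "vld \<sigma>" and w: "wcrs u (cr u x) \<sigma>" "wcrs u (cr u x) (step m \<sigma>)" and n: "sd \<sigma> x < 0"
  shows "sd (step m \<sigma>) x < 0"
proof -
  have g: "gap u \<sigma> > 0" "gap u (step m \<sigma>) > 0" using gap_pos w by blast+
  have r: "(case m of PA \<Rightarrow> of_int (dd \<sigma>) * (cr u (av \<sigma>) - cr u x) | PB \<Rightarrow> of_int (dd \<sigma>) * (cr u x - cr u (Bv \<sigma>)) | OP \<Rightarrow> gap u \<sigma>) \<ge> 0"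
    using w(1) g by (cases m) (auto simp: wcrs_def)
  have "sd \<sigma> x * gap u (step m \<sigma>) < 0" using n g by (simp add: mult_neg_pos)
  then have "sd (step m \<sigma>) x * gap u \<sigma> < 0" using sd_gap[OF v, of x u m] mult_nonneg_nonneg[OF less_imp_le[OF S_pos] r] by linarith
  then show ?thesis using g by (simp add: mult_less_0_iff)
qed

lemma sd_fwd0:
  assumes v: "vld \<sigma>" and w: "crs u (cr u x) \<sigma>" "crs u (cr u x) (step m \<sigma>)" and n: "sd \<sigma> x \<le> 0"
  shows "sd (step m \<sigma>) x < 0"
proof -
  have g: "gap u \<sigma> > 0" "gap u (step m \<sigma>) > 0" using gap_pos w by blast+
  have r: "(case m of PA \<Rightarrow> of_int (dd \<sigma>) * (cr u (av \<sigma>) - cr u x) | PB \<Rightarrow> of_int (dd \<sigma>) * (cr u x - cr u (Bv \<sigma>)) | OP \<Rightarrow> gap u \<sigma>) > 0"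
    using w(1) g by (cases m) (auto simp: crs_def)
  have "sd \<sigma> x * gap u (step m \<sigma>) \<le> 0" using n g by (simp add: mult_nonpos_nonneg)
  then have "sd (step m \<sigma>) x * gap u \<sigma> < 0" using sd_gap[OF v, of x u m] mult_pos_pos[OF S_pos r] by linarith
  then show ?thesis using g by (simp add: mult_less_0_iff)
qed

lemma sd_bwd:
  assumes v: "vld \<sigma>" and w: "wcrs u (cr u x) \<sigma>" "wcrs u (cr u x) (step m \<sigma>)" and n: "sd (step m \<sigma>) x > 0"
  shows "sd \<sigma> x > 0"
proof -
  have g: "gap u \<sigma> > 0" "gap u (step m \<sigma>) > 0" using gap_pos w by blast+
  have r: "(case m of PA \<Rightarrow> of_int (dd \<sigma>) * (cr u (av \<sigma>) - cr u x) | PB \<Rightarrow> of_int (dd \<sigma>) * (cr u x - cr u (Bv \<sigma>)) | OP \<Rightarrow> gap u \<sigma>) \<ge> 0"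
    using w(1) g by (cases m) (auto simp: wcrs_def)
  have "sd (step m \<sigma>) x * gap u \<sigma> > 0" using n g by simp
  then have "sd \<sigma> x * gap u (step m \<sigma>) > 0" using sd_gap[OF v, of x u m] mult_nonneg_nonneg[OF less_imp_le[OF S_pos] r] by linarith
  then show ?thesis using g by (simp add: zero_less_mult_iff)
qed

lemma chain_sd_fwd:
  assumes g: "chain g n" and ji: "j \<le> i" "i \<le> n"
    and c: "\<And>l. j \<le> l \<Longrightarrow> l \<le> i \<Longrightarrow> wcrs u (cr u x) (g l)" and s: "sd (g j) x < 0"
  shows "sd (g i) x < 0"
  using ji c
proof (induction i rule: dec_induct)
  case base show ?case by (rule s)
next
  case (step l)
  obtain m where m: "g (Suc l) = geo.step L \<alpha> m (g l)" by (rule chain_stepE[OF g, of l]) (use step in auto)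
  show ?case unfolding m by (rule sd_fwd[OF chain_vld[OF g], of l u]) (use step m[symmetric] in auto)
qed

lemma chain_sd_fwd0:
  assumes g: "chain g n" and ji: "j < i" "i \<le> n"
    and c: "\<And>l. j \<le> l \<Longrightarrow> l \<le> i \<Longrightarrow> crs u (cr u x) (g l)" and s: "sd (g j) x \<le> 0"
  shows "sd (g i) x < 0"
proof -
  obtain m where m: "g (Suc j) = step m (g j)" by (rule chain_stepE[OF g, of j]) (use ji in auto)
  have "sd (g (Suc j)) x < 0" unfolding m by (rule sd_fwd0[OF chain_vld[OF g]]) (use ji c[of j] c[of "Suc j"] s m in auto)
  then show ?thesis by (intro chain_sd_fwd[OF g, of "Suc j" i u]) (use ji c crs_wcrs in auto)
qed

lemma chain_sd_bwd:
  assumes g: "chain g n" and ji: "j \<le> i" "i \<le> n"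
    and c: "\<And>l. j \<le> l \<Longrightarrow> l \<le> i \<Longrightarrow> wcrs u (cr u x) (g l)" and s: "sd (g i) x > 0"
  shows "sd (g j) x > 0"
  using ji(1) c
proof (induction j rule: inc_induct)
  case base show ?case by (rule s)
next
  case (step l)
  obtain m where m: "g (Suc l) = geo.step L \<alpha> m (g l)" by (rule chain_stepE[OF g, of l]) (use step ji in auto)
  show ?case by (rule sd_bwd[OF chain_vld[OF g], of l u x m]) (use step m[symmetric] ji in auto)
qed

lemma sd_ctr: "vld \<sigma> \<Longrightarrow> sd \<sigma> (ctr \<sigma>) = S / 2"
  using cr_E[of "dd \<sigma>" "kl \<sigma>"] by (auto simp: sd_def ctr_def cr_simps vld_def)

lemma sd_affine: "sd \<sigma> (p + t *\<^sub>R (c - p)) = (1 - t) * sd \<sigma> p + t * sd \<sigma> c"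
  by (simp add: sd_def cr_simps algebra_simps)

abbreviation ray :: "complex \<Rightarrow> complex \<Rightarrow> ds \<Rightarrow> bool" where "ray p v \<sigma> \<equiv> crs v (cr v p) \<sigma>"

lemma ray_iff: "ray p v \<sigma> \<longleftrightarrow> of_int (dd \<sigma>) * cr v (av \<sigma> - p) > 0 \<and> of_int (dd \<sigma>) * cr v (p - Bv \<sigma>) > 0"
  by (simp add: crs_def cr_simps)

lemma on_edge:
  assumes v: "vld \<sigma>" and x: "sd \<sigma> x = 0" and c: "ray x u \<sigma>"
  obtains t where "0 < t" "t < 1" "x = av \<sigma> + (t * sg \<sigma>) *\<^sub>R E (kl \<sigma>)"
proof -
  have d: "dd \<sigma> = 1 \<or> dd \<sigma> = -1" "sg \<sigma> = 1 \<or> sg \<sigma> = -1" using v by (auto simp: vld_def)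
  have nz: "E (kl \<sigma>) \<noteq> 0" using norm_E[of "kl \<sigma>"] L by force
  have "cr (E (kl \<sigma>)) (x - av \<sigma>) = 0" using x d by (auto simp: sd_def)
  then obtain a where a: "x - av \<sigma> = a *\<^sub>R E (kl \<sigma>)" by (rule cr_0_parallel[OF _ nz])
  define t where "t = a * sg \<sigma>"
  have x: "x = av \<sigma> + (t * sg \<sigma>) *\<^sub>R E (kl \<sigma>)" using a d by (auto simp: t_def algebra_simps)
  have g: "gap u \<sigma> > 0" using gap_pos c by blast
  have "of_int (dd \<sigma>) * cr u (av \<sigma> - x) = t * gap u \<sigma>" "of_int (dd \<sigma>) * cr u (x - Bv \<sigma>) = (1 - t) * gap u \<sigma>"
    unfolding gap_eq x Bv_def by (simp_all add: cr_simps algebra_simps)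
  then have "t * gap u \<sigma> > 0" "(1 - t) * gap u \<sigma> > 0" using c by (simp_all add: ray_iff)
  then have "0 < t" "t < 1" using g by (simp_all add: zero_less_mult_iff)
  then show ?thesis using x by (rule that)
qed

text \<open>Visibility is first known only for lines parallel to \<open>u\<close>. The point where
  the segment meets the line of the side lies on such a line through the open side, hence in the
  open side itself.\<close>

lemma segment_ray:
  assumes v: "vld \<sigma>" and p: "sd \<sigma> p < 0" and c: "sd \<sigma> c > 0"
    and x: "\<And>t. 0 < t \<Longrightarrow> t < 1 \<Longrightarrow> sd \<sigma> (p + t *\<^sub>R (c - p)) = 0 \<Longrightarrow> ray (p + t *\<^sub>R (c - p)) u \<sigma>"
  shows "ray p (c - p) \<sigma>"
proof -
  have d: "dd \<sigma> = 1 \<or> dd \<sigma> = -1" "sg \<sigma> = 1 \<or> sg \<sigma> = -1" using v by (auto simp: vld_def)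
  define t where "t = - sd \<sigma> p / (sd \<sigma> c - sd \<sigma> p)"
  have t: "0 < t" "t < 1" using p c by (auto simp: t_def field_simps)
  define X where "X = p + t *\<^sub>R (c - p)"
  have X0: "sd \<sigma> X = 0" unfolding X_def sd_affine using p c by (simp add: t_def field_simps)
  obtain b where b: "0 < b" "b < 1" "X = av \<sigma> + (b * sg \<sigma>) *\<^sub>R E (kl \<sigma>)"
    by (rule on_edge[OF v X0]) (use x[OF t] X0 X_def in auto)
  have g: "gap (c - p) \<sigma> > 0"
  proof -
    have "gap (c - p) \<sigma> = sd \<sigma> c - sd \<sigma> p" unfolding gap_eq sd_def cr_swap[of "c - p"] by (simp add: cr_simps algebra_simps)
    then show ?thesis using p c by simp
  qed
  have px: "p = X - t *\<^sub>R (c - p)" by (simp add: X_def)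
  have "cr (c - p) p = cr (c - p) X" by (subst px) (simp add: cr_simps)
  then have "cr (c - p) (av \<sigma> - p) = cr (c - p) (av \<sigma> - X)" "cr (c - p) (p - Bv \<sigma>) = cr (c - p) (X - Bv \<sigma>)"
    by (simp_all add: cr_simps)
  moreover have "of_int (dd \<sigma>) * cr (c - p) (av \<sigma> - X) = b * gap (c - p) \<sigma>" "of_int (dd \<sigma>) * cr (c - p) (X - Bv \<sigma>) = (1 - b) * gap (c - p) \<sigma>"
    unfolding gap_eq b(3) Bv_def by (simp_all add: cr_simps algebra_simps)
  ultimately show ?thesis using b g by (simp add: ray_iff)
qed

text \<open>Only \<open>OP\<close> can reverse a state, and its fixed position is half that of
  \<open>A2\<close>, which is the position of the centre.\<close>

lemma retrace_ctr:
  assumes v: "vld \<sigma>" and c: "crs u \<eta> \<sigma>" and ok: "okst (fu u) (pr u \<eta> \<sigma>)"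
    and r: "nxt (fu u) (pr u \<eta> \<sigma>) = rv (pr u \<eta> \<sigma>)"
  shows "\<eta> = cr u (ctr \<sigma>)"
proof -
  have d: "dd \<sigma> = 1 \<or> dd \<sigma> = -1" using v by (auto simp: vld_def)
  have "cr u (A2 \<sigma>) = 2 * cr u (ctr \<sigma>) - cr u (av \<sigma>)"
    by (simp add: A2_def ctr_def cr_simps algebra_simps)
  with ok show ?thesis
    using abs_om(3)[OF v crs_gap[OF c]] r d
    by (cases rule: nxt_cases) (auto simp: rv_def)
qed

text \<open>Reversing both \<open>u\<close> and the side reduces this to
  \<open>hits_forward\<close>: the ends of the earlier side are corners of the rhombus seen
  backwards.\<close>

lemma hits_backward:
  assumes v: "vld \<sigma>" and c: "wcrs u \<eta> (step m \<sigma>)"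
  shows "\<eta> = cr u (av \<sigma>) \<Longrightarrow> hits (fu u) True (rv (pr u \<eta> (step m \<sigma>)))"
    "\<eta> = cr u (Bv \<sigma>) \<Longrightarrow> hits (fu u) False (rv (pr u \<eta> (step m \<sigma>)))"
proof -
  define \<rho> where "\<rho> = DS (kl (step m \<sigma>)) (av (step m \<sigma>)) (sg (step m \<sigma>)) (- dd (step m \<sigma>))"
  have r: "vld \<rho>" using vld_step[OF v, of m] by (auto simp: vld_def \<rho>_def)
  have w: "wcrs (- u) (- \<eta>) \<rho>" using c by (simp add: wcrs_def \<rho>_def cr_simps Bv_def algebra_simps)
  have f: "fu (- u) = (\<lambda>k. - fu u k)" by (auto simp: cr_simps)
  have p: "pr (- u) (- \<eta>) \<rho> = rv (pr u \<eta> (step m \<sigma>))"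
    by (rule st_eqI) (simp_all add: \<rho>_def cr_simps algebra_simps)
  have h: "hits (fu (- u)) a s = hits (fu u) a s" for a s
    by (simp add: hits_def om_def f)
  have eq: "av \<sigma> = av \<rho> \<or> av \<sigma> = A2 \<rho>" "Bv \<sigma> = Bv \<rho> \<or> Bv \<sigma> = B2 \<rho>"
    by (cases m; simp add: \<rho>_def step_def A2_def Bv_def B2_def algebra_simps)+
  show "\<eta> = cr u (av \<sigma>) \<Longrightarrow> hits (fu u) True (rv (pr u \<eta> (step m \<sigma>)))"
    using eq(1) hits_forward[OF r w] unfolding h p by (auto simp: cr_simps)
  show "\<eta> = cr u (Bv \<sigma>) \<Longrightarrow> hits (fu u) False (rv (pr u \<eta> (step m \<sigma>)))"
    using eq(2) hits_forward[OF r w] unfolding h p by (auto simp: cr_simps)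
qed

end

section \<open>Visible vertices and narrow beams\<close>

lemma tendsto_cr: "((\<lambda>u. cr u x) \<longlongrightarrow> cr u0 x) (nhds u0)"
  unfolding cr_def by (intro tendsto_intros filterlim_ident)

lemma wedge_trans:
  assumes "x \<in> wedge a b" "y \<in> wedge a b" "cr x y > 0" "v \<in> wedge x y" shows "v \<in> wedge a b"
proof -
  have e: "cr x y *\<^sub>R v = cr v y *\<^sub>R x + cr x v *\<^sub>R y" by (rule cr_identity)
  have "cr x y * cr a v = cr v y * cr a x + cr x v * cr a y" "cr x y * cr v b = cr v y * cr x b + cr x v * cr y b"
    using arg_cong[OF e, of "cr a"] arg_cong[OF e, of "\<lambda>w. cr w b"] by (simp_all add: cr_simps)
  moreover have "cr v y * cr a x + cr x v * cr a y > 0" "cr v y * cr x b + cr x v * cr y b > 0"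
    using assms by (auto simp: wedge_def intro!: add_pos_pos)
  ultimately have "cr a v > 0" "cr v b > 0" using assms(3) by (metis zero_less_mult_pos)+
  then show ?thesis by (simp add: wedge_def)
qed

lemma wedge_combo:
  assumes v: "v \<in> wedge x y" and c: "cr x y > 0"
  obtains s t where "s > 0" "t > 0" "v = s *\<^sub>R x + t *\<^sub>R y"
proof -
  have "(1 / cr x y) *\<^sub>R (cr x y *\<^sub>R v) = (1 / cr x y) *\<^sub>R (cr v y *\<^sub>R x + cr x v *\<^sub>R y)"
    using cr_identity by metis
  then have "v = (cr v y / cr x y) *\<^sub>R x + (cr x v / cr x y) *\<^sub>R y"
    using c by (simp add: scaleR_add_right)
  then show ?thesis using v c that[of "cr v y / cr x y" "cr x v / cr x y"] by (auto simp: wedge_def)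
qed

lemma wedge_add: "v \<in> wedge a b \<Longrightarrow> w \<in> wedge a b \<Longrightarrow> s > 0 \<Longrightarrow> t > 0 \<Longrightarrow> s *\<^sub>R v + t *\<^sub>R w \<in> wedge a b"
  by (auto simp: wedge_def cr_simps intro!: add_pos_pos)

text \<open>A wedge is convex, so a linear function without zeros on it has constant sign.\<close>

lemma wedge_sign:
  assumes n: "\<And>v. v \<in> wedge a b \<Longrightarrow> cr v x \<noteq> 0" and v: "v \<in> wedge a b" "w \<in> wedge a b" and p: "cr v x > 0"
  shows "cr w x > 0"
proof (rule ccontr)
  assume "\<not> cr w x > 0"
  then have w: "cr w x < 0" using n[OF v(2)] by simp
  have "(- cr w x) *\<^sub>R v + cr v x *\<^sub>R w \<in> wedge a b" using v p w by (intro wedge_add) auto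
  from n[OF this] show False by (simp add: cr_simps)
qed

context geo
begin

lemma ray_scale: assumes "c > 0" shows "ray p (c *\<^sub>R v) \<sigma> = ray p v \<sigma>"
proof -
  have "0 < c * x \<longleftrightarrow> 0 < x" for x using assms by (simp add: zero_less_mult_iff)
  then show ?thesis unfolding ray_iff unfolding cr_simps(5) mult.left_commute[of _ c] by simp
qed

lemma step_sel [simp]:
  "dd (step PA \<sigma>) = dd \<sigma>" "dd (step PB \<sigma>) = dd \<sigma>" "dd (step OP \<sigma>) = - dd \<sigma>"
  "av (step PA \<sigma>) = av \<sigma>" "av (step PB \<sigma>) = A2 \<sigma>" "av (step OP \<sigma>) = A2 \<sigma>"
  "Bv (step PA \<sigma>) = B2 \<sigma>" "Bv (step PB \<sigma>) = Bv \<sigma>" "Bv (step OP \<sigma>) = B2 \<sigma>"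
  by (simp_all add: step_def A2_def Bv_def B2_def algebra_simps)

lemma ev_ray:
  assumes "ray p u \<sigma>" shows "eventually (\<lambda>v. ray p v \<sigma>) (nhds u)"
proof -
  have "((\<lambda>v. of_int (dd \<sigma>) * cr v y) \<longlongrightarrow> of_int (dd \<sigma>) * cr u y) (nhds u)" for y
    by (intro tendsto_intros tendsto_cr)
  then have "eventually (\<lambda>v. of_int (dd \<sigma>) * cr v y > 0) (nhds u)" if "of_int (dd \<sigma>) * cr u y > 0" for y
    using that by (rule order_tendstoD(1))
  then show ?thesis using assms unfolding ray_iff by (auto intro: eventually_conj)
qed

text \<open>Two directions with the same chain cannot separate by more than the length of a side, so both would take bounded time; but their distance along
the sides stays bounded below, so one of them advances by a fixed amount at every step.\<close>

lemma no_infinite: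
  assumes g: "\<And>n. chain g n" and p: "sd (g 0) p < 0" and u: "cr u1 u2 > 0"
    and r: "\<And>i. ray p u1 (g i)" "\<And>i. ray p u2 (g i)"
  shows False
proof -
  have v: "vld (g i)" for i using chain_vld[OF g] by blast
  \<comment> \<open>The time at which the ray reaches side \<open>i\<close>; \<open>\<rho>\<close>
    is the relative position on this side, measured from the \<open>A\<close>-vertex.\<close>
  define T where "T u i = - sd (g i) p / gap u (g i)" for u i
  define \<rho> where "\<rho> u i = of_int (dd (g i)) * (cr u (av (g i)) - cr u p) / gap u (g i)" for u i
  define c where "c = cr u1 u2"
  have nz: "norm u1 > 0" "norm u2 > 0" using u by (auto simp: cr_simps)
  have gp: "gap u (g i) > 0" "gap u (g i) \<le> norm u * L" "0 < \<rho> u i" "\<rho> u i < 1" if "u = u1 \<or> u = u2" for u i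
  proof -
    have rr: "ray p u (g i)" using that r by auto
    show gg: "gap u (g i) > 0" using gap_pos rr by blast
    show "gap u (g i) \<le> norm u * L" by (rule gap_le[OF v])
    show "0 < \<rho> u i" "\<rho> u i < 1" using gg rr unfolding \<rho>_def by (auto simp: crs_def gap_def field_simps)
  qed
  have X: "p + T u i *\<^sub>R u = av (g i) + (\<rho> u i * sg (g i)) *\<^sub>R E (kl (g i))" if uu: "u = u1 \<or> u = u2" for u i
  proof -
    define D where "D = p + T u i *\<^sub>R u - av (g i) - (\<rho> u i * sg (g i)) *\<^sub>R E (kl (g i))"
    have d: "dd (g i) = 1 \<or> dd (g i) = -1" "sg (g i) = 1 \<or> sg (g i) = -1" using v[of i] by (auto simp: vld_def)
    have g0: "gap u (g i) \<noteq> 0" using gp(1)[OF uu, of i] by simp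
    have e: "gap u (g i) = - of_int (dd (g i)) * sg (g i) * fu u (kl (g i))" by (rule gap_eq)
    then have f0: "fu u (kl (g i)) \<noteq> 0" using g0 by auto
    have ef: "cr (E (kl (g i))) u = - fu u (kl (g i))" by (rule cr_swap)
    have 1: "cr u D = 0" unfolding D_def using d g0 f0
      by (auto simp: cr_simps \<rho>_def e field_simps)
    have 2: "cr (E (kl (g i))) D = 0" unfolding D_def using d g0 f0
      by (auto simp: cr_simps T_def e sd_def ef field_simps)
    have "fu u (kl (g i)) *\<^sub>R D = cr D (E (kl (g i))) *\<^sub>R u + cr u D *\<^sub>R E (kl (g i))" by (rule cr_identity)
    also have "\<dots> = 0" using 1 2 cr_swap[of D] by simp
    finally have "D = 0" using f0 by simp
    moreover have "p + T u i *\<^sub>R u = D + (av (g i) + (\<rho> u i * sg (g i)) *\<^sub>R E (kl (g i)))" by (simp add: D_def)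
    ultimately show ?thesis by simp
  qed
  have incr: "T u (Suc i) - T u i > 0" 
    and incc: "\<exists>m. g (Suc i) = step m (g i) \<and> T u (Suc i) - T u i \<ge> S / (norm u * L) * (case m of PA \<Rightarrow> \<rho> u i | PB \<Rightarrow> 1 - \<rho> u i | OP \<Rightarrow> 1)"
    if uu: "u = u1 \<or> u = u2" for u i
  proof -
    obtain m where m: "g (Suc i) = step m (g i)" by (rule chain_stepE[OF g, of i]) auto
    define R where "R m = (case m of PA \<Rightarrow> \<rho> u i | PB \<Rightarrow> 1 - \<rho> u i | OP \<Rightarrow> 1)" for m
    note gi = gp[OF uu, of i] and gs = gp[OF uu, of "Suc i"]
    have Rp: "R m > 0" using gi by (cases m) (simp_all add: R_def)
    have q: "(case m of PA \<Rightarrow> of_int (dd (g i)) * (cr u (av (g i)) - cr u p) | PB \<Rightarrow> of_int (dd (g i)) * (cr u p - cr u (Bv (g i))) | OP \<Rightarrow> gap u (g i)) = R m * gap u (g i)"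
    proof -
      have "\<rho> u i * gap u (g i) = of_int (dd (g i)) * (cr u (av (g i)) - cr u p)" using gi(1) by (simp add: \<rho>_def)
      moreover have "(1 - \<rho> u i) * gap u (g i) = gap u (g i) - \<rho> u i * gap u (g i)" by (simp add: algebra_simps)
      ultimately show ?thesis by (cases m) (simp_all add: R_def, simp add: gap_def algebra_simps)
    qed
    have "sd (g i) p * gap u (g (Suc i)) - sd (g (Suc i)) p * gap u (g i) = S * (R m * gap u (g i))"
      using sd_gap[OF v, of i p u m] unfolding q m .
    then have "(sd (g i) p * gap u (g (Suc i)) - sd (g (Suc i)) p * gap u (g i)) / (gap u (g i) * gap u (g (Suc i))) =
      S * (R m * gap u (g i)) / (gap u (g i) * gap u (g (Suc i)))" by simp
    then have t: "T u (Suc i) - T u i = S / gap u (g (Suc i)) * R m" using gi(1) gs(1)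
      by (simp add: T_def field_simps)
    have "S / gap u (g (Suc i)) \<ge> S / (norm u * L)" using gs S_pos L by (intro divide_left_mono) auto
    then have a: "T u (Suc i) - T u i \<ge> S / (norm u * L) * R m" unfolding t using Rp by (intro mult_right_mono) auto
    show "\<exists>m. g (Suc i) = step m (g i) \<and> T u (Suc i) - T u i \<ge> S / (norm u * L) * (case m of PA \<Rightarrow> \<rho> u i | PB \<Rightarrow> 1 - \<rho> u i | OP \<Rightarrow> 1)"
      using a m unfolding R_def by blast
    show "T u (Suc i) - T u i > 0" unfolding t using S_pos gs Rp by simp
  qed
  have T0: "T u i \<ge> T u 0" "T u 0 > 0" if "u = u1 \<or> u = u2" for u i
  proof -
    show "T u i \<ge> T u 0" using incr[OF that] by (induction i) (auto intro: order.trans less_imp_le)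
    show "T u 0 > 0" using p gp(1)[OF that, of 0] by (simp add: T_def divide_neg_pos)
  qed
  have diff: "T u1 i *\<^sub>R u1 - T u2 i *\<^sub>R u2 = ((\<rho> u1 i - \<rho> u2 i) * sg (g i)) *\<^sub>R E (kl (g i))" for i
  proof -
    have "T u1 i *\<^sub>R u1 - T u2 i *\<^sub>R u2 = (p + T u1 i *\<^sub>R u1) - (p + T u2 i *\<^sub>R u2)" by simp
    then show ?thesis unfolding X[of u1 i, simplified] X[of u2 i, simplified] by (simp add: algebra_simps)
  qed
  have nd: "norm (T u1 i *\<^sub>R u1 - T u2 i *\<^sub>R u2) = \<bar>\<rho> u1 i - \<rho> u2 i\<bar> * L" for i
    unfolding diff using v[of i] L by (auto simp: vld_def abs_mult)
  have b2: "T u2 i * c \<le> norm u1 * (\<bar>\<rho> u1 i - \<rho> u2 i\<bar> * L)" for i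
    using cr_le[of u1 "T u1 i *\<^sub>R u1 - T u2 i *\<^sub>R u2"] unfolding nd by (simp add: cr_simps c_def)
  have b1: "T u1 i * c \<le> norm u2 * (\<bar>\<rho> u1 i - \<rho> u2 i\<bar> * L)" for i
    using cr_le[of u2 "T u1 i *\<^sub>R u1 - T u2 i *\<^sub>R u2"] unfolding nd by (simp add: cr_simps c_def cr_swap[of u2 u1])
  have r1: "\<bar>\<rho> u1 i - \<rho> u2 i\<bar> \<le> 1" for i using gp(3,4)[of u1 i] gp(3,4)[of u2 i] by auto
  define \<delta> where "\<delta> = T u2 0 * c / (norm u1 * L)"
  have dp: "\<delta> > 0" using T0(2)[of u2] u nz L by (simp add: \<delta>_def c_def)
  have dd: "\<bar>\<rho> u1 i - \<rho> u2 i\<bar> \<ge> \<delta>" for i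
  proof -
    have "T u2 0 * c \<le> norm u1 * (\<bar>\<rho> u1 i - \<rho> u2 i\<bar> * L)" 
    proof -
      have "T u2 0 * c \<le> T u2 i * c" using T0(1)[of u2 i] u by (intro mult_right_mono) (auto simp: c_def)
      then show ?thesis using b2[of i] by linarith
    qed
    then show ?thesis using nz L by (simp add: \<delta>_def field_simps)
  qed
  \<comment> \<open>The weights make the lower bounds for the growth of the two times comparable:
    both become \<open>S / L\<close>.\<close>
  define Q where "Q i = norm u1 * T u1 i + norm u2 * T u2 i" for i
  have Qinc: "Q (Suc i) - Q i \<ge> S / L * \<delta>" for i
  proof -
    obtain m where m: "g (Suc i) = step m (g i)" "T u1 (Suc i) - T u1 i \<ge> S / (norm u1 * L) * (case m of PA \<Rightarrow> \<rho> u1 i | PB \<Rightarrow> 1 - \<rho> u1 i | OP \<Rightarrow> 1)"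
      using incc[of u1 i] by blast
    obtain m' where m': "g (Suc i) = step m' (g i)" "T u2 (Suc i) - T u2 i \<ge> S / (norm u2 * L) * (case m' of PA \<Rightarrow> \<rho> u2 i | PB \<Rightarrow> 1 - \<rho> u2 i | OP \<Rightarrow> 1)"
      using incc[of u2 i] by blast
    have "m' = m" using step_ok(2)[OF v r(1)[of i], of m] step_ok(2)[OF v r(1)[of i], of m'] r(1)[of "Suc i"] m(1) m'(1) by metis
    note m' = m'[unfolded this]
    have "norm u1 * (T u1 (Suc i) - T u1 i) \<ge> S / L * (case m of PA \<Rightarrow> \<rho> u1 i | PB \<Rightarrow> 1 - \<rho> u1 i | OP \<Rightarrow> 1)"
      using mult_left_mono[OF m(2), of "norm u1"] nz by simp
    moreover have "norm u2 * (T u2 (Suc i) - T u2 i) \<ge> S / L * (case m of PA \<Rightarrow> \<rho> u2 i | PB \<Rightarrow> 1 - \<rho> u2 i | OP \<Rightarrow> 1)"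
      using mult_left_mono[OF m'(2), of "norm u2"] nz by simp
    ultimately have 1: "Q (Suc i) - Q i \<ge> S / L * ((case m of PA \<Rightarrow> \<rho> u1 i | PB \<Rightarrow> 1 - \<rho> u1 i | OP \<Rightarrow> 1) + (case m of PA \<Rightarrow> \<rho> u2 i | PB \<Rightarrow> 1 - \<rho> u2 i | OP \<Rightarrow> 1))"
      by (simp add: Q_def algebra_simps)
    have 2: "(case m of PA \<Rightarrow> \<rho> u1 i | PB \<Rightarrow> 1 - \<rho> u1 i | OP \<Rightarrow> 1) + (case m of PA \<Rightarrow> \<rho> u2 i | PB \<Rightarrow> 1 - \<rho> u2 i | OP \<Rightarrow> 1) \<ge> \<delta>"
      using dd[of i] r1[of i] gp(3,4)[of u1 i] gp(3,4)[of u2 i] by (cases m) auto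
    have "S / L * \<delta> \<le> S / L * ((case m of PA \<Rightarrow> \<rho> u1 i | PB \<Rightarrow> 1 - \<rho> u1 i | OP \<Rightarrow> 1) + (case m of PA \<Rightarrow> \<rho> u2 i | PB \<Rightarrow> 1 - \<rho> u2 i | OP \<Rightarrow> 1))"
      using 2 S_pos L by (intro mult_left_mono) auto
    then show ?thesis using 1 by linarith
  qed
  have Qlow: "Q i \<ge> of_nat i * (S / L * \<delta>)" for i
  proof (induction i)
    case 0 then show ?case using T0(2)[of u1] T0(2)[of u2] nz by (simp add: Q_def)
  next
    case (Suc i) then show ?case using Qinc[of i] by (simp only: of_nat_Suc distrib_right)
  qed
  have Qup: "Q i \<le> 2 * (norm u1 * norm u2 * L / c)" for i
  proof -
    have c0: "c > 0" using u by (simp add: c_def)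
    have "T u2 i * c \<le> norm u1 * L" "T u1 i * c \<le> norm u2 * L"
      using b2[of i] b1[of i] r1[of i] L nz
      by (smt (verit) mult_left_mono mult_right_mono mult_cancel_right1)+
    then have "T u2 i \<le> norm u1 * L / c" "T u1 i \<le> norm u2 * L / c" using c0 by (simp_all add: pos_le_divide_eq)
    then have "norm u2 * T u2 i \<le> norm u2 * (norm u1 * L / c)" "norm u1 * T u1 i \<le> norm u1 * (norm u2 * L / c)"
      using nz by (auto intro!: mult_left_mono simp del: times_divide_eq_right)
    moreover have "norm u2 * (norm u1 * L / c) = norm u1 * norm u2 * L / c" "norm u1 * (norm u2 * L / c) = norm u1 * norm u2 * L / c" by simp_all
    ultimately show ?thesis unfolding Q_def by linarith
  qed
  have "S / L * \<delta> > 0" using S_pos L dp by simp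
  then obtain n where "of_nat n * (S / L * \<delta>) > 2 * (norm u1 * norm u2 * L / c)"
    using reals_Archimedean3 by blast
  then show False using Qlow[of n] Qup[of n] by linarith
qed

section \<open>Beams of directions and their narrowing\<close>

definition beam :: "complex \<Rightarrow> (nat \<Rightarrow> ds) \<Rightarrow> nat \<Rightarrow> complex \<Rightarrow> complex \<Rightarrow> bool" where
  "beam p g n a b \<longleftrightarrow> chain g n \<and> sd (g 0) p < 0 \<and> cr a b > 0 \<and> (\<forall>v\<in>wedge a b. \<forall>i\<le>n. ray p v (g i))"

text \<open>The chain is extended by following the direction \<open>a + b\<close>. While no new
  vertex lies in a direction of the wedge, \<open>wedge_sign\<close> forces the same move for all
  its directions; by \<open>no_infinite\<close> this must stop.\<close>

lemma vis:
  assumes b: "beam p g n a b"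
  obtains G n' v z where "n \<le> n'" "\<And>i. i \<le> n \<Longrightarrow> G i = g i" "beam p G n' a b" "v \<in> wedge a b"
    "z = B2 (G n') \<or> z = A2 (G n')" "cr v (z - p) = 0"
proof -
  have ab: "cr a b > 0" using b by (simp add: beam_def)
  have mid: "a + b \<in> wedge a b" using ab by (simp add: wedge_def cr_simps)
  define G where "G i = (if i \<le> n then g i else (rec_nat (g n) (\<lambda>_ \<sigma>. step (mv (fu (a + b)) (pr (a + b) (cr (a + b) p) \<sigma>)) \<sigma>)) (i - n))" for i
  have Gn: "G i = g i" if "i \<le> n" for i using that by (simp add: G_def)
  have GS: "G (Suc i) = step (mv (fu (a + b)) (pr (a + b) (cr (a + b) p) (G i))) (G i)" if "n \<le> i" for i
    using that by (cases "i = n") (auto simp: G_def Suc_diff_le)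
  note goal = that
  show ?thesis
  proof (rule ccontr)
    assume nt: "\<not> thesis"
    have all: "beam p G i a b" if "n \<le> i" for i
      using that
    proof (induction i rule: dec_induct)
      case base
      have "chain G n" using b Gn chain_cong by (auto simp: beam_def)
      then show ?case using b Gn by (auto simp: beam_def)
    next
      case (step i)
      have v: "vld (G i)" using chain_vld step by (auto simp: beam_def)
      have r: "ray p w (G i)" if "w \<in> wedge a b" for w using step that by (auto simp: beam_def)
      have nz: "cr w (B2 (G i) - p) \<noteq> 0" "cr w (A2 (G i) - p) \<noteq> 0" if w: "w \<in> wedge a b" for w
        using nt goal[OF \<open>n \<le> i\<close> Gn \<open>beam p G i a b\<close> w, of "B2 (G i)"] goal[OF \<open>n \<le> i\<close> Gn \<open>beam p G i a b\<close> w, of "A2 (G i)"]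
        by auto
      have ok: "okst (fu w) (pr w (cr w p) (G i))" if "w \<in> wedge a b" for w
        unfolding pr_okst_iff[OF v r[OF that]] using nz[OF that] by (auto simp: cr_simps)
      have d: "dd (G i) = 1 \<or> dd (G i) = -1" using v by (auto simp: vld_def)
      have nz': "cr w (p - B2 (G i)) \<noteq> 0" "cr w (p - A2 (G i)) \<noteq> 0" if "w \<in> wedge a b" for w
        using nz[OF that] by (auto simp: cr_simps)
      have s: "cr w (B2 (G i) - p) > 0 \<longleftrightarrow> cr (a + b) (B2 (G i) - p) > 0"
        "cr w (A2 (G i) - p) > 0 \<longleftrightarrow> cr (a + b) (A2 (G i) - p) > 0"
        "cr w (p - B2 (G i)) > 0 \<longleftrightarrow> cr (a + b) (p - B2 (G i)) > 0"
        "cr w (p - A2 (G i)) > 0 \<longleftrightarrow> cr (a + b) (p - A2 (G i)) > 0" if "w \<in> wedge a b" for w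
        using wedge_sign[OF nz(1)] wedge_sign[OF nz(2)] wedge_sign[OF nz'(1)] wedge_sign[OF nz'(2)] that mid by blast+
      have mveq: "mv (fu w) (pr w (cr w p) (G i)) = mv (fu (a + b)) (pr (a + b) (cr (a + b) p) (G i))" if "w \<in> wedge a b" for w
        unfolding pr_mv[OF v r[OF that]] pr_mv[OF v r[OF mid]] using s[OF that] d by (auto simp: cr_simps(4))
      have "ray p w (G (Suc i))" if "w \<in> wedge a b" for w
        unfolding GS[OF \<open>n \<le> i\<close>] using pr_step(1)[OF v r[OF that] ok[OF that]] unfolding mveq[OF that] .
      moreover have "chain G (Suc i)" using chain_Suc[OF _ GS[OF \<open>n \<le> i\<close>]] step by (auto simp: beam_def)
      ultimately show ?case using step by (auto simp: beam_def le_Suc_eq)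
    qed
    have c: "chain G i" for i using all[of "max n i"] chain_mono by (auto simp: beam_def)
    have r: "ray p w (G i)" if "w \<in> wedge a b" for w i using all[of "max n i"] that by (auto simp: beam_def)
    have m2: "a + 2 *\<^sub>R b \<in> wedge a b" using ab by (simp add: wedge_def cr_simps)
    have "cr (a + b) (a + 2 *\<^sub>R b) > 0" using ab by (simp add: cr_simps cr_swap[of b a])
    then show False using no_infinite[OF c _ _ r[OF mid] r[OF m2]] all[OF order_refl] by (auto simp: beam_def)
  qed
qed

lemma chain_sd_neg:
  assumes "chain g n" "sd (g 0) p < 0" "\<And>i. i \<le> n \<Longrightarrow> ray p v (g i)" "i \<le> n"
  shows "sd (g i) p < 0"
  by (rule chain_sd_fwd[OF assms(1), of 0 i v]) (use assms crs_wcrs in auto)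

lemma sd_vertex: "vld \<sigma> \<Longrightarrow> z = B2 \<sigma> \<or> z = A2 \<sigma> \<Longrightarrow> sd \<sigma> z = S"
  using cr_E[of "dd \<sigma>" "kl \<sigma>"] by (auto simp: sd_def A2_def B2_def cr_simps vld_def)

text \<open>At a visible vertex the rays part. The chain is continued on the side to which
  \<open>w\<close> points, and the new side of the chain is visible from that side only.\<close>

lemma side:
  assumes g: "chain g n" and p: "sd (g 0) p < 0" and r: "\<And>i. i \<le> n \<Longrightarrow> ray p v0 (g i)"
    and z: "z = B2 (g n) \<or> z = A2 (g n)" "cr v0 (z - p) = 0" and w: "cr v0 w \<noteq> 0"
  obtains m t0 where "t0 > 0"
    "\<And>i t. 0 < t \<Longrightarrow> t \<le> t0 \<Longrightarrow> i \<le> Suc n \<Longrightarrow> ray p (v0 + t *\<^sub>R w) ((g(Suc n := step m (g n))) i)"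
    "\<And>v. ray p v (step m (g n)) \<Longrightarrow> cr v0 w * cr v0 v > 0"
proof -
  have v: "vld (g n)" by (rule chain_vld[OF g]) simp
  have d: "dd (g n) = 1 \<or> dd (g n) = -1" using v by (auto simp: vld_def)
  have "sd (g n) p < 0" by (rule chain_sd_neg[OF g p r]) auto
  moreover have "sd (g n) z > 0" using sd_vertex[OF v z(1)] S_pos by simp
  ultimately have "z \<noteq> p" by auto
  have v0: "v0 \<noteq> 0" using w by (auto simp: cr_simps)
  obtain \<tau> where \<tau>: "z - p = \<tau> *\<^sub>R v0" by (rule cr_0_parallel[OF z(2) v0])
  have \<tau>0: "\<tau> \<noteq> 0" using \<tau> \<open>z \<noteq> p\<close> by auto
  define e where "e = (if \<tau> * cr w v0 > 0 then 1 else - 1 :: real)"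
  have e: "e * cr w (z - p) > 0" 
  proof -
    have "cr w v0 \<noteq> 0" using w cr_swap[of w v0] by simp
    then have "\<tau> * cr w v0 \<noteq> 0" using \<tau>0 by simp
    moreover obtain X where X: "X = \<tau> * cr w v0" by simp
    ultimately show ?thesis unfolding \<tau> e_def cr_simps X[symmetric] by auto
  qed
  \<comment> \<open>A ray passing close to \<open>z\<close> leaves through one of the two sides
    meeting there: \<open>PB\<close> or \<open>OP\<close> at \<open>A2\<close>, \<open>PA\<close> or
    \<open>OP\<close> at \<open>B2\<close>.\<close>
  define m where "m = (if z = A2 (g n) then (if e = of_int (dd (g n)) then PB else OP) else (if e = of_int (dd (g n)) then OP else PA))"
  have e2: "e = of_int (dd (g n)) \<or> e = - of_int (dd (g n))" using d by (auto simp: e_def)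
  \<comment> \<open>Stands for the other end of the exit side; the ray clears it by an open
    condition that already holds for \<open>v0\<close>.\<close>
  define q where "q = (if z = A2 (g n) then (if e = of_int (dd (g n)) then of_int (dd (g n)) *\<^sub>R (p - Bv (g n)) else of_int (dd (g n)) *\<^sub>R (B2 (g n) - p))
    else (if e = of_int (dd (g n)) then of_int (dd (g n)) *\<^sub>R (p - A2 (g n)) else of_int (dd (g n)) *\<^sub>R (av (g n) - p)))"
  have rs: "ray p v (step m (g n)) \<longleftrightarrow> e * cr v (z - p) > 0 \<and> cr v q > 0" for v
    using z(1) e2 d by (auto simp: ray_iff m_def q_def cr_simps)
  have q0: "cr v0 q > 0"
    using r[OF order_refl] z d par4[of v0 "g n"] by (auto simp: q_def ray_iff cr_simps)
  have f1: "filterlim (\<lambda>t. v0 + t *\<^sub>R w) (nhds v0) (at_right 0)"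
    by (rule tendsto_eq_intros refl | simp)+
  have ev1: "eventually (\<lambda>t. \<forall>i\<in>{..n}. ray p (v0 + t *\<^sub>R w) (g i)) (at_right 0)"
  proof (rule eventually_ball_finite, simp, rule ballI)
    fix i assume "i \<in> {..n}"
    then have "eventually (\<lambda>v. ray p v (g i)) (nhds v0)" by (intro ev_ray r) simp
    then show "eventually (\<lambda>t. ray p (v0 + t *\<^sub>R w) (g i)) (at_right 0)" using f1 by (rule eventually_compose_filterlim)
  qed
  have ev2: "eventually (\<lambda>t. cr (v0 + t *\<^sub>R w) q > 0) (at_right 0)"
    using order_tendstoD(1)[OF tendsto_cr q0] f1 by (rule eventually_compose_filterlim)
  have ev3: "eventually (\<lambda>t::real. t > 0) (at_right 0)" by (simp add: eventually_at_right_less)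
  from ev1 ev2 have "eventually (\<lambda>t. (\<forall>i\<in>{..n}. ray p (v0 + t *\<^sub>R w) (g i)) \<and> cr (v0 + t *\<^sub>R w) q > 0) (at_right 0)"
    by (rule eventually_conj)
  then obtain b where b: "b > 0" "\<And>t. 0 < t \<Longrightarrow> t < b \<Longrightarrow> (\<forall>i\<in>{..n}. ray p (v0 + t *\<^sub>R w) (g i)) \<and> cr (v0 + t *\<^sub>R w) q > 0"
    unfolding eventually_at_right_field by auto
  show ?thesis
  proof (rule that[of "b / 2" m])
    show "b / 2 > 0" using b by simp
    show "ray p (v0 + t *\<^sub>R w) ((g(Suc n := step m (g n))) i)" if t: "0 < t" "t \<le> b / 2" and i: "i \<le> Suc n" for i t
    proof (cases "i = Suc n")
      case True
      have "e * cr (v0 + t *\<^sub>R w) (z - p) = t * (e * cr w (z - p))" using z(2) by (simp add: cr_simps algebra_simps)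
      also have "\<dots> > 0" using e t by simp
      finally show ?thesis using True b(2)[of t] t rs by simp
    next
      case False then show ?thesis using b(2)[of t] t i by simp
    qed
    show "cr v0 w * cr v0 v > 0" if "ray p v (step m (g n))" for v
    proof -
      have "(e * \<tau>) * cr v v0 > 0" "(e * \<tau>) * cr w v0 > 0" using that e unfolding rs \<tau> by (simp_all add: cr_simps)
      then have "cr v v0 * cr w v0 > 0" by (metis mult_less_0_iff not_less_iff_gr_or_eq zero_less_mult_iff)
      then show ?thesis unfolding cr_swap[of v] cr_swap[of w] by (simp add: mult.commute)
    qed
  qed
qed

lemma narrow_left:
  assumes b: "beam p g n a b"
  obtains G n' a' b' where "n < n'" "\<And>i. i \<le> n \<Longrightarrow> G i = g i" "beam p G n' a' b'" "a' \<in> wedge a b" "b' \<in> wedge a b"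
    "\<And>v. ray p v (G n') \<Longrightarrow> cr a' v > 0"
proof -
  obtain H l v z where H: "n \<le> l" "\<And>i. i \<le> n \<Longrightarrow> H i = g i" "beam p H l a b" "v \<in> wedge a b"
    "z = B2 (H l) \<or> z = A2 (H l)" "cr v (z - p) = 0" by (rule vis[OF b]) blast
  have ch: "chain H l" "sd (H 0) p < 0" "\<And>i. i \<le> l \<Longrightarrow> ray p v (H i)" using H by (auto simp: beam_def)
  have vb: "cr v b > 0" "cr a v > 0" using H(4) by (auto simp: wedge_def)
  obtain m t0 where t0: "t0 > 0" "\<And>i t. 0 < t \<Longrightarrow> t \<le> t0 \<Longrightarrow> i \<le> Suc l \<Longrightarrow> ray p (v + t *\<^sub>R b) ((H(Suc l := step m (H l))) i)"
    "\<And>w. ray p w (step m (H l)) \<Longrightarrow> cr v b * cr v w > 0"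
    by (rule side[OF ch H(5,6), of b]) (use vb in auto)
  define b' where "b' = v + t0 *\<^sub>R b"
  define G where "G = H(Suc l := step m (H l))"
  have vb': "cr v b' > 0" using vb t0 by (simp add: b'_def cr_simps)
  show ?thesis
  proof (rule that[of "Suc l" G v b'])
    show "n < Suc l" using H by simp
    show "G i = g i" if "i \<le> n" for i using H that by (simp add: G_def)
    show "v \<in> wedge a b" by (rule H)
    show "b' \<in> wedge a b" using vb t0 b by (auto simp: b'_def wedge_def cr_simps beam_def intro!: add_pos_pos)
    show "cr v w > 0" if "ray p w (G (Suc l))" for w using t0(3)[of w] that vb by (simp add: G_def zero_less_mult_iff)
    have "chain G (Suc l)" by (rule chain_Suc) (use ch(1) in \<open>auto simp: G_def intro: chain_cong\<close>)
    moreover have "ray p w (G i)" if w: "w \<in> wedge v b'" and i: "i \<le> Suc l" for w i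
    proof -
      obtain s t where st: "s > 0" "t > 0" "w = s *\<^sub>R v + t *\<^sub>R b'" by (rule wedge_combo[OF w vb'])
      have "w = (s + t) *\<^sub>R (v + (t * t0 / (s + t)) *\<^sub>R b)" 
      proof -
        have "w = (s + t) *\<^sub>R v + (t * t0) *\<^sub>R b" using st(3) by (simp add: b'_def algebra_simps)
        then show ?thesis using st by (simp add: scaleR_add_right)
      qed
      moreover have "t * t0 / (s + t) > 0" "t * t0 / (s + t) \<le> t0" using st t0 by (auto simp: field_simps)
      ultimately show ?thesis using t0(2)[of "t * t0 / (s + t)" i] i st ray_scale[of "s + t"] by (simp add: G_def)
    qed
    ultimately show "beam p G (Suc l) v b'" using ch(2) vb' by (auto simp: beam_def G_def)
  qed
qed

lemma narrow_right:
  assumes b: "beam p g n a b"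
  obtains G n' a' b' where "n < n'" "\<And>i. i \<le> n \<Longrightarrow> G i = g i" "beam p G n' a' b'" "a' \<in> wedge a b" "b' \<in> wedge a b"
    "\<And>v. ray p v (G n') \<Longrightarrow> cr v b' > 0"
proof -
  obtain H l v z where H: "n \<le> l" "\<And>i. i \<le> n \<Longrightarrow> H i = g i" "beam p H l a b" "v \<in> wedge a b"
    "z = B2 (H l) \<or> z = A2 (H l)" "cr v (z - p) = 0" by (rule vis[OF b]) blast
  have ch: "chain H l" "sd (H 0) p < 0" "\<And>i. i \<le> l \<Longrightarrow> ray p v (H i)" using H by (auto simp: beam_def)
  have vb: "cr v b > 0" "cr a v > 0" using H(4) by (auto simp: wedge_def)
  have va: "cr v a < 0" using vb cr_swap[of v a] by simp
  obtain m t0 where t0: "t0 > 0" "\<And>i t. 0 < t \<Longrightarrow> t \<le> t0 \<Longrightarrow> i \<le> Suc l \<Longrightarrow> ray p (v + t *\<^sub>R a) ((H(Suc l := step m (H l))) i)"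
    "\<And>w. ray p w (step m (H l)) \<Longrightarrow> cr v a * cr v w > 0"
    by (rule side[OF ch H(5,6), of a]) (use va in auto)
  define a' where "a' = v + t0 *\<^sub>R a"
  define G where "G = H(Suc l := step m (H l))"
  have va': "cr a' v > 0" using vb t0 by (simp add: a'_def cr_simps)
  show ?thesis
  proof (rule that[of "Suc l" G a' v])
    show "n < Suc l" using H by simp
    show "G i = g i" if "i \<le> n" for i using H that by (simp add: G_def)
    show "v \<in> wedge a b" by (rule H)
    show "a' \<in> wedge a b" using vb t0 b by (auto simp: a'_def wedge_def cr_simps beam_def intro!: add_pos_pos)
    show "cr w v > 0" if "ray p w (G (Suc l))" for w
      using t0(3)[of w] that va cr_swap[of w v] by (simp add: G_def zero_less_mult_iff)
    have "chain G (Suc l)" by (rule chain_Suc) (use ch(1) in \<open>auto simp: G_def intro: chain_cong\<close>)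
    moreover have "ray p w (G i)" if w: "w \<in> wedge a' v" and i: "i \<le> Suc l" for w i
    proof -
      obtain s t where st: "s > 0" "t > 0" "w = s *\<^sub>R a' + t *\<^sub>R v" by (rule wedge_combo[OF w va'])
      have "w = (s + t) *\<^sub>R (v + (s * t0 / (s + t)) *\<^sub>R a)" 
      proof -
        have "w = (s + t) *\<^sub>R v + (s * t0) *\<^sub>R a" using st(3) by (simp add: a'_def algebra_simps)
        then show ?thesis using st by (simp add: scaleR_add_right)
      qed
      moreover have "s * t0 / (s + t) > 0" "s * t0 / (s + t) \<le> t0" using st t0 by (auto simp: field_simps)
      ultimately show ?thesis using t0(2)[of "s * t0 / (s + t)" i] i st ray_scale[of "s + t"] by (simp add: G_def)
    qed
    ultimately show "beam p G (Suc l) a' v" using ch(2) va' by (auto simp: beam_def G_def)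
  qed
qed

text \<open>A vertex passed on either side turns control of the direction into control of the chain:
  whatever follows the longer chain has its direction in the old wedge. Later constructions only
  guarantee the chain.\<close>

lemma narrow:
  assumes b: "beam p g n a b"
  obtains G n' a' b' where "n < n'" "\<And>i. i \<le> n \<Longrightarrow> G i = g i" "beam p G n' a' b'"
    "\<And>v. (\<And>i. i \<le> n' \<Longrightarrow> ray p v (G i)) \<Longrightarrow> v \<in> wedge a b"
proof -
  obtain H l a1 b1 where H: "n < l" "\<And>i. i \<le> n \<Longrightarrow> H i = g i" "beam p H l a1 b1" "a1 \<in> wedge a b" "b1 \<in> wedge a b"
    "\<And>v. ray p v (H l) \<Longrightarrow> cr a1 v > 0" by (rule narrow_left[OF b]) blast
  obtain G n' a2 b2 where G: "l < n'" "\<And>i. i \<le> l \<Longrightarrow> G i = H i" "beam p G n' a2 b2" "a2 \<in> wedge a1 b1" "b2 \<in> wedge a1 b1"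
    "\<And>v. ray p v (G n') \<Longrightarrow> cr v b2 > 0" by (rule narrow_right[OF H(3)]) blast
  have ab1: "cr a1 b1 > 0" using H by (simp add: beam_def)
  have b2: "b2 \<in> wedge a b" by (rule wedge_trans[OF H(4,5) ab1 G(5)])
  show ?thesis
  proof (rule that[of n' G a2 b2])
    show "v \<in> wedge a b" if r: "\<And>i. i \<le> n' \<Longrightarrow> ray p v (G i)" for v
    proof (rule wedge_trans[OF H(4) b2])
      show "cr a1 b2 > 0" using G(5) by (simp add: wedge_def)
      show "v \<in> wedge a1 b2" using G(6)[OF r] H(6)[of v] r[of l] G(1,2) by (simp add: wedge_def)
    qed
  qed (use G H in auto)
qed

lemma lengthen:
  assumes b: "beam p g n a b"
  shows "\<exists>G n' a' b'. M \<le> n' \<and> n \<le> n' \<and> (\<forall>i\<le>n. G i = g i) \<and> beam p G n' a' b'"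
proof (induction M)
  case 0 then show ?case using b by blast
next
  case (Suc M)
  then obtain H l a1 b1 where H: "M \<le> l" "n \<le> l" "\<And>i. i \<le> n \<Longrightarrow> H i = g i" "beam p H l a1 b1" by blast
  obtain G n' a2 b2 where G: "l < n'" "\<And>i. i \<le> l \<Longrightarrow> G i = H i" "beam p G n' a2 b2"
    by (rule narrow_left[OF H(4)]) blast
  show ?case by (intro exI[of _ G] exI[of _ n'] exI[of _ a2] exI[of _ b2]) (use G H in auto)
qed

end

section \<open>A visible vertex and its tails\<close>

locale hub = geo +
  fixes g :: "nat \<Rightarrow> ds" and m :: nat and p :: complex
  assumes ch: "chain g m" and p0: "sd (g 0) p < 0"
begin

abbreviation N :: int where "N \<equiv> kl (g m)"
abbreviation d :: int where "d \<equiv> dd (g m)"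

text \<open>The position at which the line through \<open>x\<close> in direction \<open>u\<close>
  crosses the last side, in the coordinate of the one-dimensional states there; \<open>lin\<close>
  goes back from positions to lines.\<close>

definition posn :: "complex \<Rightarrow> complex \<Rightarrow> real" where
  "posn u x = of_int d * (cr u (av (g m)) - cr u x)"

definition lin :: "complex \<Rightarrow> real \<Rightarrow> real" where
  "lin u y = cr u (av (g m)) - of_int d * y"

lemma v: "i \<le> m \<Longrightarrow> vld (g i)" using ch by (rule chain_vld)

lemma d1: "d = 1 \<or> d = -1" using v[of m] by (simp add: vld_def)

lemma lin_posn [simp]: "lin u (posn u x) = cr u x"
  using d1 by (auto simp: lin_def posn_def)

lemma pr_lin: "pr u (lin u y) (g m) = St N y d"
  using d1 by (auto simp: pr_def lin_def)

lemma posn_affine: "posn u (x + t *\<^sub>R (c - x)) = (1 - t) * posn u x + t * posn u c"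
  by (simp add: posn_def cr_simps algebra_simps)

text \<open>\<open>Lo\<close> and \<open>Up\<close> order the ends of every side along the
  coordinate of the last one; which of them is the \<open>A\<close>-vertex depends on the relative
  direction of crossing.\<close>

definition Lo :: "nat \<Rightarrow> complex" where "Lo i = (if dd (g i) = d then av (g i) else Bv (g i))"
definition Up :: "nat \<Rightarrow> complex" where "Up i = (if dd (g i) = d then Bv (g i) else av (g i))"

lemma crs_iff:
  assumes "i \<le> m"
  shows "crs u (lin u y) (g i) \<longleftrightarrow> posn u (Lo i) < y \<and> y < posn u (Up i)"
proof -
  have "dd (g i) = 1 \<or> dd (g i) = -1" using v[OF assms] by (simp add: vld_def)
  then show ?thesis using d1 by (auto simp: crs_def lin_def posn_def Lo_def Up_def)
qed

lemma wcrs_iff: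
  assumes "i \<le> m"
  shows "wcrs u (lin u y) (g i) \<longleftrightarrow> posn u (Lo i) \<le> y \<and> y \<le> posn u (Up i) \<and> posn u (Lo i) < posn u (Up i)"
proof -
  have "dd (g i) = 1 \<or> dd (g i) = -1" using v[OF assms] by (simp add: vld_def)
  then show ?thesis using d1 by (auto simp: wcrs_def lin_def posn_def Lo_def Up_def)
qed

text \<open>The segment from \<open>p\<close> to the centre sweeps exactly the parallel lines
  between \<open>posn u p\<close> and \<open>\<mu>\<close>, all of which follow one chain. The line
  through \<open>p\<close> itself is left out, since it may run into a vertex.\<close>

lemma see:
  assumes pn: "\<And>i. i \<le> m \<Longrightarrow> sd (g i) p < 0"
    and ret: "orb (fu u) (St N \<mu> d) (Suc a) = rv (orb (fu u) (St N \<mu> d) a)"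
    and I1: "\<And>y i. y = \<mu> \<or> posn u p < y \<and> y < \<mu> \<or> \<mu> < y \<and> y < posn u p \<Longrightarrow> i \<le> m \<Longrightarrow> crs u (lin u y) (g i)"
    and I2: "\<And>y j. y = \<mu> \<or> posn u p < y \<and> y < \<mu> \<or> \<mu> < y \<and> y < posn u p \<Longrightarrow> j \<le> a \<Longrightarrow>
       okst (fu u) (orb (fu u) (St N y d) j) \<and> mv (fu u) (orb (fu u) (St N y d) j) = mv (fu u) (orb (fu u) (St N \<mu> d) j)"
  obtains G where "chain G (m + a)" "\<And>i. i \<le> m \<Longrightarrow> G i = g i" "\<And>i. i \<le> m + a \<Longrightarrow> ray p (ctr (G (m + a)) - p) (G i)"
proof -
  define good where "good y \<longleftrightarrow> (y = \<mu> \<or> posn u p < y \<and> y < \<mu> \<or> \<mu> < y \<and> y < posn u p)" for y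
  define G where "G i = (if i \<le> m then g i else rec_nat (g m) (\<lambda>j \<sigma>. step (mv (fu u) (orb (fu u) (St N \<mu> d) j)) \<sigma>) (i - m))" for i
  have Gm: "G i = g i" if "i \<le> m" for i using that by (simp add: G_def)
  have GS: "G (Suc (m + j)) = step (mv (fu u) (orb (fu u) (St N \<mu> d) j)) (G (m + j))" for j
    by (cases "j = 0") (auto simp: G_def Suc_diff_le)
  have cG: "chain G (m + j)" for j
  proof (induction j)
    case 0 show ?case using chain_cong[OF ch, of G] Gm by simp
  next
    case (Suc j) then show ?case using chain_Suc[OF Suc GS] by simp
  qed
  have vG: "vld (G i)" for i using chain_vld[OF cG[of i], of i] by simp
  have P: "crs u (lin u y) (G (m + j)) \<and> pr u (lin u y) (G (m + j)) = orb (fu u) (St N y d) j"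
    if y: "good y" and j: "j \<le> a" for y j
    using j
  proof (induction j)
    case 0 show ?case using I1[of y m] y Gm[of m] pr_lin by (simp add: good_def)
  next
    case (Suc j)
    then have IH: "crs u (lin u y) (G (m + j))" "pr u (lin u y) (G (m + j)) = orb (fu u) (St N y d) j" by auto
    note i2 = I2[OF y[unfolded good_def], of j]
    have "okst (fu u) (pr u (lin u y) (G (m + j)))" using i2 IH Suc.prems by simp
    from pr_step[OF vG IH(1) this] show ?case using GS[of j] i2 IH Suc.prems by (simp add: orb_Suc)
  qed
  have C: "crs u (lin u y) (G i)" if "good y" "i \<le> m + a" for y i
  proof (cases "i \<le> m")
    case True then show ?thesis using I1[of y i] that Gm by (simp add: good_def)
  next
    case False then show ?thesis using P[OF that(1), of "i - m"] that(2) by simp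
  qed
  have gm: "good \<mu>" by (simp add: good_def)
  define c where "c = ctr (G (m + a))"
  have "lin u \<mu> = cr u c" unfolding c_def
    by (rule retrace_ctr[OF vG]) (use P[OF gm, of a] ret I2[of \<mu> a] in \<open>auto simp: orb_Suc\<close>)
  then have pc: "posn u c = \<mu>" using d1 by (auto simp: posn_def lin_def)
  have sc0: "sd (G (m + a)) c > 0" using sd_ctr[OF vG, of "m + a"] S_pos by (simp add: c_def)
  have sc: "sd (G i) c > 0" if "i \<le> m + a" for i
    by (rule chain_sd_bwd[OF cG that order_refl, of u])
      (use C[OF gm] crs_wcrs pc lin_posn[of u c] sc0 in auto)
  have X: "good (posn u (p + t *\<^sub>R (c - p)))" if "0 < t" "t < 1" for t
  proof -
    have e: "posn u (p + t *\<^sub>R (c - p)) = (1 - t) * posn u p + t * \<mu>" using posn_affine[of u p t c] pc by simp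
    consider "posn u p = \<mu>" | "posn u p < \<mu>" | "posn u p > \<mu>" by linarith
    then show ?thesis
    proof cases
      case 1 then show ?thesis unfolding good_def e by (simp add: algebra_simps)
    next
      case 2
      then have "t * (\<mu> - posn u p) > 0" "(1 - t) * (\<mu> - posn u p) > 0" using that by auto
      then show ?thesis unfolding good_def e by (auto simp: algebra_simps)
    next
      case 3
      then have "t * (posn u p - \<mu>) > 0" "(1 - t) * (posn u p - \<mu>) > 0" using that by auto
      then show ?thesis unfolding good_def e by (auto simp: algebra_simps)
    qed
  qed
  have XC: "ray (p + t *\<^sub>R (c - p)) u (G i)" if "0 < t" "t < 1" "i \<le> m + a" for t i
    using C[OF X[OF that(1,2)] that(3)] lin_posn by simp
  \<comment> \<open>Beyond side \<open>m\<close> no line through \<open>p\<close> is known to follow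
    the chain. The point where the segment meets side \<open>m\<close> is, and affinity carries the
    sign back to \<open>p\<close>.\<close>
  have sp: "sd (G i) p < 0" if i: "i \<le> m + a" for i
  proof (cases "i \<le> m")
    case True then show ?thesis using pn Gm by simp
  next
    case False
    have pm: "sd (g m) p < 0" "sd (g m) c > 0" using pn[of m] sc[of m] Gm[of m] by auto
    define t where "t = - sd (g m) p / (sd (g m) c - sd (g m) p)"
    have t: "0 < t" "t < 1" using pm by (auto simp: t_def field_simps)
    define X where "X = p + t *\<^sub>R (c - p)"
    have X0: "sd (g m) X = 0" unfolding X_def sd_affine using pm by (simp add: t_def field_simps)
    have "sd (G i) X < 0"
      by (rule chain_sd_fwd0[OF cG, of m i a u]) (use False i XC[OF t] X0 Gm[of m] in \<open>auto simp: X_def\<close>)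
    then have "(1 - t) * sd (G i) p + t * sd (G i) c < 0" by (simp add: X_def sd_affine)
    moreover have "t * sd (G i) c > 0" using t sc[OF i] by simp
    ultimately have "(1 - t) * sd (G i) p < 0" by linarith
    then show ?thesis using t by (simp add: mult_less_0_iff)
  qed
  show ?thesis
  proof (rule that[of G])
    show "chain G (m + a)" by (rule cG)
    show "ray p (ctr (G (m + a)) - p) (G i)" if "i \<le> m + a" for i
      unfolding c_def[symmetric] by (rule segment_ray[OF vG sp[OF that] sc[OF that]]) (use XC that in auto)
  qed (rule Gm)
qed

section \<open>Separatrices traced back from the last side\<close>

definition endp :: "nat \<Rightarrow> bool \<Rightarrow> complex \<Rightarrow> bool" where
  "endp i ty V \<longleftrightarrow> i \<le> m \<and> V = (if ty then av (g i) else Bv (g i))"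

definition good :: "complex \<Rightarrow> complex \<Rightarrow> nat \<Rightarrow> bool" where
  "good u V i \<longleftrightarrow> (\<forall>j. i < j \<and> j \<le> m \<longrightarrow> ray V u (g j)) \<and> gap u (g m) > 0"

text \<open>The line through \<open>V\<close> followed backwards from the last side;
  \<open>j\<close> counts the sides already passed.\<close>

definition T :: "complex \<Rightarrow> complex \<Rightarrow> nat \<Rightarrow> st" where
  "T u V j = rv (pr u (cr u V) (g (m - j)))"

lemma T_simps [simp]: "lev (T u V j) = kl (g (m - j))" "dr (T u V j) = - dd (g (m - j))"
  "pos (T u V j) = of_int (dd (g (m - j))) * (cr u (av (g (m - j))) - cr u V)"
  by (simp_all add: T_def)

text \<open>The run stops at side \<open>Suc i\<close>, because the rhombus before it has
  \<open>V\<close> as a corner. For \<open>i = m\<close> the truncated subtraction gives length 0,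
  \<open>V\<close> being an end of the last side.\<close>

lemma vtail:
  assumes e: "endp i ty V" and G: "good u V i"
  shows "run (fu u) (T u V) (m - i - 1)" "hits (fu u) ty (T u V (m - i - 1))"
proof -
  define r where "r = m - i - 1"
  have im: "i \<le> m" using e by (simp add: endp_def)
  have "run (fu u) (T u V) r \<and> hits (fu u) ty (T u V r)"
  proof (cases "i = m")
    case True
    have "0 \<le> gap u (g m)" using G by (simp add: good_def)
    then have "pos (T u V 0) = (if ty then 0 else \<bar>fu u (kl (g m))\<bar>)"
      using True e abs_om(1)[OF v[of m], of u] G d1 by (auto simp: endp_def good_def gap_def)
    then show ?thesis using True d1 by (auto simp: run_def hits_def r_def)
  next
    case False
    then have im': "i < m" using im by simp
    have R: "run (fu u) (\<lambda>l. pr u (cr u V) (g (Suc i + l))) (m - Suc i)"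
      by (rule chain_run[OF ch]) (use G in \<open>auto simp: good_def\<close>)
    have "run (fu u) (\<lambda>j. rv (pr u (cr u V) (g (Suc i + (m - Suc i - j))))) (m - Suc i)"
      using run_rev[OF R] by simp
    moreover have "rv (pr u (cr u V) (g (Suc i + (m - Suc i - j)))) = T u V j" if "j \<le> r" for j
    proof -
      have e: "Suc i + (m - Suc i - j) = m - j" using that im' by (simp add: r_def)
      show ?thesis by (simp only: T_def e)
    qed
    ultimately have run: "run (fu u) (T u V) r" by (auto simp: run_def r_def Suc_diff_Suc)
    obtain mm where mm: "g (Suc i) = step mm (g i)" by (rule chain_stepE[OF ch im'])
    have w: "wcrs u (cr u V) (step mm (g i))" using G im' mm crs_wcrs by (auto simp: good_def)
    have "m - r = Suc i" using im' by (simp add: r_def)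
    then have "T u V r = rv (pr u (cr u V) (step mm (g i)))" by (simp add: T_def mm)
    then have "hits (fu u) ty (T u V r)" using hits_backward[OF v[OF im] w] e by (cases ty) (auto simp: endp_def)
    then show ?thesis using run by simp
  qed
  then show "run (fu u) (T u V) (m - i - 1)" "hits (fu u) ty (T u V (m - i - 1))" by (auto simp: r_def)
qed

text \<open>If a tail meets the last side again in the opposite direction, the parallel line halfway between retraces itself about a centre.\<close>

lemma rev_ctr:
  assumes pn: "\<And>i. i \<le> m \<Longrightarrow> sd (g i) p < 0"
    and sl: "\<And>i. i \<le> m \<Longrightarrow> posn u (Lo i) \<le> ql \<and> qr \<le> posn u (Up i)" and k: "ql < posn u p" "posn u p < qr"
    and G: "good u V i" and V: "posn u V = ql \<or> posn u V = qr"
    and j: "j \<le> m - i - 1" "kl (g (m - j)) = N" "dd (g (m - j)) = - d" "ql \<le> pos (T u V j)" "pos (T u V j) \<le> qr"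
  shows "\<exists>n<m. m \<le> 2 * n + 1 \<and> (\<forall>l\<le>n. ray p (ctr (g n) - p) (g l))"
proof -
  have j0: "j > 0" using j(3) d1 by (cases j) auto
  have ji: "i < m - j" "j \<le> m" using j(1) j0 by auto
  define y where "y = (posn u V + pos (T u V j)) / 2"
  have yr: "ql \<le> y" "y \<le> qr" using V j(4,5) k by (auto simp: y_def)
  have c: "crs u (lin u y) (g l)" if l: "m - j \<le> l" "l \<le> m" for l
  proof -
    have "ray V u (g l)" using G l ji by (auto simp: good_def)
    then have "posn u (Lo l) < posn u V" "posn u V < posn u (Up l)"
      using crs_iff[OF l(2), of u "posn u V"] by auto
    then show ?thesis unfolding crs_iff[OF l(2)] using sl[OF l(2)] V j(4,5) k by (auto simp: y_def)
  qed
  have e: "pr u (lin u y) (g m) = rv (pr u (lin u y) (g (m - j)))"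
    using j(2,3) d1 unfolding pr_lin by (intro st_eqI) (auto simp: lin_def y_def posn_def field_simps)
  have R: "run (fu u) (\<lambda>l. pr u (lin u y) (g (m - j + l))) (m - (m - j))" by (rule chain_run[OF ch]) (use c in auto)
  have mj: "m - (m - j) = j" using ji by simp
  obtain a where a: "j = 2 * a + 1" "pr u (lin u y) (g (m - j + Suc a)) = rv (pr u (lin u y) (g (m - j + a)))"
    by (rule retrace[OF R[unfolded mj]]) (use e ji j0 in auto)
  \<comment> \<open>With \<open>j = 2 * a + 1\<close> and \<open>j \<le> m\<close> the centre is
    found no earlier than half way along the chain, which suffices later.\<close>
  define n where "n = m - j + a"
  have n: "n < m" "m \<le> 2 * n + 1" using a(1) ji by (auto simp: n_def)
  have "okst (fu u) (pr u (lin u y) (g n)) \<and> pr u (lin u y) (g (Suc n)) = nxt (fu u) (pr u (lin u y) (g n))"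
    using R[unfolded run_def mj, rule_format, of a] a(1) by (simp add: n_def)
  then have "lin u y = cr u (ctr (g n))"
    using retrace_ctr[OF v, of n u "lin u y"] c[of n] n a(2) by (simp add: n_def)
  then have py: "posn u (ctr (g n)) = y" using d1 by (auto simp: posn_def lin_def)
  have wc: "wcrs u (cr u (ctr (g n))) (g l)" if "l \<le> m" for l
    using wcrs_iff[OF that, of u y] sl[OF that] yr k \<open>lin u y = cr u (ctr (g n))\<close> by auto
  have sn: "sd (g n) (ctr (g n)) > 0" using sd_ctr[OF v, of n] n S_pos by simp
  have "ray p (ctr (g n) - p) (g l)" if l: "l \<le> n" for l
  proof (rule segment_ray)
    have lm: "l \<le> m" using l n by simp
    show "vld (g l)" "sd (g l) p < 0" using v pn lm by auto
    show "sd (g l) (ctr (g n)) > 0"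
      by (rule chain_sd_bwd[OF chain_mono[OF ch less_imp_le[OF n(1)]] l order_refl, of u]) (use wc n sn in auto)
    fix t :: real assume t: "0 < t" "t < 1"
    have "posn u (p + t *\<^sub>R (ctr (g n) - p)) = (1 - t) * posn u p + t * y" using posn_affine py by simp
    moreover have "(1 - t) * ql < (1 - t) * posn u p" "(1 - t) * posn u p < (1 - t) * qr" "t * ql \<le> t * y" "t * y \<le> t * qr"
      using t k yr by (auto intro!: mult_left_mono)
    ultimately have "ql < posn u (p + t *\<^sub>R (ctr (g n) - p))" "posn u (p + t *\<^sub>R (ctr (g n) - p)) < qr"
      by (simp_all add: algebra_simps)
    then show "ray (p + t *\<^sub>R (ctr (g n) - p)) u (g l)"
      using crs_iff[OF lm, of u "posn u (p + t *\<^sub>R (ctr (g n) - p))"] sl[OF lm] by simp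
  qed
  then show ?thesis using n by blast
qed

text \<open>Since mirror images stay in the base interval, the line of the centre is at most half
  way from \<open>p\<close> to either end; \<open>sl\<close> is what keeps all lines up to there
  inside every side of the chain.\<close>

lemma germ_see:
  assumes B: "base (fu u) N q1 q2 a1 a2 t1 t2 r1 r2"
    and bd: "\<And>P n. run (fu u) P n \<Longrightarrow> lev (P 0) = N \<Longrightarrow> dr (P 0) = d \<Longrightarrow> q1 < pos (P 0) \<Longrightarrow> pos (P 0) < q2 \<Longrightarrow>
       (\<And>j. 0 < j \<Longrightarrow> j \<le> n \<Longrightarrow> \<not> (lev (P j) = N \<and> q1 < pos (P j) \<and> pos (P j) < q2)) \<Longrightarrow> k1 \<le> lev (P n) \<and> lev (P n) \<le> k2"
    and k: "q1 \<le> posn u p" "posn u p \<le> q2" and e: "e = (1::real) \<and> posn u p < q2 \<or> e = -1 \<and> q1 < posn u p"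
    and pn: "\<And>i. i \<le> m \<Longrightarrow> sd (g i) p < 0"
    and sl: "\<And>i. i \<le> m \<Longrightarrow> posn u (Lo i) < (q1 + posn u p) / 2 \<and> (posn u p + q2) / 2 < posn u (Up i)"
  shows "\<exists>G n. m \<le> n \<and> chain G n \<and> (\<forall>i\<le>m. G i = g i) \<and> (\<forall>i\<le>n. ray p (ctr (G n) - p) (G i))"
proof -
  interpret base "fu u" N q1 q2 a1 a2 t1 t2 r1 r2 by (rule B)
  define \<kappa> where "\<kappa> = posn u p"
  obtain \<mu> a \<delta> where s: "\<delta> > 0" "\<And>t. 0 < t \<Longrightarrow> t < \<delta> \<Longrightarrow> \<kappa> + e * t \<noteq> \<mu> \<Longrightarrow> seen d \<mu> a (\<kappa> + e * t)"
  proof (rule germ_seen[OF d1, of k1 k2 \<kappa> e])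
    fix x n assume "inJ (St N x d)" "alive d x n"
    then show "k1 \<le> lev (orb (fu u) (St N x d) n) \<and> lev (orb (fu u) (St N x d) n) \<le> k2"
      by (intro bd[of "orb (fu u) (St N x d)" n]) (auto simp: alive_def inJ_def intro!: run_orb)
  qed (use k e in \<open>auto simp: \<kappa>_def\<close>)
  have ee: "e = 1 \<or> e = -1" using e by auto
  have ex: "\<exists>t. 0 < t \<and> t < \<delta> \<and> t < \<epsilon> \<and> \<kappa> + e * t \<noteq> \<mu>" if "\<epsilon> > 0" for \<epsilon>
  proof (cases "\<kappa> + e * (min \<delta> \<epsilon> / 2) = \<mu>")
    case True then show ?thesis using that s(1) ee by (intro exI[of _ "min \<delta> \<epsilon> / 3"]) auto
  next
    case False then show ?thesis using that s(1) by (intro exI[of _ "min \<delta> \<epsilon> / 2"]) auto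
  qed
  have mu: "(q1 + \<kappa>) / 2 \<le> \<mu> \<and> \<mu> \<le> (\<kappa> + q2) / 2"
  proof (rule ccontr)
    assume n: "\<not> ?thesis"
    have *: False if E: "\<epsilon> > 0" and c: "\<epsilon> = \<mu> - (\<kappa> + q2) / 2 \<or> \<epsilon> = (q1 + \<kappa>) / 2 - \<mu>" for \<epsilon>
    proof -
      obtain t where t: "0 < t" "t < \<delta>" "t < \<epsilon>" "\<kappa> + e * t \<noteq> \<mu>" using ex[OF E] by blast
      have "seen d \<mu> a (\<kappa> + e * t)" by (rule s(2)[OF t(1,2,4)])
      then have 1: "q1 < 2 * \<mu> - (\<kappa> + e * t)" "2 * \<mu> - (\<kappa> + e * t) < q2" by (auto simp: seen_def)
      have 2: "e * t \<le> t" "- t \<le> e * t" using ee t(1) by auto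
      from c show False
      proof
        assume "\<epsilon> = \<mu> - (\<kappa> + q2) / 2" then show False using t(1,3) 1 2 by argo
      next
        assume "\<epsilon> = (q1 + \<kappa>) / 2 - \<mu>" then show False using t(1,3) 1 2 by argo
      qed
    qed
    show False using n *[of "\<mu> - (\<kappa> + q2) / 2"] *[of "(q1 + \<kappa>) / 2 - \<mu>"] by auto
  qed
  have sn: "\<exists>x. seen d \<mu> a x \<and> min x (2 * \<mu> - x) < y \<and> y < max x (2 * \<mu> - x)"
    if y: "y = \<mu> \<or> \<kappa> < y \<and> y < \<mu> \<or> \<mu> < y \<and> y < \<kappa>" for y
  proof -
    define \<epsilon> where "\<epsilon> = (if y = \<mu> then 1 else \<bar>y - \<kappa>\<bar>)"
    have "\<epsilon> > 0" using y by (auto simp: \<epsilon>_def)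
    then obtain t where t: "0 < t" "t < \<delta>" "t < \<epsilon>" "\<kappa> + e * t \<noteq> \<mu>" using ex by blast
    have "min (\<kappa> + e * t) (2 * \<mu> - (\<kappa> + e * t)) < y \<and> y < max (\<kappa> + e * t) (2 * \<mu> - (\<kappa> + e * t))"
      using y t ee by (auto simp: \<epsilon>_def min_def max_def split: if_splits)
    then show ?thesis using s(2)[OF t(1,2,4)] by blast
  qed
  show ?thesis
  proof (rule see[OF pn])
    show "orb (fu u) (St N \<mu> d) (Suc a) = rv (orb (fu u) (St N \<mu> d) a)"
      using sn[of \<mu>] by (auto simp: seen_def)
    show "crs u (lin u y) (g i)" if "y = \<mu> \<or> posn u p < y \<and> y < \<mu> \<or> \<mu> < y \<and> y < posn u p" "i \<le> m" for y i
      unfolding crs_iff[OF that(2)] using that(1) sl[OF that(2)] mu k by (auto simp: \<kappa>_def field_simps)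
    show "okst (fu u) (orb (fu u) (St N y d) j) \<and> mv (fu u) (orb (fu u) (St N y d) j) = mv (fu u) (orb (fu u) (St N \<mu> d) j)"
      if yy: "y = \<mu> \<or> posn u p < y \<and> y < \<mu> \<or> \<mu> < y \<and> y < posn u p" and jj: "j \<le> a" for y j
    proof -
      obtain x where x: "seen d \<mu> a x" "min x (2 * \<mu> - x) < y \<and> y < max x (2 * \<mu> - x)"
        using sn[of y] yy by (auto simp: \<kappa>_def)
      then show ?thesis using jj by (simp add: seen_def)
    qed
    show ?thesis if "chain G (m + a)" "\<And>i. i \<le> m \<Longrightarrow> G i = g i" "\<And>i. i \<le> m + a \<Longrightarrow> ray p (ctr (G (m + a)) - p) (G i)" for G
      by (intro exI[of _ G] exI[of _ "m + a"]) (use that in auto)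
  qed
qed

end

section \<open>Walls and changes of direction\<close>

lemma run_no_repeat:
  assumes t: "run f t r" "\<not> okst f (t r)" and j: "i \<le> r" "j \<le> r" "t i = t j"
  shows "i = j"
proof -
  have aux: False if "i < j" "j \<le> r" "t i = t j" for i j
  proof -
    have "t (i + k) = t (j + k)" if "j + k \<le> r" for k
      using that by (induction k) (use \<open>i < j\<close> \<open>t i = t j\<close> t in \<open>auto simp: run_def\<close>)
    from this[of "r - j"] have "t (i + (r - j)) = t r" using that by simp
    moreover have "i + (r - j) < r" using that by simp
    ultimately show False using t unfolding run_def by metis
  qed
  show ?thesis using aux[of i j] aux[of j i] j by (metis linorder_neqE_nat)
qed

text \<open>A side parallel to the direction has width zero and cannot be crossed, and the level
  changes by at most one at a time.\<close>

lemma level_barrier: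
  assumes r: "run f P k" and f: "f n = 0"
  shows "lev (P 0) < n \<Longrightarrow> lev (P k) < n" "n < lev (P 0) \<Longrightarrow> n < lev (P k)"
proof -
  have ne: "lev (P i) \<noteq> n" if "i \<le> k" "k > 0" for i using run_inner[OF r that] f by (auto simp: inner_st_def)
  have st: "lev (P (Suc i)) = lev (P i) \<or> \<bar>lev (P (Suc i)) - lev (P i)\<bar> = 1" if "i < k" for i
  proof -
    have o: "okst f (P i)" "P (Suc i) = nxt f (P i)" using r that by (auto simp: run_def)
    have "dr (P i) = 1 \<or> dr (P i) = -1" using o by (auto simp: okst_def inner_st_def)
    from o(1) show ?thesis unfolding o(2) by (cases rule: nxt_cases) (use \<open>dr (P i) = 1 \<or> dr (P i) = -1\<close> in auto)
  qed
  have "(lev (P 0) < n \<longrightarrow> lev (P i) < n) \<and> (n < lev (P 0) \<longrightarrow> n < lev (P i))" if "i \<le> k" for i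
    using that
  proof (induction i)
    case (Suc i)
    then show ?case using ne[of i] ne[of "Suc i"] st[of i] by auto
  qed simp
  then show "lev (P 0) < n \<Longrightarrow> lev (P k) < n" "n < lev (P 0) \<Longrightarrow> n < lev (P k)" by auto
qed

text \<open>The count depends only on the order of crossings, so a small change of direction
  preserves it.\<close>

lemma cbar_cong:
  assumes "\<And>i. i \<le> r \<Longrightarrow> lev (t i) = lev (t' i) \<and> dr (t i) = dr (t' i) \<and> (lev (t' i) = N \<longrightarrow> (pos (t i) < y \<longleftrightarrow> pos (t' i) < y'))"
  shows "cbar t r (St N y d) = cbar t' r (St N y' d)"
proof -
  have l: "less_st (t i) (St N y d) = less_st (t' i) (St N y' d)" "tile (t i) = tile (t' i)" if "i \<le> r" for i
    using assms[OF that] by (auto simp: less_st_def tile_def)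
  have tl: "tile (St N y d) = tile (St N y' d)" by (simp add: tile_def)
  show ?thesis unfolding cbar_def cnt_def tl using l by (auto intro!: sum.cong arg_cong2[of _ _ _ _ "(+)"])
qed

lemma tail_sub:
  assumes "tail f N q1 q2 q a t r" "q1 \<le> q1'" "q2' \<le> q2" shows "tail f N q1' q2' q a t r"
  using assms by (force simp: tail_def)

lemma ev_less:
  fixes F H :: "complex \<Rightarrow> real"
  assumes "(F \<longlongrightarrow> F u0) (nhds u0)" "(H \<longlongrightarrow> H u0) (nhds u0)" "F u0 < H u0"
  shows "eventually (\<lambda>u. F u < H u) (nhds u0)"
proof -
  have "((\<lambda>u. H u - F u) \<longlongrightarrow> H u0 - F u0) (nhds u0)" using assms by (intro tendsto_intros)
  from order_tendstoD(1)[OF this, of 0] assms(3) show ?thesis by simp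
qed

context geo
begin

text \<open>The argument of \<open>E n\<close> is \<open>(2 * n + 1) * \<alpha>\<close>. For
  irrational \<open>\<alpha> / pi\<close> these angles are dense modulo \<open>pi\<close>, even with
  \<open>n\<close> beyond any bound of a given sign; so a wall can be placed arbitrarily far up or
  down by an arbitrarily small turn to a prescribed side.\<close>

lemma closing:
  assumes irr: "\<alpha> / pi \<notin> \<rat>" and u0: "u0 \<noteq> 0" and P: "eventually P (nhds u0)" and s: "s = 1 \<or> s = (-1::real)"
    and e: "e = 1 \<or> e = (-1::int)"
  shows "\<exists>n u. e * n \<ge> e * M \<and> fu u n = 0 \<and> s * cr u0 u > 0 \<and> P u"
proof -
  have "((\<lambda>\<phi>. cis \<phi> * u0) \<longlongrightarrow> cis 0 * u0) (nhds 0)" 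
    by (intro tendsto_intros filterlim_ident)
  then have "filterlim (\<lambda>\<phi>. cis \<phi> * u0) (nhds u0) (nhds 0)" by simp
  with P have "eventually (\<lambda>\<phi>. P (cis \<phi> * u0)) (nhds 0)" by (rule eventually_compose_filterlim)
  then obtain \<epsilon>0 where \<epsilon>0: "\<epsilon>0 > 0" "\<And>\<phi>. \<bar>\<phi>\<bar> < \<epsilon>0 \<Longrightarrow> P (cis \<phi> * u0)"
    by (auto simp: eventually_nhds_metric dist_real_def)
  define \<epsilon> where "\<epsilon> = min \<epsilon>0 pi / pi"
  have eps: "\<epsilon> > 0" "\<epsilon> * pi \<le> \<epsilon>0" "\<epsilon> * pi \<le> pi" using \<epsilon>0 by (auto simp: \<epsilon>_def)
  define \<theta> where "\<theta> = of_int e * (2 * \<alpha> / pi)"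
  have "\<theta> \<notin> \<rat>"
  proof
    assume "\<theta> \<in> \<rat>"
    then have "\<theta> * of_int e / 2 \<in> \<rat>" by (intro Rats_divide Rats_mult) auto
    moreover have "\<theta> * of_int e / 2 = \<alpha> / pi" using e by (auto simp: \<theta>_def)
    ultimately show False using irr by simp
  qed
  define \<beta> where "\<beta> = Arg u0"
  have ub: "u0 = norm u0 *\<^sub>R cis \<beta>" using rcis_cmod_Arg[of u0] by (simp add: \<beta>_def rcis_def scaleR_conv_of_real)
  obtain h k where hk: "k > 0" "\<bar>of_int k * \<theta> - of_int h - ((\<beta> - \<alpha>) / pi + s * \<epsilon> / 2 - of_int M * (2 * \<alpha> / pi))\<bar> < \<epsilon> / 2"
    by (rule sequence_of_fractional_parts_is_dense[OF \<open>\<theta> \<notin> \<rat>\<close>, of "\<epsilon> / 2"]) (use eps in auto)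
  define n where "n = M + e * k"
  define \<phi> where "\<phi> = (2 * of_int n + 1) * \<alpha> - of_int h * pi - \<beta>"
  define x where "x = of_int k * \<theta> - of_int h - ((\<beta> - \<alpha>) / pi - of_int M * (2 * \<alpha> / pi))"
  have xr: "\<bar>x - s * \<epsilon> / 2\<bar> < \<epsilon> / 2" using hk(2) by (simp add: x_def algebra_simps)
  have px: "\<phi> = pi * x" by (simp add: \<phi>_def x_def n_def \<theta>_def field_simps)
  have sx: "0 < s * x" "s * x < \<epsilon>" "\<bar>x\<bar> < \<epsilon>" using s
  proof -
    have "- (\<epsilon> / 2) < x - s * \<epsilon> / 2" "x - s * \<epsilon> / 2 < \<epsilon> / 2" using xr by linarith+
    then show "0 < s * x" "s * x < \<epsilon>" "\<bar>x\<bar> < \<epsilon>" using s by auto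
  qed
  then have "\<bar>\<phi>\<bar> < \<epsilon> * pi" "0 < s * \<phi>" using px by (auto simp: abs_mult mult.commute[of pi] mult.assoc[symmetric])
  define u where "u = cis \<phi> * u0"
  have Pu: "P u" unfolding u_def by (rule \<epsilon>0(2)) (use \<open>\<bar>\<phi>\<bar> < \<epsilon> * pi\<close> eps in linarith)
  have "cr u0 u = norm u0 ^ 2 * sin \<phi>"
    unfolding cmod_power2 by (simp add: cr_def u_def algebra_simps power2_eq_square)
  moreover have "s * sin \<phi> > 0"
  proof -
    have ap: "\<bar>\<phi>\<bar> < pi" using \<open>\<bar>\<phi>\<bar> < \<epsilon> * pi\<close> eps by linarith
    from s show ?thesis
    proof
      assume "s = 1" then show ?thesis using sin_gt_zero[of \<phi>] ap \<open>0 < s * \<phi>\<close> by auto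
    next
      assume "s = -1" then show ?thesis using sin_gt_zero[of "- \<phi>"] ap \<open>0 < s * \<phi>\<close> by auto
    qed
  qed
  moreover have "norm u0 ^ 2 > 0" using u0 by simp
  ultimately have "norm u0 ^ 2 * (s * sin \<phi>) > 0" by (meson mult_pos_pos)
  then have su: "s * cr u0 u > 0" using \<open>cr u0 u = norm u0 ^ 2 * sin \<phi>\<close> by (simp add: ac_simps)
  have "u = norm u0 *\<^sub>R cis (\<phi> + \<beta>)" 
  proof -
    have "u = cis \<phi> * (norm u0 *\<^sub>R cis \<beta>)" unfolding u_def using ub by (rule arg_cong)
    then show ?thesis by (simp add: cis_mult)
  qed
  then have "u = norm u0 *\<^sub>R cis ((2 * of_int n + 1) * \<alpha> - of_int h * pi)" by (simp add: \<phi>_def)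
  then have "fu u n = norm u0 * L * sin (of_int h * pi)"
    by (simp add: cr_def E_def sin_diff cos_diff algebra_simps)
  then have "fu u n = 0" by (simp add: sin_zero_iff_int2)
  moreover have "e * n \<ge> e * M" using hk(1) e by (auto simp: n_def)
  ultimately show ?thesis using su Pu by blast
qed

end

context hub
begin
text \<open>\<open>K\<close> carries the parity of \<open>psi\<close> in a form that can be fixed
  before the direction is perturbed. Condition \<open>c\<close> collects the cases in which levels
  are bounded both ways, by parity alone or by parity and a wall.\<close>

lemma base_goal:
  assumes B: "base (fu u) N q1 q2 a1 a2 t1 t2 r1 r2"
    and lv: "\<And>s. s \<le> r1 \<Longrightarrow> lo < lev (t1 s) \<and> lev (t1 s) < hi" "\<And>s. s \<le> r2 \<Longrightarrow> lo < lev (t2 s) \<and> lev (t2 s) < hi"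
    and N: "lo < N" "N < hi"
    and y: "q1 < y" "y < q2" and K: "even (K + base.psi a1 a2 t1 t2 r1 r2 (St N y d))"
    and c: "(odd K \<and> (a1 = a2 \<or> (\<exists>n\<ge>hi. fu u n = 0))) \<or> (even K \<and> a1 \<noteq> a2 \<and> (\<exists>n\<le>lo. fu u n = 0))"
    and k: "q1 \<le> posn u p" "posn u p \<le> q2"
    and pn: "\<And>i. i \<le> m \<Longrightarrow> sd (g i) p < 0"
    and sl: "\<And>i. i \<le> m \<Longrightarrow> posn u (Lo i) < (q1 + posn u p) / 2 \<and> (posn u p + q2) / 2 < posn u (Up i)"
  shows "\<exists>G n. m \<le> n \<and> chain G n \<and> (\<forall>i\<le>m. G i = g i) \<and> (\<forall>i\<le>n. ray p (ctr (G n) - p) (G i))"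
proof -
  interpret base "fu u" N q1 q2 a1 a2 t1 t2 r1 r2 by (rule B)
  \<comment> \<open>\<open>p\<close> may sit at an end of the base interval; the germ is taken
    pointing inwards.\<close>
  define e :: real where "e = (if posn u p < q2 then 1 else -1)"
  have e: "e = 1 \<and> posn u p < q2 \<or> e = -1 \<and> q1 < posn u p" using k q12 by (auto simp: e_def)
  have P: "even (K + psi s) \<and> inJ s" if "lev s = N" "dr s = d" "q1 < pos s" "pos s < q2" for s
  proof -
    have p: "s = St N (pos s) d" using that by (intro st_eqI) auto
    have "psi (St N (pos s) d) = psi (St N y d)" by (rule psi_const_J) (use that y in \<open>auto simp: inJ_def\<close>)
    then show ?thesis using K p that by (simp add: inJ_def)
  qed
  have lb: "odd K \<Longrightarrow> lo < lev (P n)" "odd K \<Longrightarrow> a1 = a2 \<Longrightarrow> lev (P n) < hi" "even K \<Longrightarrow> a1 \<noteq> a2 \<Longrightarrow> lev (P n) < hi"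
    if "run (fu u) P n" "lev (P 0) = N" "dr (P 0) = d" "q1 < pos (P 0)" "pos (P 0) < q2"
      "\<And>j. 0 < j \<Longrightarrow> j \<le> n \<Longrightarrow> \<not> (lev (P j) = N \<and> q1 < pos (P j) \<and> pos (P j) < q2)" for P n
  proof -
    note pp = P[OF that(2-5)]
    have par: "odd (psi (P 0)) \<longleftrightarrow> odd K" using pp by auto
    have nJ: "\<And>j. 0 < j \<Longrightarrow> j \<le> n \<Longrightarrow> \<not> inJ (P j)" using that(6) by (simp add: inJ_def)
    note l = levels_bounded[OF lv that(1) conjunct2[OF pp] nJ]
    show "odd K \<Longrightarrow> lo < lev (P n)" "odd K \<Longrightarrow> a1 = a2 \<Longrightarrow> lev (P n) < hi" "even K \<Longrightarrow> a1 \<noteq> a2 \<Longrightarrow> lev (P n) < hi"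
      using l par by blast+
  qed
  from c consider "odd K" "a1 = a2" | n where "odd K" "n \<ge> hi" "fu u n = 0" | n where "even K" "a1 \<noteq> a2" "n \<le> lo" "fu u n = 0" by blast
  then show ?thesis
  proof cases
    case 1
    show ?thesis by (rule germ_see[OF B, of lo hi e]) (use lb 1 k e pn sl in \<open>auto intro: less_imp_le\<close>)
  next
    case (2 n)
    show ?thesis
    proof (rule germ_see[OF B, of lo n e])
      fix P n' assume a: "run (fu u) P n'" "lev (P 0) = N" "dr (P 0) = d" "q1 < pos (P 0)" "pos (P 0) < q2"
        "\<And>j. 0 < j \<Longrightarrow> j \<le> n' \<Longrightarrow> \<not> (lev (P j) = N \<and> q1 < pos (P j) \<and> pos (P j) < q2)"
      have "lev (P n') < n" by (rule level_barrier(1)[where f = "fu u"]) (use a 2 N in auto)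
      then show "lo \<le> lev (P n') \<and> lev (P n') \<le> n" using lb(1)[OF a] 2 by simp
    qed (use k e pn sl in auto)
  next
    case (3 n)
    show ?thesis
    proof (rule germ_see[OF B, of n hi e])
      fix P n' assume a: "run (fu u) P n'" "lev (P 0) = N" "dr (P 0) = d" "q1 < pos (P 0)" "pos (P 0) < q2"
        "\<And>j. 0 < j \<Longrightarrow> j \<le> n' \<Longrightarrow> \<not> (lev (P j) = N \<and> q1 < pos (P j) \<and> pos (P j) < q2)"
      have "n < lev (P n')" by (rule level_barrier(2)[where f = "fu u"]) (use a 3 N in auto)
      then show "n \<le> lev (P n') \<and> lev (P n') \<le> hi" using lb(3)[OF a] 3 by simp
    qed (use k e pn sl in auto)
  qed
qed

lemma hits_z:
  assumes z: "z = (if az then A2 (g m) else B2 (g m))" and c: "ray z u (g m)"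
  shows "hits (fu u) az (St N (posn u z) d)"
proof -
  have "pr u (cr u z) (g m) = St N (posn u z) d" using pr_lin[of u "posn u z"] by simp
  then show ?thesis using hits_forward(1,2)[OF v[of m] crs_wcrs[OF c]] z by (cases az) auto
qed

end

section \<open>Perturbing the direction\<close>

lemma last_argmax:
  fixes h :: "nat \<Rightarrow> real"
  obtains i where "i \<le> m" "\<And>j. j \<le> m \<Longrightarrow> h j \<le> h i" "\<And>j. i < j \<Longrightarrow> j \<le> m \<Longrightarrow> h j < h i"
proof -
  have "\<exists>i\<le>m. (\<forall>j\<le>m. h j \<le> h i) \<and> (\<forall>j. i < j \<and> j \<le> m \<longrightarrow> h j < h i)"
  proof (induction m)
    case (Suc m)
    then obtain i where i: "i \<le> m" "\<forall>j\<le>m. h j \<le> h i" "\<forall>j. i < j \<and> j \<le> m \<longrightarrow> h j < h i" by blast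
    show ?case
    proof (cases "h (Suc m) < h i")
      case True then show ?thesis using i by (intro exI[of _ i]) (auto simp: le_Suc_eq)
    next
      case False
      then have "h j \<le> h (Suc m)" if "j \<le> m" for j using i(2) that by (meson not_less order.trans)
      then show ?thesis by (intro exI[of _ "Suc m"]) (auto simp: le_Suc_eq)
    qed
  qed simp
  then show ?thesis using that by blast
qed

lemma finite_max:
  fixes P :: "'a \<Rightarrow> real"
  assumes "finite X" "X \<noteq> {}" obtains x where "x \<in> X" "\<And>y. y \<in> X \<Longrightarrow> P y \<le> P x"
proof -
  have "Max (P ` X) \<in> P ` X" using assms by (intro Max_in) auto
  then obtain x where x: "x \<in> X" "P x = Max (P ` X)" by auto
  show ?thesis by (rule that[OF x(1)]) (use assms x in auto)
qed

lemma finite_min: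
  fixes P :: "'a \<Rightarrow> real"
  assumes "finite X" "X \<noteq> {}" obtains x where "x \<in> X" "\<And>y. y \<in> X \<Longrightarrow> P x \<le> P y"
  by (rule finite_max[OF assms, of "\<lambda>x. - P x"]) auto

lemma eventually_all_le: "(\<And>i. i \<le> n \<Longrightarrow> eventually (P i) F) \<Longrightarrow> eventually (\<lambda>u. \<forall>i\<le>(n::nat). P i u) F"
proof -
  assume "\<And>i. i \<le> n \<Longrightarrow> eventually (P i) F"
  then have "eventually (\<lambda>u. \<forall>i\<in>{..n}. P i u) F" by (intro eventually_ball_finite) auto
  then show ?thesis by (rule eventually_mono) auto
qed

context hub
begin

lemma tendsto_posn: "((\<lambda>u. posn u x) \<longlongrightarrow> posn u0 x) (nhds u0)"
  unfolding posn_def by (intro tendsto_intros tendsto_cr)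

lemma tendsto_T: "((\<lambda>u. pos (T u V j)) \<longlongrightarrow> pos (T u0 V j)) (nhds u0)"
  unfolding T_simps by (intro tendsto_intros tendsto_cr)

text \<open>Here \<open>uz\<close> is the direction of the vertex \<open>z\<close> and \<open>u\<close> a nearby direction in which the combinatorics of the tails is unchanged.
The tails and \<open>z\<close> give three base intervals; their parities are not independent, since \<open>z\<close> contributes to only one of the two short ones.\<close>

lemma frame_goal:
  fixes u uz z :: complex and V1 V2 :: complex and ty1 ty2 az :: bool and i1 i2 a b :: nat
  defines "r1 \<equiv> m - i1 - 1 - a" and "r2 \<equiv> m - i2 - 1 - b"
  defines "q1 \<equiv> \<lambda>v. pos (T v V1 a)" and "q2 \<equiv> \<lambda>v. pos (T v V2 b)"
  defines "t1 \<equiv> \<lambda>v j. T v V1 (a + j)" and "t2 \<equiv> \<lambda>v j. T v V2 (b + j)"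
  defines "K1 \<equiv> cbar (t1 uz) r1 (St N (posn uz z) d) + corr ty1 (t1 uz) r1 N"
    and "K2 \<equiv> cbar (t2 uz) r2 (St N (posn uz z) d) + corr ty2 (t2 uz) r2 N"
    and "Kz \<equiv> of_bool (az \<and> tile (St N 0 d) \<le> N)"
  assumes pn: "\<And>i. i \<le> m \<Longrightarrow> sd (g i) p < 0"
    and e1: "endp i1 ty1 V1" "a \<le> m - i1 - 1" "kl (g (m - a)) = N"
    and e2: "endp i2 ty2 V2" "b \<le> m - i2 - 1" "kl (g (m - b)) = N"
    and z: "z = (if az then A2 (g m) else B2 (g m))"
    and E1: "\<And>j. a < j \<Longrightarrow> j \<le> m - i1 - 1 \<Longrightarrow> kl (g (m - j)) = N \<Longrightarrow>
        pos (T uz V1 j) < q1 uz \<or> pos (T uz V1 j) > q2 uz \<or> V1 = V2 \<and> j = b"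
    and E2: "\<And>j. b < j \<Longrightarrow> j \<le> m - i2 - 1 \<Longrightarrow> kl (g (m - j)) = N \<Longrightarrow>
        pos (T uz V2 j) < q1 uz \<or> pos (T uz V2 j) > q2 uz \<or> V2 = V1 \<and> j = a"
    and z0: "q1 uz < posn uz z" "posn uz z < q2 uz"
    and G: "good u V1 i1" "good u V2 i2" and zu: "q1 u < posn u z" "posn u z < q2 u" and zr: "ray z u (g m)"
    and k: "q1 u < posn u p" "posn u p < q2 u"
    and F: "\<And>j V. j \<le> m \<Longrightarrow> V = V1 \<or> V = V2 \<Longrightarrow> (pos (T uz V j) < q1 uz \<longrightarrow> pos (T u V j) < q1 u) \<and> (q2 uz < pos (T uz V j) \<longrightarrow> q2 u < pos (T u V j))"
    and sl: "\<And>i. i \<le> m \<Longrightarrow> posn u (Lo i) < (q1 u + posn u p) / 2 \<and> (posn u p + q2 u) / 2 < posn u (Up i)"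
    and lo: "\<And>i. i \<le> m \<Longrightarrow> lo < kl (g i) \<and> kl (g i) < hi"
    and c: "(ty1 = ty2 \<and> odd (K1 + K2)) \<or>
      (posn u p \<le> posn u z \<and> (odd (K1 + Kz) \<and> (ty1 = az \<or> (\<exists>n\<ge>hi. fu u n = 0)) \<or> even (K1 + Kz) \<and> ty1 \<noteq> az \<and> (\<exists>n\<le>lo. fu u n = 0))) \<or>
      (posn u z \<le> posn u p \<and> (even (K2 + Kz) \<and> (az = ty2 \<or> (\<exists>n\<ge>hi. fu u n = 0)) \<or> odd (K2 + Kz) \<and> az \<noteq> ty2 \<and> (\<exists>n\<le>lo. fu u n = 0)))"
  shows "\<exists>G n. m \<le> n \<and> chain G n \<and> (\<forall>i\<le>m. G i = g i) \<and> (\<forall>i\<le>n. ray p (ctr (G n) - p) (G i))"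
proof -
  have tl1: "tail (fu u) N (q1 u) (q2 u) (q1 u) ty1 (t1 u) r1"
    unfolding tail_def
  proof (intro conjI allI impI)
    have ar: "a + r1 = m - i1 - 1" using e1 by (simp add: r1_def)
    show "lev (t1 u 0) = N" "pos (t1 u 0) = q1 u" using e1 by (simp_all add: t1_def q1_def)
    show "run (fu u) (t1 u) r1" using vtail(1)[OF e1(1) G(1)] by (auto simp: run_def t1_def r1_def)
    show "hits (fu u) ty1 (t1 u r1)" using vtail(2)[OF e1(1) G(1)] ar by (simp add: t1_def)
    fix i assume i: "0 < i \<and> i \<le> r1"
    show "\<not> (lev (t1 u i) = N \<and> q1 u < pos (t1 u i) \<and> pos (t1 u i) < q2 u)"
    proof
      assume h: "lev (t1 u i) = N \<and> q1 u < pos (t1 u i) \<and> pos (t1 u i) < q2 u"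
      have "kl (g (m - (a + i))) = N" using h by (simp add: t1_def)
      with E1[of "a + i"] i ar have "pos (T uz V1 (a + i)) < q1 uz \<or> pos (T uz V1 (a + i)) > q2 uz \<or> V1 = V2 \<and> a + i = b" by auto
      moreover have "a + i \<le> m" using i ar by auto
      ultimately show False using F[of "a + i" V1] h by (auto simp: t1_def q2_def)
    qed
  qed
  have tl2: "tail (fu u) N (q1 u) (q2 u) (q2 u) ty2 (t2 u) r2"
    unfolding tail_def
  proof (intro conjI allI impI)
    have ar: "b + r2 = m - i2 - 1" using e2 by (simp add: r2_def)
    show "lev (t2 u 0) = N" "pos (t2 u 0) = q2 u" using e2 by (simp_all add: t2_def q2_def)
    show "run (fu u) (t2 u) r2" using vtail(1)[OF e2(1) G(2)] by (auto simp: run_def t2_def r2_def)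
    show "hits (fu u) ty2 (t2 u r2)" using vtail(2)[OF e2(1) G(2)] ar by (simp add: t2_def)
    fix i assume i: "0 < i \<and> i \<le> r2"
    show "\<not> (lev (t2 u i) = N \<and> q1 u < pos (t2 u i) \<and> pos (t2 u i) < q2 u)"
    proof
      assume h: "lev (t2 u i) = N \<and> q1 u < pos (t2 u i) \<and> pos (t2 u i) < q2 u"
      have "kl (g (m - (b + i))) = N" using h by (simp add: t2_def)
      with E2[of "b + i"] i ar have "pos (T uz V2 (b + i)) < q1 uz \<or> pos (T uz V2 (b + i)) > q2 uz \<or> V2 = V1 \<and> b + i = a" by auto
      moreover have "b + i \<le> m" using i ar by auto
      ultimately show False using F[of "b + i" V2] h by (auto simp: t2_def q1_def)
    qed
  qed
  \<comment> \<open>The visible vertex serves as a separatrix of length zero.\<close>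
  define tz :: "nat \<Rightarrow> st" where "tz = (\<lambda>_. St N (posn u z) d)"
  have tlz: "tail (fu u) N x y (posn u z) az tz 0" for x y
    using hits_z[OF z zr] by (auto simp: tail_def tz_def run_def intro: gr0I)
  have qq: "q1 u < q2 u" using zu by simp
  have B: "base (fu u) N (q1 u) (q2 u) ty1 ty2 (t1 u) (t2 u) r1 r2"
    by (intro base.intro qq tl1 tl2)
  have B1: "base (fu u) N (q1 u) (posn u z) ty1 az (t1 u) tz r1 0"
    by (intro base.intro zu tail_sub[OF tl1] tlz) (use zu in auto)
  have B2: "base (fu u) N (posn u z) (q2 u) az ty2 tz (t2 u) 0 r2"
    by (intro base.intro zu tail_sub[OF tl2] tlz) (use zu in auto)
  \<comment> \<open>Crossings of the tail keep their order relative to the base interval, so the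
    count at \<open>u\<close> equals the one computed once and for all at \<open>uz\<close>.\<close>
  have c1: "cbar (t1 u) r1 (St N y d) = cbar (t1 uz) r1 (St N (posn uz z) d)" if y: "q1 u < y" "y < q2 u" for y
  proof (rule cbar_cong)
    fix i assume i: "i \<le> r1"
    have ar: "a + r1 = m - i1 - 1" using e1 by (simp add: r1_def)
    have "pos (t1 u i) < y \<longleftrightarrow> pos (t1 uz i) < posn uz z" if n: "kl (g (m - (a + i))) = N"
    proof (cases "i = 0")
      case True then show ?thesis using y z0 by (simp add: t1_def q1_def)
    next
      case False
      then have "pos (T uz V1 (a + i)) < q1 uz \<or> pos (T uz V1 (a + i)) > q2 uz \<or> V1 = V2 \<and> a + i = b"
        using E1[of "a + i"] i ar n by auto
      moreover have "a + i \<le> m" using i ar by auto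
      ultimately show ?thesis using F[of "a + i" V1] y z0 by (auto simp: t1_def q2_def)
    qed
    then show "lev (t1 u i) = lev (t1 uz i) \<and> dr (t1 u i) = dr (t1 uz i) \<and> (lev (t1 uz i) = N \<longrightarrow> (pos (t1 u i) < y \<longleftrightarrow> pos (t1 uz i) < posn uz z))"
      by (simp add: t1_def)
  qed
  have c2: "cbar (t2 u) r2 (St N y d) = cbar (t2 uz) r2 (St N (posn uz z) d)" if y: "q1 u < y" "y < q2 u" for y
  proof (rule cbar_cong)
    fix i assume i: "i \<le> r2"
    have ar: "b + r2 = m - i2 - 1" using e2 by (simp add: r2_def)
    have "pos (t2 u i) < y \<longleftrightarrow> pos (t2 uz i) < posn uz z" if n: "kl (g (m - (b + i))) = N"
    proof (cases "i = 0")
      case True then show ?thesis using y z0 by (simp add: t2_def q2_def)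
    next
      case False
      then have "pos (T uz V2 (b + i)) < q1 uz \<or> pos (T uz V2 (b + i)) > q2 uz \<or> V2 = V1 \<and> b + i = a"
        using E2[of "b + i"] i ar n by auto
      moreover have "b + i \<le> m" using i ar by auto
      ultimately show ?thesis using F[of "b + i" V2] y z0 by (auto simp: t2_def q1_def)
    qed
    then show "lev (t2 u i) = lev (t2 uz i) \<and> dr (t2 u i) = dr (t2 uz i) \<and> (lev (t2 uz i) = N \<longrightarrow> (pos (t2 u i) < y \<longleftrightarrow> pos (t2 uz i) < posn uz z))"
      by (simp add: t2_def)
  qed
  have cc: "corr ty1 (t1 u) r1 N = corr ty1 (t1 uz) r1 N" "corr ty2 (t2 u) r2 N = corr ty2 (t2 uz) r2 N"
    by (simp_all add: corr_def tile_def t1_def t2_def)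
  have K1: "cbar (t1 u) r1 (St N y d) + corr ty1 (t1 u) r1 N = K1" and K2: "cbar (t2 u) r2 (St N y d) + corr ty2 (t2 u) r2 N = K2"
    if "q1 u < y" "y < q2 u" for y
    using c1[OF that] c2[OF that] cc by (simp_all add: K1_def K2_def)
  have Kz: "corr az tz 0 N = Kz" by (simp add: corr_def Kz_def tz_def tile_def)
  have cz: "cbar tz 0 (St N y d) = of_bool (posn u z < y)" for y
    by (simp add: cbar_def cnt_def tz_def less_st_def tile_def)
  have lv1: "lo < lev (t1 u s) \<and> lev (t1 u s) < hi" "lo < lev (t2 u s) \<and> lev (t2 u s) < hi" "lo < lev (tz s) \<and> lev (tz s) < hi" for s
    using lo by (auto simp: t1_def t2_def tz_def)
  have N: "lo < N" "N < hi" using lo[of m] by auto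
  consider "ty1 = ty2 \<and> odd (K1 + K2)" |
      "posn u p \<le> posn u z" "odd (K1 + Kz) \<and> (ty1 = az \<or> (\<exists>n\<ge>hi. fu u n = 0)) \<or> even (K1 + Kz) \<and> ty1 \<noteq> az \<and> (\<exists>n\<le>lo. fu u n = 0)" |
      "posn u z \<le> posn u p" "even (K2 + Kz) \<and> (az = ty2 \<or> (\<exists>n\<ge>hi. fu u n = 0)) \<or> odd (K2 + Kz) \<and> az \<noteq> ty2 \<and> (\<exists>n\<le>lo. fu u n = 0)"
    using c by blast
  then show ?thesis
  proof cases
    case 1
    show ?thesis
    proof (rule base_goal[OF B lv1(1,2) N zu])
      show "even (K1 + K2 + base.psi ty1 ty2 (t1 u) (t2 u) r1 r2 (St N (posn u z) d))"
      proof -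
        have "base.psi ty1 ty2 (t1 u) (t2 u) r1 r2 (St N (posn u z) d) = K1 + K2"
          unfolding base.psi_def[OF B] using K1[OF zu] K2[OF zu] by simp
        then show ?thesis by presburger
      qed
    qed (use 1 k pn sl in auto)
  next
    case 2
    define y where "y = (q1 u + posn u z) / 2"
    have y: "q1 u < y" "y < posn u z" using zu by (auto simp: y_def)
    show ?thesis
    proof (rule base_goal[OF B1 lv1(1,3) N y])
      show "even (K1 + Kz + base.psi ty1 az (t1 u) tz r1 0 (St N y d))"
      proof -
        have "base.psi ty1 az (t1 u) tz r1 0 (St N y d) = K1 + Kz"
          unfolding base.psi_def[OF B1] using K1[of y] Kz cz[of y] y zu by simp
        then show ?thesis by presburger
      qed
      show "posn u (Lo i) < (q1 u + posn u p) / 2 \<and> (posn u p + posn u z) / 2 < posn u (Up i)" if "i \<le> m" for i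
        using sl[OF that] zu 2(1) by auto
    qed (use 2 k pn zu in auto)
  next
    case 3
    define y where "y = (q2 u + posn u z) / 2"
    have y: "posn u z < y" "y < q2 u" using zu by (auto simp: y_def)
    show ?thesis
    proof (rule base_goal[OF B2 lv1(3,2) N y])
      \<comment> \<open>In the upper interval \<open>z\<close> lies below \<open>y\<close>, and its
        half chord is in the rhombus that \<open>St N y d\<close> enters; this is the extra
        1.\<close>
      show "even (K2 + Kz + 1 + base.psi az ty2 tz (t2 u) 0 r2 (St N y d))"
      proof -
        have "base.psi az ty2 tz (t2 u) 0 r2 (St N y d) = K2 + Kz + 1"
          unfolding base.psi_def[OF B2] using K2[of y] Kz cz[of y] y zu by simp
        then show ?thesis by presburger
      qed
      show "posn u (Lo i) < (posn u z + posn u p) / 2 \<and> (posn u p + q2 u) / 2 < posn u (Up i)" if "i \<le> m" for i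
        using sl[OF that] zu 3(1) by auto
    qed (use 3 k pn zu in auto)
  qed
qed

section \<open>Choice of the base interval and of the direction\<close>

text \<open>If a tail meets the base side in the wrong direction, \<open>rev_ctr\<close> already
  yields a centre, though possibly only half way along the chain; hence the weak bound
  \<open>m \<le> 2 * n + 1\<close>. Otherwise all relevant crossings have one direction and the
  three base intervals are available.\<close>

theorem hub_main:
  assumes irr: "\<alpha> / pi \<notin> \<rat>" and u0: "\<And>i. i \<le> m \<Longrightarrow> ray p u0 (g i)"
    and z: "z = B2 (g m) \<or> z = A2 (g m)" "cr u0 (z - p) = 0"
  shows "\<exists>G n. m \<le> 2 * n + 1 \<and> chain G n \<and> (\<forall>i. i \<le> m \<and> i \<le> n \<longrightarrow> G i = g i) \<and> (\<forall>i\<le>n. ray p (ctr (G n) - p) (G i))"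
proof (cases "\<exists>n<m. m \<le> 2 * n + 1 \<and> (\<forall>l\<le>n. ray p (ctr (g n) - p) (g l))")
  case True
  then obtain n where n: "n < m" "m \<le> 2 * n + 1" "\<forall>l\<le>n. ray p (ctr (g n) - p) (g l)" by blast
  then show ?thesis using chain_mono[OF ch, of n] by (intro exI[of _ g] exI[of _ n]) auto
next
  case False
  have pn: "sd (g i) p < 0" if "i \<le> m" for i by (rule chain_sd_neg[OF ch p0 u0 that]) simp
  have gp: "gap u0 (g m) > 0" using gap_pos u0 by blast
  define az where "az \<longleftrightarrow> z = A2 (g m)"
  have zz: "z = (if az then A2 (g m) else B2 (g m))" using z by (auto simp: az_def)
  define qz where "qz = posn u0 z"
  have pz: "posn u0 p = qz" using z(2) by (simp add: qz_def posn_def cr_simps)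
  have rz: "ray z u0 (g i)" if "i \<le> m" for i using u0[OF that] z(2) by (simp add: cr_simps)
  \<comment> \<open>The lines crossing all sides form a strip bounded by two vertices. Taking the
    last extremal side ensures that the line through its vertex crosses all later sides strictly, so
    the tail really starts on side \<open>m\<close>.\<close>
  obtain iL where iL: "iL \<le> m" "\<And>j. j \<le> m \<Longrightarrow> posn u0 (Lo j) \<le> posn u0 (Lo iL)"
    "\<And>j. iL < j \<Longrightarrow> j \<le> m \<Longrightarrow> posn u0 (Lo j) < posn u0 (Lo iL)"
    by (rule last_argmax[of m "\<lambda>j. posn u0 (Lo j)"]) blast
  obtain iR where iR: "iR \<le> m" "\<And>j. j \<le> m \<Longrightarrow> posn u0 (Up iR) \<le> posn u0 (Up j)"
    "\<And>j. iR < j \<Longrightarrow> j \<le> m \<Longrightarrow> posn u0 (Up iR) < posn u0 (Up j)"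
    by (rule last_argmax[of m "\<lambda>j. - posn u0 (Up j)"]) auto
  define ql where "ql = posn u0 (Lo iL)"
  define qr where "qr = posn u0 (Up iR)"
  have sl: "posn u0 (Lo i) \<le> ql \<and> qr \<le> posn u0 (Up i)" if "i \<le> m" for i
    using iL(2) iR(2) that by (simp add: ql_def qr_def)
  have lz: "ql < qz" "qz < qr" using crs_iff[OF iL(1), of u0 qz] crs_iff[OF iR(1), of u0 qz] rz[OF iL(1)] rz[OF iR(1)]
    by (auto simp: ql_def qr_def qz_def)
  define I where "I w = (if w then iL else iR)" for w
  define V where "V w = (if w then Lo iL else Up iR)" for w
  define ty where "ty w = (if w then dd (g iL) = d else dd (g iR) \<noteq> d)" for w
  define r where "r w = m - I w - 1" for w
  have ep: "endp (I w) (ty w) (V w)" for w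
    using iL(1) iR(1) by (auto simp: endp_def I_def V_def ty_def Lo_def Up_def)
  have gd: "good u0 (V w) (I w)" for w
  proof -
    have "ray (V w) u0 (g j)" if j: "I w < j" "j \<le> m" for j
    proof -
      have "posn u0 (Lo j) < posn u0 (V w) \<and> posn u0 (V w) < posn u0 (Up j)"
        using sl[OF j(2)] lz iL(3)[of j] iR(3)[of j] j by (cases w) (auto simp: I_def V_def ql_def qr_def)
      then show ?thesis using crs_iff[OF j(2), of u0 "posn u0 (V w)"] by simp
    qed
    then show ?thesis using gp by (simp add: good_def)
  qed
  define P where "P x = pos (T u0 (V (fst x)) (snd x))" for x
  have P0: "P (True, 0) = ql" "P (False, 0) = qr" by (simp_all add: P_def V_def ql_def qr_def posn_def)
  \<comment> \<open>All crossings of the base level by the two tails within the strip. Those nearest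
    to \<open>z\<close> become the ends of the base interval, and the tails are shortened to start
    there.\<close>
  define X where "X = {x. snd x \<le> r (fst x) \<and> kl (g (m - snd x)) = N \<and> ql \<le> P x \<and> P x \<le> qr}"
  have VP: "posn u0 (V w) = ql \<or> posn u0 (V w) = qr" for w by (auto simp: V_def ql_def qr_def)
  have Xd: "dd (g (m - snd x)) = d" if "x \<in> X" for x
  proof -
    have "dd (g (m - snd x)) = 1 \<or> dd (g (m - snd x)) = -1" using v[of "m - snd x"] by (simp add: vld_def)
    moreover have "dd (g (m - snd x)) \<noteq> - d"
    proof
      assume "dd (g (m - snd x)) = - d"
      then have "\<exists>n<m. m \<le> 2 * n + 1 \<and> (\<forall>l\<le>n. ray p (ctr (g n) - p) (g l))"
        using that pz lz by (intro rev_ctr[OF pn sl _ _ gd[of "fst x"] VP[of "fst x"], of "snd x"]) (auto simp: X_def P_def r_def)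
      then show False using False by simp
    qed
    ultimately show ?thesis using d1 by auto
  qed
  have "finite X"
    by (rule finite_subset[of _ "UNIV \<times> {..m}"]) (auto simp: X_def r_def)
  have stX: "T u0 (V (fst x)) (snd x) = St N (P x) (- d)" if "x \<in> X" for x
    using that Xd[OF that] by (intro st_eqI) (auto simp: X_def P_def)
  have rl: "r w \<le> m" for w by (simp add: r_def)
  have run: "run (fu u0) (T u0 (V w)) (r w)" "hits (fu u0) (ty w) (T u0 (V w) (r w))" for w
    using vtail[OF ep gd] by (simp_all add: r_def)
  have hz: "hits (fu u0) az (St N qz d)" unfolding qz_def by (rule hits_z[OF zz rz]) simp
  \<comment> \<open>A later crossing at the position of \<open>z\<close> is excluded: its reversal
    would run into the vertex \<open>z\<close>, whereas the reversal of a state that has been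
    reached can go on.\<close>
  have Xz: "P x \<noteq> qz" if x: "x \<in> X" for x
  proof
    assume e: "P x = qz"
    have "snd x \<noteq> 0"
    proof
      assume "snd x = 0"
      then have "x = (True, 0) \<or> x = (False, 0)" by (cases x) auto
      then show False using e P0 lz by auto
    qed
    then obtain j where j: "snd x = Suc j" by (cases "snd x") auto
    have "okst (fu u0) (T u0 (V (fst x)) j)" "T u0 (V (fst x)) (snd x) = nxt (fu u0) (T u0 (V (fst x)) j)"
      using run(1)[of "fst x"] x j by (auto simp: run_def X_def)
    then have "okst (fu u0) (rv (T u0 (V (fst x)) (snd x)))" using nxt_rv(1) by simp
    then show False using stX[OF x] e hits_not_ok[OF hz] by (simp add: rv_def)
  qed
  have uniq: "j = j'" if "(w, j) \<in> X" "(w, j') \<in> X" "P (w, j) = P (w, j')" for w j j'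
    by (rule run_no_repeat[OF run(1)[of w] hits_not_ok[OF run(2)]])
      (use that stX[OF that(1)] stX[OF that(2)] in \<open>auto simp: X_def\<close>)
  have X0: "(True, 0) \<in> X" "(False, 0) \<in> X" using lz P0 by (auto simp: X_def)
  obtain x1 where x1: "x1 \<in> X" "P x1 < qz" "\<And>y. y \<in> X \<Longrightarrow> P y < qz \<Longrightarrow> P y \<le> P x1"
  proof (rule finite_max[of "{x \<in> X. P x < qz}" P])
    show "{x \<in> X. P x < qz} \<noteq> {}" using X0 P0 lz by auto
  qed (use \<open>finite X\<close> in auto)
  obtain x2 where x2: "x2 \<in> X" "P x2 > qz" "\<And>y. y \<in> X \<Longrightarrow> P y > qz \<Longrightarrow> P x2 \<le> P y"
  proof (rule finite_min[of "{x \<in> X. P x > qz}" P])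
    show "{x \<in> X. P x > qz} \<noteq> {}" using X0 P0 lz by auto
  qed (use \<open>finite X\<close> in auto)
  \<comment> \<open>In direction \<open>u0\<close> the two tails may share crossings, which separate
    when the direction changes and could then enter the interval. Taking both ends on one tail
    whenever possible makes every crossing at an end belong to the chosen index.\<close>
  obtain w1 a w2 b where sel: "(w1, a) \<in> X" "(w2, b) \<in> X" "P (w1, a) = P x1" "P (w2, b) = P x2"
    "w1 = w2 \<or> (\<nexists>w j j'. (w, j) \<in> X \<and> (w, j') \<in> X \<and> P (w, j) = P x1 \<and> P (w, j') = P x2)"
  proof (cases "\<exists>w j j'. (w, j) \<in> X \<and> (w, j') \<in> X \<and> P (w, j) = P x1 \<and> P (w, j') = P x2")
    case True then show ?thesis using that by blast
  next
    case False then show ?thesis using that[of "fst x1" "snd x1" "fst x2" "snd x2"] x1(1) x2(1) by simp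
  qed
  have E: "P (w, j) < P x1 \<or> P (w, j) > P x2 \<or> w = w1 \<and> j = a \<or> w = w2 \<and> j = b"
    if w: "w = w1 \<or> w = w2" and j: "j \<le> r w" "kl (g (m - j)) = N" for w j
  proof (cases "(w, j) \<in> X")
    case False
    then have "P (w, j) < ql \<or> qr < P (w, j)" using j by (auto simp: X_def)
    then show ?thesis using x1(1) x2(1) by (auto simp: X_def)
  next
    case True
    then consider "P (w, j) < P x1" | "P (w, j) = P x1" | "P (w, j) > P x2" | "P (w, j) = P x2"
      using Xz[OF True] x1(3)[OF True] x2(3)[OF True] by linarith
    then show ?thesis
    proof cases
      case 2
      have "w = w1" using w sel(2,4,5) True 2 by blast
      moreover have "j = a" by (rule uniq[of w]) (use True sel 2 \<open>w = w1\<close> in auto)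
      ultimately show ?thesis by simp
    next
      case 4
      have "w = w2" using w sel(1,3,5) True 4 by blast
      moreover have "j = b" by (rule uniq[of w]) (use True sel 4 \<open>w = w2\<close> in auto)
      ultimately show ?thesis by simp
    qed auto
  qed
  define q1 where "q1 u = pos (T u (V w1) a)" for u
  define q2 where "q2 u = pos (T u (V w2) b)" for u
  have q0: "q1 u0 = P x1" "q2 u0 = P x2" using sel(3,4) by (simp_all add: q1_def q2_def P_def)
  have qlr: "ql \<le> q1 u0" "q2 u0 \<le> qr" using x1(1) x2(1) by (auto simp: q0 X_def)
  \<comment> \<open>Everything the frame needs from a direction, as conditions that are open and
    hold at \<open>u0\<close>.\<close>
  define Fr where "Fr u \<longleftrightarrow> (good u (V w1) (I w1) \<and> good u (V w2) (I w2)) \<and> (q1 u < posn u z \<and> posn u z < q2 u) \<and> ray z u (g m) \<and>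
     (q1 u < posn u p \<and> posn u p < q2 u) \<and>
     (\<forall>j\<le>m. \<forall>V'\<in>{V w1, V w2}. (pos (T u0 V' j) < q1 u0 \<longrightarrow> pos (T u V' j) < q1 u) \<and> (q2 u0 < pos (T u0 V' j) \<longrightarrow> q2 u < pos (T u V' j))) \<and>
     (\<forall>i\<le>m. posn u (Lo i) < (q1 u + posn u p) / 2 \<and> (posn u p + q2 u) / 2 < posn u (Up i))" for u
  have tq: "(q1 \<longlongrightarrow> q1 u0) (nhds u0)" "(q2 \<longlongrightarrow> q2 u0) (nhds u0)"
    unfolding q1_def[abs_def] q2_def[abs_def] by (rule tendsto_T)+
  have tm: "((\<lambda>u. (q1 u + posn u p) / 2) \<longlongrightarrow> (q1 u0 + posn u0 p) / 2) (nhds u0)"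
    "((\<lambda>u. (posn u p + q2 u) / 2) \<longlongrightarrow> (posn u0 p + q2 u0) / 2) (nhds u0)"
    by (intro tendsto_intros tq tendsto_posn; simp)+
  have evg: "eventually (\<lambda>u. good u (V w) (I w)) (nhds u0)" for w
  proof -
    have 1: "eventually (\<lambda>u. \<forall>j\<le>m. I w < j \<longrightarrow> ray (V w) u (g j)) (nhds u0)"
    proof (rule eventually_all_le)
      fix j assume "j \<le> m"
      then show "eventually (\<lambda>u. I w < j \<longrightarrow> ray (V w) u (g j)) (nhds u0)"
        using gd[of w] by (cases "I w < j") (auto simp: good_def intro: ev_ray)
    qed
    have 2: "eventually (\<lambda>u. gap u (g m) > 0) (nhds u0)"
      unfolding gap_def by (rule ev_less) (use gp in \<open>auto simp: gap_def intro!: tendsto_intros tendsto_cr\<close>)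
    from 1 2 show ?thesis by eventually_elim (auto simp: good_def)
  qed
  have zq: "q1 u0 < posn u0 z" "posn u0 z < q2 u0" "q1 u0 < posn u0 p" "posn u0 p < q2 u0"
    using x1(2) x2(2) pz by (auto simp: q0 qz_def)
  have "eventually Fr (nhds u0)" unfolding Fr_def[abs_def]
  proof (intro eventually_conj)
    show "eventually (\<lambda>u. \<forall>j\<le>m. \<forall>V'\<in>{V w1, V w2}. (pos (T u0 V' j) < q1 u0 \<longrightarrow> pos (T u V' j) < q1 u) \<and> (q2 u0 < pos (T u0 V' j) \<longrightarrow> q2 u < pos (T u V' j))) (nhds u0)"
    proof (intro eventually_all_le eventually_ball_finite ballI eventually_conj)
      fix j V'
      show "eventually (\<lambda>u. pos (T u0 V' j) < q1 u0 \<longrightarrow> pos (T u V' j) < q1 u) (nhds u0)"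
        using ev_less[OF tendsto_T[where V = V' and j = j] tq(1)] by (cases "pos (T u0 V' j) < q1 u0") auto
      show "eventually (\<lambda>u. q2 u0 < pos (T u0 V' j) \<longrightarrow> q2 u < pos (T u V' j)) (nhds u0)"
        using ev_less[OF tq(2) tendsto_T[where V = V' and j = j]] by (cases "q2 u0 < pos (T u0 V' j)") auto
    qed simp
    show "eventually (\<lambda>u. \<forall>i\<le>m. posn u (Lo i) < (q1 u + posn u p) / 2 \<and> (posn u p + q2 u) / 2 < posn u (Up i)) (nhds u0)"
    proof (intro eventually_all_le eventually_conj)
      fix i assume i: "i \<le> m"
      show "eventually (\<lambda>u. posn u (Lo i) < (q1 u + posn u p) / 2) (nhds u0)"
        by (rule ev_less[OF tendsto_posn tm(1)]) (use sl[OF i] qlr zq in auto)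
      show "eventually (\<lambda>u. (posn u p + q2 u) / 2 < posn u (Up i)) (nhds u0)"
        by (rule ev_less[OF tm(2) tendsto_posn]) (use sl[OF i] qlr zq in auto)
    qed
  qed (use evg ev_ray[OF rz[of m]] ev_less[OF tq(1) tendsto_posn] ev_less[OF tendsto_posn tq(2)] zq in auto)
  note evF = this
  define lo where "lo = Min (kl ` g ` {..m}) - 1"
  define hi where "hi = Max (kl ` g ` {..m}) + 1"
  have lohi: "lo < kl (g i) \<and> kl (g i) < hi" if "i \<le> m" for i
  proof -
    have "Min (kl ` g ` {..m}) \<le> kl (g i)" "kl (g i) \<le> Max (kl ` g ` {..m})" using that by (auto intro!: Min_le Max_ge)
    then show ?thesis by (simp add: lo_def hi_def)
  qed
  define K1 where "K1 = cbar (\<lambda>j. T u0 (V w1) (a + j)) (r w1 - a) (St N (posn u0 z) d) + corr (ty w1) (\<lambda>j. T u0 (V w1) (a + j)) (r w1 - a) N"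
  define K2 where "K2 = cbar (\<lambda>j. T u0 (V w2) (b + j)) (r w2 - b) (St N (posn u0 z) d) + corr (ty w2) (\<lambda>j. T u0 (V w2) (b + j)) (r w2 - b) N"
  define Kz :: nat where "Kz = of_bool (az \<and> tile (St N 0 d) \<le> N)"
  have u00: "u0 \<noteq> 0" using gp by (auto simp: gap_def cr_simps)
  have key: "\<exists>G n. m \<le> n \<and> chain G n \<and> (\<forall>i\<le>m. G i = g i) \<and> (\<forall>i\<le>n. ray p (ctr (G n) - p) (G i))"
    if F: "Fr u" and c: "(ty w1 = ty w2 \<and> odd (K1 + K2)) \<or>
      (posn u p \<le> posn u z \<and> (odd (K1 + Kz) \<and> (ty w1 = az \<or> (\<exists>n\<ge>hi. fu u n = 0)) \<or> even (K1 + Kz) \<and> ty w1 \<noteq> az \<and> (\<exists>n\<le>lo. fu u n = 0))) \<or>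
      (posn u z \<le> posn u p \<and> (even (K2 + Kz) \<and> (az = ty w2 \<or> (\<exists>n\<ge>hi. fu u n = 0)) \<or> odd (K2 + Kz) \<and> az \<noteq> ty w2 \<and> (\<exists>n\<le>lo. fu u n = 0)))" for u
  proof (rule frame_goal[OF pn ep[of w1] _ _ ep[of w2] _ _ zz, where a = a and b = b and uz = u0 and u = u and lo = lo and hi = hi])
    show "a \<le> m - I w1 - 1" "b \<le> m - I w2 - 1" "kl (g (m - a)) = N" "kl (g (m - b)) = N"
      using sel(1,2) by (auto simp: X_def r_def)
    show "pos (T u0 (V w1) j) < pos (T u0 (V w1) a) \<or> pos (T u0 (V w1) j) > pos (T u0 (V w2) b) \<or> V w1 = V w2 \<and> j = b"
      if "a < j" "j \<le> m - I w1 - 1" "kl (g (m - j)) = N" for j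
      using E[of w1 j] that sel(3,4) by (auto simp: P_def r_def)
    show "pos (T u0 (V w2) j) < pos (T u0 (V w1) a) \<or> pos (T u0 (V w2) j) > pos (T u0 (V w2) b) \<or> V w2 = V w1 \<and> j = a"
      if "b < j" "j \<le> m - I w2 - 1" "kl (g (m - j)) = N" for j
      using E[of w2 j] that sel(3,4) by (auto simp: P_def r_def)
    note F' = F[unfolded Fr_def q1_def q2_def]
    show "pos (T u0 (V w1) a) < posn u0 z" "posn u0 z < pos (T u0 (V w2) b)" using zq by (simp_all only: q1_def q2_def)
    show "good u (V w1) (I w1)" "good u (V w2) (I w2)" using F' by blast+
    show "pos (T u (V w1) a) < posn u z" "posn u z < pos (T u (V w2) b)" using F' by blast+
    show "ray z u (g m)" using F' by blast
    show "pos (T u (V w1) a) < posn u p" "posn u p < pos (T u (V w2) b)" using F' by blast+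
    show "(pos (T u0 V' j) < pos (T u0 (V w1) a) \<longrightarrow> pos (T u V' j) < pos (T u (V w1) a)) \<and>
       (pos (T u0 (V w2) b) < pos (T u0 V' j) \<longrightarrow> pos (T u (V w2) b) < pos (T u V' j))"
      if "j \<le> m" "V' = V w1 \<or> V' = V w2" for j V'
      using F' that by blast
    show "posn u (Lo i) < (pos (T u (V w1) a) + posn u p) / 2 \<and> (posn u p + pos (T u (V w2) b)) / 2 < posn u (Up i)" if "i \<le> m" for i
      using F' that by blast
    show "lo < kl (g i) \<and> kl (g i) < hi" if "i \<le> m" for i by (rule lohi[OF that])
    show "ty w1 = ty w2 \<and> odd (cbar (\<lambda>j. T u0 (V w1) (a + j)) (m - I w1 - 1 - a) (St N (posn u0 z) d) + corr (ty w1) (\<lambda>j. T u0 (V w1) (a + j)) (m - I w1 - 1 - a) N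
        + (cbar (\<lambda>j. T u0 (V w2) (b + j)) (m - I w2 - 1 - b) (St N (posn u0 z) d) + corr (ty w2) (\<lambda>j. T u0 (V w2) (b + j)) (m - I w2 - 1 - b) N)) \<or>
      posn u p \<le> posn u z \<and> (odd (cbar (\<lambda>j. T u0 (V w1) (a + j)) (m - I w1 - 1 - a) (St N (posn u0 z) d) + corr (ty w1) (\<lambda>j. T u0 (V w1) (a + j)) (m - I w1 - 1 - a) N
        + of_bool (az \<and> tile (St N 0 d) \<le> N)) \<and> (ty w1 = az \<or> (\<exists>n\<ge>hi. fu u n = 0)) \<or>
        even (cbar (\<lambda>j. T u0 (V w1) (a + j)) (m - I w1 - 1 - a) (St N (posn u0 z) d) + corr (ty w1) (\<lambda>j. T u0 (V w1) (a + j)) (m - I w1 - 1 - a) N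
        + of_bool (az \<and> tile (St N 0 d) \<le> N)) \<and> ty w1 \<noteq> az \<and> (\<exists>n\<le>lo. fu u n = 0)) \<or>
      posn u z \<le> posn u p \<and> (even (cbar (\<lambda>j. T u0 (V w2) (b + j)) (m - I w2 - 1 - b) (St N (posn u0 z) d) + corr (ty w2) (\<lambda>j. T u0 (V w2) (b + j)) (m - I w2 - 1 - b) N
        + of_bool (az \<and> tile (St N 0 d) \<le> N)) \<and> (az = ty w2 \<or> (\<exists>n\<ge>hi. fu u n = 0)) \<or>
        odd (cbar (\<lambda>j. T u0 (V w2) (b + j)) (m - I w2 - 1 - b) (St N (posn u0 z) d) + corr (ty w2) (\<lambda>j. T u0 (V w2) (b + j)) (m - I w2 - 1 - b) N
        + of_bool (az \<and> tile (St N 0 d) \<le> N)) \<and> az \<noteq> ty w2 \<and> (\<exists>n\<le>lo. fu u n = 0))"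
      using c unfolding K1_def K2_def Kz_def r_def .
  qed
  have F0: "Fr u0" using evF by (rule eventually_nhds_x_imp_x)
  have side: "posn u p - posn u z = of_int d * cr u (z - p)" for u by (simp add: posn_def cr_simps algebra_simps)
  have "\<exists>G n. m \<le> n \<and> chain G n \<and> (\<forall>i\<le>m. G i = g i) \<and> (\<forall>i\<le>n. ray p (ctr (G n) - p) (G i))"
  proof (cases "ty w1 = az \<and> ty w2 = az")
    case True
    have pz': "posn u0 p = posn u0 z" using pz by (simp add: qz_def)
    \<comment> \<open>The parities of the three intervals are those of \<open>K1 + K2\<close>,
      \<open>K1 + Kz\<close> and \<open>K2 + Kz + 1\<close>. Their sum is odd, so one of them is
      odd, and with three vertices of the same type that bounds the levels both ways. In direction
      \<open>u0\<close> the point \<open>p\<close> lies at the common end of the two short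
      intervals, hence in all three.\<close>
    have "odd (K1 + K2) \<or> odd (K1 + Kz) \<or> even (K2 + Kz)" by presburger
    then show ?thesis using key[OF F0] True pz' by auto
  next
    case False
    obtain \<tau> where \<tau>: "z - p = \<tau> *\<^sub>R u0" by (rule cr_0_parallel[OF z(2) u00])
    have "z \<noteq> p" using pn[of m] sd_vertex[OF v[of m] z(1)] S_pos by auto
    then have \<tau>0: "\<tau> \<noteq> 0" using \<tau> by auto
    \<comment> \<open>The turn has two tasks: its sign \<open>s\<close> moves \<open>p\<close> into
      the short interval to be used, and the parity decides whether the wall must stand above or
      below the tails.\<close>
    have clo: "\<exists>u. Fr u \<and> s * (posn u p - posn u z) \<ge> 0 \<and> (if up then \<exists>n\<ge>hi. fu u n = 0 else \<exists>n\<le>lo. fu u n = 0)"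
      if s: "s = 1 \<or> s = (-1::real)" for s up
    proof -
      define s' where "s' = - s * of_int d * sgn \<tau>"
      have s': "s' = 1 \<or> s' = -1" using s d1 \<tau>0 by (auto simp: s'_def sgn_if)
      define e :: int where "e = (if up then 1 else -1)"
      have e1: "e = 1 \<or> e = -1" by (simp add: e_def)
      obtain n u where nu: "e * n \<ge> e * (if up then hi else lo)" "fu u n = 0" "s' * cr u0 u > 0" "Fr u"
        using closing[OF irr u00 evF s' e1, of "if up then hi else lo"] by blast
      have "s * (posn u p - posn u z) = \<bar>\<tau>\<bar> * (s' * cr u0 u)"
        unfolding side \<tau> using \<tau>0 by (simp add: cr_simps s'_def cr_swap[of u u0] abs_mult_sgn[symmetric] mult.commute mult.left_commute)
      also have "\<dots> \<ge> 0" using nu(3) by simp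
      finally show ?thesis using nu by (intro exI[of _ u]) (auto simp: e_def split: if_splits)
    qed
    show ?thesis
    proof (cases "ty w1 = az")
      case False
      obtain u where u: "Fr u" "posn u p \<le> posn u z" "if odd (K1 + Kz) then \<exists>n\<ge>hi. fu u n = 0 else \<exists>n\<le>lo. fu u n = 0"
        using clo[of "-1" "odd (K1 + Kz)"] by auto
      then show ?thesis using key[OF u(1)] False by (cases "odd (K1 + Kz)") auto
    next
      case True
      then have n2: "ty w2 \<noteq> az" using False by simp
      obtain u where u: "Fr u" "posn u z \<le> posn u p" "if even (K2 + Kz) then \<exists>n\<ge>hi. fu u n = 0 else \<exists>n\<le>lo. fu u n = 0"
        using clo[of 1 "even (K2 + Kz)"] by auto
      then show ?thesis using key[OF u(1)] n2 by (cases "even (K2 + Kz)") auto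
    qed
  qed
  then obtain G n where "m \<le> n" "chain G n" "\<forall>i\<le>m. G i = g i" "\<forall>i\<le>n. ray p (ctr (G n) - p) (G i)" by blast
  then show ?thesis by (intro exI[of _ G] exI[of _ n]) auto
qed

end

section \<open>Coordinates in a rhombus\<close>

context geo
begin


section \<open>A centre visible within a given wedge\<close>

theorem see_centre:
  assumes irr: "\<alpha> / pi \<notin> \<rat>" and b: "beam p g n a b"
  obtains G n' where "n < n'" "chain G n'" "\<And>i. i \<le> n \<Longrightarrow> G i = g i" "ctr (G n') - p \<in> wedge a b"
    "\<And>i. i \<le> n' \<Longrightarrow> ray p (ctr (G n') - p) (G i)"
proof -
  obtain H l a1 b1 where H: "n < l" "\<And>i. i \<le> n \<Longrightarrow> H i = g i" "beam p H l a1 b1"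
    "\<And>v. (\<And>i. i \<le> l \<Longrightarrow> ray p v (H i)) \<Longrightarrow> v \<in> wedge a b" by (rule narrow[OF b]) blast
  \<comment> \<open>The centre may appear half way along the chain; length \<open>2 * l + 2\<close>
    puts it beyond side \<open>l\<close>, so its direction follows the narrowing chain and lies in
    the wedge.\<close>
  obtain K k a2 b2 where K: "2 * l + 2 \<le> k" "l \<le> k" "\<And>i. i \<le> l \<Longrightarrow> K i = H i" "beam p K k a2 b2"
    using lengthen[OF H(3), of "2 * l + 2"] by blast
  obtain J m u z where J: "k \<le> m" "\<And>i. i \<le> k \<Longrightarrow> J i = K i" "beam p J m a2 b2" "u \<in> wedge a2 b2"
    "z = B2 (J m) \<or> z = A2 (J m)" "cr u (z - p) = 0" by (rule vis[OF K(4)]) blast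
  have hub: "hub L \<alpha> J m p" using J(3) by (unfold_locales) (auto simp: beam_def)
  obtain G n' where G: "m \<le> 2 * n' + 1" "chain G n'" "\<forall>i. i \<le> m \<and> i \<le> n' \<longrightarrow> G i = J i" "\<forall>i\<le>n'. ray p (ctr (G n') - p) (G i)"
    using hub.hub_main[OF hub irr, of u z] J by (auto simp: beam_def)
  have ln: "l \<le> n'" "l \<le> m" using G(1) K(1) J(1) by auto
  have GH: "G i = H i" if "i \<le> l" for i using G(3) J(2) K(2,3) ln that by simp
  show ?thesis
  proof (rule that[of n' G])
    show "n < n'" using H(1) ln by simp
    show "G i = g i" if "i \<le> n" for i using GH[of i] H(1,2) that by simp
    show "ctr (G n') - p \<in> wedge a b" 
    proof (rule H(4))
      fix i assume "i \<le> l"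
      then show "ray p (ctr (G n') - p) (H i)" using G(4)[rule_format, of i] GH[of i] ln by simp
    qed
  qed (use G in auto)
qed

section \<open>Reversed chains and normalised rhombus coordinates\<close>

definition rvd :: "ds \<Rightarrow> ds" where "rvd \<sigma> = DS (kl \<sigma>) (av \<sigma>) (sg \<sigma>) (- dd \<sigma>)"

lemma rvd_simps [simp]: "kl (rvd \<sigma>) = kl \<sigma>" "av (rvd \<sigma>) = av \<sigma>" "sg (rvd \<sigma>) = sg \<sigma>" "dd (rvd \<sigma>) = - dd \<sigma>"
  "Bv (rvd \<sigma>) = Bv \<sigma>" "vld (rvd \<sigma>) = vld \<sigma>" "rvd (rvd \<sigma>) = \<sigma>" "sd (rvd \<sigma>) x = - sd \<sigma> x"
  by (auto simp: rvd_def Bv_def vld_def sd_def)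

lemma step_rvd: "step m (rvd (step m \<sigma>)) = rvd \<sigma>"
  by (cases m; cases \<sigma>) (simp_all add: step_def rvd_def A2_def algebra_simps)

lemma ray_rvd: "ray x (- u) (rvd \<sigma>) = ray x u \<sigma>"
  unfolding crs_def by (simp add: cr_simps algebra_simps)

lemma chain_rvd: assumes "chain g n" shows "chain (\<lambda>j. rvd (g (n - j))) n"
  unfolding chain_def
proof (intro conjI allI impI)
  show "vld (rvd (g (n - 0)))" using chain_vld[OF assms, of n] by simp
  fix i assume i: "i < n"
  then have e: "n - i = Suc (n - Suc i)" by simp
  obtain m where "g (Suc (n - Suc i)) = step m (g (n - Suc i))" by (rule chain_stepE[OF assms, of "n - Suc i"]) (use i in auto)
  then show "\<exists>m. rvd (g (n - Suc i)) = step m (rvd (g (n - i)))" unfolding e using step_rvd by metis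
qed

text \<open>\<open>nctr\<close> and \<open>nlev\<close> belong to the rhombus being left,
  \<open>ctr\<close> and \<open>flev\<close> to the one being entered. A rhombus of level
  \<open>l\<close> is that of level 0 turned by \<open>2 * l * \<alpha>\<close>.\<close>

definition nctr :: "ds \<Rightarrow> complex" where "nctr \<sigma> = av \<sigma> + (sg \<sigma> / 2) *\<^sub>R (E (kl \<sigma>) + E (kl \<sigma> - dd \<sigma>))"
definition nlev :: "ds \<Rightarrow> int" where "nlev \<sigma> = (if dd \<sigma> = 1 then kl \<sigma> else kl \<sigma> + 1)"
definition flev :: "ds \<Rightarrow> int" where "flev \<sigma> = (if dd \<sigma> = 1 then kl \<sigma> + 1 else kl \<sigma>)"

lemma nctr_step: "vld \<sigma> \<Longrightarrow> nctr (step m \<sigma>) = ctr \<sigma>" "vld \<sigma> \<Longrightarrow> nlev (step m \<sigma>) = flev \<sigma>"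
  by (cases m; auto simp: nctr_def ctr_def step_def A2_def nlev_def flev_def vld_def algebra_simps complex_eq_iff)+

lemma nctr_rvd [simp]: "nctr (rvd \<sigma>) = ctr \<sigma>" "ctr (rvd \<sigma>) = nctr \<sigma>"
  by (simp_all add: nctr_def ctr_def rvd_def)

lemma nlev_rvd: "vld \<sigma> \<Longrightarrow> nlev (rvd \<sigma>) = flev \<sigma>" "vld \<sigma> \<Longrightarrow> flev (rvd \<sigma>) = nlev \<sigma>"
  by (auto simp: nlev_def flev_def vld_def)

text \<open>\<open>Px\<close> and \<open>Qy\<close> are the half diagonals of the rhombus, that is
  the legs of the triangle.\<close>

definition Px :: real where "Px = L * cos \<alpha>"
definition Qy :: real where "Qy = L * sin \<alpha>"

lemma PQ: "Px > 0" "Qy > 0" 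
  using L al cos_gt_zero[of \<alpha>] sin_gt_zero[of \<alpha>] pi_gt_zero by (auto simp: Px_def Qy_def)

definition wc :: "complex \<Rightarrow> int \<Rightarrow> complex \<Rightarrow> complex" where
  "wc c l x = cis (- (2 * of_int l * \<alpha>)) * (x - c)"

text \<open>The norm whose unit ball is the rhombus of level 0 about the origin.\<close>

definition rh :: "complex \<Rightarrow> real" where "rh w = \<bar>Re w\<bar> / Px + \<bar>Im w\<bar> / Qy"

lemma E_level: "E l = cis (2 * of_int l * \<alpha>) * Complex Px Qy" "E (l - 1) = cis (2 * of_int l * \<alpha>) * Complex Px (- Qy)"
proof -
  have "Complex Px Qy = L *\<^sub>R cis \<alpha>" "Complex Px (- Qy) = L *\<^sub>R cis (- \<alpha>)"
    by (simp_all add: complex_eq_iff Px_def Qy_def)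
  then show "E l = cis (2 * of_int l * \<alpha>) * Complex Px Qy" "E (l - 1) = cis (2 * of_int l * \<alpha>) * Complex Px (- Qy)"
    by (simp_all add: E_def cis_mult algebra_simps)
qed

lemma E_near:
  assumes "vld \<sigma>"
  shows "E (kl \<sigma>) = cis (2 * of_int (nlev \<sigma>) * \<alpha>) * Complex Px (of_int (dd \<sigma>) * Qy)"
    "E (kl \<sigma> - dd \<sigma>) = cis (2 * of_int (nlev \<sigma>) * \<alpha>) * Complex Px (- of_int (dd \<sigma>) * Qy)"
  using assms E_level[of "kl \<sigma>"] E_level[of "kl \<sigma> + 1"] unfolding vld_def nlev_def by auto

lemma cis_cancel: "cis (- a) * (cis a * w) = w"
  by (simp add: mult.assoc[symmetric] cis_mult)

lemma av_near:
  assumes "vld \<sigma>" shows "av \<sigma> = nctr \<sigma> - cis (2 * of_int (nlev \<sigma>) * \<alpha>) * (of_real (sg \<sigma> * Px))"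
proof -
  have "Complex Px (of_int (dd \<sigma>) * Qy) + Complex Px (- of_int (dd \<sigma>) * Qy) = of_real (2 * Px)"
    by (simp add: complex_eq_iff)
  then have "E (kl \<sigma>) + E (kl \<sigma> - dd \<sigma>) = cis (2 * of_int (nlev \<sigma>) * \<alpha>) * of_real (2 * Px)"
    unfolding E_near[OF assms] by (metis distrib_left)
  then show ?thesis by (simp add: nctr_def scaleR_conv_of_real)
qed

lemma edge_near:
  assumes "vld \<sigma>" "x = av \<sigma> + (t * sg \<sigma>) *\<^sub>R E (kl \<sigma>)"
  shows "wc (nctr \<sigma>) (nlev \<sigma>) x = Complex (- sg \<sigma> * (1 - t) * Px) (of_int (dd \<sigma>) * sg \<sigma> * t * Qy)"
proof -
  have "x - nctr \<sigma> = cis (2 * of_int (nlev \<sigma>) * \<alpha>) * ((t * sg \<sigma>) *\<^sub>R Complex Px (of_int (dd \<sigma>) * Qy) - of_real (sg \<sigma> * Px))"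
    unfolding assms(2) av_near[OF assms(1)] E_near(1)[OF assms(1)] by (simp add: algebra_simps)
  then have "wc (nctr \<sigma>) (nlev \<sigma>) x = (t * sg \<sigma>) *\<^sub>R Complex Px (of_int (dd \<sigma>) * Qy) - of_real (sg \<sigma> * Px)"
    unfolding wc_def by (simp only: cis_cancel)
  then show ?thesis by (simp add: complex_eq_iff algebra_simps)
qed

lemma edge_far:
  assumes "vld \<sigma>" "x = av \<sigma> + (t * sg \<sigma>) *\<^sub>R E (kl \<sigma>)"
  shows "wc (ctr \<sigma>) (flev \<sigma>) x = Complex (- sg \<sigma> * (1 - t) * Px) (- of_int (dd \<sigma>) * sg \<sigma> * t * Qy)"
  using edge_near[of "rvd \<sigma>" x t] assms by (simp add: nlev_rvd)

lemma cr_cis: "cr (cis a * x) (cis a * y) = cr x y"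
proof -
  have "cr (cis a * x) (cis a * y) = (cos a * cos a + sin a * sin a) * cr x y"
    by (simp add: cr_def algebra_simps del: sin_cos_squared_add3)
  then show ?thesis by simp
qed

lemma wc_inv: "x = c + cis (2 * of_int l * \<alpha>) * wc c l x"
  by (simp add: wc_def mult.assoc[symmetric] cis_mult)

lemma sd_near:
  assumes v: "vld \<sigma>"
  shows "sd \<sigma> x = Px * Qy * (- sg \<sigma> * (Re (wc (nctr \<sigma>) (nlev \<sigma>) x) / Px) + of_int (dd \<sigma>) * sg \<sigma> * (Im (wc (nctr \<sigma>) (nlev \<sigma>) x) / Qy) - 1)"
proof -
  define w where "w = wc (nctr \<sigma>) (nlev \<sigma>) x"
  have "x - av \<sigma> = cis (2 * of_int (nlev \<sigma>) * \<alpha>) * (w + of_real (sg \<sigma> * Px))"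
    unfolding av_near[OF v] w_def using wc_inv[of x "nctr \<sigma>" "nlev \<sigma>"] by (simp add: algebra_simps)
  then have "sd \<sigma> x = of_int (dd \<sigma>) * sg \<sigma> * cr (Complex Px (of_int (dd \<sigma>) * Qy)) (w + of_real (sg \<sigma> * Px))"
    unfolding sd_def E_near(1)[OF v] by (simp only: cr_cis)
  also have "\<dots> = Px * Qy * (- sg \<sigma> * (Re w / Px) + of_int (dd \<sigma>) * sg \<sigma> * (Im w / Qy) - 1)"
    using v PQ by (auto simp: vld_def cr_def field_simps)
  finally show ?thesis by (simp add: w_def)
qed

lemma near_inside: assumes "vld \<sigma>" "rh (wc (nctr \<sigma>) (nlev \<sigma>) x) < 1" shows "sd \<sigma> x < 0"
proof -
  define w where "w = wc (nctr \<sigma>) (nlev \<sigma>) x"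
  have e: "\<bar>Re w\<bar> / Px = \<bar>Re w / Px\<bar>" "\<bar>Im w\<bar> / Qy = \<bar>Im w / Qy\<bar>" using PQ by simp_all
  have "\<bar>Re w / Px\<bar> + \<bar>Im w / Qy\<bar> < 1" using assms(2) unfolding rh_def w_def[symmetric] e .
  moreover
  have "- sg \<sigma> * X \<le> \<bar>X\<bar>" "of_int (dd \<sigma>) * sg \<sigma> * X \<le> \<bar>X\<bar>" for X :: real
    using assms(1) abs_ge_self[of X] abs_ge_minus_self[of X] by (auto simp: vld_def)
  note ab = this
  moreover have "- sg \<sigma> * (Re w / Px) \<le> \<bar>Re w / Px\<bar>" "of_int (dd \<sigma>) * sg \<sigma> * (Im w / Qy) \<le> \<bar>Im w / Qy\<bar>"
    by (rule ab)+
  ultimately have "- sg \<sigma> * (Re w / Px) + of_int (dd \<sigma>) * sg \<sigma> * (Im w / Qy) - 1 < 0" by linarith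
  then show ?thesis unfolding sd_near[OF assms(1)] w_def[symmetric] using PQ by (simp add: mult_pos_neg)
qed

end

section \<open>Folding straight lines to billiard trajectories\<close>

locale bill = geo +
  fixes C e1 e2 :: point
  assumes orth: "e1 \<bullet> e1 = 1" "e2 \<bullet> e2 = 1" "e1 \<bullet> e2 = 0"
begin

definition io :: "complex \<Rightarrow> point" where "io w = Re w *\<^sub>R e1 + Im w *\<^sub>R e2"
definition A :: point where "A = C + Px *\<^sub>R e1"
definition B :: point where "B = C + Qy *\<^sub>R e2"

lemma orth': "e2 \<bullet> e1 = 0" using orth by (simp add: inner_commute)

lemma io_inner: "io w \<bullet> io z = Re w * Re z + Im w * Im z"
  by (simp add: io_def inner_add_left inner_add_right orth orth')

lemma io_linear: "io (w + z) = io w + io z" "io (r *\<^sub>R w) = r *\<^sub>R io w" "io (w - z) = io w - io z" "io 0 = 0"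
  by (simp_all add: io_def algebra_simps)

lemma io_norm: "norm (io w) = norm w"
  using norm_eq_sqrt_inner[of "io w"] by (simp add: io_inner cmod_def power2_eq_square)

lemma io_inj: "io w = io z \<longleftrightarrow> w = z"
  by (metis io_linear(3) io_norm norm_eq_zero right_minus_eq)

lemma AB_io: "A = C + io (of_real Px)" "B = C + io (Complex 0 Qy)" "C = C + io 0"
  by (simp_all add: A_def B_def io_def)

lemma in_triangle:
  assumes "Re w \<ge> 0" "Im w \<ge> 0" "Re w / Px + Im w / Qy \<le> 1"
  shows "C + io w \<in> triangle A B C"
proof -
  define a where "a = Re w / Px"
  define b where "b = Im w / Qy"
  have ab: "0 \<le> a" "0 \<le> b" "a + b \<le> 1" "Re w = a * Px" "Im w = b * Qy" using assms PQ by (auto simp: a_def b_def)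
  have "C + io w = a *\<^sub>R A + b *\<^sub>R B + (1 - a - b) *\<^sub>R C"
    by (simp add: io_def ab(4,5) A_def B_def algebra_simps)
  then show ?thesis unfolding triangle_def convex_hull_3 using ab by force
qed

lemma corners: "C + io w = A \<longleftrightarrow> w = of_real Px" "C + io w = B \<longleftrightarrow> w = Complex 0 Qy" "C + io w = C \<longleftrightarrow> w = 0"
  using io_inj[of w "of_real Px"] io_inj[of w "Complex 0 Qy"] io_inj[of w 0] AB_io by (auto simp: io_linear)

lemma two_scale: "(2 * r) *\<^sub>R x = r *\<^sub>R x + r *\<^sub>R (x :: point)"
  by (metis mult_2 scaleR_add_left)

lemma reflect_BC: "reflect (C - B) (io z) = io (Complex (- Re z) (Im z))"
proof -
  have e: "C - B = (- Qy) *\<^sub>R e2" by (simp add: B_def)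
  have "reflect (C - B) (io z) = (2 * Im z) *\<^sub>R e2 - io z" using PQ
    unfolding reflect_def e io_def by (simp add: inner_add_left orth orth')
  then show ?thesis by (simp add: io_def two_scale)
qed

lemma reflect_CA: "reflect (A - C) (io z) = io (Complex (Re z) (- Im z))"
proof -
  have e: "A - C = Px *\<^sub>R e1" by (simp add: A_def)
  have "reflect (A - C) (io z) = (2 * Re z) *\<^sub>R e1 - io z" using PQ
    unfolding reflect_def e io_def by (simp add: inner_add_left orth orth')
  then show ?thesis by (simp add: io_def two_scale)
qed

text \<open>The hypotenuse has direction \<open>pi - \<alpha>\<close>, and a reflection doubles this
  angle: \<open>- 2 * \<alpha>\<close> modulo a full turn.\<close>

lemma reflect_AB: "reflect (B - A) (io z) = io (cis (- (2 * \<alpha>)) * cnj z)"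
proof -
  define n where "n = Complex (- cos \<alpha>) (sin \<alpha>)"
  have BA: "B - A = io (L *\<^sub>R n)" by (simp add: B_def A_def io_def n_def Px_def Qy_def)
  have "reflect (B - A) (io z) = (2 * (io z \<bullet> io n)) *\<^sub>R io n - io z"
  proof -
    have "io n \<bullet> io n = 1" by (simp add: io_inner n_def)
    then show ?thesis using L by (simp add: reflect_def BA io_linear)
  qed
  also have "\<dots> = io ((2 * (io z \<bullet> io n)) *\<^sub>R n - z)" by (simp add: io_linear)
  also have "(2 * (io z \<bullet> io n)) *\<^sub>R n - z = cis (- (2 * \<alpha>)) * cnj z"
  proof -
    have c: "cis (- (2 * \<alpha>)) = Complex (2 * (cos \<alpha> * cos \<alpha>) - 1) (- (2 * sin \<alpha> * cos \<alpha>))"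
      using cos_double_cos[of \<alpha>] sin_double[of \<alpha>] by (simp add: complex_eq_iff power2_eq_square)
    have s: "sin \<alpha> * sin \<alpha> = 1 - cos \<alpha> * cos \<alpha>" using sin_cos_squared_add[of \<alpha>] by (simp add: power2_eq_square)
    have s': "sin \<alpha> * (sin \<alpha> * x) = x - cos \<alpha> * (cos \<alpha> * x)" for x
      by (metis (no_types, opaque_lifting) s left_diff_distrib mult.assoc mult_1)
    show ?thesis
      unfolding c by (simp add: complex_eq_iff io_inner n_def algebra_simps s s')
  qed
  finally show ?thesis .
qed

text \<open>Folding a rhombus onto the triangle reflects the two coordinates independently; on an axis both signs represent the same phase point
up to a bounce, which is why \<open>repw\<close> is a relation.\<close>

definition mi :: "real \<Rightarrow> real \<Rightarrow> complex \<Rightarrow> complex" where "mi a b w = Complex (a * Re w) (b * Im w)"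

definition repw :: "complex \<Rightarrow> complex \<Rightarrow> point \<times> point \<Rightarrow> bool" where
  "repw w v y \<longleftrightarrow> (\<exists>a b. (a = 1 \<or> a = -1) \<and> (b = 1 \<or> b = -1) \<and> a * Re w \<ge> 0 \<and> b * Im w \<ge> 0 \<and>
     y = (C + io (mi a b w), io (mi a b v)))"

text \<open>Excludes the tips of the rhombus, which fold to \<open>A\<close> and \<open>B\<close>.
  The third corner is the centre and is excluded separately.\<close>

definition nco :: "complex \<Rightarrow> bool" where
  "nco w \<longleftrightarrow> \<not> (\<bar>Re w\<bar> = Px \<and> Im w = 0) \<and> \<not> (Re w = 0 \<and> \<bar>Im w\<bar> = Qy)"

abbreviation fl :: "point \<times> point \<Rightarrow> real \<Rightarrow> point \<times> point \<Rightarrow> bool" where "fl \<equiv> flow A B C"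

lemma repw_ex: obtains y where "repw w v y"
proof -
  define a where "a = (if Re w \<ge> 0 then 1 else -1 :: real)"
  define b where "b = (if Im w \<ge> 0 then 1 else -1 :: real)"
  have "repw w v (C + io (mi a b w), io (mi a b v))" unfolding repw_def
    by (intro exI[of _ a] exI[of _ b]) (auto simp: a_def b_def)
  then show ?thesis by (rule that)
qed

lemma repw_uminus: "repw (- w) (- v) y \<longleftrightarrow> repw w v y"
proof -
  have "repw w v y" if "repw (- w) (- v) y" for w v
  proof -
    from that obtain a b where ab: "(a = 1 \<or> a = -1)" "(b = 1 \<or> b = -1)" "a * Re (- w) \<ge> 0" "b * Im (- w) \<ge> 0"
      "y = (C + io (mi a b (- w)), io (mi a b (- v)))" unfolding repw_def by blast
    have "mi a b (- x) = mi (- a) (- b) x" for x by (simp add: mi_def)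
    then show ?thesis unfolding repw_def using ab by (intro exI[of _ "- a"] exI[of _ "- b"]) auto
  qed
  from this[of w v] this[of "- w" "- v"] show ?thesis by auto
qed

lemma rh_bound: assumes "rh w \<le> 1" shows "\<bar>Re w\<bar> \<le> Px" "\<bar>Im w\<bar> \<le> Qy" "\<bar>Re w\<bar> = Px \<Longrightarrow> Im w = 0" "\<bar>Im w\<bar> = Qy \<Longrightarrow> Re w = 0"
proof -
  have p: "\<bar>Re w\<bar> / Px \<ge> 0" "\<bar>Im w\<bar> / Qy \<ge> 0" using PQ by auto
  have "\<bar>Re w\<bar> / Px \<le> 1" "\<bar>Im w\<bar> / Qy \<le> 1" using assms p unfolding rh_def by linarith+
  then show "\<bar>Re w\<bar> \<le> Px" "\<bar>Im w\<bar> \<le> Qy" using PQ by (simp_all add: divide_le_eq)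
  show "Im w = 0" if "\<bar>Re w\<bar> = Px"
  proof -
    have "\<bar>Re w\<bar> / Px = 1" using that PQ by simp
    then have "\<bar>Im w\<bar> / Qy = 0" using assms p unfolding rh_def by linarith
    then show ?thesis using PQ by simp
  qed
  show "Re w = 0" if "\<bar>Im w\<bar> = Qy"
  proof -
    have "\<bar>Im w\<bar> / Qy = 1" using that PQ by simp
    then have "\<bar>Re w\<bar> / Px = 0" using assms p unfolding rh_def by linarith
    then show ?thesis using PQ by simp
  qed
qed

text \<open>Two foldings of a point differ only on an axis; there the folded point is inside a leg,
  and a bounce leads from one to the other.\<close>

lemma flow_eq:
  assumes w: "rh w \<le> 1" "w \<noteq> 0" "nco w" and y: "repw w v y" "repw w v y'" and f: "fl Z t y"
  shows "fl Z t y'"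
proof -
  obtain a b where ab: "(a = 1 \<or> a = -1)" "(b = 1 \<or> b = -1)" "a * Re w \<ge> 0" "b * Im w \<ge> 0" "y = (C + io (mi a b w), io (mi a b v))"
    using y(1) by (auto simp: repw_def)
  obtain a' b' where ab': "(a' = 1 \<or> a' = -1)" "(b' = 1 \<or> b' = -1)" "a' * Re w \<ge> 0" "b' * Im w \<ge> 0" "y' = (C + io (mi a' b' w), io (mi a' b' v))"
    using y(2) by (auto simp: repw_def)
  consider "a = a'" "b = b'" | "Re w = 0" "Im w \<noteq> 0" "b = b'" "a' = - a" | "Im w = 0" "Re w \<noteq> 0" "a = a'" "b' = - b"
    using ab(1-4) ab'(1-4) w(2) by (auto simp: complex_eq_iff)
  then show ?thesis
  proof cases
    case 1 then show ?thesis using f ab ab' by simp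
  next
    case 2
    have "b * Im w = \<bar>Im w\<bar>" using ab(2,4) by (elim disjE) simp_all
    moreover have "\<bar>Im w\<bar> < Qy" using rh_bound(2)[OF w(1)] w(3) 2(1) by (simp add: nco_def)
    ultimately have Q: "0 < b * Im w" "b * Im w < Qy" using 2(2) by simp_all
    have p: "C + io (mi a b w) \<in> open_segment B C"
      unfolding in_segment
    proof (intro conjI exI[of _ "1 - b * Im w / Qy"])
      show "B \<noteq> C" using corners(2)[of 0] PQ by (auto simp: io_linear complex_eq_iff)
      show "C + io (mi a b w) = (1 - (1 - b * Im w / Qy)) *\<^sub>R B + (1 - b * Im w / Qy) *\<^sub>R C"
        using PQ 2(1) by (simp add: B_def io_def mi_def algebra_simps)
    qed (use Q PQ in auto)
    have "fl Z t (C + io (mi a b w), reflect (C - B) (io (mi a b v)))"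
      by (rule flow.bounce) (use f ab(5) p in \<open>auto simp: sides_def\<close>)
    moreover have "reflect (C - B) (io (mi a b v)) = io (mi a' b' v)" unfolding reflect_BC using 2 by (simp add: mi_def)
    moreover have "mi a b w = mi a' b' w" using 2 by (simp add: mi_def)
    ultimately show ?thesis using ab'(5) by simp
  next
    case 3
    have "a * Re w = \<bar>Re w\<bar>" using ab(1,3) by (elim disjE) simp_all
    moreover have "\<bar>Re w\<bar> < Px" using rh_bound(1)[OF w(1)] w(3) 3(1) by (simp add: nco_def)
    ultimately have Q: "0 < a * Re w" "a * Re w < Px" using 3(2) by simp_all
    have p: "C + io (mi a b w) \<in> open_segment C A"
      unfolding in_segment
    proof (intro conjI exI[of _ "a * Re w / Px"])
      show "C \<noteq> A" using corners(1)[of 0] PQ by (auto simp: io_linear complex_eq_iff)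
      show "C + io (mi a b w) = (1 - a * Re w / Px) *\<^sub>R C + (a * Re w / Px) *\<^sub>R A"
        using PQ 3(1) by (simp add: A_def io_def mi_def algebra_simps)
    qed (use Q PQ in auto)
    have "fl Z t (C + io (mi a b w), reflect (A - C) (io (mi a b v)))"
      by (rule flow.bounce) (use f ab(5) p in \<open>auto simp: sides_def\<close>)
    moreover have "reflect (A - C) (io (mi a b v)) = io (mi a' b' v)" unfolding reflect_CA using 3 by (simp add: mi_def)
    moreover have "mi a b w = mi a' b' w" using 3 by (simp add: mi_def)
    ultimately show ?thesis using ab'(5) by simp
  qed
qed

section \<open>Straight segments inside one rhombus\<close>

lemma rh_convex:
  assumes "rh w0 \<le> 1" "rh w1 \<le> 1" "0 \<le> k" "k \<le> 1" shows "rh ((1 - k) *\<^sub>R w0 + k *\<^sub>R w1) \<le> 1"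
proof -
  have ab: "\<bar>(1 - k) * x + k * y\<bar> \<le> (1 - k) * \<bar>x\<bar> + k * \<bar>y\<bar>" for x y :: real
    using assms(3,4) abs_triangle_ineq[of "(1 - k) * x" "k * y"] by (simp add: abs_mult)
  have "rh ((1 - k) *\<^sub>R w0 + k *\<^sub>R w1) \<le> ((1 - k) * \<bar>Re w0\<bar> + k * \<bar>Re w1\<bar>) / Px + ((1 - k) * \<bar>Im w0\<bar> + k * \<bar>Im w1\<bar>) / Qy"
    unfolding rh_def using PQ ab by (intro add_mono divide_right_mono) auto
  also have "\<dots> = (1 - k) * rh w0 + k * rh w1"
    unfolding rh_def add_divide_distrib times_divide_eq_right[symmetric] distrib_left by simp
  also have "\<dots> \<le> (1 - k) * 1 + k * 1" using assms by (intro add_mono mult_left_mono) auto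
  finally show ?thesis by simp
qed

text \<open>Within the rhombus only the tips reach the maximal coordinates, so the strict bounds at
  \<open>w0\<close> persist up to, but not including, the far end.\<close>

lemma nco_convex:
  assumes r: "rh w0 \<le> 1" "rh w1 \<le> 1" and k: "0 \<le> k" "k < 1" and n: "nco w0"
  shows "nco ((1 - k) *\<^sub>R w0 + k *\<^sub>R w1)"
proof -
  have ab: "\<bar>(1 - k) * x + k * y\<bar> < M" if "\<bar>x\<bar> < M" "\<bar>y\<bar> \<le> M" for x y M :: real
  proof -
    have "\<bar>(1 - k) * x + k * y\<bar> \<le> (1 - k) * \<bar>x\<bar> + k * \<bar>y\<bar>"
      using k abs_triangle_ineq[of "(1 - k) * x" "k * y"] by (simp add: abs_mult)
    moreover have "(1 - k) * \<bar>x\<bar> < (1 - k) * M" "k * \<bar>y\<bar> \<le> k * M" using that k by (auto intro: mult_left_mono)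
    ultimately have "\<bar>(1 - k) * x + k * y\<bar> < (1 - k) * M + k * M" by linarith
    then show ?thesis by (simp add: algebra_simps)
  qed
  note b0 = rh_bound[OF r(1)] and b1 = rh_bound[OF r(2)]
  have "\<bar>Re w0\<bar> < Px" "\<bar>Im w0\<bar> < Qy" 
  proof -
    show "\<bar>Re w0\<bar> < Px" using b0(1,3) n by (cases "\<bar>Re w0\<bar> = Px") (auto simp only: nco_def less_le)
    show "\<bar>Im w0\<bar> < Qy" using b0(2,4) n by (cases "\<bar>Im w0\<bar> = Qy") (auto simp only: nco_def less_le)
  qed
  then have "\<bar>Re ((1 - k) *\<^sub>R w0 + k *\<^sub>R w1)\<bar> < Px" "\<bar>Im ((1 - k) *\<^sub>R w0 + k *\<^sub>R w1)\<bar> < Qy"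
    using ab[OF _ b1(1), of "Re w0"] ab[OF _ b1(2), of "Im w0"] by (simp_all del: abs_mult)
  then show ?thesis unfolding nco_def by linarith
qed

lemma flow_move:
  assumes q: "Re w0 \<ge> 0" "Im w0 \<ge> 0" "Re w1 \<ge> 0" "Im w1 \<ge> 0" and r: "rh w0 \<le> 1" "rh w1 \<le> 1" and n: "nco w0"
    and T: "T > 0" "w1 = w0 + T *\<^sub>R v" and z: "\<And>r. 0 \<le> r \<Longrightarrow> r \<le> T \<Longrightarrow> w0 + r *\<^sub>R v \<noteq> 0"
    and f: "fl Z t (C + io w0, io v)"
  shows "fl Z (t + T) (C + io w1, io v)"
proof -
  have m: "fl Z (t + T) (C + io w0 + T *\<^sub>R io v, io v)"
  proof (rule flow.move[OF f T(1)])
    have c: "w0 + s *\<^sub>R v = (1 - s / T) *\<^sub>R w0 + (s / T) *\<^sub>R w1" for s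
      using T by (simp add: algebra_simps)
    have tr: "C + io w \<in> triangle A B C" if "rh w \<le> 1" "Re w \<ge> 0" "Im w \<ge> 0" for w
      using that by (intro in_triangle) (auto simp: rh_def)
    show "\<forall>s\<in>{0..<T}. C + io w0 + s *\<^sub>R io v \<in> triangle A B C - {A, B, C}"
    proof
      fix s assume s: "s \<in> {0..<T}"
      define w where "w = w0 + s *\<^sub>R v"
      have k: "0 \<le> s / T" "s / T < 1" using s T by auto
      have "rh w \<le> 1" unfolding w_def c by (rule rh_convex) (use r k in auto)
      moreover have "Re ((1 - l) *\<^sub>R w0 + l *\<^sub>R w1) \<ge> 0" "Im ((1 - l) *\<^sub>R w0 + l *\<^sub>R w1) \<ge> 0" if "0 \<le> l" "l < 1" for l
        using q that by simp_all
      then have "Re w \<ge> 0" "Im w \<ge> 0" unfolding w_def c using k by blast+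
      moreover note this
      moreover have "nco w" unfolding w_def c by (rule nco_convex) (use r k n in auto)
      moreover have "w \<noteq> 0" using z s by (simp add: w_def)
      ultimately have "C + io w \<in> triangle A B C" "C + io w \<notin> {A, B, C}" using tr corners[of w] PQ by (auto simp: nco_def)
      then show "C + io w0 + s *\<^sub>R io v \<in> triangle A B C - {A, B, C}" by (simp add: w_def io_linear add.assoc)
    qed
    show "C + io w0 + T *\<^sub>R io v \<in> triangle A B C" using tr[OF r(2)] q T(2) by (simp add: io_linear add.assoc)
  qed
  then show ?thesis by (simp add: T(2) io_linear add.assoc)
qed

lemma rh_mi [simp]: "(a = 1 \<or> a = -1) \<Longrightarrow> (b = 1 \<or> b = -1) \<Longrightarrow> rh (mi a b w) = rh w"
  by (auto simp: rh_def mi_def)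

lemma nco_mi [simp]: "(a = 1 \<or> a = -1) \<Longrightarrow> (b = 1 \<or> b = -1) \<Longrightarrow> nco (mi a b w) = nco w"
  by (auto simp: nco_def mi_def)

lemma mi_linear: "mi a b (w + r *\<^sub>R v) = mi a b w + r *\<^sub>R mi a b v"
  by (simp add: mi_def complex_eq_iff algebra_simps)

lemma seg0:
  assumes s: "a = 1 \<or> a = -1" "b = 1 \<or> b = -1" "a * Re w0 \<ge> 0" "b * Im w0 \<ge> 0" "a * Re w1 \<ge> 0" "b * Im w1 \<ge> 0"
    and r: "rh w0 \<le> 1" "rh w1 \<le> 1" and n: "nco w0" "nco w1"
    and T: "T > 0" "w1 = w0 + T *\<^sub>R v" and z: "\<And>r. 0 \<le> r \<Longrightarrow> r \<le> T \<Longrightarrow> w0 + r *\<^sub>R v \<noteq> 0"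
    and f: "fl Z t y" "repw w0 v y" and y': "repw w1 v y'"
  shows "fl Z (t + T) y'"
proof -
  have mz: "mi a b w \<noteq> 0" if "w \<noteq> 0" for w using that s(1,2) by (auto simp: mi_def complex_eq_iff)
  have r0: "repw w0 v (C + io (mi a b w0), io (mi a b v))" and r1: "repw w1 v (C + io (mi a b w1), io (mi a b v))"
    unfolding repw_def using s by blast+
  have f0: "fl Z t (C + io (mi a b w0), io (mi a b v))"
    by (rule flow_eq[OF r(1) _ n(1) f(2) r0 f(1)]) (use z[of 0] T in auto)
  have "fl Z (t + T) (C + io (mi a b w1), io (mi a b v))"
  proof (rule flow_move[OF _ _ _ _ _ _ _ T(1) _ _ f0])
    show "mi a b w1 = mi a b w0 + T *\<^sub>R mi a b v" by (simp add: T(2) mi_linear)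
    show "mi a b w0 + r *\<^sub>R mi a b v \<noteq> 0" if "0 \<le> r" "r \<le> T" for r
      using mz[OF z[OF that]] by (simp add: mi_linear)
  qed (use s r n in \<open>simp_all add: mi_def[of _ _ w0, THEN arg_cong[of _ _ Re]] mi_def[of _ _ w0, THEN arg_cong[of _ _ Im]] mi_def[of _ _ w1, THEN arg_cong[of _ _ Re]] mi_def[of _ _ w1, THEN arg_cong[of _ _ Im]]\<close>)
  then show ?thesis by (intro flow_eq[OF r(2) _ n(2) r1 y']) (use z[of T] T in auto)
qed

lemma split_root:
  fixes x y :: real assumes "x * y < 0"
  obtains k where "0 < k" "k < 1" "(1 - k) * x + k * y = 0"
proof -
  have "x - y \<noteq> 0" using assms by (auto simp: mult_less_0_iff)
  moreover have "(1 - x / (x - y)) * x + x / (x - y) * y = 0" using \<open>x - y \<noteq> 0\<close> by (simp add: field_simps)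
  moreover have "0 < x / (x - y)" "x / (x - y) < 1" using assms by (auto simp: mult_less_0_iff field_simps zero_less_divide_iff)
  ultimately show ?thesis using that by blast
qed

lemma sign_ex: fixes x y :: real assumes "\<not> x * y < 0" obtains a where "a = 1 \<or> a = -1" "a * x \<ge> 0" "a * y \<ge> 0"
proof (cases "x \<ge> 0 \<and> y \<ge> 0")
  case True then show ?thesis using that[of 1] by simp
next
  case False then show ?thesis using assms that[of "-1"] by (auto simp: mult_less_0_iff)
qed

text \<open>The segment is cut where it meets the real axis and \<open>seg0\<close> applied to both
  pieces. The folding of the cut point can be chosen freely, which absorbs the bounce.
  \<open>seg\<close> then treats the imaginary axis in the same way.\<close>

lemma seg1:
  assumes s: "a = 1 \<or> a = -1" "a * Re w0 \<ge> 0" "a * Re w1 \<ge> 0"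
    and r: "rh w0 \<le> 1" "rh w1 \<le> 1" and n: "nco w0" "nco w1"
    and T: "T > 0" "w1 = w0 + T *\<^sub>R v" and z: "\<And>r. 0 \<le> r \<Longrightarrow> r \<le> T \<Longrightarrow> w0 + r *\<^sub>R v \<noteq> 0"
    and f: "fl Z t y" "repw w0 v y" and y': "repw w1 v y'"
  shows "fl Z (t + T) y'"
proof (cases "Im w0 * Im w1 < 0")
  case False
  obtain b where b: "b = 1 \<or> b = -1" "b * Im w0 \<ge> 0" "b * Im w1 \<ge> 0" by (rule sign_ex[OF False])
  show ?thesis by (rule seg0[OF s(1) b(1) s(2) b(2) s(3) b(3) r n T z f y'])
next
  case True
  obtain k where k: "0 < k" "k < 1" "(1 - k) * Im w0 + k * Im w1 = 0" by (rule split_root[OF True])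
  define w where "w = (1 - k) *\<^sub>R w0 + k *\<^sub>R w1"
  have w: "w = w0 + (k * T) *\<^sub>R v" "w1 = w + ((1 - k) * T) *\<^sub>R v" using T(2) by (simp_all add: w_def algebra_simps)
  have rw: "rh w \<le> 1" unfolding w_def by (rule rh_convex) (use r k in auto)
  have nw: "nco w" unfolding w_def by (rule nco_convex) (use r k n in auto)
  have iw: "Im w = 0" "a * Re w \<ge> 0" 
  proof -
    show "Im w = 0" using k(3) by (simp add: w_def)
    have "a * Re w = (1 - k) * (a * Re w0) + k * (a * Re w1)" by (simp add: w_def algebra_simps)
    then show "a * Re w \<ge> 0" using s k by simp
  qed
  obtain ym where ym: "repw w v ym" by (rule repw_ex)
  have kT: "0 < k * T" "0 < (1 - k) * T" "k * T + (1 - k) * T = T" using k T by (auto simp: algebra_simps)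
  define b where "b = (if Im w0 \<ge> 0 then 1 else -1 :: real)"
  define b' where "b' = (if Im w1 \<ge> 0 then 1 else -1 :: real)"
  have 1: "fl Z (t + k * T) ym"
    by (rule seg0[OF s(1) _ s(2) _ iw(2) _ r(1) rw n(1) nw kT(1) w(1) _ f ym, of b]) (use z kT iw in \<open>auto simp: b_def\<close>)
  have "fl Z (t + k * T + (1 - k) * T) y'"
  proof (rule seg0[OF s(1) _ iw(2) _ s(3) _ rw r(2) nw n(2) kT(2) w(2) _ 1 ym y', of b'])
    fix q assume q: "0 \<le> q" "q \<le> (1 - k) * T"
    have "w + q *\<^sub>R v = w0 + (k * T + q) *\<^sub>R v" by (simp add: w(1) algebra_simps)
    then show "w + q *\<^sub>R v \<noteq> 0" using z[of "k * T + q"] q kT by simp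
  qed (use iw in \<open>auto simp: b'_def\<close>)
  then show ?thesis using kT(3) by (simp add: add.assoc)
qed

lemma seg:
  assumes r: "rh w0 \<le> 1" "rh w1 \<le> 1" and n: "nco w0" "nco w1"
    and T: "T > 0" "w1 = w0 + T *\<^sub>R v" and z: "\<And>r. 0 \<le> r \<Longrightarrow> r \<le> T \<Longrightarrow> w0 + r *\<^sub>R v \<noteq> 0"
    and f: "fl Z t y" "repw w0 v y" and y': "repw w1 v y'"
  shows "fl Z (t + T) y'"
proof (cases "Re w0 * Re w1 < 0")
  case False
  obtain b where b: "b = 1 \<or> b = -1" "b * Re w0 \<ge> 0" "b * Re w1 \<ge> 0" by (rule sign_ex[OF False])
  show ?thesis by (rule seg1[OF b r n T z f y'])
next
  case True
  obtain k where k: "0 < k" "k < 1" "(1 - k) * Re w0 + k * Re w1 = 0" by (rule split_root[OF True])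
  define w where "w = (1 - k) *\<^sub>R w0 + k *\<^sub>R w1"
  have w: "w = w0 + (k * T) *\<^sub>R v" "w1 = w + ((1 - k) * T) *\<^sub>R v" using T(2) by (simp_all add: w_def algebra_simps)
  have rw: "rh w \<le> 1" unfolding w_def by (rule rh_convex) (use r k in auto)
  have nw: "nco w" unfolding w_def by (rule nco_convex) (use r k n in auto)
  have iw: "Re w = 0" using k(3) by (simp add: w_def)
  obtain ym where ym: "repw w v ym" by (rule repw_ex)
  have kT: "0 < k * T" "0 < (1 - k) * T" "k * T + (1 - k) * T = T" using k T by (auto simp: algebra_simps)
  define b where "b = (if Re w0 \<ge> 0 then 1 else -1 :: real)"
  define b' where "b' = (if Re w1 \<ge> 0 then 1 else -1 :: real)"
  have 1: "fl Z (t + k * T) ym"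
    by (rule seg1[OF _ _ _ r(1) rw n(1) nw kT(1) w(1) _ f ym, of b]) (use z kT iw in \<open>auto simp: b_def\<close>)
  have "fl Z (t + k * T + (1 - k) * T) y'"
  proof (rule seg1[OF _ _ _ rw r(2) nw n(2) kT(2) w(2) _ 1 ym y', of b'])
    fix q assume q: "0 \<le> q" "q \<le> (1 - k) * T"
    have "w + q *\<^sub>R v = w0 + (k * T + q) *\<^sub>R v" by (simp add: w(1) algebra_simps)
    then show "w + q *\<^sub>R v \<noteq> 0" using z[of "k * T + q"] q kT by simp
  qed (use iw in \<open>auto simp: b'_def\<close>)
  then show ?thesis using kT(3) by (simp add: add.assoc)
qed

section \<open>Following a chain of rhombi\<close>

definition rp :: "complex \<Rightarrow> int \<Rightarrow> complex \<Rightarrow> complex \<Rightarrow> point \<times> point \<Rightarrow> bool" where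
  "rp c l x u y \<longleftrightarrow> repw (wc c l x) (cis (- (2 * of_int l * \<alpha>)) * u) y"

text \<open>Folding forgets half turns about the centre. This is what reverses a trajectory of the
  unfolding without any motion of the billiard.\<close>

lemma rp_flip: "rp c l (c + r) u y \<longleftrightarrow> rp c l (c - r) (- u) y"
  using repw_uminus[of "wc c l (c + r)" "cis (- (2 * of_int l * \<alpha>)) * u" y] by (simp add: rp_def wc_def)

lemma wc_add: "wc c l (x + r *\<^sub>R u) = wc c l x + r *\<^sub>R (cis (- (2 * of_int l * \<alpha>)) * u)"
  by (simp add: wc_def algebra_simps)

text \<open>Assumption \<open>z\<close> says that the line misses the centre, which folds to the
  corner \<open>C\<close>.\<close>

lemma tile_seg:
  assumes r: "rh (wc c l x) \<le> 1" "rh (wc c l (x + T *\<^sub>R u)) \<le> 1" and n: "nco (wc c l x)" "nco (wc c l (x + T *\<^sub>R u))"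
    and T: "T > 0" and z: "cr u (c - x) \<noteq> 0"
    and f: "fl Z t y" "rp c l x u y" and y': "rp c l (x + T *\<^sub>R u) u y'"
  shows "fl Z (t + T) y'"
proof (rule seg[OF r n T wc_add _ f(1) f(2)[unfolded rp_def] y'[unfolded rp_def]])
  fix q
  show "wc c l x + q *\<^sub>R (cis (- (2 * of_int l * \<alpha>)) * u) \<noteq> 0"
  proof
    assume "wc c l x + q *\<^sub>R (cis (- (2 * of_int l * \<alpha>)) * u) = 0"
    then have "wc c l (x + q *\<^sub>R u) = 0" by (simp add: wc_add)
    then have "x + q *\<^sub>R u = c" by (simp add: wc_def)
    then have "c - x = q *\<^sub>R u" by auto
    then show False using z by (simp add: cr_simps)
  qed
qed

lemma edge_tile:
  assumes "0 < t" "t < 1" "s = 1 \<or> s = -1" "d = 1 \<or> d = (-1::int)"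
  shows "rh (Complex (- s * (1 - t) * Px) (of_int d * s * t * Qy)) \<le> 1" "nco (Complex (- s * (1 - t) * Px) (of_int d * s * t * Qy))"
  using assms PQ by (auto simp: rh_def nco_def abs_mult)

lemma sign_unique: "a = 1 \<or> a = (-1::real) \<Longrightarrow> s = 1 \<or> s = -1 \<Longrightarrow> 0 \<le> a * (s * x) \<Longrightarrow> 0 < x \<Longrightarrow> a = s"
  by auto

text \<open>Neighbouring rhombi are mirror images in their common side. The two foldings of a
  crossing point therefore agree in position and differ in direction by the reflection in the
  hypotenuse, which is a bounce.\<close>

lemma cross_edge:
  assumes v: "vld \<sigma>" and x: "x = av \<sigma> + (t * sg \<sigma>) *\<^sub>R E (kl \<sigma>)" and t: "0 < t" "t < 1"
    and y: "rp (nctr \<sigma>) (nlev \<sigma>) x u y" and f: "fl Z T y" and y': "rp (ctr \<sigma>) (flev \<sigma>) x u y'"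
  shows "fl Z T y'"
proof -
  define s where "s = sg \<sigma>"
  have s: "s = 1 \<or> s = -1" and d: "dd \<sigma> = 1 \<or> dd \<sigma> = -1" using v by (auto simp: vld_def s_def)
  define vn where "vn = cis (- (2 * of_int (nlev \<sigma>) * \<alpha>)) * u"
  define vf where "vf = cis (- (2 * of_int (flev \<sigma>) * \<alpha>)) * u"
  have fl: "flev \<sigma> = nlev \<sigma> + dd \<sigma>" using d by (auto simp: flev_def nlev_def)
  have vfn: "vf = cis (- (2 * of_int (dd \<sigma>) * \<alpha>)) * vn" unfolding vf_def vn_def fl mult.assoc[symmetric] cis_mult
    by (simp add: algebra_simps)
  \<comment> \<open>An inner point of a side lies on no axis, so its folding is unique.\<close>
  have uniq: "z = (C + io (Complex ((1 - t) * Px) (t * Qy)), io (mi (- s) (b * s) w))"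
    if rr: "repw (Complex (- s * (1 - t) * Px) (b * s * t * Qy)) w z" and bb: "b = 1 \<or> b = -1" for b w z
  proof -
    obtain a' b' where ab: "(a' = 1 \<or> a' = -1)" "(b' = 1 \<or> b' = -1)" "a' * (- s * (1 - t) * Px) \<ge> 0" "b' * (b * s * t * Qy) \<ge> 0"
      "z = (C + io (mi a' b' (Complex (- s * (1 - t) * Px) (b * s * t * Qy))), io (mi a' b' w))"
      using rr unfolding repw_def complex.sel by blast
    have p: "(1 - t) * Px > 0" "t * Qy > 0" using t PQ by auto
    have "a' * (- s * ((1 - t) * Px)) \<ge> 0" using ab(3) by (simp only: mult.assoc)
    then have "a' = - s" by (intro sign_unique[OF ab(1) _ _ p(1)]) (use s in auto)
    moreover have "b' * (b * s * (t * Qy)) \<ge> 0" using ab(4) by (simp only: mult.assoc)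
    then have "b' = b * s" by (intro sign_unique[OF ab(2) _ _ p(2)]) (use s bb in auto)
    moreover have "mi (- s) (b * s) (Complex (- s * (1 - t) * Px) (b * s * t * Qy)) = Complex ((1 - t) * Px) (t * Qy)"
      using s bb by (auto simp: mi_def)
    ultimately show ?thesis using ab(5) by simp
  qed
  have y1: "y = (C + io (Complex ((1 - t) * Px) (t * Qy)), io (mi (- s) (of_int (dd \<sigma>) * s) vn))"
    by (rule uniq) (use y edge_near[OF v x] d in \<open>auto simp: rp_def vn_def s_def\<close>)
  have y2: "y' = (C + io (Complex ((1 - t) * Px) (t * Qy)), io (mi (- s) (- of_int (dd \<sigma>) * s) vf))"
    by (rule uniq) (use y' edge_far[OF v x] d in \<open>auto simp: rp_def vf_def s_def\<close>)
  have m: "cis (- (2 * \<alpha>)) * cnj (mi (- s) (of_int (dd \<sigma>) * s) vn) = mi (- s) (- of_int (dd \<sigma>) * s) vf"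
    using d
  proof
    assume d: "dd \<sigma> = 1"
    have "mi (- s) (- of_int (dd \<sigma>) * s) w = (- s) *\<^sub>R w" "cnj (mi (- s) (of_int (dd \<sigma>) * s) w) = (- s) *\<^sub>R w" for w
      using d by (simp_all add: mi_def complex_eq_iff)
    then show ?thesis using vfn d by simp
  next
    assume d: "dd \<sigma> = -1"
    have "mi (- s) (- of_int (dd \<sigma>) * s) w = (- s) *\<^sub>R cnj w" "cnj (mi (- s) (of_int (dd \<sigma>) * s) w) = (- s) *\<^sub>R cnj w" for w
      using d by (simp_all add: mi_def complex_eq_iff)
    then show ?thesis using vfn d by (simp add: cis_cnj)
  qed
  have p: "C + io (Complex ((1 - t) * Px) (t * Qy)) \<in> open_segment A B"
    unfolding in_segment
  proof (intro conjI exI[of _ t])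
    show "A \<noteq> B" using corners(2)[of "of_real Px"] PQ AB_io by (auto simp: complex_eq_iff)
    show "C + io (Complex ((1 - t) * Px) (t * Qy)) = (1 - t) *\<^sub>R A + t *\<^sub>R B"
      by (simp add: A_def B_def io_def algebra_simps)
  qed (use t in auto)
  have "fl Z T (C + io (Complex ((1 - t) * Px) (t * Qy)), reflect (B - A) (io (mi (- s) (of_int (dd \<sigma>) * s) vn)))"
    by (rule flow.bounce) (use f y1 p in \<open>auto simp: sides_def\<close>)
  then show ?thesis unfolding y2 reflect_AB m .
qed

lemma sd_along: "sd \<sigma> (x + r *\<^sub>R u) = sd \<sigma> x + r * gap u \<sigma>"
  unfolding gap_eq by (simp add: sd_def cr_simps cr_swap[of u] algebra_simps)

lemma chain_flow:
  assumes g: "chain g n" and ray: "\<And>i. i \<le> n \<Longrightarrow> ray x u (g i)" and s0: "sd (g 0) x < 0"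
    and r0: "rh (wc (nctr (g 0)) (nlev (g 0)) x) \<le> 1" "nco (wc (nctr (g 0)) (nlev (g 0)) x)"
    and c: "cr u (nctr (g 0) - x) \<noteq> 0" "\<And>i. i \<le> n \<Longrightarrow> cr u (ctr (g i) - x) \<noteq> 0"
    and s1: "sd (g n) (x + T *\<^sub>R u) > 0"
    and r1: "rh (wc (ctr (g n)) (flev (g n)) (x + T *\<^sub>R u)) \<le> 1" "nco (wc (ctr (g n)) (flev (g n)) (x + T *\<^sub>R u))"
    and f: "fl Z t y" "rp (nctr (g 0)) (nlev (g 0)) x u y" and y': "rp (ctr (g n)) (flev (g n)) (x + T *\<^sub>R u) u y'"
  shows "fl Z (t + T) y'"
proof -
  have v: "vld (g i)" if "i \<le> n" for i by (rule chain_vld[OF g that])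
  define \<tau> where "\<tau> i = - sd (g i) x / gap u (g i)" for i
  have gp: "gap u (g i) > 0" if "i \<le> n" for i using gap_pos ray[OF that] by blast
  have sX: "sd (g i) (x + \<tau> i *\<^sub>R u) = 0" if "i \<le> n" for i
    unfolding sd_along \<tau>_def using gp[OF that] by simp
  have rX: "ray (x + q *\<^sub>R u) u (g i)" if "i \<le> n" for i q using ray[OF that] by (simp add: cr_simps)
  have X: "\<exists>k. 0 < k \<and> k < 1 \<and> x + \<tau> i *\<^sub>R u = av (g i) + (k * sg (g i)) *\<^sub>R E (kl (g i))" if "i \<le> n" for i
    by (rule on_edge[OF v[OF that] sX[OF that] rX[OF that]]) blast
  have near: "rh (wc (nctr (g i)) (nlev (g i)) (x + \<tau> i *\<^sub>R u)) \<le> 1 \<and> nco (wc (nctr (g i)) (nlev (g i)) (x + \<tau> i *\<^sub>R u))"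
    and far: "rh (wc (ctr (g i)) (flev (g i)) (x + \<tau> i *\<^sub>R u)) \<le> 1 \<and> nco (wc (ctr (g i)) (flev (g i)) (x + \<tau> i *\<^sub>R u))" if i: "i \<le> n" for i
  proof -
    obtain k where k: "0 < k" "k < 1" "x + \<tau> i *\<^sub>R u = av (g i) + (k * sg (g i)) *\<^sub>R E (kl (g i))" using X[OF i] by blast
    have sd: "sg (g i) = 1 \<or> sg (g i) = -1" "dd (g i) = 1 \<or> dd (g i) = -1" "- dd (g i) = 1 \<or> - dd (g i) = -1" using v[OF i] by (auto simp: vld_def)
    show "rh (wc (nctr (g i)) (nlev (g i)) (x + \<tau> i *\<^sub>R u)) \<le> 1 \<and> nco (wc (nctr (g i)) (nlev (g i)) (x + \<tau> i *\<^sub>R u))"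
      unfolding edge_near[OF v[OF i] k(3)] using edge_tile[OF k(1,2) sd(1,2)] by blast
    show "rh (wc (ctr (g i)) (flev (g i)) (x + \<tau> i *\<^sub>R u)) \<le> 1 \<and> nco (wc (ctr (g i)) (flev (g i)) (x + \<tau> i *\<^sub>R u))"
      unfolding edge_far[OF v[OF i] k(3)] using edge_tile[OF k(1,2) sd(1,3)] by simp
  qed
  have cross: "fl Z q y2" if h: "i \<le> n" "fl Z q y1" "rp (nctr (g i)) (nlev (g i)) (x + \<tau> i *\<^sub>R u) u y1" "rp (ctr (g i)) (flev (g i)) (x + \<tau> i *\<^sub>R u) u y2" for i q y1 y2
  proof -
    obtain k where k: "0 < k" "k < 1" "x + \<tau> i *\<^sub>R u = av (g i) + (k * sg (g i)) *\<^sub>R E (kl (g i))" using X[OF h(1)] by blast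
    show ?thesis by (rule cross_edge[OF v[OF h(1)] k(3,1,2) h(3,2,4)])
  qed
  have ex: "\<exists>y. rp c l q u y" for c l q unfolding rp_def using repw_ex by metis
  have \<tau>0: "\<tau> 0 > 0" unfolding \<tau>_def using s0 gp[of 0] by (simp add: divide_neg_pos)
  have inc: "\<tau> i < \<tau> (Suc i)" if "Suc i \<le> n" for i
  proof -
    have "sd (g (Suc i)) (x + \<tau> i *\<^sub>R u) < 0"
      by (rule chain_sd_fwd0[OF g, of i "Suc i" u]) (use that rX sX in auto)
    then have "\<tau> i * gap u (g (Suc i)) < - sd (g (Suc i)) x" unfolding sd_along by linarith
    then show ?thesis unfolding \<tau>_def[of "Suc i"] using gp[OF that] by (subst pos_less_divide_eq) auto
  qed
  have split: "x + b *\<^sub>R u = (x + a *\<^sub>R u) + (b - a) *\<^sub>R u" for a b by (simp add: algebra_simps)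
  have P: "fl Z (t + \<tau> i) y2" if "i \<le> n" "rp (ctr (g i)) (flev (g i)) (x + \<tau> i *\<^sub>R u) u y2" for i y2
    using that
  proof (induction i arbitrary: y2)
    case 0
    obtain y1 where y1: "rp (nctr (g 0)) (nlev (g 0)) (x + \<tau> 0 *\<^sub>R u) u y1" using ex by blast
    have "fl Z (t + \<tau> 0) y1"
      by (rule tile_seg[OF r0(1) _ r0(2) _ \<tau>0 c(1) f y1]) (use near[of 0] in auto)
    from cross[OF _ this y1 0(2)] show ?case by simp
  next
    case (Suc i)
    have i: "i \<le> n" using Suc.prems by simp
    obtain y0 where y0: "rp (ctr (g i)) (flev (g i)) (x + \<tau> i *\<^sub>R u) u y0" using ex by blast
    obtain y1 where y1: "rp (nctr (g (Suc i))) (nlev (g (Suc i))) (x + \<tau> (Suc i) *\<^sub>R u) u y1" using ex by blast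
    obtain mm where mm: "g (Suc i) = step mm (g i)" by (rule chain_stepE[OF g, of i]) (use Suc.prems in auto)
    have nf: "nctr (g (Suc i)) = ctr (g i)" "nlev (g (Suc i)) = flev (g i)" unfolding mm using nctr_step[OF v[OF i]] by auto
    have f0: "fl Z (t + \<tau> i) y0" by (rule Suc.IH[OF i y0])
    have "fl Z (t + \<tau> i + (\<tau> (Suc i) - \<tau> i)) y1"
    proof (rule tile_seg[OF _ _ _ _ _ _ f0 y0])
      show "rp (ctr (g i)) (flev (g i)) (x + \<tau> i *\<^sub>R u + (\<tau> (Suc i) - \<tau> i) *\<^sub>R u) u y1"
        using y1 unfolding nf by (simp add: split[symmetric])
      show "0 < \<tau> (Suc i) - \<tau> i" using inc[OF Suc.prems(1)] by simp
      show "cr u (ctr (g i) - (x + \<tau> i *\<^sub>R u)) \<noteq> 0" using c(2)[OF i] by (simp add: cr_simps)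
    qed (use far[OF i] near[OF Suc.prems(1)] in \<open>auto simp: nf split[symmetric]\<close>)
    then have "fl Z (t + \<tau> (Suc i)) y1" by simp
    from cross[OF Suc.prems(1) this y1 Suc.prems(2)] show ?case .
  qed
  have lt: "\<tau> n < T"
  proof -
    have "- sd (g n) x < T * gap u (g n)" using s1 unfolding sd_along by linarith
    then show ?thesis unfolding \<tau>_def using gp[of n] by (subst pos_divide_less_eq) auto
  qed
  obtain y0 where y0: "rp (ctr (g n)) (flev (g n)) (x + \<tau> n *\<^sub>R u) u y0" using ex by blast
  have f0: "fl Z (t + \<tau> n) y0" by (rule P[OF order_refl y0])
  have "fl Z (t + \<tau> n + (T - \<tau> n)) y'"
  proof (rule tile_seg[OF _ _ _ _ _ _ f0 y0])
    show "rp (ctr (g n)) (flev (g n)) (x + \<tau> n *\<^sub>R u + (T - \<tau> n) *\<^sub>R u) u y'" using y' by (simp add: split[symmetric])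
    show "cr u (ctr (g n) - (x + \<tau> n *\<^sub>R u)) \<noteq> 0" using c(2)[of n] by (simp add: cr_simps)
  qed (use lt far[of n] r1 in \<open>auto simp: split[symmetric]\<close>)
  then show ?thesis by simp
qed

end

section \<open>Periodic trajectories and their density\<close>

lemma ev_lin_pos: "a > 0 \<Longrightarrow> eventually (\<lambda>t. a + t * b > (0::real)) (at_right 0)"
proof -
  assume "a > 0"
  have "((\<lambda>t. a + t * b) \<longlongrightarrow> a + 0 * b) (at_right 0)" by (intro tendsto_intros)
  then show ?thesis using \<open>a > 0\<close> by (auto dest: order_tendstoD(1))
qed

lemma ev_lin_ne: "a \<noteq> 0 \<or> b \<noteq> 0 \<Longrightarrow> eventually (\<lambda>t. a + t * b \<noteq> (0::real)) (at_right 0)"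
proof -
  assume ab: "a \<noteq> 0 \<or> b \<noteq> 0"
  consider "a > 0" | "a < 0" | "a = 0" "b \<noteq> 0" using ab by linarith
  then show ?thesis
  proof cases
    case 1 from ev_lin_pos[OF 1, of b] show ?thesis by eventually_elim simp
  next
    case 2
    then have "- a > 0" by simp
    from ev_lin_pos[OF this, of "- b"] show ?thesis by eventually_elim (auto simp: algebra_simps)
  next
    case 3
    have "eventually (\<lambda>t::real. t > 0) (at_right 0)" by (simp add: eventually_at_right_less)
    then show ?thesis by eventually_elim (use 3 in auto)
  qed
qed

lemma wedge_ball:
  assumes u: "u \<noteq> 0" and d: "\<delta> > 0"
  obtains a b where "cr a b > 0" "\<And>v. v \<in> wedge a b \<Longrightarrow> \<exists>c v'. c > 0 \<and> v' \<in> ball u \<delta> \<and> v = c *\<^sub>R v'"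
proof -
  define k where "k = \<delta> / (2 * norm u)"
  have k: "k > 0" "k * norm u < \<delta>" using u d by (auto simp: k_def)
  define a where "a = u - k *\<^sub>R (\<i> * u)"
  define b where "b = u + k *\<^sub>R (\<i> * u)"
  have iu: "cr u (\<i> * u) = norm u ^ 2" "cr (\<i> * u) u = - (norm u ^ 2)" unfolding cmod_power2 by (simp_all add: cr_def power2_eq_square)
  have ab: "cr a b > 0" using k u by (simp add: a_def b_def cr_simps iu)
  have "a \<in> ball u \<delta>" "b \<in> ball u \<delta>" using k by (simp_all add: a_def b_def dist_norm norm_mult)
  then have seg: "(1 - t) *\<^sub>R a + t *\<^sub>R b \<in> ball u \<delta>" if "0 \<le> t" "t \<le> 1" for t
    using that convex_ball[of u \<delta>] unfolding convex_alt by blast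
  show ?thesis
  proof (rule that[OF ab])
    fix v assume "v \<in> wedge a b"
    then obtain s t where st: "s > 0" "t > 0" "v = s *\<^sub>R a + t *\<^sub>R b" by (rule wedge_combo[OF _ ab])
    have "1 - t / (s + t) = s / (s + t)" using st by (simp add: field_simps)
    then have "v = (s + t) *\<^sub>R ((1 - t / (s + t)) *\<^sub>R a + (t / (s + t)) *\<^sub>R b)" using st by (simp add: scaleR_add_right)
    then show "\<exists>c v'. c > 0 \<and> v' \<in> ball u \<delta> \<and> v = c *\<^sub>R v'"
      using st seg[of "t / (s + t)"] by (intro exI[of _ "s + t"] exI[of _ "(1 - t / (s + t)) *\<^sub>R a + (t / (s + t)) *\<^sub>R b"]) auto
  qed
qed

context geo
begin

lemma rh_lt: assumes "rh w < 1" shows "\<bar>Re w\<bar> < Px" "\<bar>Im w\<bar> < Qy"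
proof -
  have p: "\<bar>Re w\<bar> / Px \<ge> 0" "\<bar>Im w\<bar> / Qy \<ge> 0" using PQ by auto
  have "\<bar>Re w\<bar> / Px < 1" "\<bar>Im w\<bar> / Qy < 1" using assms p unfolding rh_def by linarith+
  then show "\<bar>Re w\<bar> < Px" "\<bar>Im w\<bar> < Qy" using PQ by (simp_all add: divide_less_eq)
qed

lemma rh_cont: "continuous_on UNIV rh"
  unfolding rh_def by (intro continuous_intros) (use PQ in auto)

lemma rh_small: assumes "norm w * (1 / Px + 1 / Qy) < 1" shows "rh w < 1"
proof -
  have "rh w \<le> norm w / Px + norm w / Qy" unfolding rh_def using PQ abs_Re_le_cmod[of w] abs_Im_le_cmod[of w]
    by (intro add_mono divide_right_mono) auto
  also have "\<dots> = norm w * (1 / Px + 1 / Qy)" by (simp add: algebra_simps)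
  finally show ?thesis using assms by linarith
qed

lemma norm_wc: "norm (wc c l x) = norm (x - c)"
  by (simp add: wc_def norm_mult)

lemma exit_edge:
  assumes w: "rh w < 1" and u: "u \<noteq> 0"
    and gen: "cr u (of_real Px - w) \<noteq> 0" "cr u (- of_real Px - w) \<noteq> 0" "cr u (Complex 0 Qy - w) \<noteq> 0" "cr u (Complex 0 (- Qy) - w) \<noteq> 0"
  obtains \<sigma> where "vld \<sigma>" "nctr \<sigma> = 0" "nlev \<sigma> = 0" "ray w u \<sigma>"
proof -
  \<comment> \<open>After this time the point has norm at least \<open>Px + Qy\<close>, which no
    interior point of the rhombus has.\<close>
  define T1 where "T1 = (norm w + Px + Qy) / norm u"
  have nu: "norm u > 0" using u by simp
  have T1: "T1 \<ge> 0" using PQ nu by (simp add: T1_def)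
  have "rh (w + T1 *\<^sub>R u) \<ge> 1"
  proof (rule ccontr)
    assume "\<not> ?thesis"
    then have "\<bar>Re (w + T1 *\<^sub>R u)\<bar> < Px" "\<bar>Im (w + T1 *\<^sub>R u)\<bar> < Qy" using rh_lt by (meson not_le)+
    then have "norm (w + T1 *\<^sub>R u) < Px + Qy" using cmod_le[of "w + T1 *\<^sub>R u"] by linarith
    moreover have "norm (T1 *\<^sub>R u) = norm w + Px + Qy" using nu PQ T1 by (simp add: T1_def)
    ultimately show False using norm_triangle_ineq[of "w + T1 *\<^sub>R u" "- w"] by simp
  qed
  moreover have "continuous_on {0..T1} (\<lambda>T. rh (w + T *\<^sub>R u))"
    by (rule continuous_on_compose2[OF rh_cont]) (auto intro!: continuous_intros)
  ultimately obtain T where T: "0 \<le> T" "T \<le> T1" "rh (w + T *\<^sub>R u) = 1"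
    using IVT'[of "\<lambda>T. rh (w + T *\<^sub>R u)" 0 1 T1] w T1 by auto
  define x where "x = w + T *\<^sub>R u"
  have Tp: "T > 0" using T w by (cases "T = 0") auto
  have cx: "cr u (x - w) = 0" by (simp add: x_def cr_simps)
  have r1: "\<bar>Re x\<bar> / Px + \<bar>Im x\<bar> / Qy = 1" using T(3) by (simp add: rh_def x_def)
  have ne: "Re x \<noteq> 0" "Im x \<noteq> 0"
  proof -
    show "Re x \<noteq> 0"
    proof
      assume z: "Re x = 0"
      then have "\<bar>Im x\<bar> = Qy" using r1 PQ by (simp add: field_simps)
      then have "x = Complex 0 Qy \<or> x = Complex 0 (- Qy)" using z by (auto simp: complex_eq_iff abs_if split: if_splits)
      then show False using gen cx by auto
    qed
    show "Im x \<noteq> 0"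
    proof
      assume z: "Im x = 0"
      then have "\<bar>Re x\<bar> = Px" using r1 PQ by (simp add: field_simps)
      then have "x = of_real Px \<or> x = - of_real Px" using z by (auto simp: complex_eq_iff abs_if split: if_splits)
      then show False using gen cx by auto
    qed
  qed
  \<comment> \<open>The quadrant of the exit point \<open>x\<close> selects the side: its
    \<open>A\<close>-vertex lies on the same side of the imaginary axis as \<open>x\<close>.\<close>
  define s where "s = (if Re x > 0 then -1 else 1 :: real)"
  define d where "d = (if (Im x > 0) = (Re x > 0) then -1 else 1 :: int)"
  define t where "t = \<bar>Im x\<bar> / Qy"
  have t: "0 < t" "t < 1" "1 - t = \<bar>Re x\<bar> / Px"
  proof -
    have "\<bar>Re x\<bar> / Px > 0" "\<bar>Im x\<bar> / Qy > 0" using ne PQ by auto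
    then show "0 < t" "t < 1" "1 - t = \<bar>Re x\<bar> / Px" using r1 unfolding t_def by linarith+
  qed
  have d1: "d = 1 \<or> d = -1" by (simp add: d_def)
  define \<sigma> where "\<sigma> = DS (if d = 1 then 0 else -1) (of_real (- s * Px)) s d"
  have v: "vld \<sigma>" by (simp add: vld_def \<sigma>_def s_def d_def)
  have E0: "E 0 = Complex Px Qy" "E (-1) = Complex Px (- Qy)" using E_level[of 0] by simp_all
  have Ek: "E (kl \<sigma>) = Complex Px (of_int d * Qy)" "E (kl \<sigma> - dd \<sigma>) = Complex Px (- of_int d * Qy)"
    using E0 d1 by (auto simp: \<sigma>_def)
  have n: "nctr \<sigma> = 0" "nlev \<sigma> = 0"
    using d1 unfolding nctr_def Ek by (auto simp: \<sigma>_def nlev_def complex_eq_iff)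
  have "Re x = - s * ((1 - t) * Px)" "Im x = of_int d * (s * (t * Qy))"
    using t(3) PQ ne by (auto simp: s_def d_def t_def)
  then have xe: "x = av \<sigma> + (t * sg \<sigma>) *\<^sub>R E (kl \<sigma>)" unfolding Ek
    by (simp add: complex_eq_iff \<sigma>_def algebra_simps)
  have sw: "sd \<sigma> w < 0" by (rule near_inside[OF v]) (use w n in \<open>simp add: wc_def\<close>)
  have "sd \<sigma> x = 0" unfolding sd_def xe by (simp add: cr_simps)
  moreover have "sd \<sigma> x = sd \<sigma> w + T * gap u \<sigma>"
    unfolding gap_eq x_def by (simp add: sd_def cr_simps cr_swap[of u] algebra_simps)
  ultimately have "T * gap u \<sigma> > 0" using sw by linarith
  then have gp: "gap u \<sigma> > 0" using Tp by (simp add: zero_less_mult_iff)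
  have "ray x u \<sigma>"
  proof -
    have "of_int (dd \<sigma>) * cr u (av \<sigma> - x) = t * gap u \<sigma>" "of_int (dd \<sigma>) * cr u (x - Bv \<sigma>) = (1 - t) * gap u \<sigma>"
      unfolding gap_eq xe Bv_def by (simp_all add: cr_simps algebra_simps)
    then show ?thesis unfolding ray_iff using gp t(1,2) by (metis mult_pos_pos diff_gt_0_iff_gt)
  qed
  then have "ray w u \<sigma>" using cx by (simp add: cr_simps)
  then show ?thesis using that v n by blast
qed

end

context bill
begin
lemma nco_lt: "rh w < 1 \<Longrightarrow> nco w" using rh_lt by (force simp: nco_def)

text \<open>The displacement must be small, so that the same sides are crossed, but nonzero: the
  centres on the line, both ends included, are copies of the corner \<open>C\<close>. The three legs
  last \<open>k\<close>, \<open>D\<close> and \<open>D - k\<close>, so the period is twice the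
  distance of the centres.\<close>

lemma periodic_line:
  assumes H: "chain H n" "K < n" and w: "norm w = 1" and r: "\<And>i. i \<le> n \<Longrightarrow> ray (nctr (H 0)) w (H i)"
    and D: "ctr (H n) = nctr (H 0) + D *\<^sub>R w" "D > 0"
    and y: "y = nctr (H 0) + k *\<^sub>R w" "rh (wc (ctr (H K)) (flev (H K)) y) < 1" and e: "\<eta> > 0"
  obtains x T where "norm (x - y) < \<eta>" "T > 0" "rh (wc (ctr (H K)) (flev (H K)) x) < 1"
    "\<And>y0. rp (ctr (H K)) (flev (H K)) x (- w) y0 \<Longrightarrow> fl y0 T y0"
proof -
  define c1 where "c1 = nctr (H 0)"
  define c2 where "c2 = ctr (H n)"
  have v: "vld (H i)" if "i \<le> n" for i by (rule chain_vld[OF H(1) that])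
  have wi: "cr w (\<i> * w) = 1" using w by (simp add: cr_def cmod_def power2_eq_square)
  have ev1: "eventually (\<lambda>t. \<forall>i\<le>n. ray (c1 + t *\<^sub>R (\<i> * w)) w (H i) \<and> ray (c1 - t *\<^sub>R (\<i> * w)) w (H i)) (at_right 0)"
  proof (rule eventually_all_le)
    fix i assume i: "i \<le> n"
    have p: "of_int (dd (H i)) * cr w (av (H i) - c1) > 0" "of_int (dd (H i)) * cr w (c1 - Bv (H i)) > 0"
      using r[OF i] by (simp_all add: ray_iff c1_def)
    from ev_lin_pos[OF p(1), of "of_int (dd (H i))"] ev_lin_pos[OF p(1), of "- of_int (dd (H i))"]
      ev_lin_pos[OF p(2), of "of_int (dd (H i))"] ev_lin_pos[OF p(2), of "- of_int (dd (H i))"]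
    show "eventually (\<lambda>t. ray (c1 + t *\<^sub>R (\<i> * w)) w (H i) \<and> ray (c1 - t *\<^sub>R (\<i> * w)) w (H i)) (at_right 0)"
      unfolding crs_def by eventually_elim (simp add: cr_simps wi algebra_simps)
  qed
  have ev2: "eventually (\<lambda>t. \<forall>i\<le>n. cr w (ctr (H i) - (c1 + t *\<^sub>R (\<i> * w))) \<noteq> 0 \<and> cr w (ctr (H i) - (c1 - t *\<^sub>R (\<i> * w))) \<noteq> 0) (at_right 0)"
  proof (rule eventually_all_le)
    fix i assume i: "i \<le> n"
    have "eventually (\<lambda>t. cr w (ctr (H i) - c1) + t * 1 \<noteq> 0) (at_right 0)" "eventually (\<lambda>t. cr w (ctr (H i) - c1) + t * (-1) \<noteq> 0) (at_right 0)"
      by (rule ev_lin_ne; simp)+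
    then show "eventually (\<lambda>t. cr w (ctr (H i) - (c1 + t *\<^sub>R (\<i> * w))) \<noteq> 0 \<and> cr w (ctr (H i) - (c1 - t *\<^sub>R (\<i> * w))) \<noteq> 0) (at_right 0)"
      by eventually_elim (simp add: cr_simps wi algebra_simps)
  qed
  have ev3: "eventually (\<lambda>t. 1 + t * - (1 / Px + 1 / Qy) > 0) (at_right 0)" by (rule ev_lin_pos) simp
  have ev4: "eventually (\<lambda>t. rh (wc (ctr (H K)) (flev (H K)) (y - t *\<^sub>R (\<i> * w))) < 1) (at_right 0)"
  proof -
    have "continuous_on UNIV (\<lambda>t::real. rh (wc (ctr (H K)) (flev (H K)) (y - t *\<^sub>R (\<i> * w))))"
      by (rule continuous_on_compose2[OF rh_cont]) (auto simp: wc_def intro!: continuous_intros)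
    then have "isCont (\<lambda>t::real. rh (wc (ctr (H K)) (flev (H K)) (y - t *\<^sub>R (\<i> * w)))) 0"
      by (simp add: continuous_on_eq_continuous_at)
    then have "((\<lambda>t::real. rh (wc (ctr (H K)) (flev (H K)) (y - t *\<^sub>R (\<i> * w)))) \<longlongrightarrow> rh (wc (ctr (H K)) (flev (H K)) y)) (at_right 0)"
      unfolding isCont_def using tendsto_mono[OF at_le[of "{0<..}" UNIV "0::real"]] by simp
    from order_tendstoD(2)[OF this y(2)] show ?thesis .
  qed
  have ev5: "eventually (\<lambda>t. \<eta> + t * (-1) > 0) (at_right 0)" by (rule ev_lin_pos[OF e])
  have ev6: "eventually (\<lambda>t::real. t > 0) (at_right 0)" by (simp add: eventually_at_right_less)
  have "eventually (\<lambda>t. (\<forall>i\<le>n. ray (c1 + t *\<^sub>R (\<i> * w)) w (H i) \<and> ray (c1 - t *\<^sub>R (\<i> * w)) w (H i)) \<and>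
     (\<forall>i\<le>n. cr w (ctr (H i) - (c1 + t *\<^sub>R (\<i> * w))) \<noteq> 0 \<and> cr w (ctr (H i) - (c1 - t *\<^sub>R (\<i> * w))) \<noteq> 0) \<and>
     1 + t * - (1 / Px + 1 / Qy) > 0 \<and> rh (wc (ctr (H K)) (flev (H K)) (y - t *\<^sub>R (\<i> * w))) < 1 \<and> \<eta> + t * (-1) > 0 \<and> t > 0) (at_right 0)"
    using ev1 ev2 ev3 ev4 ev5 ev6 by (intro eventually_conj)
  from eventually_happens'[OF trivial_limit_at_right_real this]
  obtain \<delta> where \<delta>: "\<And>i. i \<le> n \<Longrightarrow> ray (c1 + \<delta> *\<^sub>R (\<i> * w)) w (H i) \<and> ray (c1 - \<delta> *\<^sub>R (\<i> * w)) w (H i)"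
     "\<And>i. i \<le> n \<Longrightarrow> cr w (ctr (H i) - (c1 + \<delta> *\<^sub>R (\<i> * w))) \<noteq> 0 \<and> cr w (ctr (H i) - (c1 - \<delta> *\<^sub>R (\<i> * w))) \<noteq> 0"
     "1 + \<delta> * - (1 / Px + 1 / Qy) > 0" "rh (wc (ctr (H K)) (flev (H K)) (y - \<delta> *\<^sub>R (\<i> * w))) < 1" "\<eta> + \<delta> * (-1) > 0" "\<delta> > 0"
    by blast
  define q where "q = \<delta> *\<^sub>R (\<i> * w)"
  have nq: "norm q = \<delta>" using w \<delta>(6) by (simp add: q_def norm_mult)
  have wq: "cr w q = \<delta>" by (simp add: q_def cr_simps wi)
  define x where "x = y - q"
  have small: "\<And>c l. rh (wc c l (c + q)) < 1" "\<And>c l. rh (wc c l (c - q)) < 1"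
  proof -
    have "\<delta> * (1 / Px + 1 / Qy) < 1" using \<delta>(3) unfolding mult_minus_right by linarith
    then show "rh (wc c l (c + q)) < 1" "rh (wc c l (c - q)) < 1" for c l
      by (intro rh_small, simp add: norm_wc nq)+
  qed
  note rays = \<delta>(1)[folded q_def] and ctrs = \<delta>(2)[folded q_def] and rx = \<delta>(4)[folded q_def, folded x_def]
  have cx: "cr w x = cr w (c1 - q)" by (simp add: x_def y(1) cr_simps c1_def)
  have c2: "c2 = c1 + D *\<^sub>R w" using D by (simp add: c1_def c2_def)
  have c2q: "cr w (c2 - q) = cr w (c1 - q)" by (simp add: c2 cr_simps)
  have rr: "ray (c1 - q) w (H i)" "ray (c1 + q) w (H i)" if "i \<le> n" for i using rays[OF that] by auto
  have rm: "ray z (- w) (rvd (H i))" if "i \<le> n" "cr w z = cr w (c1 - q)" for i z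
    unfolding ray_rvd that(2) by (rule rr(1)[OF that(1)])
  have cm: "cr (- w) (ctr (H i) - z) \<noteq> 0" if "i \<le> n" "cr w z = cr w (c1 - q)" for i z
    using ctrs[OF that(1)] that(2) by (simp add: cr_simps)
  have cm0: "cr (- w) (c1 - z) \<noteq> 0" if "cr w z = cr w (c1 - q)" for z
    using that \<delta>(6) by (simp add: cr_simps wq)
  have HS: "nctr (H (Suc i)) = ctr (H i)" "nlev (H (Suc i)) = flev (H i)" if i: "i < n" for i
  proof -
    obtain mm where "H (Suc i) = step mm (H i)" by (rule chain_stepE[OF H(1) i])
    then show "nctr (H (Suc i)) = ctr (H i)" "nlev (H (Suc i)) = flev (H i)" using nctr_step[OF v[of i]] i by auto
  qed
  have nr: "nctr (H i) = (if i = 0 then c1 else ctr (H (i - 1)))" if "i \<le> n" for i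
    using HS[of "i - 1"] that by (cases i) (auto simp: c1_def)
  have cmn: "cr (- w) (nctr (H i) - z) \<noteq> 0" if "i \<le> n" "cr w z = cr w (c1 - q)" for i z
    unfolding nr[OF that(1)] using cm[OF _ that(2), of "i - 1"] cm0[OF that(2)] that(1) by auto
  show ?thesis
  proof (rule that[of x "k + D + (D - k)"])
    show "norm (x - y) < \<eta>" using \<delta>(5) nq by (simp add: x_def)
    show "k + D + (D - k) > 0" using D by simp
    show "rh (wc (ctr (H K)) (flev (H K)) x) < 1" by (rule rx)
    fix y0 assume y0: "rp (ctr (H K)) (flev (H K)) x (- w) y0"
    have ex: "\<exists>y. rp c l z u y" for c l z u unfolding rp_def using repw_ex by metis
    obtain y1 where y1: "rp c1 (nlev (H 0)) (c1 - q) (- w) y1" using ex by blast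
    obtain y2 where y2: "rp c2 (flev (H n)) (c2 + q) w y2" using ex by blast
    have f1: "fl y0 (0 + k) y1"
    proof (rule chain_flow[where g = "\<lambda>j. rvd (H (K - j))" and n = K and x = x and u = "- w"])
      show "chain (\<lambda>j. rvd (H (K - j))) K" by (rule chain_rvd[OF chain_mono[OF H(1)]]) (use H in simp)
      show "ray x (- w) (rvd (H (K - i)))" if "i \<le> K" for i by (rule rm) (use H cx in auto)
      have vK: "vld (rvd (H K))" using v[of K] H by simp
      have nK: "nctr (rvd (H (K - 0))) = ctr (H K)" "nlev (rvd (H (K - 0))) = flev (H K)" using nlev_rvd[OF v[of K]] H by auto
      show "sd (rvd (H (K - 0))) x < 0" by (rule near_inside) (use vK nK rx in auto)
      show "rh (wc (nctr (rvd (H (K - 0)))) (nlev (rvd (H (K - 0)))) x) \<le> 1" "nco (wc (nctr (rvd (H (K - 0)))) (nlev (rvd (H (K - 0)))) x)"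
        unfolding nK using rx nco_lt by auto
      show "cr (- w) (nctr (rvd (H (K - 0))) - x) \<noteq> 0" unfolding nK by (rule cm) (use H cx in auto)
      show "cr (- w) (ctr (rvd (H (K - i))) - x) \<noteq> 0" if "i \<le> K" for i unfolding nctr_rvd by (rule cmn) (use H cx in auto)
      have xe: "x + k *\<^sub>R (- w) = c1 - q" by (simp add: x_def y(1) c1_def)
      have f0: "ctr (rvd (H (K - K))) = c1" "flev (rvd (H (K - K))) = nlev (H 0)" using nlev_rvd[OF v[of 0]] by (auto simp: c1_def)
      have "sd (H 0) (c1 - q) < 0" by (rule near_inside) (use v small in \<open>auto simp: c1_def\<close>)
      then show "sd (rvd (H (K - K))) (x + k *\<^sub>R (- w)) > 0" unfolding xe by simp
      show "rh (wc (ctr (rvd (H (K - K)))) (flev (rvd (H (K - K)))) (x + k *\<^sub>R (- w))) \<le> 1"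
        "nco (wc (ctr (rvd (H (K - K)))) (flev (rvd (H (K - K)))) (x + k *\<^sub>R (- w)))"
        unfolding xe f0 using small(2) nco_lt less_imp_le by blast+
      show "fl y0 0 y0" by (rule flow.start)
      show "rp (nctr (rvd (H (K - 0)))) (nlev (rvd (H (K - 0)))) x (- w) y0" unfolding nK by (rule y0)
      show "rp (ctr (rvd (H (K - K)))) (flev (rvd (H (K - K)))) (x + k *\<^sub>R (- w)) (- w) y1" unfolding xe f0 by (rule y1)
    qed
    have y1': "rp c1 (nlev (H 0)) (c1 + q) w y1" using y1 rp_flip by simp
    have f2: "fl y0 (0 + k + D) y2"
    proof (rule chain_flow[OF H(1) _ _ _ _ _ _ _ _ _ f1, where x = "c1 + q" and u = w])
      have xe: "c1 + q + D *\<^sub>R w = c2 + q" by (simp add: c2)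
      show "ray (c1 + q) w (H i)" if "i \<le> n" for i by (rule rr(2)[OF that])
      show "sd (H 0) (c1 + q) < 0" by (rule near_inside) (use v small in \<open>auto simp: c1_def\<close>)
      show "rh (wc (nctr (H 0)) (nlev (H 0)) (c1 + q)) \<le> 1" "nco (wc (nctr (H 0)) (nlev (H 0)) (c1 + q))"
        unfolding c1_def using small(1) nco_lt less_imp_le by blast+
      show "cr w (nctr (H 0) - (c1 + q)) \<noteq> 0" using \<delta>(6) wq by (simp add: c1_def[symmetric] cr_simps)
      show "cr w (ctr (H i) - (c1 + q)) \<noteq> 0" if "i \<le> n" for i using ctrs[OF that] by simp
      have "sd (rvd (H n)) (c2 + q) < 0"
        by (rule near_inside) (use v small nlev_rvd[OF v[of n]] in \<open>auto simp: c2_def\<close>)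
      then show "sd (H n) (c1 + q + D *\<^sub>R w) > 0" unfolding xe by simp
      show "rh (wc (ctr (H n)) (flev (H n)) (c1 + q + D *\<^sub>R w)) \<le> 1" "nco (wc (ctr (H n)) (flev (H n)) (c1 + q + D *\<^sub>R w))"
        unfolding xe unfolding c2_def using small(1) nco_lt less_imp_le by blast+
      show "rp (nctr (H 0)) (nlev (H 0)) (c1 + q) w y1" using y1' by (simp add: c1_def)
      show "rp (ctr (H n)) (flev (H n)) (c1 + q + D *\<^sub>R w) w y2" unfolding xe using y2 by (simp add: c2_def)
    qed
    have y2': "rp c2 (flev (H n)) (c2 - q) (- w) y2" using y2 rp_flip by simp
    define M where "M = n - Suc K"
    have M: "n - M = Suc K" using H by (simp add: M_def)
    have "fl y0 (0 + k + D + (D - k)) y0"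
    proof (rule chain_flow[where g = "\<lambda>j. rvd (H (n - j))" and n = M and x = "c2 - q" and u = "- w"])
      show "chain (\<lambda>j. rvd (H (n - j))) M" by (rule chain_mono[OF chain_rvd[OF H(1)]]) (simp add: M_def)
      show "ray (c2 - q) (- w) (rvd (H (n - i)))" if "i \<le> M" for i by (rule rm) (use c2q in auto)
      have nK: "nctr (rvd (H (n - 0))) = c2" "nlev (rvd (H (n - 0))) = flev (H n)" using nlev_rvd[OF v[of n]] by (auto simp: c2_def)
      show "sd (rvd (H (n - 0))) (c2 - q) < 0" by (rule near_inside) (use v[of n] nK small in auto)
      show "rh (wc (nctr (rvd (H (n - 0)))) (nlev (rvd (H (n - 0)))) (c2 - q)) \<le> 1" "nco (wc (nctr (rvd (H (n - 0)))) (nlev (rvd (H (n - 0)))) (c2 - q))"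
        unfolding nK using small(2) nco_lt less_imp_le by blast+
      show "cr (- w) (nctr (rvd (H (n - 0))) - (c2 - q)) \<noteq> 0" unfolding nctr_rvd by (rule cm) (use c2q in auto)
      show "cr (- w) (ctr (rvd (H (n - i))) - (c2 - q)) \<noteq> 0" if "i \<le> M" for i unfolding nctr_rvd by (rule cmn) (use c2q in auto)
      have xe: "c2 - q + (D - k) *\<^sub>R (- w) = x" by (simp add: x_def y(1) c1_def[symmetric] c2 algebra_simps)
      have f0: "ctr (rvd (H (n - M))) = ctr (H K)" "flev (rvd (H (n - M))) = flev (H K)"
        unfolding M using nlev_rvd[OF v[of "Suc K"]] HS[OF H(2)] H by auto
      have "sd (H (Suc K)) x < 0" by (rule near_inside) (use v[of "Suc K"] HS[OF H(2)] H rx in auto)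
      then show "sd (rvd (H (n - M))) (c2 - q + (D - k) *\<^sub>R (- w)) > 0" unfolding xe M by simp
      show "rh (wc (ctr (rvd (H (n - M)))) (flev (rvd (H (n - M)))) (c2 - q + (D - k) *\<^sub>R (- w))) \<le> 1"
        "nco (wc (ctr (rvd (H (n - M)))) (flev (rvd (H (n - M)))) (c2 - q + (D - k) *\<^sub>R (- w)))"
        unfolding xe f0 using rx nco_lt by auto
      show "fl y0 (0 + k + D) y2" by (rule f2)
      show "rp (nctr (rvd (H (n - 0)))) (nlev (rvd (H (n - 0)))) (c2 - q) (- w) y2" unfolding nK by (rule y2')
      show "rp (ctr (rvd (H (n - M)))) (flev (rvd (H (n - M)))) (c2 - q + (D - k) *\<^sub>R (- w)) (- w) y0" unfolding xe f0 by (rule y0)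
    qed
    then show "fl y0 (k + D + (D - k)) y0" by simp
  qed
qed

end

lemma tendsto_sgn_nhds: "u \<noteq> 0 \<Longrightarrow> ((\<lambda>v. sgn v) \<longlongrightarrow> sgn u) (nhds (u :: complex))"
  unfolding sgn_div_norm by (intro tendsto_intros filterlim_ident) auto

context bill
begin

lemma periodic_near:
  assumes irr: "\<alpha> / pi \<notin> \<rat>" and p: "Re p > 0" "Im p > 0" "rh p < 1" and u: "norm u = 1"
    and gen: "cr u (of_real Px - p) \<noteq> 0" "cr u (- of_real Px - p) \<noteq> 0" "cr u (Complex 0 Qy - p) \<noteq> 0" "cr u (Complex 0 (- Qy) - p) \<noteq> 0"
    and e: "\<epsilon> > 0"
  obtains x v where "norm (x - p) < \<epsilon>" "norm (v - u) < \<epsilon>" "norm v = 1" "Re x > 0" "Im x > 0" "rh x < 1"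
    "periodic A B C (C + io x, io v)"
proof -
  have u0: "u \<noteq> 0" and su: "sgn u = u" using u by (auto simp: sgn_div_norm)
  obtain \<sigma> where \<sigma>: "vld \<sigma>" "nctr \<sigma> = 0" "nlev \<sigma> = 0" "ray p u \<sigma>" by (rule exit_edge[OF p(3) u0 gen])
  have "eventually (\<lambda>v. ray p v \<sigma> \<and> dist (sgn v) u < \<epsilon> / 2) (nhds u)"
    using ev_ray[OF \<sigma>(4)] tendstoD[OF tendsto_sgn_nhds[OF u0], of "\<epsilon> / 2"] e by (auto simp: su intro: eventually_conj)
  then obtain d1 where d1: "d1 > 0" "\<And>v. v \<in> ball u d1 \<Longrightarrow> ray p v \<sigma> \<and> dist (sgn v) u < \<epsilon> / 2"
    unfolding eventually_nhds_metric by (auto simp: dist_commute)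
  obtain a b where ab: "cr a b > 0" "\<And>v. v \<in> wedge a b \<Longrightarrow> \<exists>c v'. c > 0 \<and> v' \<in> ball u d1 \<and> v = c *\<^sub>R v'"
    by (rule wedge_ball[OF u0 d1(1)]) blast
  have wab: "ray p v \<sigma> \<and> dist (sgn v) u < \<epsilon> / 2" if h: "v \<in> wedge a b" for v
  proof -
    obtain c v' where "c > 0" "v' \<in> ball u d1" "v = c *\<^sub>R v'" using ab(2)[OF h] by blast
    then show ?thesis using d1(2)[of v'] ray_scale[of c] by (simp add: sgn_scaleR)
  qed
  have sp: "sd \<sigma> p < 0" by (rule near_inside[OF \<sigma>(1)]) (use \<sigma>(2,3) p(3) in \<open>simp add: wc_def\<close>)
  have b1: "beam p (\<lambda>_. \<sigma>) 0 a b" using \<sigma>(1) sp ab(1) wab by (auto simp: beam_def chain_def)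
  obtain G N where G: "0 < N" "chain G N" "\<And>i. i \<le> 0 \<Longrightarrow> G i = \<sigma>" "ctr (G N) - p \<in> wedge a b"
    "\<And>i. i \<le> N \<Longrightarrow> ray p (ctr (G N) - p) (G i)" by (rule see_centre[OF irr b1]) blast
  define c1 where "c1 = ctr (G N)"
  define u1 where "u1 = c1 - p"
  have u1: "ray p u1 (G i)" if "i \<le> N" for i using G(5)[OF that] by (simp add: u1_def c1_def)
  have su1: "dist (sgn u1) u < \<epsilon> / 2" using wab G(4) by (simp add: u1_def c1_def)
  have u10: "u1 \<noteq> 0" using G(4) by (auto simp: u1_def c1_def wedge_def cr_simps)
  have G0: "G 0 = \<sigma>" using G(3) by simp
  \<comment> \<open>Prescribing the chain from the centre back to the rhombus of \<open>p\<close> as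
    the start of the second beam forces the segment between the centres through that
    rhombus.\<close>
  define H0 where "H0 = (\<lambda>j. rvd (G (N - j)))"
  have cH0: "chain H0 N" unfolding H0_def by (rule chain_rvd[OF G(2)])
  have cc: "cr u1 c1 = cr u1 p" using cr_swap[of p c1] by (simp add: u1_def cr_simps)
  have rH0: "ray c1 (- u1) (H0 j)" if "j \<le> N" for j
    unfolding H0_def ray_rvd cc using u1[of "N - j"] by simp
  have vGN: "vld (G N)" by (rule chain_vld[OF G(2)]) simp
  have sH0: "sd (H0 0) c1 < 0" using sd_ctr[OF vGN] S_pos by (simp add: H0_def c1_def)
  have "open {x. rh x < 1 \<and> 0 < Re x \<and> 0 < Im x \<and> dist x p < \<epsilon>}"
    by (intro open_Collect_conj open_Collect_less rh_cont continuous_intros)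
  then obtain \<eta> where eta: "\<eta> > 0" "\<And>x. dist x p < \<eta> \<Longrightarrow> rh x < 1 \<and> Re x > 0 \<and> Im x > 0 \<and> dist x p < \<epsilon>"
    using p e unfolding open_dist by force
  have nu10: "- u1 \<noteq> 0" using u10 by simp
  \<comment> \<open>At the distance \<open>norm u1\<close> of \<open>p\<close> from
    \<open>c1\<close> the second bound for the direction keeps the segment within
    \<open>\<eta> / 2\<close> of \<open>p\<close>.\<close>
  have "eventually (\<lambda>v. (\<forall>j\<le>N. ray c1 v (H0 j)) \<and> dist (sgn v) (sgn (- u1)) < min (\<epsilon> / 2) (\<eta> / (2 * norm u1))) (nhds (- u1))"
  proof (intro eventually_conj eventually_all_le)
    show "eventually (\<lambda>v. dist (sgn v) (sgn (- u1)) < min (\<epsilon> / 2) (\<eta> / (2 * norm u1))) (nhds (- u1))"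
      by (rule tendstoD[OF tendsto_sgn_nhds[OF nu10]]) (use e eta(1) u10 in auto)
  qed (rule ev_ray[OF rH0])
  then obtain d2 where d2: "d2 > 0" "\<And>v. v \<in> ball (- u1) d2 \<Longrightarrow> (\<forall>j\<le>N. ray c1 v (H0 j)) \<and> dist (sgn v) (sgn (- u1)) < min (\<epsilon> / 2) (\<eta> / (2 * norm u1))"
    unfolding eventually_nhds_metric by (auto simp: dist_commute)
  obtain a' b' where ab': "cr a' b' > 0" "\<And>v. v \<in> wedge a' b' \<Longrightarrow> \<exists>c v'. c > 0 \<and> v' \<in> ball (- u1) d2 \<and> v = c *\<^sub>R v'"
    by (rule wedge_ball[OF nu10 d2(1)]) blast
  have wab': "(\<forall>j\<le>N. ray c1 v (H0 j)) \<and> dist (sgn v) (sgn (- u1)) < min (\<epsilon> / 2) (\<eta> / (2 * norm u1))" if h: "v \<in> wedge a' b'" for v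
  proof -
    obtain c v' where "c > 0" "v' \<in> ball (- u1) d2" "v = c *\<^sub>R v'" using ab'(2)[OF h] by blast
    then show ?thesis using d2(2)[of v'] ray_scale[of c] by (simp add: sgn_scaleR)
  qed
  have b2: "beam c1 H0 N a' b'" using cH0 sH0 ab'(1) wab' by (auto simp: beam_def)
  obtain H n where H: "N < n" "chain H n" "\<And>i. i \<le> N \<Longrightarrow> H i = H0 i" "ctr (H n) - c1 \<in> wedge a' b'"
    "\<And>i. i \<le> n \<Longrightarrow> ray c1 (ctr (H n) - c1) (H i)" by (rule see_centre[OF irr b2]) blast
  define u2 where "u2 = ctr (H n) - c1"
  define w where "w = sgn u2"
  have u20: "u2 \<noteq> 0" using H(4) by (auto simp: u2_def wedge_def cr_simps)
  have w1: "norm w = 1" using u20 by (simp add: w_def norm_sgn)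
  have u2w: "u2 = norm u2 *\<^sub>R w" using u20 by (simp add: w_def sgn_div_norm)
  have dw: "dist w (sgn (- u1)) < \<epsilon> / 2" "dist w (sgn (- u1)) < \<eta> / (2 * norm u1)" using wab'[OF H(4)] by (simp_all add: w_def u2_def)
  have nc: "nctr (H 0) = c1" using H(3)[of 0] by (simp add: H0_def c1_def)
  have HN: "H N = rvd \<sigma>" using H(3)[of N] G0 by (simp add: H0_def)
  have cN: "ctr (H N) = 0" "flev (H N) = 0" using \<sigma> nlev_rvd[OF \<sigma>(1)] by (simp_all add: HN)
  \<comment> \<open>The point of the new segment at the same distance from \<open>c1\<close> as
    \<open>p\<close>.\<close>
  define y where "y = c1 + norm u1 *\<^sub>R w"
  have "y - p = norm u1 *\<^sub>R (w - sgn (- u1))"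
  proof -
    have "norm u1 *\<^sub>R sgn u1 = u1" using u10 by (simp add: sgn_div_norm)
    moreover have "y - p = u1 + norm u1 *\<^sub>R w" by (simp add: y_def u1_def)
    ultimately show ?thesis by (simp add: sgn_minus scaleR_add_right)
  qed
  then have "norm (y - p) = norm u1 * dist w (sgn (- u1))" by (simp add: dist_norm)
  also have "\<dots> < norm u1 * (\<eta> / (2 * norm u1))" using dw(2) u10 by (intro mult_strict_left_mono) auto
  also have "\<dots> = \<eta> / 2" using u10 by simp
  finally have yp: "norm (y - p) < \<eta> / 2" .
  have ry: "rh (wc (ctr (H N)) (flev (H N)) y) < 1" using eta(2)[of y] yp eta(1) by (simp add: cN wc_def dist_norm)
  have rw: "ray (nctr (H 0)) w (H i)" if "i \<le> n" for i
  proof -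
    have "ray c1 u2 (H i)" using H(5)[OF that] by (simp add: u2_def)
    then have "ray c1 (norm u2 *\<^sub>R w) (H i)" using u2w by simp
    then show ?thesis using ray_scale[of "norm u2" w c1] u20 nc by simp
  qed
  have cn: "ctr (H n) = nctr (H 0) + norm u2 *\<^sub>R w" using u2w nc by (simp add: u2_def)
  obtain x T where x: "norm (x - y) < \<eta> / 2" "T > 0" "rh (wc (ctr (H N)) (flev (H N)) x) < 1"
    "\<And>y0. rp (ctr (H N)) (flev (H N)) x (- w) y0 \<Longrightarrow> fl y0 T y0"
    by (rule periodic_line[OF H(2) H(1) w1 rw cn _ _ ry, of "norm u1" "\<eta> / 2"]) (use u20 eta(1) nc in \<open>auto simp: y_def\<close>)
  have "norm (x - p) < \<eta>" using norm_triangle_ineq[of "x - y" "y - p"] x(1) yp by simp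
  then have xx: "rh x < 1" "Re x > 0" "Im x > 0" "norm (x - p) < \<epsilon>" using eta(2)[of x] by (auto simp: dist_norm)
  have "rp (ctr (H N)) (flev (H N)) x (- w) (C + io x, io (- w))"
    unfolding rp_def cN repw_def using xx by (intro exI[of _ 1]) (simp add: wc_def mi_def io_def)
  from x(4)[OF this] x(2) have per: "periodic A B C (C + io x, io (- w))" by (auto simp: periodic_def)
  have "dist (- w) u < \<epsilon>"
  proof -
    have "- w - sgn u1 = - (w - sgn (- u1))" by (simp add: sgn_minus)
    then have "dist (- w) (sgn u1) = dist w (sgn (- u1))" unfolding dist_norm by (metis norm_minus_cancel)
    then show ?thesis using dist_triangle[of "- w" u "sgn u1"] dw(1) su1 by linarith
  qed
  then show ?thesis using that[of x "- w"] xx w1 per by (simp add: dist_norm)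
qed

section \<open>Density in the whole phase space\<close>

lemma io_surj: obtains w where "v = io w"
proof -
  define r where "r = v - io (Complex (v \<bullet> e1) (v \<bullet> e2))"
  have r0: "r \<bullet> e1 = 0" "r \<bullet> e2 = 0" by (simp_all add: r_def io_def inner_diff_left inner_add_left orth orth')
  have v2: "x \<bullet> y = x $ 1 * y $ 1 + x $ 2 * y $ 2" for x y :: point by (simp add: inner_vec_def sum_2)
  define a b c d where abcd: "a = e1 $ 1" "b = e1 $ 2" "c = e2 $ 1" "d = e2 $ 2"
  have o: "a * a + b * b = 1" "c * c + d * d = 1" "a * c + b * d = 0" using orth by (simp_all add: v2 abcd)
  have q: "r $ 1 * a + r $ 2 * b = 0" "r $ 1 * c + r $ 2 * d = 0" using r0 by (simp_all add: v2 abcd)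
  have "(a * d - b * c)\<^sup>2 = (a * a + b * b) * (c * c + d * d) - (a * c + b * d)\<^sup>2" by (simp add: power2_eq_square algebra_simps)
  then have D: "a * d - b * c \<noteq> 0" using o by auto
  have "r $ 1 * (a * d - b * c) = (r $ 1 * a + r $ 2 * b) * d - (r $ 1 * c + r $ 2 * d) * b"
    "r $ 2 * (a * d - b * c) = (r $ 1 * c + r $ 2 * d) * a - (r $ 1 * a + r $ 2 * b) * c" by (simp_all add: algebra_simps)
  then have "r $ 1 * (a * d - b * c) = 0" "r $ 2 * (a * d - b * c) = 0" by (simp_all only: q mult_zero_left diff_self)
  then have "r $ 1 = 0" "r $ 2 = 0" using D by simp_all
  then have "r = 0" by (simp add: vec_eq_iff forall_2)
  then show ?thesis using that by (simp add: r_def)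
qed

lemma triangle_io:
  assumes "X \<in> triangle A B C"
  obtains w where "X = C + io w" "Re w \<ge> 0" "Im w \<ge> 0" "Re w / Px + Im w / Qy \<le> 1"
proof -
  obtain a b c where abc: "0 \<le> a" "0 \<le> b" "0 \<le> c" "a + b + c = 1" "X = a *\<^sub>R A + b *\<^sub>R B + c *\<^sub>R C"
    using assms unfolding triangle_def convex_hull_3 by blast
  have c: "c = 1 - a - b" using abc by simp
  show ?thesis
  proof (rule that[of "Complex (a * Px) (b * Qy)"])
    show "X = C + io (Complex (a * Px) (b * Qy))" unfolding abc(5) c by (simp add: A_def B_def io_def algebra_simps)
  qed (use abc PQ in auto)
qed

theorem dense_periodic:
  assumes irr: "\<alpha> / pi \<notin> \<rat>"
  shows "phase_space A B C \<subseteq> closure {x \<in> phase_space A B C. periodic A B C x}"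
proof
  fix z assume "z \<in> phase_space A B C"
  then obtain X V where z: "z = (X, V)" "X \<in> triangle A B C" "norm V = 1" by (auto simp: phase_space_def)
  obtain w where w: "X = C + io w" "Re w \<ge> 0" "Im w \<ge> 0" "Re w / Px + Im w / Qy \<le> 1" by (rule triangle_io[OF z(2)])
  obtain u0 where u0: "V = io u0" by (rule io_surj)
  have nu0: "norm u0 = 1" using z(3) u0 io_norm by simp
  show "z \<in> closure {x \<in> phase_space A B C. periodic A B C x}"
    unfolding closure_approachable
  proof (intro allI impI)
    fix \<epsilon> :: real assume e: "\<epsilon> > 0"
    \<comment> \<open>The centroid; moving slightly towards it makes any point of the triangle an
      interior one.\<close>
    define m where "m = Complex (Px / 3) (Qy / 3)"
    define M where "M = norm (m - w) + 1"
    define k where "k = min (1/2) (\<epsilon> / (8 * M))"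
    have k: "0 < k" "k \<le> 1/2" "k * norm (m - w) < \<epsilon> / 4"
    proof -
      have n: "M > 0" by (simp add: M_def add_nonneg_pos)
      show "0 < k" using e n by (simp add: k_def)
      show "k \<le> 1/2" by (simp only: k_def min.cobounded1)
      have "k * norm (m - w) \<le> k * M" using \<open>0 < k\<close> by (simp add: M_def)
      also have "\<dots> \<le> \<epsilon> / (8 * M) * M" using n by (intro mult_right_mono) (simp_all add: k_def)
      also have "\<dots> = \<epsilon> / 8" using n by simp
      finally show "k * norm (m - w) < \<epsilon> / 4" using e by simp
    qed
    define p where "p = w + k *\<^sub>R (m - w)"
    have pr: "Re p = (1 - k) * Re w + k * (Px / 3)" "Im p = (1 - k) * Im w + k * (Qy / 3)" by (simp_all add: p_def m_def algebra_simps)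
    have p0: "Re p > 0" "Im p > 0" unfolding pr using k w PQ by (auto intro!: add_nonneg_pos)
    have "rh p = (1 - k) * (Re w / Px + Im w / Qy) + k * (2 / 3)"
      using p0 PQ unfolding rh_def abs_of_pos[OF p0(1)] abs_of_pos[OF p0(2)] unfolding pr by (simp add: field_simps)
    also have "\<dots> \<le> (1 - k) * 1 + k * (2 / 3)" using w(4) k by (intro add_right_mono mult_left_mono) auto
    also have "\<dots> < 1" using k by simp
    finally have rp: "rh p < 1" .
    have pw: "norm (p - w) < \<epsilon> / 4" using k by (simp add: p_def)
    \<comment> \<open>The tips of the rhombus seen from \<open>p\<close>. Each rules out only
      isolated directions, so a small turn of \<open>u0\<close> avoids them all.\<close>
    define W where "W = {of_real Px - p, - of_real Px - p, Complex 0 Qy - p, Complex 0 (- Qy) - p}"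
    have W0: "x \<noteq> 0" if "x \<in> W" for x using that p0 by (auto simp: W_def complex_eq_iff)
    have "eventually (\<lambda>t. \<forall>x\<in>W. cr (u0 + t *\<^sub>R (\<i> * u0)) x \<noteq> 0) (at_right 0)"
    proof (rule eventually_ball_finite)
      show "finite W" by (simp add: W_def)
      show "\<forall>x\<in>W. eventually (\<lambda>t. cr (u0 + t *\<^sub>R (\<i> * u0)) x \<noteq> 0) (at_right 0)"
      proof
        fix x assume x: "x \<in> W"
        have "cr u0 x \<noteq> 0 \<or> cr (\<i> * u0) x \<noteq> 0"
        proof (rule ccontr)
          assume n: "\<not> ?thesis"
          have u00: "u0 \<noteq> 0" using nu0 by auto
          obtain c where c: "x = c *\<^sub>R u0" by (rule cr_0_parallel[of u0 x]) (use n u00 in auto)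
          have "cr (\<i> * u0) u0 = - (norm u0 ^ 2)" unfolding cmod_power2 by (simp add: cr_def power2_eq_square)
          then have "c = 0" using n nu0 by (simp add: c cr_simps)
          then show False using W0[OF x] c by simp
        qed
        from ev_lin_ne[OF this] show "eventually (\<lambda>t. cr (u0 + t *\<^sub>R (\<i> * u0)) x \<noteq> 0) (at_right 0)"
          by eventually_elim (simp add: cr_simps)
      qed
    qed
    moreover have "eventually (\<lambda>t. dist (sgn (u0 + t *\<^sub>R (\<i> * u0))) u0 < \<epsilon> / 4 \<and> u0 + t *\<^sub>R (\<i> * u0) \<noteq> 0) (at_right 0)"
    proof -
      have u00: "u0 \<noteq> 0" using nu0 by auto
      have f: "filterlim (\<lambda>t. u0 + t *\<^sub>R (\<i> * u0)) (nhds u0) (at_right 0)" by (rule tendsto_eq_intros refl | simp)+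
      have "eventually (\<lambda>v. dist (sgn v) u0 < \<epsilon> / 4) (nhds u0)"
        using tendstoD[OF tendsto_sgn_nhds[OF u00], of "\<epsilon> / 4"] e nu0 by (simp add: sgn_div_norm)
      moreover have "eventually (\<lambda>v. v \<noteq> 0) (nhds u0)" using u00 by (rule t1_space_nhds)
      ultimately have "eventually (\<lambda>v. dist (sgn v) u0 < \<epsilon> / 4 \<and> v \<noteq> 0) (nhds u0)" by (rule eventually_conj)
      then show ?thesis using f by (rule eventually_compose_filterlim)
    qed
    ultimately have "eventually (\<lambda>t. (\<forall>x\<in>W. cr (u0 + t *\<^sub>R (\<i> * u0)) x \<noteq> 0) \<and> dist (sgn (u0 + t *\<^sub>R (\<i> * u0))) u0 < \<epsilon> / 4 \<and> u0 + t *\<^sub>R (\<i> * u0) \<noteq> 0) (at_right 0)"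
      by (rule eventually_conj)
    from eventually_happens'[OF trivial_limit_at_right_real this]
    obtain t where t: "\<forall>x\<in>W. cr (u0 + t *\<^sub>R (\<i> * u0)) x \<noteq> 0" "dist (sgn (u0 + t *\<^sub>R (\<i> * u0))) u0 < \<epsilon> / 4" "u0 + t *\<^sub>R (\<i> * u0) \<noteq> 0" by blast
    define u where "u = sgn (u0 + t *\<^sub>R (\<i> * u0))"
    have un: "norm u = 1" using t(3) by (simp add: u_def norm_sgn)
    have uW: "cr u x \<noteq> 0" if "x \<in> W" for x using t(1) t(3) that by (simp add: u_def sgn_div_norm cr_simps(5))
    have e4: "\<epsilon> / 4 > 0" using e by simp
    obtain x v where xv: "norm (x - p) < \<epsilon> / 4" "norm (v - u) < \<epsilon> / 4" "norm v = 1" "Re x > 0" "Im x > 0" "rh x < 1"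
      "periodic A B C (C + io x, io v)"
      by (rule periodic_near[OF irr p0 rp un uW uW uW uW e4]) (auto simp: W_def)
    have "norm (x - w) < \<epsilon> / 2" using norm_triangle_ineq[of "x - p" "p - w"] xv(1) pw by simp
    moreover have "norm (v - u0) < \<epsilon> / 2" using norm_triangle_ineq[of "v - u" "u - u0"] xv(2) t(2) by (simp add: u_def dist_norm)
    moreover have "dist (C + io x, io v) z \<le> norm (x - w) + norm (v - u0)"
    proof -
      have "dist (C + io x) X = norm (x - w)" "dist (io v) V = norm (v - u0)"
        using io_norm[of "x - w"] io_norm[of "v - u0"] by (simp_all add: w(1) u0 dist_norm io_linear)
      then show ?thesis unfolding z(1) dist_Pair_Pair using sqrt_sum_squares_le_sum_abs[of "norm (x - w)" "norm (v - u0)"] by simp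
    qed
    ultimately have "dist (C + io x, io v) z < \<epsilon>" by linarith
    moreover have "C + io x \<in> triangle A B C" using xv(4-6) by (intro in_triangle) (auto simp: rh_def)
    moreover have "norm (io v) = 1" using xv(3) io_norm by simp
    ultimately show "\<exists>y\<in>{x \<in> phase_space A B C. periodic A B C x}. dist y z < \<epsilon>"
      using xv(7) by (intro bexI[of _ "(C + io x, io v)"]) (auto simp: phase_space_def)
  qed
qed

end

section \<open>Coordinates for an arbitrary right triangle\<close>

theorem theorem1:
  fixes A B C :: point
  assumes "right_triangle A B C"
    and "\<not> rational_triangle A B C"
  shows "phase_space A B C \<subseteq> closure {x \<in> phase_space A B C. periodic A B C x}"
proof -
  have nc: "\<not> collinear {A, B, C}" and ang: "vertex_angle A C B = pi / 2" using assms(1) by (auto simp: right_triangle_def)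
  have ne: "A \<noteq> C" "B \<noteq> C" using nc by (auto simp: insert_commute)
  define P where "P = norm (A - C)"
  define Q where "Q = norm (B - C)"
  have PQ: "P > 0" "Q > 0" using ne by (auto simp: P_def Q_def)
  have perp: "(A - C) \<bullet> (B - C) = 0"
  proof -
    have b: "\<bar>(A - C) \<bullet> (B - C) / (norm (A - C) * norm (B - C))\<bar> \<le> 1"
      using Cauchy_Schwarz_ineq2[of "A - C" "B - C"] ne by (simp add: divide_le_eq)
    then have "cos (vertex_angle A C B) = (A - C) \<bullet> (B - C) / (norm (A - C) * norm (B - C))"
      unfolding vertex_angle_def using abs_le_D1[OF b] abs_le_D2[OF b] by (intro cos_arccos) linarith+
    then show ?thesis using ang ne by simp
  qed
  have ort: "(a - b) \<bullet> (a - b) = a \<bullet> a + b \<bullet> b" "(a - b) \<bullet> a = a \<bullet> a" "(b - a) \<bullet> b = b \<bullet> b" if "a \<bullet> b = 0" for a b :: point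
    using that by (simp_all add: inner_diff_left inner_diff_right inner_commute)
  define L where "L = sqrt (P\<^sup>2 + Q\<^sup>2)"
  \<comment> \<open>The angle at \<open>A\<close>; the one at \<open>B\<close> is its complement, so
    the triangle is rational as soon as \<open>\<alpha> / pi\<close> is.\<close>
  define \<alpha> where "\<alpha> = arctan (Q / P)"
  have L: "L > 0" using PQ by (simp add: L_def add_pos_pos)
  have al: "0 < \<alpha>" "\<alpha> < pi / 2" using PQ arctan_ubound[of "Q / P"] by (auto simp: \<alpha>_def)
  have sq: "sqrt (1 + (Q / P)\<^sup>2) = L / P"
  proof -
    have "1 + (Q / P)\<^sup>2 = (P\<^sup>2 + Q\<^sup>2) / P\<^sup>2" using PQ by (simp add: field_simps)
    then show ?thesis using PQ by (simp add: L_def real_sqrt_divide)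
  qed
  have cs: "cos \<alpha> = P / L" "sin \<alpha> = Q / L" unfolding \<alpha>_def cos_arctan sin_arctan sq using PQ by simp_all
  define e1 where "e1 = (1 / P) *\<^sub>R (A - C)"
  define e2 where "e2 = (1 / Q) *\<^sub>R (B - C)"
  interpret b: bill L \<alpha> C e1 e2
  proof
    show "e1 \<bullet> e1 = 1" "e2 \<bullet> e2 = 1" using PQ by (simp_all add: e1_def e2_def P_def Q_def dot_square_norm power2_eq_square)
    show "e1 \<bullet> e2 = 0" using perp by (simp add: e1_def e2_def)
  qed (use L al in auto)
  have pq: "b.Px = P" "b.Qy = Q" using cs L by (simp_all add: b.Px_def b.Qy_def)
  have AB: "b.A = A" "b.B = B" unfolding b.A_def b.B_def pq using PQ by (simp_all add: e1_def e2_def)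
  have nAB: "norm (A - B) = L"
  proof -
    have "norm (A - B) ^ 2 = P\<^sup>2 + Q\<^sup>2"
    proof -
      have "A - B = (A - C) - (B - C)" by simp
      then have "norm (A - B) ^ 2 = ((A - C) - (B - C)) \<bullet> ((A - C) - (B - C))" by (simp add: power2_norm_eq_inner)
      also have "\<dots> = P\<^sup>2 + Q\<^sup>2" unfolding ort(1)[OF perp] by (simp only: P_def Q_def power2_norm_eq_inner)
      finally show ?thesis .
    qed
    then show ?thesis unfolding L_def by (metis norm_ge_zero real_sqrt_unique)
  qed
  have va: "vertex_angle B A C = \<alpha>"
  proof -
    have "(B - A) \<bullet> (C - A) = P\<^sup>2"
    proof -
      have "(B - A) \<bullet> (C - A) = ((A - C) - (B - C)) \<bullet> (A - C)" by (simp add: inner_diff_left inner_diff_right)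
      also have "\<dots> = P\<^sup>2" unfolding ort(2)[OF perp] by (simp only: P_def power2_norm_eq_inner)
      finally show ?thesis .
    qed
    moreover have "norm (B - A) = L" "norm (C - A) = P" using nAB by (simp_all add: norm_minus_commute P_def)
    ultimately have "vertex_angle B A C = arccos (cos \<alpha>)" using PQ by (simp add: vertex_angle_def cs power2_eq_square)
    then show ?thesis using al by (simp add: arccos_cos)
  qed
  have vb: "vertex_angle A B C = pi / 2 - \<alpha>"
  proof -
    have "(A - B) \<bullet> (C - B) = Q\<^sup>2"
    proof -
      have "(A - B) \<bullet> (C - B) = ((B - C) - (A - C)) \<bullet> (B - C)" by (simp add: inner_diff_left inner_diff_right)
      also have "\<dots> = Q\<^sup>2" unfolding ort(3)[OF perp] by (simp only: Q_def power2_norm_eq_inner)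
      finally show ?thesis .
    qed
    moreover have "norm (C - B) = Q" by (simp add: norm_minus_commute Q_def)
    ultimately have "vertex_angle A B C = arccos (cos (pi / 2 - \<alpha>))" using PQ nAB
      by (simp add: vertex_angle_def cs power2_eq_square cos_diff)
    then show ?thesis using al by (simp add: arccos_cos)
  qed
  have "\<alpha> / pi \<notin> \<rat>"
  proof
    assume r: "\<alpha> / pi \<in> \<rat>"
    have "(pi / 2 - \<alpha>) / pi = 1 / 2 - \<alpha> / pi" by (simp add: field_simps)
    then have "(pi / 2 - \<alpha>) / pi \<in> \<rat>" using r by simp
    moreover have "pi / 2 / pi \<in> \<rat>" by simp
    ultimately show False using assms(2) r by (simp add: rational_triangle_def va vb ang)
  qed
  from b.dense_periodic[OF this] show ?thesis unfolding AB .
qed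

end
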